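(* Consider the binomial parameter-driven time series model described in the context, with $\tau_0>0$, and suppose Conditions (C1)–(C4) hold and the null hypothesis $H_0^{(\psi)}:\psi=0$ of no serial dependence in the latent process is true (so $\tilde\alpha_t$ are i.i.d. $N(0,1)$). Let $L\ge1$ be a fixed integer. Then, as $n\to\infty$, $$\hat Q_\psi(L)=\sum_{a=1}^L\frac{n^{-1}S_{\psi_a}^2(\hat\beta^{(1)},\hat\tau^{(1)},0)}{n^{-1}\hat\Omega_{aa}}\ \xrightarrow{d}\ \chi^2(L).$$
   Context: Model: $x_t\in\mathbb{R}^r$ are observed regressors (written $x_{nt}$ when they depend on $n$), $m_t\ge1$ are numbers of binomial trials, $b(w)=\log(1+e^w)$ with derivative $\dot b(w)=e^w/(1+e^w)$. Let $\tilde\alpha_t$ be a stationary Gaussian ARMA process with zero mean, unit-variance innovations... normalized so that its correlation matrix is $R(\psi)$, where $\psi$ collects the autoregressive and moving-average coefficients and $\psi=0$ corresponds to $\tilde\alpha_t$ i.i.d. $N(0,1)$. Set $W_t(\beta,\tau)=x_t^{\top}\beta+\tau^{1/2}\tilde\alpha_t$, $\tau\ge0$. Given $\{W_t\}$, the $Y_t$ are independent with density $f(y_t\mid W_t)=\exp\{y_tW_t-m_tb(W_t)+\log\binom{m_t}{y_t}\}$ (binomial with $m_t$ trials and success probability $\dot b(W_t)$). True values are $\delta_0=(\beta_0,\tau_0)$. Marginal likelihood: with $g$ the standard normal density and $\delta=(\beta,\tau)$, $$l_1(\delta)=\sum_{t=1}^n\log\int_{\mathbb{R}}\exp\big(y_tW_t(\beta,\tau)-m_tb(W_t(\beta,\tau))+\log\tbinom{m_t}{y_t}\big)g(\tilde\alpha_t)\,d\tilde\alpha_t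 .$$ The marginal estimator $\hat\delta^{(1)}=(\hat\beta^{(1)},\hat\tau^{(1)})$ maximizes $l_1$ over the compact set $\Theta=\{\beta:\|\beta-\beta_0\|\le d_1\}\times\{\tau\ge0:|\tau-\tau_0|\le d_2\}$, $d_1,d_2<\infty$. Score components: with $f(y_t;\beta,\tau)=\int f(y_t\mid W_t(\beta,\tau))g(\tilde\alpha_t)d\tilde\alpha_t$, define $$u_t(y_t;\beta,\tau)=y_t-f(y_t;\beta,\tau)^{-1}\int_{\mathbb{R}}m_t\dot b(x_t^{\top}\beta+\sqrt\tau\tilde\alpha_t)f(y_t\mid W_t(\beta,\tau))g(\tilde\alpha_t)d\tilde\alpha_t$$ (i.e. $y_t-m_tE[\dot b(W_t)\mid y_t]$ under the model with i.i.d. latent process), $U_t=u_t(Y_t;\beta,\tau)$, and $$S_{\psi_a}(\beta,\tau,0)=\tau\sum_{t=a+1}^nU_tU_{t-a},\qquad \Omega_{aa}=\tau^2\sum_{t=a+1}^nE(U_t^2)E(U_{t-a}^2),\qquad E(U_t^2)=\sum_{y=0}^{m_t}f(y;\beta,\tau)u_t(y;\beta,\tau)^2 .$$ $\hat\Omega_{aa}$ is $\Omega_{aa}$ evaluated at $(\beta,\tau)=(\hat\beta^{(1)},\hat\tau^{(1)})$, and $S_{\psi_a}(\hat\beta^{(1)},\hat\tau^{(1)},0)$ likewise. Conditions: (C1) $1\le m_t\le M$ and either (a) $\{m_t\}$ is stationary with $\kappa_j=P(m_t=j)$, $\kappa_M>0$, $\sum_j\kappa_j=1$, strongly mixing, independent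 of the regressors, with summable mixing coefficients; or (b) $\{m_t\}$ is asymptotically stationary with $\kappa_j$ the limits of finite-sample frequencies of $m_t=j$. (C2) Either (a) $x_{nt}=h(t/n)$ for a piecewise continuous $h:[0,1]\to\mathbb{R}^r$; or (b) $x_{nt}=x_t$, an observed trajectory of a stationary process $\{X_t\}$ with $E(e^{s^{\top}X_t})<\infty$ for all $s\in\mathbb{R}^r$. (C3) For all sufficiently large $n$, the span of $\{x_{nt}:1\le t\le n\}$ has rank $r$. (C4) $n^{-1}l_1(\delta)$ converges to a limit function $Q(\delta)$, and $Q$ has a unique maximum at the true value $\delta_0$. *)

theory Defs
  imports "HOL-Probability.Probability"
begin

definition bfun :: "real \<Rightarrow> real" where
  "bfun w = ln (1 + exp w)"

definition bdot :: "real \<Rightarrow> real" where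
  "bdot w = exp w / (1 + exp w)"

text \<open>Conditional binomial density f(y | W) with m trials:
  exp(y W - m b(W) + log (m choose y)), written so that it is 0 for y > m.\<close>
definition fcond :: "nat \<Rightarrow> nat \<Rightarrow> real \<Rightarrow> real" where
  "fcond m y w = real (m choose y) * exp (real y * w - real m * bfun w)"

text \<open>Marginal density f(y; beta, tau) where eta = x' beta.\<close>
definition fmarg :: "nat \<Rightarrow> real \<Rightarrow> real \<Rightarrow> nat \<Rightarrow> real" where
  "fmarg m eta tau y =
     (LINT a|lborel. fcond m y (eta + sqrt tau * a) * std_normal_density a)"

definition ufun :: "nat \<Rightarrow> real \<Rightarrow> real \<Rightarrow> nat \<Rightarrow> real" where
  "ufun m eta tau y = real y -
     (LINT a|lborel. real m * bdot (eta + sqrt tau * a) * fcond m y (eta + sqrt tau * a)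
                      * std_normal_density a) / fmarg m eta tau y"

definition EU2 :: "nat \<Rightarrow> real \<Rightarrow> real \<Rightarrow> real" where
  "EU2 m eta tau = (\<Sum>y = 0..m. fmarg m eta tau y * (ufun m eta tau y)\<^sup>2)"

text \<open>Marginal log-likelihood l_1 for sample size n, given regressors x t = x_{nt},
  trials m t and observations y t (t = 1..n).\<close>
definition loglik1 :: "(nat \<Rightarrow> real^'r) \<Rightarrow> (nat \<Rightarrow> nat) \<Rightarrow> (nat \<Rightarrow> nat) \<Rightarrow> nat
    \<Rightarrow> real^'r \<Rightarrow> real \<Rightarrow> real" where
  "loglik1 x m y n \<beta> \<tau> = (\<Sum>t = 1..n. ln (fmarg (m t) (x t \<bullet> \<beta>) \<tau> (y t)))"

definition Spsi :: "(nat \<Rightarrow> real^'r) \<Rightarrow> (nat \<Rightarrow> nat) \<Rightarrow> (nat \<Rightarrow> nat) \<Rightarrow> nat \<Rightarrow> nat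
    \<Rightarrow> real^'r \<Rightarrow> real \<Rightarrow> real" where
  "Spsi x m y n a \<beta> \<tau> = \<tau> * (\<Sum>t = a + 1..n.
      ufun (m t) (x t \<bullet> \<beta>) \<tau> (y t) * ufun (m (t - a)) (x (t - a) \<bullet> \<beta>) \<tau> (y (t - a)))"

definition Omega :: "(nat \<Rightarrow> real^'r) \<Rightarrow> (nat \<Rightarrow> nat) \<Rightarrow> nat \<Rightarrow> nat
    \<Rightarrow> real^'r \<Rightarrow> real \<Rightarrow> real" where
  "Omega x m n a \<beta> \<tau> = \<tau>\<^sup>2 * (\<Sum>t = a + 1..n.
      EU2 (m t) (x t \<bullet> \<beta>) \<tau> * EU2 (m (t - a)) (x (t - a) \<bullet> \<beta>) \<tau>)"

definition Qstat :: "(nat \<Rightarrow> real^'r) \<Rightarrow> (nat \<Rightarrow> nat) \<Rightarrow> (nat \<Rightarrow> nat) \<Rightarrow> nat \<Rightarrow> nat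
    \<Rightarrow> real^'r \<Rightarrow> real \<Rightarrow> real" where
  "Qstat x m y n L \<beta> \<tau> = (\<Sum>a = 1..L.
      ((Spsi x m y n a \<beta> \<tau>)\<^sup>2 / real n) / (Omega x m n a \<beta> \<tau> / real n))"

definition Theta :: "real^'r \<Rightarrow> real \<Rightarrow> real \<Rightarrow> real \<Rightarrow> ((real^'r) \<times> real) set" where
  "Theta \<beta>0 \<tau>0 d1 d2 = {(\<beta>, \<tau>). norm (\<beta> - \<beta>0) \<le> d1 \<and> 0 \<le> \<tau> \<and> \<bar>\<tau> - \<tau>0\<bar> \<le> d2}"

definition chi2_density :: "nat \<Rightarrow> real \<Rightarrow> real" where
  "chi2_density k x = (if 0 < x then
      x powr (real k / 2 - 1) * exp (- x / 2) / (2 powr (real k / 2) * Gamma (real k / 2))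
    else 0)"

definition chi2 :: "nat \<Rightarrow> real measure" where
  "chi2 k = density lborel (\<lambda>x. ennreal (chi2_density k x))"

definition piecewise_cont01 :: "(real \<Rightarrow> real^'r) \<Rightarrow> bool" where
  "piecewise_cont01 h \<longleftrightarrow> (\<exists>D. finite D \<and> D \<subseteq> {0..1} \<and> continuous_on ({0..1} - D) h \<and>
     (\<forall>d\<in>D. (0 < d \<longrightarrow> (\<exists>l. (h \<longlongrightarrow> l) (at_left d))) \<and>
             (d < 1 \<longrightarrow> (\<exists>l. (h \<longlongrightarrow> l) (at_right d)))))"

definition gen_sigma :: "'a measure \<Rightarrow> ('i \<Rightarrow> 'a \<Rightarrow> 'b) \<Rightarrow> 'i set \<Rightarrow> 'b measure \<Rightarrow> 'a set set" where
  "gen_sigma M X I N = sigma_sets (space M) (\<Union>i\<in>I. {X i -` A \<inter> space M | A. A \<in> sets N})"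

definition stationary_seq :: "'a measure \<Rightarrow> 'b measure \<Rightarrow> (nat \<Rightarrow> 'a \<Rightarrow> 'b) \<Rightarrow> bool" where
  "stationary_seq M N X \<longleftrightarrow> (\<forall>h.
     distr M (PiM UNIV (\<lambda>_. N)) (\<lambda>\<omega> t. X (t + h) \<omega>) = distr M (PiM UNIV (\<lambda>_. N)) (\<lambda>\<omega> t. X t \<omega>))"

definition mix_coef :: "'a measure \<Rightarrow> 'b measure \<Rightarrow> (nat \<Rightarrow> 'a \<Rightarrow> 'b) \<Rightarrow> nat \<Rightarrow> real" where
  "mix_coef M N X k = (SUP j. SUP A \<in> gen_sigma M X {..j} N. SUP B \<in> gen_sigma M X {j + k..} N.
      \<bar>measure M (A \<inter> B) - measure M A * measure M B\<bar>)"

end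

theory Submission
  imports Defs
begin

text \<open>
  Conditionally on the regressors and the numbers of trials, the latent process integrates out and the
  \<open>Y\<^sub>t\<close> are independent with densities \<open>f\<close>. Write \<open>\<sigma> = sqrt \<tau>\<close>; then \<open>ln f\<close>, the scores \<open>u\<close> and
  \<open>E (U\<^sup>2)\<close> are Lipschitz in \<open>(\<beta>, \<sigma>)\<close> with constants linear in \<open>norm x\<close>, even at \<open>\<tau> = 0\<close>, so (C4) and
  compactness of \<open>\<Theta>\<close> give consistency of the marginal estimator. Only \<open>m\<^sub>t \<le> M\<close> and bounded second
  moments of the regressors are used from (C1) and (C2).

  The information matrix may be singular, so no rate for the estimator is available. Instead, the
  likelihood inequality at the maximiser together with a contraction bound for the centred log-likelihood
  on shrinking balls shows that the summed Kullback--Leibler divergence between the true and the fitted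
  densities is \<open>o\<^sub>P (sqrt n)\<close>. By a Hellinger bound the same holds for the sum of squares of the
  conditional means of the fitted scores. Hence the bias of the plug-in lag products is negligible, and
  their centred part is handled by the same contraction bound. Thus the true parameter can be
  substituted into the statistic.

  At the true parameter the lag products are martingale differences. Their joint characteristic function
  is estimated by telescoping, which yields the Laplace transform of the statistic by Gaussian
  linearisation; its limit \<open>(1 + 2 k) powr (- L / 2)\<close> at natural numbers \<open>k\<close> determines the weak limit.
\<close>

section \<open>Laplace transforms and the chi-squared distribution\<close>

text \<open>Every estimate is made for one fixed value of regressors and trials, where expectations
  over the responses are finite sums (\<open>EE\<close>) and all constants are explicit;
  \<open>cond_expectation\<close> integrates the outcome, so conditional weak convergence never has
  to be formulated. The variance sums are only bounded below by a multiple of n: the statistic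
  normalises itself, so their limits do not enter. The order o(sqrt n) for the total divergence is
  the one that matters, because lag sums are divided by sqrt n and their bias is bounded by a sum of
  squares of conditional means. It comes from a deviation bound \<rho> * sqrt n on a ball of radius
  \<rho>, where consistency allows any \<rho> > 0. Two features shape the contraction argument. A
  summand is Lipschitz in several linear functionals of the parameter at once (regressor, lagged
  regressor, \<sigma>), so the comparison is proved for lists of functionals. And the summands for
  lag products share responses, so they are sorted into two classes of disjoint pairs. Suprema are
  taken over finite nets, which keeps them measurable.\<close>

lemma (in prob_space) integrable_exp_neg:
  assumes "f \<in> borel_measurable M" "AE x in M. 0 \<le> f x" "0 \<le> (k::real)"
  shows "integrable M (\<lambda>x. exp (- k * f x))"
proof (rule integrable_const_bound[where B=1])
  show "AE x in M. norm (exp (- k * f x)) \<le> 1"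
    using assms(2) by eventually_elim (use assms(3) in simp)
qed (use assms(1) in measurable)

text \<open>In the variable \<open>exp (- x)\<close> a continuous step is a continuous function on \<open>[0, 1]\<close>, hence a uniform limit
  of polynomials, whose integrals are values of the Laplace transform at natural numbers.\<close>
lemma laplace_imp_weak_conv:
  fixes \<mu> :: "nat \<Rightarrow> real measure" and \<nu> :: "real measure"
  assumes \<mu>: "\<And>n. real_distribution (\<mu> n)" "\<And>n. AE x in \<mu> n. 0 \<le> x"
    and \<nu>: "real_distribution \<nu>" "AE x in \<nu>. 0 \<le> x"
    and lap: "\<And>k::nat. (\<lambda>n. \<integral>x. exp (- real k * x) \<partial>\<mu> n) \<longlonglongrightarrow> (\<integral>x. exp (- real k * x) \<partial>\<nu>)"
  shows "weak_conv_m \<mu> \<nu>"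
proof (rule integral_cts_step_conv_imp_weak_conv[OF \<mu>(1) \<nu>(1)])
  fix x y :: real assume xy: "x < y"
  \<comment> \<open>The variable is w = exp (- u). Truncating w at exp (- y) keeps the logarithm
    continuous down to w = 0 and changes nothing, because \<open>cts_step x y\<close> is constantly
    0 from y on.\<close>
  define \<phi> where "\<phi> = (\<lambda>w. cts_step x y (- ln (max w (exp (- y)))))"
  have "isCont (cts_step x y) u" for u
    using uniformly_continuous_imp_continuous[OF cts_step_uniformly_continuous[OF xy]]
    by (simp add: continuous_on_eq_continuous_at)
  then have cts: "continuous_on UNIV (cts_step x y)" by (simp add: continuous_on_eq_continuous_at)
  have pos: "0 < max w (exp (- y))" for w by (simp add: less_max_iff_disj)
  have "continuous_on {0..1} (\<lambda>w. - ln (max w (exp (- y))))"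
    using pos by (intro continuous_intros) (metis less_irrefl)
  then have \<phi>: "continuous_on {0..1} \<phi>"
    unfolding \<phi>_def by (rule continuous_on_compose2[OF cts]) auto
  have eq: "cts_step x y u = \<phi> (exp (- u))" for u
  proof (cases "u \<le> y")
    case True
    then have "max (exp (- u)) (exp (- y)) = exp (- u)" by simp
    then show ?thesis unfolding \<phi>_def by simp
  next
    case False
    then have "max (exp (- u)) (exp (- y)) = exp (- y)" by simp
    then show ?thesis unfolding \<phi>_def using False xy by (simp add: cts_step_def)
  qed
  show "(\<lambda>n. integral\<^sup>L (\<mu> n) (cts_step x y)) \<longlonglongrightarrow> integral\<^sup>L \<nu> (cts_step x y)"
  proof (rule LIMSEQ_I)
    fix e :: real assume e: "0 < e"
    obtain g where g: "real_polynomial_function g" "\<And>w. w \<in> {0..1} \<Longrightarrow> \<bar>\<phi> w - g w\<bar> < e / 4"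
      using Stone_Weierstrass_real_polynomial_function[OF _ \<phi>, of "e / 4"] e by auto
    obtain a N where ga: "g = (\<lambda>w. \<Sum>i\<le>N. a i * w ^ i)" using g(1) unfolding real_polynomial_function_iff_sum by auto
    have gexp: "g (exp (- u)) = (\<Sum>i\<le>N. a i * exp (- real i * u))" for u :: real
      unfolding ga by (simp add: exp_of_nat_mult[symmetric])
    \<comment> \<open>The polynomial costs e / 4 under any law on the nonnegative half-line: there
      exp (- u) stays in [0, 1], the range on which \<open>g\<close> is close to \<phi>.\<close>
    have appr: "\<bar>integral\<^sup>L \<rho> (cts_step x y) - (\<Sum>i\<le>N. a i * (\<integral>u. exp (- real i * u) \<partial>\<rho>))\<bar> \<le> e / 4"
      if \<rho>: "real_distribution \<rho>" "AE x in \<rho>. 0 \<le> x" for \<rho>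
    proof -
      interpret real_distribution \<rho> by fact
      have i: "integrable \<rho> (\<lambda>u. exp (- real i * u))" for i
        using integrable_exp_neg[of "\<lambda>u. u" "real i"] \<rho>(2) by simp
      have s: "(\<Sum>i\<le>N. a i * (\<integral>u. exp (- real i * u) \<partial>\<rho>)) = (\<integral>u. g (exp (- u)) \<partial>\<rho>)"
        unfolding gexp by (simp only: Bochner_Integration.integral_sum integrable_mult_right i integral_mult_right_zero)
      have ig: "integrable \<rho> (\<lambda>u. g (exp (- u)))" unfolding gexp by (intro Bochner_Integration.integrable_sum integrable_mult_right i)
      have "\<bar>(\<integral>u. cts_step x y u - g (exp (- u)) \<partial>\<rho>)\<bar> \<le> (\<integral>u. \<bar>cts_step x y u - g (exp (- u))\<bar> \<partial>\<rho>)"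
        by (rule integral_abs_bound)
      also have "\<dots> \<le> (\<integral>u. e / 4 \<partial>\<rho>)"
      proof (rule integral_mono_AE)
        show "integrable \<rho> (\<lambda>u. \<bar>cts_step x y u - g (exp (- u))\<bar>)"
          by (intro integrable_abs Bochner_Integration.integrable_diff ig integrable_cts_step xy)
        show "AE u in \<rho>. \<bar>cts_step x y u - g (exp (- u))\<bar> \<le> e / 4"
          using \<rho>(2)
        proof eventually_elim
          case (elim u)
          then have "exp (- u) \<in> {0..1}" by simp
          from g(2)[OF this] show ?case unfolding eq by simp
        qed
      qed simp
      also have "\<dots> = e / 4" using prob_space by simp
      finally show ?thesis unfolding s using Bochner_Integration.integral_diff[OF integrable_cts_step[OF xy] ig] by simp
    qed
    have "(\<lambda>n. \<Sum>i\<le>N. a i * (\<integral>u. exp (- real i * u) \<partial>\<mu> n)) \<longlonglongrightarrow> (\<Sum>i\<le>N. a i * (\<integral>u. exp (- real i * u) \<partial>\<nu>))"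
      by (intro tendsto_intros lap)
    from LIMSEQ_D[OF this, of "e / 4"] e obtain n0 where n0: "\<And>n. n \<ge> n0 \<Longrightarrow> norm ((\<Sum>i\<le>N. a i * (\<integral>u. exp (- real i * u) \<partial>\<mu> n)) - (\<Sum>i\<le>N. a i * (\<integral>u. exp (- real i * u) \<partial>\<nu>))) < e / 4"
      by auto
    show "\<exists>no. \<forall>n\<ge>no. norm (integral\<^sup>L (\<mu> n) (cts_step x y) - integral\<^sup>L \<nu> (cts_step x y)) < e"
    proof (intro exI[of _ n0] allI impI)
      fix n assume "n0 \<le> n"
      from n0[OF this] appr[OF \<mu>, of n] appr[OF \<nu>] e
      show "norm (integral\<^sup>L (\<mu> n) (cts_step x y) - integral\<^sup>L \<nu> (cts_step x y)) < e"
        unfolding real_norm_def by linarith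
    qed
  qed
qed

section \<open>The chi-squared law and its Laplace transform\<close>

lemma chi2_density_nonneg: "1 \<le> L \<Longrightarrow> 0 \<le> chi2_density L x"
  unfolding chi2_density_def by (auto intro!: mult_nonneg_nonneg divide_nonneg_nonneg Gamma_real_nonneg)

lemma chi2_density_measurable[measurable]: "chi2_density L \<in> borel_measurable borel"
  unfolding chi2_density_def[abs_def] by measurable

text \<open>Substituting t = c * x with c = 1/2 + k turns the Gamma integral of order L / 2 into the
  tilted chi-squared density; \<open>D\<close> gathers the constants. The nonnegative integral asks
  for no integrability, and k = 0 later shows that the density has total mass 1.\<close>

lemma nn_integral_chi2_exp:
  assumes L: "1 \<le> L" and k: "0 \<le> (k::real)"
  shows "(\<integral>\<^sup>+x. ennreal (chi2_density L x * exp (- k * x)) \<partial>lborel) = ennreal ((1 + 2 * k) powr (- real L / 2))"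
proof -
  define h where "h = real L / 2"
  define c where "c = 1 / 2 + k"
  have h: "0 < h" and c: "0 < c" using L k unfolding h_def c_def by auto
  define D where "D = c powr h * (2 powr h * Gamma h)"
  have G: "0 < Gamma h" using h by (rule Gamma_real_pos)
  have D: "0 < D" unfolding D_def using c G by simp
  have "ennreal (Gamma h) = (\<integral>\<^sup>+t. ennreal (indicator {0..} t * t powr (h - 1) / exp t) \<partial>lborel)"
    using h by (rule Gamma_conv_nn_integral_real)
  also have "\<dots> = \<bar>c\<bar> * (\<integral>\<^sup>+x. ennreal (indicator {0..} (0 + c * x) * (0 + c * x) powr (h - 1) / exp (0 + c * x)) \<partial>lborel)"
    using c by (intro nn_integral_real_affine) auto
  also have "\<dots> = (\<integral>\<^sup>+x. ennreal c * ennreal (indicator {0..} (c * x) * (c * x) powr (h - 1) / exp (c * x)) \<partial>lborel)"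
    using c by (subst nn_integral_cmult) auto
  also have "\<dots> = (\<integral>\<^sup>+x. ennreal D * ennreal (chi2_density L x * exp (- k * x)) \<partial>lborel)"
  proof (intro nn_integral_cong)
    fix x :: real
    have "c * (indicator {0..} (c * x) * (c * x) powr (h - 1) / exp (c * x)) = D * (chi2_density L x * exp (- k * x))"
    proof (cases "0 < x")
      case True
      have e: "exp (- x / 2) * exp (- k * x) = 1 / exp (c * x)"
      proof -
        have "- x / 2 + - k * x = - (c * x)" unfolding c_def by (simp add: distrib_right)
        then show ?thesis unfolding exp_add[symmetric] by (simp only: exp_minus inverse_eq_divide)
      qed
      have p: "c * (c * x) powr (h - 1) = c powr h * x powr (h - 1)"
        using c True by (simp add: powr_mult powr_diff)
      have "D * (chi2_density L x * exp (- k * x)) = c powr h * (x powr (h - 1) * (exp (- x / 2) * exp (- k * x)))"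
        unfolding chi2_density_def h_def[symmetric] D_def using True G by simp
      also have "\<dots> = c * (c * x) powr (h - 1) / exp (c * x)" unfolding e p by simp
      finally show ?thesis using True c by simp
    next
      case False
      then have "c * x < 0 \<or> c * x = 0" using c by (auto simp: mult_le_0_iff not_less le_less mult_less_0_iff)
      then show ?thesis using False by (auto simp: chi2_density_def)
    qed
    then show "ennreal c * ennreal (indicator {0..} (c * x) * (c * x) powr (h - 1) / exp (c * x)) = ennreal D * ennreal (chi2_density L x * exp (- k * x))"
      using c D by (simp add: ennreal_mult'[symmetric])
  qed
  also have "\<dots> = ennreal D * (\<integral>\<^sup>+x. ennreal (chi2_density L x * exp (- k * x)) \<partial>lborel)"
    by (rule nn_integral_cmult) measurable
  finally have "ennreal (1 / D) * ennreal (Gamma h) = ennreal (1 / D) * ennreal D * (\<integral>\<^sup>+x. ennreal (chi2_density L x * exp (- k * x)) \<partial>lborel)"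
    by (simp add: mult.assoc)
  then have "(\<integral>\<^sup>+x. ennreal (chi2_density L x * exp (- k * x)) \<partial>lborel) = ennreal (Gamma h / D)"
    using D G by (simp add: ennreal_mult'[symmetric])
  also have "Gamma h / D = (1 + 2 * k) powr (- real L / 2)"
  proof -
    have "D = (1 + 2 * k) powr h * Gamma h" 
    proof -
      have "c * 2 = 1 + 2 * k" unfolding c_def by simp
      then show ?thesis unfolding D_def using c by (metis (no_types, lifting) mult.assoc powr_mult less_imp_le zero_le_numeral)
    qed
    then show ?thesis using G k by (simp add: powr_minus_divide h_def)
  qed
  finally show ?thesis .
qed

lemma real_distribution_chi2: 
  assumes "1 \<le> L" shows "real_distribution (chi2 L)"
proof -
  have "emeasure (chi2 L) (space (chi2 L)) = (\<integral>\<^sup>+x. ennreal (chi2_density L x * exp (- 0 * x)) \<partial>lborel)"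
    unfolding chi2_def by (subst emeasure_density) auto
  also have "\<dots> = 1" unfolding nn_integral_chi2_exp[OF assms order_refl] by simp
  finally have "prob_space (chi2 L)" by (rule prob_spaceI)
  then show ?thesis unfolding real_distribution_def real_distribution_axioms_def by (simp add: chi2_def)
qed

lemma chi2_nonneg: "AE x in chi2 L. 0 \<le> x"
  unfolding chi2_def by (subst AE_density) (auto simp: chi2_density_def)

lemma chi2_laplace:
  assumes L: "1 \<le> L" and k: "0 \<le> (k::real)"
  shows "(\<integral>x. exp (- k * x) \<partial>chi2 L) = (1 + 2 * k) powr (- real L / 2)"
proof -
  have "(\<integral>x. exp (- k * x) \<partial>chi2 L) = (\<integral>x. chi2_density L x * exp (- k * x) \<partial>lborel)"
    unfolding chi2_def by (subst integral_density) (auto intro!: AE_I2 chi2_density_nonneg L)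
  also have "\<dots> = (1 + 2 * k) powr (- real L / 2)"
    using nn_integral_chi2_exp[OF L k] chi2_density_nonneg[OF L]
    by (subst integral_eq_nn_integral) auto
  finally show ?thesis .
qed

section \<open>The marginal binomial model\<close>

lemma bfun_nonneg: "0 \<le> bfun w"
  unfolding bfun_def by (simp add: add_increasing2)

lemma bfun_ge: "w \<le> bfun w"
proof -
  have "exp w \<le> 1 + exp w" by simp
  then have "ln (exp w) \<le> ln (1 + exp w)"
    by (metis exp_gt_zero ln_mono)
  then show ?thesis unfolding bfun_def by simp
qed

lemma bfun_mono: "w \<le> w' \<Longrightarrow> bfun w \<le> bfun w'"
  unfolding bfun_def by (intro ln_mono) (auto simp: add_pos_pos)

lemma bfun_nonexpansive: 
  assumes "w \<le> w'" shows "bfun w' - bfun w \<le> w' - w"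
proof -
  have "1 + exp w' \<le> exp (w' - w) * (1 + exp w)"
    using assms by (simp add: exp_diff divide_simps) (simp add: algebra_simps)
  then have "ln (1 + exp w') \<le> ln (exp (w' - w) * (1 + exp w))"
    by (intro ln_mono) (auto simp: add_pos_pos)
  also have "\<dots> = (w' - w) + ln (1 + exp w)"
    by (subst ln_mult) (auto simp: add_pos_pos add_nonneg_eq_0_iff)
  finally show ?thesis unfolding bfun_def by simp
qed

lemma bdot_bounds: "0 < bdot w" "bdot w < 1"
  unfolding bdot_def by (auto simp: field_simps add_pos_pos)

lemma bdot_exp: "bdot w = exp (w - bfun w)"
proof -
  have "exp (bfun w) = 1 + exp w"
    unfolding bfun_def by (simp add: add_pos_pos)
  then show ?thesis by (simp add: bdot_def exp_diff)
qed

lemma one_minus_bdot: "1 - bdot w = exp (- bfun w)"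
proof -
  have "exp (bfun w) = 1 + exp w" "1 + exp w \<noteq> 0"
    unfolding bfun_def using exp_gt_zero[of w] by (auto simp: add_pos_pos simp del: exp_gt_zero)
  then show ?thesis by (simp add: bdot_def exp_minus field_simps)
qed

text \<open>For k <= l this is bdot^k * (1 - bdot)^(l - k), the binomial weight without its
  coefficient. Letting both indices vary keeps the numerator of the score in the same family:
  multiplication by \<open>bdot\<close> raises both of them (\<open>pk_Suc\<close>).\<close>

definition pk :: "nat \<Rightarrow> nat \<Rightarrow> real \<Rightarrow> real" where
  "pk k l w = exp (real k * w - real l * bfun w)"

lemma pk_pos: "0 < pk k l w" unfolding pk_def by simp

lemma pk_le_1: 
  assumes "k \<le> l" shows "pk k l w \<le> 1"
proof -
  have "real k * w \<le> real k * bfun w" using bfun_ge by (simp add: mult_left_mono)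
  also have "\<dots> \<le> real l * bfun w" using assms bfun_nonneg by (simp add: mult_right_mono)
  finally show ?thesis unfolding pk_def by simp
qed

text \<open>The exponent has slope k - l * bdot w, which lies in [-l, l]. The bound is
  multiplicative because ratios and logarithms of mixtures are compared later.\<close>

lemma pk_lip:
  assumes "k \<le> l" "l \<le> N" shows "pk k l w' \<le> pk k l w * exp (real N * \<bar>w' - w\<bar>)"
proof -
  have "real k * (w' - w) - real l * (bfun w' - bfun w) \<le> real N * \<bar>w' - w\<bar>"
  proof (cases "w \<le> w'")
    case True
    have "real l * (bfun w' - bfun w) \<ge> 0" using bfun_mono[OF True] by simp
    moreover have "real k * (w' - w) \<le> real N * \<bar>w' - w\<bar>" using assms True 
      by (simp add: mult_right_mono)
    ultimately show ?thesis by simp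
  next
    case False
    have "real l * (bfun w - bfun w') \<le> real N * (w - w')" 
      using bfun_nonexpansive[of w' w] bfun_mono[of w' w] False assms by (intro mult_mono) auto
    moreover have "real k * (w' - w) \<le> 0" using False by (simp add: mult_nonneg_nonpos)
    ultimately show ?thesis using False by (simp add: algebra_simps)
  qed
  then show ?thesis unfolding pk_def exp_add[symmetric] by (simp add: algebra_simps)
qed

lemma pk_Suc: "pk (Suc k) (Suc l) w = bdot w * pk k l w"
  unfolding pk_def bdot_exp exp_add[symmetric] by (simp add: algebra_simps)

lemma fcond_pk: "fcond m y w = real (m choose y) * pk y m w"
  unfolding fcond_def pk_def ..

lemma bfun_measurable[measurable]: "bfun \<in> borel_measurable borel"
  unfolding bfun_def[abs_def] by measurable

lemma bdot_measurable[measurable]: "bdot \<in> borel_measurable borel"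
  unfolding bdot_def[abs_def] by measurable

lemma pk_measurable[measurable]: "pk k l \<in> borel_measurable borel"
  unfolding pk_def[abs_def] by measurable

lemma fcond_measurable[measurable]: "fcond m y \<in> borel_measurable borel"
  unfolding fcond_pk[abs_def] by measurable

lemma fcond_bounds:  "0 \<le> fcond m y w"
  unfolding fcond_pk using pk_pos[of y m w] by simp

lemma sum_fcond: "(\<Sum>y\<le>m. fcond m y w) = 1"
proof -
  have "fcond m y w = real (m choose y) * bdot w ^ y * (1 - bdot w) ^ (m - y)" if "y \<le> m" for y
    using that unfolding fcond_pk pk_def one_minus_bdot 
    unfolding bdot_exp exp_of_nat_mult[symmetric]
    by (simp add: mult.assoc exp_add[symmetric] of_nat_diff) (simp add: algebra_simps)
  then have "(\<Sum>y\<le>m. fcond m y w) = (\<Sum>y\<le>m. real (m choose y) * bdot w ^ y * (1 - bdot w) ^ (m - y))"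
    by simp
  also have "\<dots> = 1" using binomial_ring[of "bdot w" "1 - bdot w" m, symmetric] by simp
  finally show ?thesis .
qed

text \<open>Absorption, (j + 1) * C(k + 1, j + 1) = (k + 1) * C(k, j), pulls out one success and
  leaves a full binomial sum with one trial fewer.\<close>

lemma mean_fcond: "(\<Sum>y\<le>m. real y * fcond m y w) = real m * bdot w"
proof (cases m)
  case (Suc k)
  have *: "real (Suc j) * fcond m (Suc j) w = real m * bdot w * fcond k j w" for j
  proof -
    have "real (Suc j) * real (m choose Suc j) = real m * real (k choose j)"
      unfolding Suc using Suc_times_binomial[of j k] by (metis of_nat_mult)
    then show ?thesis unfolding fcond_pk unfolding Suc pk_Suc by simp
  qed
  have "(\<Sum>y\<le>m. real y * fcond m y w) = (\<Sum>j\<le>k. real (Suc j) * fcond m (Suc j) w)"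
    unfolding Suc by (subst sum.atMost_Suc_shift) simp
  also have "\<dots> = real m * bdot w * (\<Sum>j\<le>k. fcond k j w)"
    unfolding * by (simp add: sum_distrib_left)
  finally show ?thesis by (simp add: sum_fcond)
qed simp

section \<open>Gaussian mixtures of binomial weights\<close>

definition gmix :: "nat \<Rightarrow> nat \<Rightarrow> real \<Rightarrow> real \<Rightarrow> real" where
  "gmix k l \<eta> \<sigma> = (LINT a|lborel. pk k l (\<eta> + \<sigma> * a) * std_normal_density a)"

lemma integrable_std_normal[simp]: "integrable lborel std_normal_density"
  by (rule integrable_normal_density) simp

lemma integral_std_normal[simp]: "(LINT a|lborel. std_normal_density a) = 1"
  by simp

lemma integrable_exp_normal: "integrable lborel (\<lambda>a. exp (c * a) * std_normal_density a)"
proof -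
  have "exp (c * a) * std_normal_density a = exp (c\<^sup>2 / 2) * normal_density c 1 a" for a
    unfolding normal_density_def by (simp add: exp_add[symmetric] field_simps power2_eq_square)
  then show ?thesis by simp
qed

lemma integrable_exp_abs_normal: "integrable lborel (\<lambda>a. exp (c * \<bar>a\<bar>) * std_normal_density a)"
proof (rule Bochner_Integration.integrable_bound)
  show "integrable lborel (\<lambda>a. exp (c * a) * std_normal_density a + exp (- c * a) * std_normal_density a)"
    by (intro Bochner_Integration.integrable_add integrable_exp_normal)
  show "AE a in lborel. norm (exp (c * \<bar>a\<bar>) * std_normal_density a)
      \<le> norm (exp (c * a) * std_normal_density a + exp (- c * a) * std_normal_density a)"
  proof (intro AE_I2)
    fix a :: real
    have "exp (c * \<bar>a\<bar>) \<le> exp (c * a) + exp (- c * a)" by (cases "0 \<le> a") (auto simp: add_increasing)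
    then show "norm (exp (c * \<bar>a\<bar>) * std_normal_density a)
      \<le> norm (exp (c * a) * std_normal_density a + exp (- c * a) * std_normal_density a)"
      unfolding ring_distribs[symmetric] real_norm_def abs_mult by (intro mult_right_mono) auto
  qed
qed simp

lemma integrable_bounded_normal:
  fixes f :: "real \<Rightarrow> real"
  assumes [measurable]: "f \<in> borel_measurable borel" and "\<And>a. \<bar>f a\<bar> \<le> K"
  shows "integrable lborel (\<lambda>a. f a * std_normal_density a)"
proof (rule Bochner_Integration.integrable_bound)
  show "integrable lborel (\<lambda>a. K * std_normal_density a)" by simp
  show "AE a in lborel. norm (f a * std_normal_density a) \<le> norm (K * std_normal_density a)"
    using assms(2) by (intro AE_I2) (auto simp: abs_mult intro!: mult_right_mono order_trans[OF assms(2)])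
qed simp

lemma integrable_pk:
  assumes "k \<le> l"
  shows "integrable lborel (\<lambda>a. pk k l (\<eta> + \<sigma> * a) * std_normal_density a)"
  using pk_pos[of k l] pk_le_1[OF assms]
  by (intro integrable_bounded_normal[where K=1]) (auto simp: abs_if less_le_not_le)

lemma gmix_le_1:
  assumes "k \<le> l" shows "gmix k l \<eta> \<sigma> \<le> 1"
proof -
  have "gmix k l \<eta> \<sigma> \<le> (LINT a|lborel. std_normal_density a)"
    unfolding gmix_def using pk_le_1[OF assms]
    by (intro integral_mono integrable_pk assms) (auto intro!: mult_left_le_one_le simp: pk_pos less_imp_le)
  then show ?thesis by simp
qed

lemma integral_pos_lborel:
  fixes f :: "real \<Rightarrow> real"
  assumes "integrable lborel f" "\<And>a. 0 < f a"
  shows "0 < (LINT a|lborel. f a)"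
proof -
  have "(LINT a|lborel. f a) \<noteq> 0"
  proof
    assume "(LINT a|lborel. f a) = 0"
    then have "AE a in lborel. f a = 0"
      using integral_nonneg_eq_0_iff_AE[OF assms(1)] assms(2) by (simp add: less_imp_le)
    then have "AE a in lborel. (a::real) \<in> {}" using assms(2) by (auto elim!: eventually_mono simp: less_le)
    then have "emeasure lborel (UNIV :: real set) = 0"
      by (subst (asm) AE_iff_measurable[OF _ refl]) auto
    then show False by simp
  qed
  moreover have "0 \<le> (LINT a|lborel. f a)" using assms(2) by (intro integral_nonneg_AE AE_I2) (simp add: less_imp_le)
  ultimately show ?thesis by simp
qed

lemma gmix_pos: "k \<le> l \<Longrightarrow> 0 < gmix k l \<eta> \<sigma>"
  unfolding gmix_def by (intro integral_pos_lborel integrable_pk) (auto simp: pk_pos normal_density_pos)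

text \<open>The constant must be uniform over all real \<eta>, where mixtures become arbitrarily
  small, so absolute differences would not do. The mixture and its increment in \<sigma> are both
  compared with \<open>pk k l \<eta>\<close>: the mixture is at least \<open>K2\<close> times this
  value, the increment at most a multiple of \<open>K1\<close> times it.\<close>

lemma gmix_loglip:
  assumes S: "0 \<le> S"
  obtains C where "0 < C"
    "\<And>k l \<eta> \<eta>' \<sigma> \<sigma>'. k \<le> l \<Longrightarrow> l \<le> N \<Longrightarrow> 0 \<le> \<sigma> \<Longrightarrow> \<sigma> \<le> S \<Longrightarrow> 0 \<le> \<sigma>' \<Longrightarrow> \<sigma>' \<le> S \<Longrightarrow>
      gmix k l \<eta>' \<sigma>' \<le> gmix k l \<eta> \<sigma> * exp (C * (\<bar>\<eta>' - \<eta>\<bar> + \<bar>\<sigma>' - \<sigma>\<bar>))"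
proof -
  \<comment> \<open>The exponent 2 * N * S + 1 adds up three losses: N * S from the remainder of the
    exponential, N * S from replacing \<open>pk k l (\<eta> + \<sigma> * a)\<close> by
    \<open>pk k l \<eta>\<close>, and 1 from |a| <= exp |a|.\<close>
  define K1 where "K1 = (LINT a|lborel. exp ((2 * N * S + 1) * \<bar>a\<bar>) * std_normal_density a)"
  define K2 where "K2 = (LINT a|lborel. exp ((- N * S) * \<bar>a\<bar>) * std_normal_density a)"
  have K1: "K1 > 0" and K2: "K2 > 0" unfolding K1_def K2_def
    by (rule integral_pos_lborel[OF integrable_exp_abs_normal], simp add: normal_density_pos)+
  define C where "C = real N + N * K1 / K2 + 1"
  have "C > 0" unfolding C_def using K1 K2 by (simp add: add_nonneg_pos)
  moreover have "gmix k l \<eta>' \<sigma>' \<le> gmix k l \<eta> \<sigma> * exp (C * (\<bar>\<eta>' - \<eta>\<bar> + \<bar>\<sigma>' - \<sigma>\<bar>))"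
    if kl: "k \<le> l" "l \<le> N" and s: "0 \<le> \<sigma>" "\<sigma> \<le> S" "0 \<le> \<sigma>'" "\<sigma>' \<le> S" for k l \<eta> \<eta>' \<sigma> \<sigma>'
  proof -
    define D where "D = \<bar>\<sigma>' - \<sigma>\<bar>"
    have D: "0 \<le> D" "D \<le> S" using s unfolding D_def by auto
    have low: "pk k l \<eta> * K2 \<le> gmix k l \<eta> \<sigma>"
    proof -
      have "pk k l \<eta> * K2 = (LINT a|lborel. pk k l \<eta> * (exp ((- N * S) * \<bar>a\<bar>) * std_normal_density a))"
        unfolding K2_def by (rule integral_mult_right_zero[symmetric])
      also have "\<dots> \<le> gmix k l \<eta> \<sigma>" unfolding gmix_def
      proof (intro integral_mono integrable_pk kl integrable_mult_right integrable_exp_abs_normal)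
        fix a :: real
        have "pk k l \<eta> \<le> pk k l (\<eta> + \<sigma> * a) * exp (real N * \<bar>\<eta> - (\<eta> + \<sigma> * a)\<bar>)"
          by (rule pk_lip) (use kl in auto)
        also have "\<dots> \<le> pk k l (\<eta> + \<sigma> * a) * exp (real N * S * \<bar>a\<bar>)"
          using s pk_pos[of k l] by (auto simp: abs_mult mult.assoc less_imp_le intro!: mult_left_mono mult_right_mono)
        finally have "pk k l \<eta> * exp ((- N * S) * \<bar>a\<bar>) \<le> pk k l (\<eta> + \<sigma> * a)"
          by (simp add: exp_minus field_simps)
        then show "pk k l \<eta> * (exp ((- N * S) * \<bar>a\<bar>) * std_normal_density a) \<le> pk k l (\<eta> + \<sigma> * a) * std_normal_density a"
          by (simp add: mult.assoc[symmetric] mult_right_mono)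
      qed
      finally show ?thesis .
    qed
    have "gmix k l \<eta>' \<sigma>' \<le> (LINT a|lborel. exp (N * \<bar>\<eta>' - \<eta>\<bar>) * (pk k l (\<eta> + \<sigma> * a) * std_normal_density a
        + (D * N * pk k l \<eta>) * (exp ((2 * N * S + 1) * \<bar>a\<bar>) * std_normal_density a)))"
      unfolding gmix_def
    proof (intro integral_mono integrable_pk kl integrable_mult_right integrable_exp_abs_normal Bochner_Integration.integrable_add)
      fix a :: real
      \<comment> \<open>From exp z - 1 <= z * exp z at z = N * D * |a|. The factor D outside is
        kept, since it makes the bound Lipschitz; the D in the exponent is estimated by S.\<close>
      have e: "exp (real N * D * \<bar>a\<bar>) \<le> 1 + D * N * exp ((N * S + 1) * \<bar>a\<bar>)"
      proof -
        have "exp (real N * D * \<bar>a\<bar>) - 1 \<le> (real N * D * \<bar>a\<bar>) * exp (real N * D * \<bar>a\<bar>)"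
          using exp_ge_add_one_self[of "- (real N * D * \<bar>a\<bar>)"] by (simp add: exp_minus field_simps)
        also have "\<dots> \<le> (real N * D * exp \<bar>a\<bar>) * exp (real N * S * \<bar>a\<bar>)"
          using D order_trans[OF _ exp_ge_add_one_self[of "\<bar>a\<bar>"], of "\<bar>a\<bar>"]
          by (intro mult_mono) (auto intro!: mult_left_mono mult_right_mono)
        also have "\<dots> = D * N * exp ((N * S + 1) * \<bar>a\<bar>)" by (simp add: exp_add algebra_simps)
        finally show ?thesis by simp
      qed
      have "pk k l (\<eta>' + \<sigma>' * a) \<le> pk k l (\<eta> + \<sigma> * a) * exp (real N * \<bar>(\<eta>' + \<sigma>' * a) - (\<eta> + \<sigma> * a)\<bar>)"
        by (rule pk_lip) (use kl in auto)
      also have "\<dots> \<le> pk k l (\<eta> + \<sigma> * a) * exp (real N * (\<bar>\<eta>' - \<eta>\<bar> + D * \<bar>a\<bar>))"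
      proof -
        have "\<bar>(\<eta>' + \<sigma>' * a) - (\<eta> + \<sigma> * a)\<bar> \<le> \<bar>\<eta>' - \<eta>\<bar> + \<bar>(\<sigma>' - \<sigma>) * a\<bar>"
          by (simp add: algebra_simps)
        then show ?thesis unfolding abs_mult D_def using pk_pos[of k l "\<eta> + \<sigma> * a"]
          by (auto intro!: mult_left_mono)
      qed
      also have "\<dots> = exp (N * \<bar>\<eta>' - \<eta>\<bar>) * (pk k l (\<eta> + \<sigma> * a) * exp (real N * D * \<bar>a\<bar>))"
        by (simp add: exp_add algebra_simps)
      also have "\<dots> \<le> exp (N * \<bar>\<eta>' - \<eta>\<bar>) * (pk k l (\<eta> + \<sigma> * a) + D * N * pk k l \<eta> * exp ((2 * N * S + 1) * \<bar>a\<bar>))"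
      proof (intro mult_left_mono)
        have "pk k l (\<eta> + \<sigma> * a) * exp (real N * D * \<bar>a\<bar>) \<le> pk k l (\<eta> + \<sigma> * a) * (1 + D * N * exp ((N * S + 1) * \<bar>a\<bar>))"
          using e pk_pos[of k l "\<eta> + \<sigma> * a"] by (intro mult_left_mono) auto
        also have "\<dots> = pk k l (\<eta> + \<sigma> * a) + D * N * (pk k l (\<eta> + \<sigma> * a) * exp ((N * S + 1) * \<bar>a\<bar>))"
          by (simp add: algebra_simps)
        also have "\<dots> \<le> pk k l (\<eta> + \<sigma> * a) + D * N * (pk k l \<eta> * exp (N * S * \<bar>a\<bar>) * exp ((N * S + 1) * \<bar>a\<bar>))"
        proof -
          have "pk k l (\<eta> + \<sigma> * a) \<le> pk k l \<eta> * exp (real N * \<bar>(\<eta> + \<sigma> * a) - \<eta>\<bar>)"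
            by (rule pk_lip) (use kl in auto)
          also have "\<dots> \<le> pk k l \<eta> * exp (N * S * \<bar>a\<bar>)"
            using s pk_pos[of k l] by (auto simp: abs_mult mult.assoc less_imp_le intro!: mult_left_mono mult_right_mono)
          finally show ?thesis using D by (intro add_left_mono mult_left_mono mult_right_mono) auto
        qed
        finally show "pk k l (\<eta> + \<sigma> * a) * exp (real N * D * \<bar>a\<bar>) \<le> pk k l (\<eta> + \<sigma> * a) + D * N * pk k l \<eta> * exp ((2 * N * S + 1) * \<bar>a\<bar>)"
          by (simp add: algebra_simps exp_add[symmetric])
      qed simp
      finally have "pk k l (\<eta>' + \<sigma>' * a) * std_normal_density a \<le> exp (N * \<bar>\<eta>' - \<eta>\<bar>) * (pk k l (\<eta> + \<sigma> * a) + D * N * pk k l \<eta> * exp ((2 * N * S + 1) * \<bar>a\<bar>)) * std_normal_density a"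
        by (rule mult_right_mono) simp
      then show "pk k l (\<eta>' + \<sigma>' * a) * std_normal_density a \<le> exp (N * \<bar>\<eta>' - \<eta>\<bar>) * (pk k l (\<eta> + \<sigma> * a) * std_normal_density a
        + (D * N * pk k l \<eta>) * (exp ((2 * N * S + 1) * \<bar>a\<bar>) * std_normal_density a))"
        by (simp add: algebra_simps)
    qed
    also have "\<dots> = exp (N * \<bar>\<eta>' - \<eta>\<bar>) * (gmix k l \<eta> \<sigma> + (D * N * pk k l \<eta>) * K1)"
      unfolding gmix_def K1_def using kl
      by (simp only: integral_mult_right_zero Bochner_Integration.integral_add integrable_pk integrable_mult_right integrable_exp_abs_normal)
    also have "\<dots> \<le> exp (N * \<bar>\<eta>' - \<eta>\<bar>) * (gmix k l \<eta> \<sigma> * (1 + D * N * K1 / K2))"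
    proof (intro mult_left_mono)
      have "(D * N * K1 / K2) * (pk k l \<eta> * K2) \<le> (D * N * K1 / K2) * gmix k l \<eta> \<sigma>"
        using D K1 K2 low by (intro mult_left_mono) auto
      then show "gmix k l \<eta> \<sigma> + D * N * pk k l \<eta> * K1 \<le> gmix k l \<eta> \<sigma> * (1 + D * N * K1 / K2)"
        using K2 by (simp add: algebra_simps)
    qed simp
    also have "\<dots> \<le> exp (N * \<bar>\<eta>' - \<eta>\<bar>) * (gmix k l \<eta> \<sigma> * exp (D * N * K1 / K2))"
      using gmix_pos[OF kl(1), of \<eta> \<sigma>] by (intro mult_left_mono) (auto simp: exp_ge_add_one_self)
    also have "\<dots> = gmix k l \<eta> \<sigma> * exp (N * \<bar>\<eta>' - \<eta>\<bar> + D * N * K1 / K2)"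
      by (simp add: exp_add)
    also have "\<dots> \<le> gmix k l \<eta> \<sigma> * exp (C * (\<bar>\<eta>' - \<eta>\<bar> + \<bar>\<sigma>' - \<sigma>\<bar>))"
    proof -
      have "N * \<bar>\<eta>' - \<eta>\<bar> \<le> C * \<bar>\<eta>' - \<eta>\<bar>" unfolding C_def using K1 K2
        by (intro mult_right_mono) auto
      moreover have "(N * K1 / K2) * D \<le> C * D" unfolding C_def using K1 K2 D
        by (intro mult_right_mono) auto
      ultimately show ?thesis using gmix_pos[OF kl(1), of \<eta> \<sigma>] unfolding D_def
        by (auto simp: algebra_simps)
    qed
    finally show ?thesis .
  qed
  ultimately show ?thesis by (rule that)
qed

section \<open>One observation: density, score and score variance\<close>

definition fs :: "nat \<Rightarrow> real \<Rightarrow> real \<Rightarrow> nat \<Rightarrow> real" where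
  "fs m \<eta> \<sigma> y = real (m choose y) * gmix y m \<eta> \<sigma>"

text \<open>The quotient of mixtures is the posterior mean of \<open>bdot\<close> given y. For y > m
  the density vanishes and division by zero in \<open>ufun\<close> leaves y; the second branch
  copies this, so that \<open>ufun_us\<close> holds without a side condition.\<close>

definition us :: "nat \<Rightarrow> real \<Rightarrow> real \<Rightarrow> nat \<Rightarrow> real" where
  "us m \<eta> \<sigma> y = (if y \<le> m then real y - real m * (gmix (Suc y) (Suc m) \<eta> \<sigma> / gmix y m \<eta> \<sigma>) else real y)"

definition es :: "nat \<Rightarrow> real \<Rightarrow> real \<Rightarrow> real" where
  "es m \<eta> \<sigma> = (\<Sum>y\<le>m. fs m \<eta> \<sigma> y * (us m \<eta> \<sigma> y)\<^sup>2)"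

lemma fmarg_fs: "fmarg m \<eta> \<tau> y = fs m \<eta> (sqrt \<tau>) y"
  unfolding fmarg_def fs_def gmix_def fcond_pk by (simp add: mult.assoc)

lemma ufun_us: "ufun m \<eta> \<tau> y = us m \<eta> (sqrt \<tau>) y"
proof (cases "y \<le> m")
  case True
  have "(LINT a|lborel. real m * bdot (\<eta> + sqrt \<tau> * a) * fcond m y (\<eta> + sqrt \<tau> * a) * std_normal_density a)
    = real m * real (m choose y) * gmix (Suc y) (Suc m) \<eta> (sqrt \<tau>)"
    unfolding gmix_def fcond_pk pk_Suc
    by (subst integral_mult_right_zero[symmetric]) (simp add: mult_ac)
  then show ?thesis using True unfolding ufun_def fmarg_fs fs_def us_def by simp
next
  case False
  then show ?thesis unfolding ufun_def fmarg_fs fs_def us_def by simp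
qed

lemma EU2_es: "EU2 m \<eta> \<tau> = es m \<eta> (sqrt \<tau>)"
  unfolding EU2_def es_def fmarg_fs ufun_us atMost_atLeast0 ..

lemma fs_zero: "m < y \<Longrightarrow> fs m \<eta> \<sigma> y = 0"
  unfolding fs_def by simp

lemma fs_pos: "y \<le> m \<Longrightarrow> 0 < fs m \<eta> \<sigma> y"
  unfolding fs_def using gmix_pos[of y m \<eta> \<sigma>] by simp

lemma fs_nonneg: "0 \<le> fs m \<eta> \<sigma> y"
  using fs_pos[of y m \<eta> \<sigma>] fs_zero[of m y \<eta> \<sigma>] by (cases "y \<le> m") auto

lemma fs_integral: "fs m \<eta> \<sigma> y = (LINT a|lborel. fcond m y (\<eta> + \<sigma> * a) * std_normal_density a)"
  unfolding fs_def gmix_def fcond_pk by (simp add: mult.assoc)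

lemma integrable_fcond: "integrable lborel (\<lambda>a. fcond m y (\<eta> + \<sigma> * a) * std_normal_density a)"
proof (cases "y \<le> m")
  case True
  then show ?thesis using integrable_pk[OF True, of \<eta> \<sigma>] unfolding fcond_pk mult.assoc
    by (intro integrable_mult_right)
next
  case False
  then show ?thesis by (simp add: fcond_pk binomial_eq_0)
qed

lemma sum_fs: "(\<Sum>y\<le>m. fs m \<eta> \<sigma> y) = 1"
proof -
  have "(\<Sum>y\<le>m. fs m \<eta> \<sigma> y) = (LINT a|lborel. (\<Sum>y\<le>m. fcond m y (\<eta> + \<sigma> * a) * std_normal_density a))"
    unfolding fs_integral by (subst Bochner_Integration.integral_sum) (auto simp: integrable_fcond)
  also have "\<dots> = (LINT a|lborel. std_normal_density a)"
    unfolding sum_distrib_right[symmetric] sum_fcond by simp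
  finally show ?thesis by simp
qed

lemma sum_fs': "m \<le> B \<Longrightarrow> (\<Sum>y\<le>B. fs m \<eta> \<sigma> y) = 1"
  unfolding sum_fs[of m \<eta> \<sigma>, symmetric] by (intro sum.mono_neutral_right) (auto simp: fs_zero)

lemma fs_le_1: "fs m \<eta> \<sigma> y \<le> 1"
proof (cases "y \<le> m")
  case True
  have "fs m \<eta> \<sigma> y \<le> (\<Sum>y\<le>m. fs m \<eta> \<sigma> y)" using True
    by (intro member_le_sum) (auto simp: fs_nonneg)
  then show ?thesis by (simp add: sum_fs)
qed (simp add: fs_zero)

text \<open>The product \<open>fs * us\<close> is the mixture of y - m * bdot against the
  conditional density, and for each latent value these terms sum to 0 over y by
  \<open>mean_fcond\<close> and \<open>sum_fcond\<close>.\<close>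

lemma sum_fs_us: "(\<Sum>y\<le>m. fs m \<eta> \<sigma> y * us m \<eta> \<sigma> y) = 0"
proof -
  have *: "fs m \<eta> \<sigma> y * us m \<eta> \<sigma> y = 
      (LINT a|lborel. (real y * fcond m y (\<eta> + \<sigma> * a) - real m * (bdot (\<eta> + \<sigma> * a) * fcond m y (\<eta> + \<sigma> * a))) * std_normal_density a)"
    if "y \<le> m" for y
  proof -
    have 1: "integrable lborel (\<lambda>a. bdot (\<eta> + \<sigma> * a) * pk y m (\<eta> + \<sigma> * a) * std_normal_density a)"
      using integrable_pk[of "Suc y" "Suc m" \<eta> \<sigma>] that unfolding pk_Suc by simp
    have 2: "integrable lborel (\<lambda>a. bdot (\<eta> + \<sigma> * a) * fcond m y (\<eta> + \<sigma> * a) * std_normal_density a)"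
      using integrable_mult_right[OF 1, of "real (m choose y)"] unfolding fcond_pk by (simp add: mult_ac)
    have 3: "real (m choose y) * gmix (Suc y) (Suc m) \<eta> \<sigma> = (LINT a|lborel. bdot (\<eta> + \<sigma> * a) * fcond m y (\<eta> + \<sigma> * a) * std_normal_density a)"
      unfolding gmix_def pk_Suc fcond_pk by (subst integral_mult_right_zero[symmetric]) (simp add: mult_ac)
    have "fs m \<eta> \<sigma> y * us m \<eta> \<sigma> y = real y * fs m \<eta> \<sigma> y - real m * (real (m choose y) * gmix (Suc y) (Suc m) \<eta> \<sigma>)"
      using that gmix_pos[OF that, of \<eta> \<sigma>] unfolding fs_def us_def by (simp add: field_simps)
    also have "\<dots> = (LINT a|lborel. real y * (fcond m y (\<eta> + \<sigma> * a) * std_normal_density a) - real m * (bdot (\<eta> + \<sigma> * a) * fcond m y (\<eta> + \<sigma> * a) * std_normal_density a))"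
      unfolding 3 fs_integral using 2
      by (simp only: integral_mult_right_zero Bochner_Integration.integral_diff integrable_mult_right integrable_fcond)
    finally show ?thesis by (simp add: algebra_simps)
  qed
  have i: "integrable lborel (\<lambda>a. (real y * fcond m y (\<eta> + \<sigma> * a) - real m * (bdot (\<eta> + \<sigma> * a) * fcond m y (\<eta> + \<sigma> * a))) * std_normal_density a)"
    if "y \<le> m" for y
  proof (rule integrable_bounded_normal)
    fix a
    have "fcond m y (\<eta> + \<sigma> * a) \<le> (\<Sum>y\<le>m. fcond m y (\<eta> + \<sigma> * a))"
      using that by (intro member_le_sum) (auto simp: fcond_bounds)
    then have 1: "fcond m y (\<eta> + \<sigma> * a) \<le> 1" by (simp add: sum_fcond)
    have "\<bar>real y * fcond m y (\<eta> + \<sigma> * a) - real m * (bdot (\<eta> + \<sigma> * a) * fcond m y (\<eta> + \<sigma> * a))\<bar> 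
       \<le> real y * fcond m y (\<eta> + \<sigma> * a) + real m * (bdot (\<eta> + \<sigma> * a) * fcond m y (\<eta> + \<sigma> * a))"
      using bdot_bounds(1)[of "\<eta> + \<sigma> * a"] fcond_bounds[of m y "\<eta> + \<sigma> * a"] 
      by (intro abs_leI) (auto intro!: add_nonneg_nonneg mult_nonneg_nonneg simp: less_imp_le)
    also have "\<dots> \<le> real y * 1 + real m * (1 * 1)"
      using bdot_bounds[of "\<eta> + \<sigma> * a"] fcond_bounds[of m y "\<eta> + \<sigma> * a"] 1
      by (intro add_mono mult_left_mono mult_mono) auto
    finally show "\<bar>real y * fcond m y (\<eta> + \<sigma> * a) - real m * (bdot (\<eta> + \<sigma> * a) * fcond m y (\<eta> + \<sigma> * a))\<bar> \<le> real y * 1 + real m * (1 * 1)" .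
  qed measurable
  have "(\<Sum>y\<le>m. fs m \<eta> \<sigma> y * us m \<eta> \<sigma> y) = (LINT a|lborel. (\<Sum>y\<le>m. (real y * fcond m y (\<eta> + \<sigma> * a) - real m * (bdot (\<eta> + \<sigma> * a) * fcond m y (\<eta> + \<sigma> * a))) * std_normal_density a))"
    by (subst Bochner_Integration.integral_sum) (auto simp: i *)
  also have "\<dots> = 0"
    unfolding sum_distrib_right[symmetric] sum_subtractf sum_distrib_left[symmetric] mean_fcond sum_fcond by simp
  finally show ?thesis .
qed

lemma sum_fs_us': "m \<le> B \<Longrightarrow> (\<Sum>y\<le>B. fs m \<eta> \<sigma> y * us m \<eta> \<sigma> y) = 0"
  unfolding sum_fs_us[of m \<eta> \<sigma>, symmetric] by (intro sum.mono_neutral_right) (auto simp: fs_zero)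

lemma es': "m \<le> B \<Longrightarrow> es m \<eta> \<sigma> = (\<Sum>y\<le>B. fs m \<eta> \<sigma> y * (us m \<eta> \<sigma> y)\<^sup>2)"
  unfolding es_def by (intro sum.mono_neutral_left) (auto simp: fs_zero)

text \<open>The quotient averages \<open>bdot\<close>, which lies in (0, 1), against the posterior
  law of the latent variable.\<close>

lemma gmix_ratio: 
  assumes "y \<le> m" 
  shows "0 < gmix (Suc y) (Suc m) \<eta> \<sigma> / gmix y m \<eta> \<sigma>" "gmix (Suc y) (Suc m) \<eta> \<sigma> / gmix y m \<eta> \<sigma> \<le> 1"
proof -
  show "0 < gmix (Suc y) (Suc m) \<eta> \<sigma> / gmix y m \<eta> \<sigma>" using assms by (intro divide_pos_pos gmix_pos) auto
  have "gmix (Suc y) (Suc m) \<eta> \<sigma> \<le> gmix y m \<eta> \<sigma>"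
    unfolding gmix_def
  proof (intro integral_mono integrable_pk)
    fix a show "pk (Suc y) (Suc m) (\<eta> + \<sigma> * a) * std_normal_density a \<le> pk y m (\<eta> + \<sigma> * a) * std_normal_density a"
      unfolding pk_Suc using bdot_bounds[of "\<eta> + \<sigma> * a"] pk_pos[of y m "\<eta> + \<sigma> * a"]
      by (intro mult_right_mono mult_left_le_one_le) auto
  qed (use assms in auto)
  then show "gmix (Suc y) (Suc m) \<eta> \<sigma> / gmix y m \<eta> \<sigma> \<le> 1" using gmix_pos[OF assms, of \<eta> \<sigma>] by simp
qed

lemma us_bound:
  assumes "m \<le> B" "y \<le> B" shows "\<bar>us m \<eta> \<sigma> y\<bar> \<le> real B"
proof (cases "y \<le> m")
  case True
  have "0 \<le> real m * (gmix (Suc y) (Suc m) \<eta> \<sigma> / gmix y m \<eta> \<sigma>)" "real m * (gmix (Suc y) (Suc m) \<eta> \<sigma> / gmix y m \<eta> \<sigma>) \<le> real m * 1"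
    using gmix_ratio[OF True, of \<eta> \<sigma>] by (intro mult_nonneg_nonneg mult_left_mono; simp)+
  then have "- real m \<le> us m \<eta> \<sigma> y" "us m \<eta> \<sigma> y \<le> real y" using True unfolding us_def by simp_all
  then show ?thesis using assms by (auto simp: abs_le_iff)
qed (use assms in \<open>simp add: us_def\<close>)

lemma es_bounds: "m \<le> B \<Longrightarrow> 0 \<le> es m \<eta> \<sigma>" "m \<le> B \<Longrightarrow> es m \<eta> \<sigma> \<le> (real B)\<^sup>2"
proof -
  assume m: "m \<le> B"
  show "0 \<le> es m \<eta> \<sigma>" unfolding es_def by (intro sum_nonneg mult_nonneg_nonneg fs_nonneg) auto
  have "es m \<eta> \<sigma> \<le> (\<Sum>y\<le>m. fs m \<eta> \<sigma> y * (real B)\<^sup>2)" unfolding es_def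
    using us_bound[OF m] m by (intro sum_mono mult_left_mono fs_nonneg) (auto simp: abs_le_square_iff[symmetric])
  also have "\<dots> = (real B)\<^sup>2" unfolding sum_distrib_right[symmetric] sum_fs by simp
  finally show "es m \<eta> \<sigma> \<le> (real B)\<^sup>2" .
qed

text \<open>For numbers in [0, 1], closeness up to a factor exp c gives closeness up to c, because
  exp (- c) >= 1 - c.\<close>

lemma exp_ratio_lip:
  fixes r r' :: real
  assumes "r \<le> r' * exp c" "r' \<le> r * exp c" "0 \<le> r" "r \<le> 1" "0 \<le> r'" "r' \<le> 1" "0 \<le> c"
  shows "\<bar>r - r'\<bar> \<le> c"
proof -
  have *: "a - b \<le> c" if "a \<le> b * exp c" "0 \<le> a" "a \<le> 1" for a b :: real
  proof -
    have "b \<ge> a * exp (- c)" using that by (simp add: exp_minus field_simps)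
    moreover have "a * exp (- c) \<ge> a * (1 - c)" using that exp_ge_add_one_self[of "- c"] by (intro mult_left_mono) auto
    moreover have "a * c \<le> c" using that assms by (simp add: mult_left_le_one_le)
    ultimately show ?thesis by (simp add: algebra_simps)
  qed
  show ?thesis using *[of r r'] *[of r' r] assms by (simp add: abs_le_iff)
qed

lemma model_lipschitz:
  assumes "0 \<le> S"
  obtains C where "0 < C"
    "\<And>m y \<eta> \<eta>' \<sigma> \<sigma>'. m \<le> B \<Longrightarrow> y \<le> B \<Longrightarrow> 0 \<le> \<sigma> \<Longrightarrow> \<sigma> \<le> S \<Longrightarrow> 0 \<le> \<sigma>' \<Longrightarrow> \<sigma>' \<le> S \<Longrightarrow>
      \<bar>fs m \<eta> \<sigma> y - fs m \<eta>' \<sigma>' y\<bar> \<le> C * (\<bar>\<eta> - \<eta>'\<bar> + \<bar>\<sigma> - \<sigma>'\<bar>)"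
    "\<And>m y \<eta> \<eta>' \<sigma> \<sigma>'. m \<le> B \<Longrightarrow> y \<le> B \<Longrightarrow> 0 \<le> \<sigma> \<Longrightarrow> \<sigma> \<le> S \<Longrightarrow> 0 \<le> \<sigma>' \<Longrightarrow> \<sigma>' \<le> S \<Longrightarrow>
      \<bar>ln (fs m \<eta> \<sigma> y) - ln (fs m \<eta>' \<sigma>' y)\<bar> \<le> C * (\<bar>\<eta> - \<eta>'\<bar> + \<bar>\<sigma> - \<sigma>'\<bar>)"
    "\<And>m y \<eta> \<eta>' \<sigma> \<sigma>'. m \<le> B \<Longrightarrow> y \<le> B \<Longrightarrow> 0 \<le> \<sigma> \<Longrightarrow> \<sigma> \<le> S \<Longrightarrow> 0 \<le> \<sigma>' \<Longrightarrow> \<sigma>' \<le> S \<Longrightarrow>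
      \<bar>us m \<eta> \<sigma> y - us m \<eta>' \<sigma>' y\<bar> \<le> C * (\<bar>\<eta> - \<eta>'\<bar> + \<bar>\<sigma> - \<sigma>'\<bar>)"
    "\<And>m \<eta> \<eta>' \<sigma> \<sigma>'. m \<le> B \<Longrightarrow> 0 \<le> \<sigma> \<Longrightarrow> \<sigma> \<le> S \<Longrightarrow> 0 \<le> \<sigma>' \<Longrightarrow> \<sigma>' \<le> S \<Longrightarrow>
      \<bar>es m \<eta> \<sigma> - es m \<eta>' \<sigma>'\<bar> \<le> C * (\<bar>\<eta> - \<eta>'\<bar> + \<bar>\<sigma> - \<sigma>'\<bar>)"
proof -
  obtain C0 where C0: "0 < C0" and gmix: "\<And>k l \<eta> \<eta>' \<sigma> \<sigma>'. k \<le> l \<Longrightarrow> l \<le> Suc B \<Longrightarrow> 0 \<le> \<sigma> \<Longrightarrow> \<sigma> \<le> S \<Longrightarrow> 0 \<le> \<sigma>' \<Longrightarrow> \<sigma>' \<le> S \<Longrightarrow>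
      gmix k l \<eta>' \<sigma>' \<le> gmix k l \<eta> \<sigma> * exp (C0 * (\<bar>\<eta>' - \<eta>\<bar> + \<bar>\<sigma>' - \<sigma>\<bar>))"
    using gmix_loglip[OF assms] by blast
  \<comment> \<open>Densities and their logarithms cost C0. The score is m times a quotient of two
    mixtures, hence 2 * B * C0. The last term treats the at most B + 1 summands of \<open>es\<close>
    by the product rule, with scores bounded by B.\<close>
  define C where "C = (1 + 2 * real B) * C0 + (real B + 1) * ((real B)\<^sup>2 * C0 + 2 * real B * (2 * real B * C0))"
  have ge0: "0 \<le> (real B + 1) * ((real B)\<^sup>2 * C0 + 2 * real B * (2 * real B * C0))" "0 \<le> 2 * real B * C0"
    using C0 by (auto intro!: mult_nonneg_nonneg add_nonneg_nonneg)
  have C_split: "C = C0 + 2 * real B * C0 + (real B + 1) * ((real B)\<^sup>2 * C0 + 2 * real B * (2 * real B * C0))"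
    unfolding C_def by (simp add: algebra_simps)
  have C: "C0 \<le> C" "2 * real B * C0 \<le> C" "0 < C" 
      "(real B + 1) * ((real B)\<^sup>2 * C0 + 2 * real B * (2 * real B * C0)) \<le> C"
    using ge0 C0 unfolding C_split by linarith+
  show thesis
  proof (rule that[of C])
    fix m y :: nat and \<eta> \<eta>' \<sigma> \<sigma>' :: real
    assume mB: "m \<le> B" and s: "0 \<le> \<sigma>" "\<sigma> \<le> S" "0 \<le> \<sigma>'" "\<sigma>' \<le> S"
    define d where "d = \<bar>\<eta> - \<eta>'\<bar> + \<bar>\<sigma> - \<sigma>'\<bar>"
    have d: "0 \<le> d" unfolding d_def by simp
    have d': "\<bar>\<eta>' - \<eta>\<bar> + \<bar>\<sigma>' - \<sigma>\<bar> = d" unfolding d_def by simp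
    have G1: "gmix k l \<eta> \<sigma> \<le> gmix k l \<eta>' \<sigma>' * exp (C0 * d)" "gmix k l \<eta>' \<sigma>' \<le> gmix k l \<eta> \<sigma> * exp (C0 * d)" if "k \<le> l" "l \<le> Suc B" for k l
      using gmix[OF that s(1,2,3,4), of \<eta>' \<eta>] gmix[OF that s(3,4,1,2), of \<eta> \<eta>'] unfolding d' by (simp_all add: d_def)
    have f: "fs m \<eta> \<sigma> y \<le> fs m \<eta>' \<sigma>' y * exp (C0 * d)" "fs m \<eta>' \<sigma>' y \<le> fs m \<eta> \<sigma> y * exp (C0 * d)" if "y \<le> m" for y
      unfolding fs_def using G1[OF that] mB by (simp_all add: mult.assoc mult_left_mono)
    have fl: "\<bar>fs m \<eta> \<sigma> y - fs m \<eta>' \<sigma>' y\<bar> \<le> C0 * d" for y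
    proof (cases "y \<le> m")
      case True
      then show ?thesis using f[OF True] d C0 by (intro exp_ratio_lip fs_nonneg fs_le_1) auto
    qed (use d C0 in \<open>simp add: fs_zero\<close>)
    have ul: "\<bar>us m \<eta> \<sigma> y - us m \<eta>' \<sigma>' y\<bar> \<le> 2 * real B * C0 * d" for y
    proof (cases "y \<le> m")
      case True
      let ?r = "\<lambda>\<eta> \<sigma>. gmix (Suc y) (Suc m) \<eta> \<sigma> / gmix y m \<eta> \<sigma>"
      have *: "a / b \<le> a' / b' * exp (2 * (C0 * d))"
        if "a \<le> a' * exp (C0 * d)" "b' \<le> b * exp (C0 * d)" "0 < a" "0 < a'" "0 < b" "0 < b'" for a b a' b' :: real
      proof -
        have "a * b' \<le> (a' * exp (C0 * d)) * (b * exp (C0 * d))"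
          using that by (intro mult_mono) auto
        also have "\<dots> = a' * b * exp (2 * (C0 * d))" by (simp only: mult_2 exp_add) (simp add: mult_ac)
        finally show ?thesis using that by (simp add: field_simps)
      qed
      have "\<bar>?r \<eta> \<sigma> - ?r \<eta>' \<sigma>'\<bar> \<le> 2 * (C0 * d)"
        using True mB d C0 gmix_ratio[OF True]
        by (intro exp_ratio_lip * gmix_pos G1) (auto simp: less_imp_le)
      then have "real m * \<bar>?r \<eta> \<sigma> - ?r \<eta>' \<sigma>'\<bar> \<le> real B * (2 * (C0 * d))"
        using mB by (intro mult_mono) auto
      moreover have "\<bar>us m \<eta> \<sigma> y - us m \<eta>' \<sigma>' y\<bar> = real m * \<bar>?r \<eta> \<sigma> - ?r \<eta>' \<sigma>'\<bar>"
        using True unfolding us_def by (simp add: abs_mult[symmetric, of "real m" for m, simplified] right_diff_distrib abs_minus_commute)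
      ultimately show ?thesis by (simp add: mult_ac)
    qed (use d C0 in \<open>simp add: us_def\<close>)
    show "\<bar>fs m \<eta> \<sigma> y - fs m \<eta>' \<sigma>' y\<bar> \<le> C * (\<bar>\<eta> - \<eta>'\<bar> + \<bar>\<sigma> - \<sigma>'\<bar>)"
      using fl[of y] C mult_right_mono[OF C(1) d] unfolding d_def by simp
    show "\<bar>us m \<eta> \<sigma> y - us m \<eta>' \<sigma>' y\<bar> \<le> C * (\<bar>\<eta> - \<eta>'\<bar> + \<bar>\<sigma> - \<sigma>'\<bar>)"
      using ul[of y] C mult_right_mono[OF C(2) d] unfolding d_def by simp
    show "\<bar>ln (fs m \<eta> \<sigma> y) - ln (fs m \<eta>' \<sigma>' y)\<bar> \<le> C * (\<bar>\<eta> - \<eta>'\<bar> + \<bar>\<sigma> - \<sigma>'\<bar>)"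
    proof (cases "y \<le> m")
      case True
      have "ln (fs m \<eta> \<sigma> y) \<le> ln (fs m \<eta>' \<sigma>' y * exp (C0 * d))"
        using f[OF True] fs_pos[OF True] by (intro ln_mono) auto
      moreover have "ln (fs m \<eta>' \<sigma>' y) \<le> ln (fs m \<eta> \<sigma> y * exp (C0 * d))"
        using f[OF True] fs_pos[OF True] by (intro ln_mono) auto
      moreover have "ln (a * exp (C0 * d)) = ln a + C0 * d" if "0 < a" for a :: real
        using that by (simp add: ln_mult)
      ultimately have "\<bar>ln (fs m \<eta> \<sigma> y) - ln (fs m \<eta>' \<sigma>' y)\<bar> \<le> C0 * d"
        using fs_pos[OF True, of \<eta> \<sigma>] fs_pos[OF True, of \<eta>' \<sigma>'] by (simp add: abs_le_iff)
      then show ?thesis using mult_right_mono[OF C(1) d] unfolding d_def by simp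
    qed (use d C in \<open>simp add: fs_zero d_def\<close>)
    have "\<bar>es m \<eta> \<sigma> - es m \<eta>' \<sigma>'\<bar> \<le> (\<Sum>y\<le>m. \<bar>fs m \<eta> \<sigma> y * (us m \<eta> \<sigma> y)\<^sup>2 - fs m \<eta>' \<sigma>' y * (us m \<eta>' \<sigma>' y)\<^sup>2\<bar>)"
      unfolding es_def sum_subtractf[symmetric] by (rule sum_abs)
    also have "\<dots> \<le> (\<Sum>y\<le>m. ((real B)\<^sup>2 * C0 + 2 * real B * (2 * real B * C0)) * d)"
    proof (intro sum_mono)
      fix y assume "y \<in> {..m}"
      then have y: "y \<le> B" using mB by simp
      let ?u = "us m \<eta> \<sigma> y" and ?u' = "us m \<eta>' \<sigma>' y" and ?f = "fs m \<eta> \<sigma> y" and ?f' = "fs m \<eta>' \<sigma>' y"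
      have "\<bar>?f * ?u\<^sup>2 - ?f' * ?u'\<^sup>2\<bar> = \<bar>(?f - ?f') * ?u\<^sup>2 + ?f' * ((?u + ?u') * (?u - ?u'))\<bar>"
        by (simp add: algebra_simps power2_eq_square)
      also have "\<dots> \<le> \<bar>?f - ?f'\<bar> * ?u\<^sup>2 + \<bar>?f'\<bar> * (\<bar>?u + ?u'\<bar> * \<bar>?u - ?u'\<bar>)"
        by (rule order_trans[OF abs_triangle_ineq]) (simp add: abs_mult)
      also have "\<dots> \<le> (C0 * d) * (real B)\<^sup>2 + 1 * ((2 * real B) * (2 * real B * C0 * d))"
        using fl[of y] ul[of y] us_bound[OF mB y, of \<eta> \<sigma>] us_bound[OF mB y, of \<eta>' \<sigma>'] fs_nonneg[of m \<eta>' \<sigma>' y] fs_le_1[of m \<eta>' \<sigma>' y]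
          d C0 by (intro add_mono mult_mono) (auto simp: abs_le_square_iff[symmetric])
      finally show "\<bar>?f * ?u\<^sup>2 - ?f' * ?u'\<^sup>2\<bar> \<le> ((real B)\<^sup>2 * C0 + 2 * real B * (2 * real B * C0)) * d"
        by (simp add: algebra_simps)
    qed
    also have "\<dots> \<le> ((real B + 1) * ((real B)\<^sup>2 * C0 + 2 * real B * (2 * real B * C0))) * d"
      unfolding sum_constant mult.assoc using mB d C0 by (intro mult_mono) auto
    also have "\<dots> \<le> C * d" using C(4) d by (rule mult_right_mono)
    finally show "\<bar>es m \<eta> \<sigma> - es m \<eta>' \<sigma>'\<bar> \<le> C * (\<bar>\<eta> - \<eta>'\<bar> + \<bar>\<sigma> - \<sigma>'\<bar>)" unfolding d_def .
  qed (use C in auto)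
qed

text \<open>The term y = 0 alone suffices: its probability is a mixture and its score is -m times a
  quotient of mixtures. The minimum \<open>g\<close> over the finitely many m is taken at \<eta> =
  0, and log-Lipschitz continuity carries it to all \<eta> in [-K, K].\<close>

lemma es_lower:
  assumes "0 \<le> \<sigma>"
  obtains c where "0 < c" "\<And>m \<eta>. 1 \<le> m \<Longrightarrow> m \<le> B \<Longrightarrow> \<bar>\<eta>\<bar> \<le> K \<Longrightarrow> c \<le> es m \<eta> \<sigma>"
proof -
  obtain C0 where C0: "0 < C0" and gmix: "\<And>k l \<eta> \<eta>' s s'. k \<le> l \<Longrightarrow> l \<le> Suc B \<Longrightarrow> 0 \<le> s \<Longrightarrow> s \<le> \<sigma> \<Longrightarrow> 0 \<le> s' \<Longrightarrow> s' \<le> \<sigma> \<Longrightarrow>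
      gmix k l \<eta>' s' \<le> gmix k l \<eta> s * exp (C0 * (\<bar>\<eta>' - \<eta>\<bar> + \<bar>s' - s\<bar>))"
    using gmix_loglip[OF assms] by blast
  define g where "g = Min ((\<lambda>m. min (gmix 0 m 0 \<sigma>) (gmix 1 (Suc m) 0 \<sigma>)) ` {..B})"
  have g: "0 < g" unfolding g_def by (subst Min_gr_iff) (auto intro!: gmix_pos)
  define c where "c = g * exp (- C0 * K) * (g * exp (- C0 * K))\<^sup>2"
  have "c \<le> es m \<eta> \<sigma>" if m: "1 \<le> m" "m \<le> B" and e: "\<bar>\<eta>\<bar> \<le> K" for m \<eta>
  proof -
    have gm: "g \<le> gmix 0 m 0 \<sigma>" "g \<le> gmix 1 (Suc m) 0 \<sigma>"
      using m unfolding g_def by (auto intro!: Min.coboundedI[THEN order_trans])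
    have low: "g * exp (- C0 * K) \<le> gmix k l \<eta> \<sigma>" if "k \<le> l" "l \<le> Suc B" "g \<le> gmix k l 0 \<sigma>" for k l
    proof -
      have "g \<le> gmix k l \<eta> \<sigma> * exp (C0 * \<bar>\<eta>\<bar>)"
        using that gmix[OF that(1,2) assms _ assms, of 0 \<eta>] by simp
      also have "\<dots> \<le> gmix k l \<eta> \<sigma> * exp (C0 * K)" using e C0 gmix_pos[OF that(1), of \<eta> \<sigma>] by (auto intro!: mult_left_mono)
      finally show ?thesis by (simp add: exp_minus field_simps)
    qed
    have 0: "g * exp (- C0 * K) \<le> fs m \<eta> \<sigma> 0" using low[of 0 m] gm m unfolding fs_def by simp
    have "g * exp (- C0 * K) \<le> gmix 1 (Suc m) \<eta> \<sigma>" using low[of 1 "Suc m"] gm m by simp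
    \<comment> \<open>The denominator is at most 1 and m is at least 1, so the numerator alone
      bounds the absolute score at y = 0 from below.\<close>
    also have "\<dots> \<le> real m * (gmix 1 (Suc m) \<eta> \<sigma> / gmix 0 m \<eta> \<sigma>)"
    proof -
      have "gmix 1 (Suc m) \<eta> \<sigma> * gmix 0 m \<eta> \<sigma> \<le> gmix 1 (Suc m) \<eta> \<sigma> * real m"
        using m gmix_le_1[of 0 m \<eta> \<sigma>] gmix_pos[of 1 "Suc m" \<eta> \<sigma>] by (intro mult_left_mono) auto
      then show ?thesis using gmix_pos[of 0 m \<eta> \<sigma>] by (simp add: field_simps)
    qed
    also have "\<dots> = \<bar>us m \<eta> \<sigma> 0\<bar>" unfolding us_def using gmix_pos[of 0 m \<eta> \<sigma>] gmix_pos[of 1 "Suc m" \<eta> \<sigma>] by (simp add: abs_mult)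
    finally have 1: "g * exp (- C0 * K) \<le> \<bar>us m \<eta> \<sigma> 0\<bar>" .
    have "c \<le> fs m \<eta> \<sigma> 0 * (us m \<eta> \<sigma> 0)\<^sup>2" unfolding c_def
      using 0 power_mono[OF 1, of 2] g fs_nonneg by (intro mult_mono) auto
    also have "\<dots> \<le> es m \<eta> \<sigma>" unfolding es_def
      by (intro member_le_sum) (auto intro!: mult_nonneg_nonneg fs_nonneg)
    finally show ?thesis .
  qed
  moreover have "0 < c" unfolding c_def using g by simp
  ultimately show thesis by (intro that)
qed

text \<open>The fitted score has mean 0 under the fitted density q, so its mean under p is a sum of
  (p - q) * us, at most B times the l1 distance. Factoring p - q into square roots, Cauchy--Schwarz
  leaves the squared Hellinger distance times 4, and the divergence dominates that distance.\<close>

lemma hellinger_bound: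
  assumes mB: "m \<le> B"
  shows "(\<Sum>y\<le>B. fs m \<eta> \<sigma> y * us m \<eta>' \<sigma>' y)\<^sup>2
    \<le> 4 * (real B)\<^sup>2 * (\<Sum>y\<le>B. fs m \<eta> \<sigma> y * (ln (fs m \<eta> \<sigma> y) - ln (fs m \<eta>' \<sigma>' y)))"
proof -
  define p where "p = fs m \<eta> \<sigma>"
  define q where "q = fs m \<eta>' \<sigma>'"
  have pq: "0 \<le> p y" "0 \<le> q y" for y unfolding p_def q_def by (auto simp: fs_nonneg)
  have sums: "(\<Sum>y\<le>B. p y) = 1" "(\<Sum>y\<le>B. q y) = 1" unfolding p_def q_def using mB by (auto simp: sum_fs')
  define H where "H = (\<Sum>y\<le>B. (sqrt (p y) - sqrt (q y))\<^sup>2)"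
  have Heq: "H = 2 - 2 * (\<Sum>y\<le>B. sqrt (p y) * sqrt (q y))"
    unfolding H_def power2_diff using pq sums by (simp add: sum.distrib sum_subtractf sum_distrib_left mult_ac)
  have KL: "H \<le> (\<Sum>y\<le>B. p y * (ln (p y) - ln (q y)))"
  proof -
    \<comment> \<open>This is ln z <= z - 1 at z = sqrt (q / p), multiplied by 2 * p; for y > m both
      sides are 0.\<close>
    have "2 * p y - 2 * (sqrt (p y) * sqrt (q y)) \<le> p y * (ln (p y) - ln (q y))" for y
    proof (cases "y \<le> m")
      case True
      then have pos: "0 < p y" "0 < q y" unfolding p_def q_def by (auto simp: fs_pos)
      let ?z = "sqrt (q y) / sqrt (p y)"
      have "ln ?z \<le> ?z - 1" using pos by (intro ln_le_minus_one) simp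
      moreover have "ln ?z = (ln (q y) - ln (p y)) / 2" using pos by (simp add: ln_div ln_sqrt)
      ultimately have "ln (q y) - ln (p y) \<le> 2 * (?z - 1)" by argo
      then have "p y * (ln (q y) - ln (p y)) \<le> p y * (2 * (?z - 1))" using pos by (intro mult_left_mono) auto
      moreover have "p y * ?z = sqrt (p y) * sqrt (q y)"
        using pos by (simp add: field_simps)
      moreover have "p y * (2 * (z - 1)) = 2 * (p y * z) - 2 * p y" for z by (simp add: algebra_simps)
      moreover have "p y * (ln (q y) - ln (p y)) = - (p y * (ln (p y) - ln (q y)))" by (simp add: algebra_simps)
      ultimately show ?thesis by argo
    qed (simp add: p_def q_def fs_zero)
    then have "(\<Sum>y\<le>B. 2 * p y - 2 * (sqrt (p y) * sqrt (q y))) \<le> (\<Sum>y\<le>B. p y * (ln (p y) - ln (q y)))"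
      by (intro sum_mono)
    then show ?thesis unfolding Heq sum_subtractf sum_distrib_left[symmetric] sums by simp
  qed
  have S4: "(\<Sum>y\<le>B. (sqrt (p y) + sqrt (q y))\<^sup>2) \<le> 4"
  proof -
    have "(\<Sum>y\<le>B. (sqrt (p y) + sqrt (q y))\<^sup>2) \<le> (\<Sum>y\<le>B. 2 * p y + 2 * q y)"
      using pq by (intro sum_mono) (auto simp: power2_sum sum_squares_bound[of "sqrt (p y)" "sqrt (q y)" for y, simplified]
          intro: order_trans[OF sum_squares_bound])
    then show ?thesis by (simp add: sum.distrib sum_distrib_left[symmetric] sums)
  qed
  have "(\<Sum>y\<le>B. p y * us m \<eta>' \<sigma>' y) = (\<Sum>y\<le>B. (p y - q y) * us m \<eta>' \<sigma>' y)"
    using sum_fs_us'[OF mB, of \<eta>' \<sigma>'] unfolding q_def left_diff_distrib sum_subtractf by simp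
  then have "\<bar>\<Sum>y\<le>B. p y * us m \<eta>' \<sigma>' y\<bar> \<le> (\<Sum>y\<le>B. \<bar>p y - q y\<bar> * \<bar>us m \<eta>' \<sigma>' y\<bar>)"
    unfolding abs_mult[symmetric] by (metis sum_abs)
  also have "\<dots> \<le> (\<Sum>y\<le>B. \<bar>p y - q y\<bar> * real B)"
    using us_bound[OF mB] by (intro sum_mono mult_left_mono) auto
  also have "\<dots> = real B * (\<Sum>y\<le>B. \<bar>sqrt (p y) - sqrt (q y)\<bar> * (sqrt (p y) + sqrt (q y)))"
  proof -
    have "\<bar>p y - q y\<bar> = \<bar>sqrt (p y) - sqrt (q y)\<bar> * (sqrt (p y) + sqrt (q y))" for y
    proof -
      have "p y - q y = (sqrt (p y) - sqrt (q y)) * (sqrt (p y) + sqrt (q y))"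
        using pq[of y] by (simp add: algebra_simps)
      then show ?thesis using pq[of y] by (simp add: abs_mult)
    qed
    then show ?thesis by (simp add: sum_distrib_left mult_ac)
  qed
  finally have "(\<Sum>y\<le>B. p y * us m \<eta>' \<sigma>' y)\<^sup>2 \<le> (real B * (\<Sum>y\<le>B. \<bar>sqrt (p y) - sqrt (q y)\<bar> * (sqrt (p y) + sqrt (q y))))\<^sup>2"
    by (rule abs_le_square_iff[THEN iffD1, OF order_trans[OF _ abs_ge_self]])
  also have "\<dots> = (real B)\<^sup>2 * (\<Sum>y\<le>B. \<bar>sqrt (p y) - sqrt (q y)\<bar> * (sqrt (p y) + sqrt (q y)))\<^sup>2"
    by (simp add: power_mult_distrib)
  also have "\<dots> \<le> (real B)\<^sup>2 * ((\<Sum>y\<le>B. \<bar>sqrt (p y) - sqrt (q y)\<bar>\<^sup>2) * (\<Sum>y\<le>B. (sqrt (p y) + sqrt (q y))\<^sup>2))"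
    by (intro mult_left_mono Cauchy_Schwarz_ineq_sum) auto
  also have "\<dots> \<le> (real B)\<^sup>2 * (H * 4)"
    unfolding H_def power2_abs by (intro mult_left_mono S4 sum_nonneg) auto
  also have "\<dots> \<le> 4 * (real B)\<^sup>2 * (\<Sum>y\<le>B. p y * (ln (p y) - ln (q y)))"
  proof -
    have "(real B)\<^sup>2 * H \<le> (real B)\<^sup>2 * (\<Sum>y\<le>B. p y * (ln (p y) - ln (q y)))" using KL by (intro mult_left_mono) auto
    then show ?thesis by (simp add: mult_ac)
  qed
  finally show ?thesis unfolding p_def q_def .
qed

section \<open>Lag products of independent bounded scores\<close>

text \<open>Expectation under independent coordinates, as a finite sum. It is vector valued so that
  real statistics and complex exponentials share one calculus, and \<open>p\<close> is a parameter
  because it will be the conditional law given regressors and trials.\<close>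

definition EE :: "nat \<Rightarrow> (nat \<Rightarrow> nat \<Rightarrow> real) \<Rightarrow> nat set \<Rightarrow> ((nat \<Rightarrow> nat) \<Rightarrow> 'b::real_vector) \<Rightarrow> 'b" where
  "EE B p A F = (\<Sum>y\<in>PiE A (\<lambda>_. {..B}). (\<Prod>t\<in>A. p t (y t)) *\<^sub>R F y)"

locale indep_pmf =
  fixes B :: nat and p :: "nat \<Rightarrow> nat \<Rightarrow> real"
  assumes p_nonneg: "\<And>t b. 0 \<le> p t b" and p_sum: "\<And>t. (\<Sum>b\<le>B. p t b) = 1"
begin

lemma EE_empty[simp]: "EE B p {} F = F (\<lambda>_. undefined)"
  unfolding EE_def by simp

lemma EE_insert:
  assumes "finite A" "t \<notin> A"
  shows "EE B p (insert t A) F = (\<Sum>b\<le>B. p t b *\<^sub>R EE B p A (\<lambda>y. F (y(t := b))))"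
proof -
  have "EE B p (insert t A) F = (\<Sum>(b, y)\<in>{..B} \<times> PiE A (\<lambda>_. {..B}). (\<Prod>s\<in>insert t A. p s ((y(t := b)) s)) *\<^sub>R F (y(t := b)))"
    unfolding EE_def PiE_insert_eq using assms
    by (subst sum.reindex[OF inj_combinator[OF assms(2)]]) (simp add: case_prod_unfold)
  also have "\<dots> = (\<Sum>b\<le>B. \<Sum>y\<in>PiE A (\<lambda>_. {..B}). (\<Prod>s\<in>insert t A. p s ((y(t := b)) s)) *\<^sub>R F (y(t := b)))"
    by (rule sum.cartesian_product[symmetric])
  also have "\<dots> = (\<Sum>b\<le>B. \<Sum>y\<in>PiE A (\<lambda>_. {..B}). p t b *\<^sub>R ((\<Prod>s\<in>A. p s (y s)) *\<^sub>R F (y(t := b))))"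
  proof (intro sum.cong refl)
    fix b y
    have "(\<Prod>s\<in>A. p s (if s = t then b else y s)) = (\<Prod>s\<in>A. p s (y s))"
      using assms by (intro prod.cong) auto
    then show "(\<Prod>s\<in>insert t A. p s ((y(t := b)) s)) *\<^sub>R F (y(t := b)) = p t b *\<^sub>R ((\<Prod>s\<in>A. p s (y s)) *\<^sub>R F (y(t := b)))"
      using assms by simp
  qed
  finally show ?thesis unfolding EE_def by (simp add: scaleR_sum_right)
qed

lemma EE_add: "EE B p A (\<lambda>y. F y + G y) = EE B p A F + EE B p A G"
  unfolding EE_def by (simp add: scaleR_add_right sum.distrib)

lemma EE_diff: "EE B p A (\<lambda>y. F y - G y) = EE B p A F - EE B p A G"
  unfolding EE_def by (simp add: scaleR_diff_right sum_subtractf)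

lemma EE_sum: "EE B p A (\<lambda>y. \<Sum>i\<in>I. F i y) = (\<Sum>i\<in>I. EE B p A (F i))"
  unfolding EE_def by (simp add: scaleR_sum_right) (rule sum.swap)

lemma EE_scaleR: "EE B p A (\<lambda>y. c *\<^sub>R F y) = c *\<^sub>R EE B p A F"
  unfolding EE_def by (simp add: scaleR_sum_right mult.commute)

lemma EE_cmult:
  fixes F :: "(nat \<Rightarrow> nat) \<Rightarrow> 'c::real_algebra" 
  shows "EE B p A (\<lambda>y. c * F y) = c * EE B p A F" "EE B p A (\<lambda>y. F y * c) = EE B p A F * c"
  unfolding EE_def by (simp_all add: sum_distrib_left sum_distrib_right)

lemma EE_cong: "(\<And>y. y \<in> PiE A (\<lambda>_. {..B}) \<Longrightarrow> F y = G y) \<Longrightarrow> EE B p A F = EE B p A G"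
  unfolding EE_def by (intro sum.cong) auto

lemma EE_mono:
  fixes F G :: "(nat \<Rightarrow> nat) \<Rightarrow> real"
  assumes "\<And>y. y \<in> PiE A (\<lambda>_. {..B}) \<Longrightarrow> F y \<le> G y"
  shows "EE B p A F \<le> EE B p A G"
  unfolding EE_def using assms by (intro sum_mono) (auto intro!: mult_left_mono prod_nonneg p_nonneg)

lemma EE_const: 
  assumes "finite A" shows "EE B p A (\<lambda>_. c) = c"
  using assms
proof (induction A)
  case (insert t A)
  then show ?case by (simp add: EE_insert scaleR_sum_left[symmetric] p_sum)
qed simp

lemma EE_norm:
  fixes F :: "(nat \<Rightarrow> nat) \<Rightarrow> 'c::real_normed_vector"
  shows "norm (EE B p A F) \<le> EE B p A (\<lambda>y. norm (F y))"
  unfolding EE_def by (rule order_trans[OF norm_sum]) (simp add: abs_of_nonneg prod_nonneg p_nonneg)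

lemma EE_nonneg:
  fixes F :: "(nat \<Rightarrow> nat) \<Rightarrow> real"
  shows "(\<And>y. y \<in> PiE A (\<lambda>_. {..B}) \<Longrightarrow> 0 \<le> F y) \<Longrightarrow> 0 \<le> EE B p A F"
  unfolding EE_def by (intro sum_nonneg) (auto intro!: mult_nonneg_nonneg prod_nonneg p_nonneg)

text \<open>The variance of |F| is nonnegative.\<close>

lemma EE_abs_le_sqrt:
  fixes F :: "(nat \<Rightarrow> nat) \<Rightarrow> real"
  assumes "finite A" "EE B p A (\<lambda>y. (F y)\<^sup>2) \<le> V"
  shows "EE B p A (\<lambda>y. \<bar>F y\<bar>) \<le> sqrt V"
proof -
  let ?m = "EE B p A (\<lambda>y. \<bar>F y\<bar>)"
  have "0 \<le> EE B p A (\<lambda>y. (\<bar>F y\<bar> - ?m)\<^sup>2)" by (intro EE_nonneg) auto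
  also have "\<dots> = EE B p A (\<lambda>y. (F y)\<^sup>2) - 2 * ?m * ?m + ?m\<^sup>2"
    unfolding power2_diff by (simp add: EE_add EE_diff EE_cmult EE_const assms mult.assoc[symmetric] power_mult_distrib)
  also have "\<dots> = EE B p A (\<lambda>y. (F y)\<^sup>2) - ?m\<^sup>2" by (simp add: power2_eq_square)
  finally show ?thesis using assms by (intro real_le_rsqrt) simp
qed

lemma EE_Fubini:
  assumes "finite A" "finite A'" "A \<inter> A' = {}"
  shows "EE B p (A \<union> A') F = EE B p A (\<lambda>z. EE B p A' (\<lambda>y. F (\<lambda>t. if t \<in> A then z t else y t)))"
  using assms
proof (induction A arbitrary: F)
  case (insert t A)
  have "EE B p (insert t A \<union> A') F = (\<Sum>b\<le>B. p t b *\<^sub>R EE B p (A \<union> A') (\<lambda>y. F (y(t := b))))"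
    using insert by (simp add: EE_insert)
  also have "\<dots> = (\<Sum>b\<le>B. p t b *\<^sub>R EE B p A (\<lambda>z. EE B p A' (\<lambda>y. F ((\<lambda>s. if s \<in> A then z s else y s)(t := b)))))"
    using insert by simp
  also have "\<dots> = (\<Sum>b\<le>B. p t b *\<^sub>R EE B p A (\<lambda>z. EE B p A' (\<lambda>y. F (\<lambda>s. if s \<in> insert t A then (z(t := b)) s else y s))))"
    by (intro sum.cong refl arg_cong2[where f=scaleR] EE_cong arg_cong[where f=F]) auto
  finally show ?case using insert by (simp add: EE_insert)
qed (simp cong: if_cong)

lemma EE_Suc: "EE B p {1..Suc n} F = (\<Sum>b\<le>B. p (Suc n) b *\<^sub>R EE B p {1..n} (\<lambda>y. F (y(Suc n := b))))"
proof -
  have "{1..Suc n} = insert (Suc n) {1..n}" by auto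
  show ?thesis unfolding \<open>{1..Suc n} = _\<close> by (rule EE_insert) auto
qed

lemma EE_Suc': "EE B p {1..Suc n} F = EE B p {1..n} (\<lambda>y. \<Sum>b\<le>B. p (Suc n) b *\<^sub>R F (y(Suc n := b)))"
  unfolding EE_Suc EE_sum EE_scaleR ..

text \<open>Each d t averages to 0 over coordinate t while earlier terms ignore that coordinate, so
  integrating out the last one kills the cross term and the squares add up. Adaptedness is expressed
  as invariance under updates of later coordinates.\<close>

lemma martingale_second_moment:
  fixes d :: "nat \<Rightarrow> (nat \<Rightarrow> nat) \<Rightarrow> real"
  assumes dep: "\<And>s t y b. s \<le> n \<Longrightarrow> s < t \<Longrightarrow> d s (y(t := b)) = d s y"
    and cent: "\<And>t y. 1 \<le> t \<Longrightarrow> t \<le> n \<Longrightarrow> (\<Sum>b\<le>B. p t b * d t (y(t := b))) = 0"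
    and bnd: "\<And>t y. 1 \<le> t \<Longrightarrow> t \<le> n \<Longrightarrow> (\<And>s. 1 \<le> s \<Longrightarrow> s \<le> t \<Longrightarrow> y s \<le> B) \<Longrightarrow> \<bar>d t y\<bar> \<le> C"
  shows "EE B p {1..n} (\<lambda>y. (\<Sum>t=1..n. d t y)\<^sup>2) \<le> real n * C\<^sup>2"
  using assms
proof (induction n)
  case (Suc n)
  let ?S = "\<lambda>y. \<Sum>t=1..n. d t y" and ?p = "p (Suc n)"
  have S: "(\<Sum>t=1..Suc n. d t (y(Suc n := b))) = ?S y + d (Suc n) (y(Suc n := b))" for y b
  proof -
    have "(\<Sum>t=1..Suc n. d t (y(Suc n := b))) = (\<Sum>t=1..n. d t (y(Suc n := b))) + d (Suc n) (y(Suc n := b))" by simp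
    also have "(\<Sum>t=1..n. d t (y(Suc n := b))) = ?S y" by (intro sum.cong refl Suc.prems(1)) auto
    finally show ?thesis .
  qed
  have "EE B p {1..Suc n} (\<lambda>y. (\<Sum>t=1..Suc n. d t y)\<^sup>2) = 
      EE B p {1..n} (\<lambda>y. \<Sum>b\<le>B. ?p b * (?S y + d (Suc n) (y(Suc n := b)))\<^sup>2)"
    unfolding EE_Suc' S by simp
  also have "\<dots> \<le> EE B p {1..n} (\<lambda>y. (?S y)\<^sup>2 + C\<^sup>2)"
  proof (rule EE_mono)
    fix y assume y: "y \<in> PiE {1..n} (\<lambda>_. {..B})"
    have "(\<Sum>b\<le>B. ?p b * (s + d (Suc n) (y(Suc n := b)))\<^sup>2) = 
      (\<Sum>b\<le>B. ?p b) * s\<^sup>2 + 2 * s * (\<Sum>b\<le>B. ?p b * d (Suc n) (y(Suc n := b))) + (\<Sum>b\<le>B. ?p b * (d (Suc n) (y(Suc n := b)))\<^sup>2)" for s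
      unfolding sum_distrib_left sum_distrib_right sum.distrib[symmetric]
      by (intro sum.cong refl) (simp add: power2_eq_square algebra_simps)
    then have "(\<Sum>b\<le>B. ?p b * (?S y + d (Suc n) (y(Suc n := b)))\<^sup>2) = (?S y)\<^sup>2 + (\<Sum>b\<le>B. ?p b * (d (Suc n) (y(Suc n := b)))\<^sup>2)"
      using Suc.prems(2)[of "Suc n" y] by (simp add: p_sum)
    also have "\<dots> \<le> (?S y)\<^sup>2 + (\<Sum>b\<le>B. ?p b * C\<^sup>2)"
    proof (intro add_left_mono sum_mono mult_left_mono p_nonneg)
      fix b assume "b \<in> {..B}"
      then have "\<bar>d (Suc n) (y(Suc n := b))\<bar> \<le> C" using y 
        by (intro Suc.prems(3)) (auto simp: PiE_iff le_Suc_eq)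
      then show "(d (Suc n) (y(Suc n := b)))\<^sup>2 \<le> C\<^sup>2"
        by (metis abs_ge_zero power2_abs power_mono)
    qed
    finally show "(\<Sum>b\<le>B. ?p b * (?S y + d (Suc n) (y(Suc n := b)))\<^sup>2) \<le> (?S y)\<^sup>2 + C\<^sup>2"
      by (simp add: sum_distrib_right[symmetric] p_sum)
  qed
  also have "\<dots> = EE B p {1..n} (\<lambda>y. (?S y)\<^sup>2) + C\<^sup>2" by (simp add: EE_add EE_const)
  also have "\<dots> \<le> real n * C\<^sup>2 + C\<^sup>2"
    using Suc.prems by (intro add_right_mono Suc.IH) auto
  finally show ?case by (simp add: algebra_simps)
qed simp

end

section \<open>Characteristic functions of linear combinations of lag sums\<close>

lemma exp_quadratic_remainder:
  fixes d :: real
  assumes "\<bar>d\<bar> \<le> 1"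
  shows "cmod (exp (\<i> * d + d\<^sup>2 / 2) - 1 - \<i> * d) \<le> 4 * \<bar>d\<bar> ^ 3"
proof -
  \<comment> \<open>The real part d^2 / 2 cancels the quadratic term of exp (i * d), leaving a cubic
    error. The constant 4 is 27/8 from the Taylor remainder plus 5/8 from what is left of 1 + z +
    z^2 / 2.\<close>
  define z :: complex where "z = \<i> * d + d\<^sup>2 / 2"
  have d2: "d\<^sup>2 \<le> \<bar>d\<bar>" using assms by (metis abs_ge_zero mult_left_le power2_abs power2_eq_square)
  have "cmod z \<le> cmod (\<i> * d) + cmod (d\<^sup>2 / 2)" unfolding z_def by (rule norm_triangle_ineq)
  also have "\<dots> = \<bar>d\<bar> + d\<^sup>2 / 2" by (simp add: norm_mult norm_divide norm_power)
  finally have nz: "cmod z \<le> 3 / 2 * \<bar>d\<bar>" using d2 by simp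
  have "cmod (exp z - (\<Sum>i\<le>2. z ^ i / fact i)) \<le> exp \<bar>Re z\<bar> * cmod z ^ 3 / fact 2"
    using Taylor_exp[of z 2] by (simp add: numeral_3_eq_3)
  also have "\<dots> \<le> 2 * (3 / 2 * \<bar>d\<bar>) ^ 3 / 2"
  proof -
    have "\<bar>Re z\<bar> \<le> 1 / 2" unfolding z_def using d2 assms by simp
    then have "exp \<bar>Re z\<bar> \<le> 2" using exp_bound_half[of "\<bar>Re z\<bar>"] by simp
    then show ?thesis using nz unfolding fact_2 by (intro divide_right_mono mult_mono power_mono) auto
  qed
  finally have 1: "cmod (exp z - (1 + z + z\<^sup>2 / 2)) \<le> 27 / 8 * \<bar>d\<bar> ^ 3"
    by (simp add: numeral_2_eq_2 power_mult_distrib power_divide)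
  have e: "1 + z + z\<^sup>2 / 2 - 1 - \<i> * d = \<i> * (d ^ 3 / 2) + of_real (d ^ 4 / 8)"
    unfolding z_def by (simp add: power2_eq_square power3_eq_cube power4_eq_xxxx field_simps)
  have "cmod (1 + z + z\<^sup>2 / 2 - 1 - \<i> * d) \<le> cmod (\<i> * (d ^ 3 / 2)) + cmod (of_real (d ^ 4 / 8))"
    unfolding e by (rule norm_triangle_ineq)
  also have "\<dots> = \<bar>d\<bar> ^ 3 / 2 + \<bar>d\<bar> ^ 4 / 8"
    by (simp only: norm_of_real) (simp add: norm_mult norm_divide norm_power power_abs)
  also have "\<bar>d\<bar> ^ 4 \<le> \<bar>d\<bar> ^ 3" using assms by (intro power_decreasing) auto
  finally have 2: "cmod (1 + z + z\<^sup>2 / 2 - 1 - \<i> * d) \<le> 5 / 8 * \<bar>d\<bar> ^ 3" by simp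
  have "cmod (exp z - 1 - \<i> * d) \<le> cmod (exp z - (1 + z + z\<^sup>2 / 2)) + cmod (1 + z + z\<^sup>2 / 2 - 1 - \<i> * d)"
    by (rule order_trans[OF _ norm_triangle_ineq]) (simp add: algebra_simps)
  then show ?thesis using 1 2 unfolding z_def by simp
qed

lemma exp_neg_lipschitz:
  fixes x y :: real
  assumes "0 \<le> x" "0 \<le> y" shows "\<bar>exp (- x) - exp (- y)\<bar> \<le> \<bar>x - y\<bar>"
proof -
  have *: "exp (- a) - exp (- b) \<le> b - a" if "0 \<le> a" "a \<le> b" for a b :: real
  proof -
    have "exp (- a) - exp (- b) = exp (- a) * (1 - exp (- (b - a)))" by (simp add: right_diff_distrib exp_add[symmetric])
    also have "\<dots> \<le> 1 * (b - a)"
    proof (intro mult_mono)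
      show "1 - exp (- (b - a)) \<le> b - a" using exp_ge_add_one_self[of "- (b - a)"] by linarith
    qed (use that in auto)
    finally show ?thesis by simp
  qed
  show ?thesis
  proof (cases "x \<le> y")
    case True
    then show ?thesis using *[of x y] assms by (simp add: abs_le_iff)
  next
    case False
    then show ?thesis using *[of y x] assms by (simp add: abs_le_iff)
  qed
qed

locale bounded_scores = indep_pmf +
  fixes U :: "nat \<Rightarrow> nat \<Rightarrow> real" and C :: real
  assumes U_bound: "\<And>t b. b \<le> B \<Longrightarrow> \<bar>U t b\<bar> \<le> C"
    and U_cent: "\<And>t. (\<Sum>b\<le>B. p t b * U t b) = 0"
begin

definition v :: "nat \<Rightarrow> real" where "v t = (\<Sum>b\<le>B. p t b * (U t b)\<^sup>2)"

definition W :: "nat \<Rightarrow> nat \<Rightarrow> (nat \<Rightarrow> nat) \<Rightarrow> real" where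
  "W n a y = (\<Sum>t=a+1..n. U t (y t) * U (t - a) (y (t - a)))"

text \<open>For a >= 1 this is the variance of \<open>W n a\<close>: the lag products are
  uncorrelated and each has variance v t * v (t - a).\<close>

definition Lam :: "nat \<Rightarrow> nat \<Rightarrow> real" where
  "Lam n a = (\<Sum>t=a+1..n. v t * v (t - a))"

text \<open>The coefficient of \<open>U t\<close> in the linear combination of lag sums
  (\<open>sum_D\<close>). It involves earlier coordinates only, so the products
  \<open>U t * V\<close> are martingale differences. The guard a < t encodes that lag a starts at
  time a + 1.\<close>

definition V :: "nat \<Rightarrow> (nat \<Rightarrow> real) \<Rightarrow> nat \<Rightarrow> (nat \<Rightarrow> nat) \<Rightarrow> real" where
  "V L c t y = (\<Sum>a=1..L. if a < t then c a * U (t - a) (y (t - a)) else 0)"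

lemma C_nonneg: "0 \<le> C" using U_bound[of 0 0] by auto

lemma U_sq: "b \<le> B \<Longrightarrow> (U t b)\<^sup>2 \<le> C\<^sup>2"
  using U_bound[of b t] C_nonneg by (auto simp: abs_le_square_iff[symmetric])

lemma v_bounds: "0 \<le> v t" "v t \<le> C\<^sup>2"
proof -
  show "0 \<le> v t" unfolding v_def by (intro sum_nonneg mult_nonneg_nonneg p_nonneg) auto
  have "v t \<le> (\<Sum>b\<le>B. p t b * C\<^sup>2)" unfolding v_def by (intro sum_mono mult_left_mono U_sq p_nonneg) auto
  then show "v t \<le> C\<^sup>2" by (simp add: sum_distrib_right[symmetric] p_sum)
qed

lemma Lam_nonneg: "0 \<le> Lam n a"
  unfolding Lam_def by (intro sum_nonneg mult_nonneg_nonneg v_bounds)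

lemma sum_lag: "(\<Sum>t=1..n. if (a::nat) < t then f t else 0) = (\<Sum>t=a+1..n. f t :: real)"
proof -
  have "(\<Sum>t=1..n. if a < t then f t else 0) = (\<Sum>t\<in>{t\<in>{1..n}. a < t}. f t)"
    by (rule sum.inter_filter[symmetric]) simp
  also have "{t\<in>{1..n}. a < t} = {a+1..n}" by auto
  finally show ?thesis .
qed

lemma sum_D: "(\<Sum>t=1..n. U t (y t) * V L c t y) = (\<Sum>a=1..L. c a * W n a y)"
proof -
  have "(\<Sum>t=1..n. U t (y t) * V L c t y) = (\<Sum>t=1..n. \<Sum>a=1..L. if a < t then c a * (U t (y t) * U (t - a) (y (t - a))) else 0)"
    unfolding V_def sum_distrib_left by (intro sum.cong refl) (auto simp: mult_ac)
  also have "\<dots> = (\<Sum>a=1..L. \<Sum>t=1..n. if a < t then c a * (U t (y t) * U (t - a) (y (t - a))) else 0)"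
    by (rule sum.swap)
  finally show ?thesis unfolding sum_lag W_def sum_distrib_left .
qed

lemma V_bound:
  assumes "\<And>a. 1 \<le> a \<Longrightarrow> a \<le> L \<Longrightarrow> \<bar>c a\<bar> \<le> h" "\<And>s. 1 \<le> s \<Longrightarrow> s < t \<Longrightarrow> y s \<le> B"
  shows "\<bar>V L c t y\<bar> \<le> real L * (h * C)"
proof -
  have "\<bar>V L c t y\<bar> \<le> (\<Sum>a=1..L. h * C)" unfolding V_def
  proof (rule order_trans[OF sum_abs], intro sum_mono)
    fix a assume a: "a \<in> {1..L}"
    then have h: "\<bar>c a\<bar> \<le> h" using assms by auto
    show "\<bar>if a < t then c a * U (t - a) (y (t - a)) else 0\<bar> \<le> h * C"
    proof (cases "a < t")
      case True
      then have "\<bar>U (t - a) (y (t - a))\<bar> \<le> C" using a by (intro U_bound assms) auto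
      then show ?thesis using True h unfolding abs_mult by (auto simp: abs_mult intro!: mult_mono order_trans[OF _ h])
    qed (use h C_nonneg in auto)
  qed
  then show ?thesis by simp
qed

lemma V_dep: "t \<le> s \<Longrightarrow> V L c t (y(s := b)) = V L c t y"
  unfolding V_def by (intro sum.cong) auto

lemma W_second_moment: "1 \<le> a \<Longrightarrow> EE B p {1..n} (\<lambda>y. (W n a y)\<^sup>2) \<le> real n * (C\<^sup>2)\<^sup>2"
proof -
  assume a: "1 \<le> a"
  let ?d = "\<lambda>t y. if a < t then U t (y t) * U (t - a) (y (t - a)) else 0"
  have "EE B p {1..n} (\<lambda>y. (\<Sum>t=1..n. ?d t y)\<^sup>2) \<le> real n * (C\<^sup>2)\<^sup>2"
  proof (rule martingale_second_moment)
    fix t y assume t: "1 \<le> t" "t \<le> n"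
    show "(\<Sum>b\<le>B. p t b * ?d t (y(t := b))) = 0"
    proof (cases "a < t")
      case True
      then have "(\<Sum>b\<le>B. p t b * ?d t (y(t := b))) = (\<Sum>b\<le>B. p t b * U t b) * U (t - a) (y (t - a))"
        using a unfolding sum_distrib_right by (intro sum.cong) auto
      then show ?thesis by (simp add: U_cent)
    qed simp
    assume "\<And>s. 1 \<le> s \<Longrightarrow> s \<le> t \<Longrightarrow> y s \<le> B"
    then show "\<bar>?d t y\<bar> \<le> C\<^sup>2" using t C_nonneg
      by (auto simp: abs_mult power2_eq_square intro!: mult_mono U_bound)
  qed auto
  then show ?thesis unfolding W_def sum_lag .
qed

text \<open>With s = t - a, the later of the two indices because a <= b, the summand is centred in
  coordinate s: through \<open>U s\<close> if a < b, through U^2 - v if a = b. After this shift the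
  sum consists of bounded martingale differences.\<close>

lemma cross_second_moment:
  assumes "a \<le> b"
  shows "EE B p {1..n} (\<lambda>y. (\<Sum>t=1..n. if a < t \<and> b < t then v t * (U (t - a) (y (t - a)) * U (t - b) (y (t - b)) - (if a = b then v (t - a) else 0)) else 0)\<^sup>2)
     \<le> real n * (C\<^sup>2 * C\<^sup>2)\<^sup>2"
proof -
  let ?d = "\<lambda>s y. if s + a \<le> n \<and> b - a < s then v (s + a) * (U s (y s) * U (s - (b - a)) (y (s - (b - a))) - (if a = b then v s else 0)) else 0"
  have eq: "(\<Sum>t=1..n. if a < t \<and> b < t then v t * (U (t - a) (y (t - a)) * U (t - b) (y (t - b)) - (if a = b then v (t - a) else 0)) else 0)
    = (\<Sum>s=1..n. ?d s y)" for y
  proof -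
    have "(\<Sum>t=1..n. if a < t \<and> b < t then v t * (U (t - a) (y (t - a)) * U (t - b) (y (t - b)) - (if a = b then v (t - a) else 0)) else 0)
      = (\<Sum>t=b+1..n. v t * (U (t - a) (y (t - a)) * U (t - b) (y (t - b)) - (if a = b then v (t - a) else 0)))"
      using assms by (subst sum_lag[symmetric]) (intro sum.cong, auto)
    also have "\<dots> = (\<Sum>s=b-a+1..n-a. ?d s y)"
    proof (rule sum.reindex_bij_witness[where j="\<lambda>t. t - a" and i="\<lambda>s. s + a"])
      fix t assume t: "t \<in> {b+1..n}"
      then have "t - a - (b - a) = t - b" "a \<le> t" "t - a + a \<le> n" "b - a < t - a" using assms by auto
      then show "?d (t - a) y = v t * (U (t - a) (y (t - a)) * U (t - b) (y (t - b)) - (if a = b then v (t - a) else 0))"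
        by simp
    qed (use assms in auto)
    also have "\<dots> = (\<Sum>s=1..n. ?d s y)"
      by (rule sum.mono_neutral_left) auto
    finally show ?thesis .
  qed
  have "EE B p {1..n} (\<lambda>y. (\<Sum>s=1..n. ?d s y)\<^sup>2) \<le> real n * (C\<^sup>2 * C\<^sup>2)\<^sup>2"
  proof (rule martingale_second_moment)
    fix t y assume t: "1 \<le> t" "t \<le> n"
    show "(\<Sum>x\<le>B. p t x * ?d t (y(t := x))) = 0"
    proof (cases "t + a \<le> n \<and> b - a < t")
      case True
      show ?thesis
      proof (cases "a = b")
        case e: True
        have "(\<Sum>x\<le>B. p t x * ?d t (y(t := x))) = (\<Sum>x\<le>B. v (t + a) * (p t x * (U t x)\<^sup>2) - v (t + a) * v t * p t x)"
          using True e by (intro sum.cong) (auto simp: power2_eq_square algebra_simps)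
        also have "\<dots> = 0" unfolding sum_subtractf sum_distrib_left[symmetric] p_sum v_def[symmetric] by simp
        finally show ?thesis .
      next
        case e: False
        then have "0 < b - a" using assms by auto
        then have "(\<Sum>x\<le>B. p t x * ?d t (y(t := x))) = (\<Sum>x\<le>B. p t x * U t x) * (v (t + a) * U (t - (b - a)) (y (t - (b - a))))"
          unfolding sum_distrib_right using True e by (intro sum.cong) (auto simp: algebra_simps)
        then show ?thesis by (simp add: U_cent)
      qed
    qed auto
    assume y: "\<And>s. 1 \<le> s \<Longrightarrow> s \<le> t \<Longrightarrow> y s \<le> B"
    show "\<bar>?d t y\<bar> \<le> C\<^sup>2 * C\<^sup>2"
    proof (cases "t + a \<le> n \<and> b - a < t")
      case True
      have "\<bar>U t (y t) * U (t - (b - a)) (y (t - (b - a))) - (if a = b then v t else 0)\<bar> \<le> C\<^sup>2"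
      proof (cases "a = b")
        case e: True
        show ?thesis using e U_sq[OF y[OF t(1) order_refl], of t] v_bounds[of t]
          by (auto simp: power2_eq_square[symmetric] abs_le_iff) (metis zero_le_power2 add.commute add_increasing diff_le_eq)+
      next
        case e: False
        then show ?thesis using True t y C_nonneg by (auto simp: abs_mult power2_eq_square intro!: mult_mono U_bound)
      qed
      moreover have "\<bar>v (t + a)\<bar> \<le> C\<^sup>2" using v_bounds[of "t + a"] by simp
      ultimately have "\<bar>v (t + a)\<bar> * \<bar>U t (y t) * U (t - (b - a)) (y (t - (b - a))) - (if a = b then v t else 0)\<bar> \<le> C\<^sup>2 * C\<^sup>2"
        by (intro mult_mono) auto
      then show ?thesis using True unfolding abs_mult[symmetric] by (simp only: if_True simp_thms)
    qed auto
  qed auto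
  then show ?thesis unfolding eq .
qed

text \<open>U^2 * V^2 splits into (U^2 - v) * V^2, a martingale difference, and v * V^2, whose
  expansion over pairs of lags is handled by \<open>cross_second_moment\<close>. For fixed h each
  part deviates only by order sqrt n in mean.\<close>

lemma quadratic_variation:
  assumes c: "\<And>a. 1 \<le> a \<Longrightarrow> a \<le> L \<Longrightarrow> \<bar>c a\<bar> \<le> h" and h: "0 \<le> h"
  shows "EE B p {1..n} (\<lambda>y. \<bar>(\<Sum>t=1..n. (U t (y t) * V L c t y)\<^sup>2) - (\<Sum>a=1..L. (c a)\<^sup>2 * Lam n a)\<bar>)
    \<le> 2 * (real L * (h * C\<^sup>2))\<^sup>2 * sqrt (real n)"
proof -
  let ?M = "\<lambda>y. \<Sum>t=1..n. ((U t (y t))\<^sup>2 - v t) * (V L c t y)\<^sup>2"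
  let ?R = "\<lambda>a b y. \<Sum>t=1..n. if a < t \<and> b < t then v t * (U (t - a) (y (t - a)) * U (t - b) (y (t - b)) - (if a = b then v (t - a) else 0)) else 0"
  \<comment> \<open>Diagonal pairs a = b carry U^2 - v, so their subtracted parts add up to the
    deterministic variance; off-diagonal pairs have mean 0 and nothing is subtracted.\<close>
  have R: "(\<Sum>a=1..L. \<Sum>b=1..L. c a * c b * ?R a b y) = (\<Sum>t=1..n. v t * (V L c t y)\<^sup>2) - (\<Sum>a=1..L. (c a)\<^sup>2 * Lam n a)" for y
  proof -
    have "(\<Sum>a=1..L. \<Sum>b=1..L. c a * c b * ?R a b y) = 
      (\<Sum>a=1..L. \<Sum>b=1..L. \<Sum>t=1..n. v t * ((if a < t then c a * U (t - a) (y (t - a)) else 0) * (if b < t then c b * U (t - b) (y (t - b)) else 0)))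
      - (\<Sum>a=1..L. \<Sum>b=1..L. \<Sum>t=1..n. if a = b then if a < t then (c a)\<^sup>2 * (v t * v (t - a)) else 0 else 0)"
      unfolding sum_distrib_left sum_subtractf[symmetric]
      by (intro sum.cong refl) (auto simp: algebra_simps power2_eq_square)
    also have "(\<Sum>a=1..L. \<Sum>b=1..L. \<Sum>t=1..n. if a = b then if a < t then (c a)\<^sup>2 * (v t * v (t - a)) else 0 else 0) 
      = (\<Sum>a=1..L. \<Sum>b=1..L. if a = b then \<Sum>t=1..n. if a < t then (c a)\<^sup>2 * (v t * v (t - a)) else 0 else 0)"
      by (intro sum.cong[of "{1..L}" "{1..L}"] refl) auto
    also have "\<dots> = (\<Sum>a=1..L. \<Sum>t=1..n. if a < t then (c a)\<^sup>2 * (v t * v (t - a)) else 0)"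
      by (rule sum.cong[OF refl]) simp
    also have "\<dots> = (\<Sum>a=1..L. (c a)\<^sup>2 * Lam n a)" unfolding sum_lag Lam_def sum_distrib_left ..
    also have "(\<Sum>a=1..L. \<Sum>b=1..L. \<Sum>t=1..n. v t * ((if a < t then c a * U (t - a) (y (t - a)) else 0) * (if b < t then c b * U (t - b) (y (t - b)) else 0)))
      = (\<Sum>a=1..L. \<Sum>t=1..n. \<Sum>b=1..L. v t * ((if a < t then c a * U (t - a) (y (t - a)) else 0) * (if b < t then c b * U (t - b) (y (t - b)) else 0)))"
      by (rule sum.cong[OF refl], rule sum.swap)
    also have "\<dots> = (\<Sum>t=1..n. \<Sum>a=1..L. \<Sum>b=1..L. v t * ((if a < t then c a * U (t - a) (y (t - a)) else 0) * (if b < t then c b * U (t - b) (y (t - b)) else 0)))"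
      by (rule sum.swap)
    also have "\<dots> = (\<Sum>t=1..n. v t * (V L c t y)\<^sup>2)"
      unfolding V_def power2_eq_square sum_product by (simp only: sum_distrib_left)
    finally show ?thesis .
  qed
  have split: "(\<Sum>t=1..n. (U t (y t) * V L c t y)\<^sup>2) - (\<Sum>a=1..L. (c a)\<^sup>2 * Lam n a) = ?M y + (\<Sum>a=1..L. \<Sum>b=1..L. c a * c b * ?R a b y)" for y
    unfolding R by (simp add: power_mult_distrib left_diff_distrib sum_subtractf)
  have "EE B p {1..n} (\<lambda>y. (?M y)\<^sup>2) \<le> real n * (C\<^sup>2 * (real L * (h * C))\<^sup>2)\<^sup>2"
  proof (rule martingale_second_moment)
    fix s t y b assume "s \<le> n" "(s::nat) < t"
    then show "((U s ((y(t := b)) s))\<^sup>2 - v s) * (V L c s (y(t := b)))\<^sup>2 = ((U s (y s))\<^sup>2 - v s) * (V L c s y)\<^sup>2"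
      by (simp add: V_dep)
  next
    fix t y
    have "(\<Sum>b\<le>B. p t b * (((U t ((y(t := b)) t))\<^sup>2 - v t) * (V L c t (y(t := b)))\<^sup>2)) = ((\<Sum>b\<le>B. p t b * (U t b)\<^sup>2) - v t * (\<Sum>b\<le>B. p t b)) * (V L c t y)\<^sup>2"
      unfolding V_dep[OF order_refl] left_diff_distrib sum_distrib_left sum_distrib_right sum_subtractf[symmetric] 
      by (intro sum.cong) (auto simp: algebra_simps)
    then show "(\<Sum>b\<le>B. p t b * (((U t ((y(t := b)) t))\<^sup>2 - v t) * (V L c t (y(t := b)))\<^sup>2)) = 0"
      by (simp add: v_def p_sum)
    assume t: "1 \<le> t" and y: "\<And>s. 1 \<le> s \<Longrightarrow> s \<le> t \<Longrightarrow> y s \<le> B"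
    have 1: "\<bar>(U t (y t))\<^sup>2 - v t\<bar> \<le> C\<^sup>2"
      unfolding abs_le_iff using U_sq[OF y[OF t order_refl], of t] v_bounds[of t] zero_le_power2[of "U t (y t)"] by linarith
    have "(V L c t y)\<^sup>2 \<le> (real L * (h * C))\<^sup>2"
      using V_bound[OF c, where t=t and y=y] y h C_nonneg by (auto simp: abs_le_square_iff[symmetric])
    then show "\<bar>((U t (y t))\<^sup>2 - v t) * (V L c t y)\<^sup>2\<bar> \<le> C\<^sup>2 * (real L * (h * C))\<^sup>2"
      using 1 by (auto simp: abs_mult intro!: mult_mono)
  qed
  then have "EE B p {1..n} (\<lambda>y. \<bar>?M y\<bar>) \<le> sqrt (real n * (C\<^sup>2 * (real L * (h * C))\<^sup>2)\<^sup>2)"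
    by (intro EE_abs_le_sqrt) auto
  then have M: "EE B p {1..n} (\<lambda>y. \<bar>?M y\<bar>) \<le> sqrt (real n) * (real L * (h * C\<^sup>2))\<^sup>2"
  proof -
    have e1: "sqrt (real n * (C\<^sup>2 * (real L * (h * C))\<^sup>2)\<^sup>2) = sqrt (real n) * (C\<^sup>2 * (real L * (h * C))\<^sup>2)"
      by (simp only: real_sqrt_mult real_sqrt_abs abs_mult abs_power2)
    have e2: "C\<^sup>2 * (real L * (h * C))\<^sup>2 = (real L * (h * C\<^sup>2))\<^sup>2" 
      by (simp add: power_mult_distrib power2_eq_square[of "C\<^sup>2"] power2_eq_square[of C])
    show ?thesis using \<open>EE B p {1..n} (\<lambda>y. \<bar>?M y\<bar>) \<le> _\<close> unfolding e1 unfolding e2 .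
  qed
  have Rb: "EE B p {1..n} (\<lambda>y. \<bar>?R a b y\<bar>) \<le> sqrt (real n) * (C\<^sup>2 * C\<^sup>2)" for a b
  proof -
    have "EE B p {1..n} (\<lambda>y. (?R a b y)\<^sup>2) \<le> real n * (C\<^sup>2 * C\<^sup>2)\<^sup>2"
    proof (cases "a \<le> b")
      case True then show ?thesis by (rule cross_second_moment)
    next
      case False
      have eq: "?R a b y = ?R b a y" for y by (intro sum.cong refl) (auto simp: mult_ac)
      show ?thesis unfolding eq by (rule cross_second_moment) (use False in simp)
    qed
    then have "EE B p {1..n} (\<lambda>y. \<bar>?R a b y\<bar>) \<le> sqrt (real n * (C\<^sup>2 * C\<^sup>2)\<^sup>2)"
      by (intro EE_abs_le_sqrt) auto
    then show ?thesis by (simp only: real_sqrt_mult real_sqrt_abs abs_mult abs_power2)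
  qed
  have "EE B p {1..n} (\<lambda>y. \<bar>?M y + (\<Sum>a=1..L. \<Sum>b=1..L. c a * c b * ?R a b y)\<bar>) \<le> EE B p {1..n} (\<lambda>y. \<bar>?M y\<bar> + (\<Sum>a=1..L. \<Sum>b=1..L. h * h * \<bar>?R a b y\<bar>))"
  proof (rule EE_mono, rule order_trans[OF abs_triangle_ineq], intro add_left_mono)
    fix y
    have "\<bar>\<Sum>a=1..L. \<Sum>b=1..L. c a * c b * ?R a b y\<bar> \<le> (\<Sum>a=1..L. \<Sum>b=1..L. \<bar>c a * c b * ?R a b y\<bar>)"
      by (rule order_trans[OF sum_abs], intro sum_mono sum_abs)
    also have "\<dots> \<le> (\<Sum>a=1..L. \<Sum>b=1..L. h * h * \<bar>?R a b y\<bar>)"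
      unfolding abs_mult using c h by (intro sum_mono mult_mono) auto
    finally show "\<bar>\<Sum>a=1..L. \<Sum>b=1..L. c a * c b * ?R a b y\<bar> \<le> (\<Sum>a=1..L. \<Sum>b=1..L. h * h * \<bar>?R a b y\<bar>)" .
  qed
  also have "\<dots> = EE B p {1..n} (\<lambda>y. \<bar>?M y\<bar>) + (\<Sum>a=1..L. \<Sum>b=1..L. h * h * EE B p {1..n} (\<lambda>y. \<bar>?R a b y\<bar>))"
    by (simp only: EE_add EE_sum EE_cmult)
  also have "\<dots> \<le> sqrt (real n) * (real L * (h * C\<^sup>2))\<^sup>2 + (\<Sum>a=1..L. \<Sum>b=1..L. h * h * (sqrt (real n) * (C\<^sup>2 * C\<^sup>2)))"
    using h by (intro add_mono M sum_mono mult_left_mono Rb) auto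
  also have "\<dots> = 2 * (real L * (h * C\<^sup>2))\<^sup>2 * sqrt (real n)"
    by (simp add: power_mult_distrib power2_eq_square[of "real L"] power2_eq_square[of h] power2_eq_square[of "C\<^sup>2"])
  finally show ?thesis unfolding split .
qed

text \<open>The compensated exponentials exp (i * D + D^2 / 2) have conditional mean 1 up to 4 *
  H^3, so by telescoping their product has mean 1 up to order n * H^3. The random compensator is
  then exchanged for the variance by \<open>quadratic_variation\<close>. Bounded increments keep all
  partial products below exp (Y^2 / 2).\<close>

lemma char_function_bound:
  assumes c: "\<And>a. 1 \<le> a \<Longrightarrow> a \<le> L \<Longrightarrow> \<bar>c a\<bar> \<le> X / sqrt (real n)" and X: "0 \<le> X" and n: "1 \<le> n"
    and Y: "Y = real L * (X * C\<^sup>2)" "Y \<le> sqrt (real n)"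
  shows "cmod (EE B p {1..n} (\<lambda>y. exp (\<i> * of_real (\<Sum>a=1..L. c a * W n a y))) - of_real (exp (- (\<Sum>a=1..L. (c a)\<^sup>2 * Lam n a) / 2)))
     \<le> exp (Y\<^sup>2 / 2) * (Y\<^sup>2 + 4 * Y ^ 3) / sqrt (real n)"
proof -
  define h where "h = X / sqrt (real n)"
  \<comment> \<open>Uniform bound of one increment; the second hypothesis on Y makes it at most 1,
    as \<open>exp_quadratic_remainder\<close> requires.\<close>
  define H where "H = Y / sqrt (real n)"
  have sn: "0 < sqrt (real n)" using n by simp
  have h: "0 \<le> h" unfolding h_def using X by simp
  have Y0: "0 \<le> Y" unfolding Y using X by simp
  have H: "0 \<le> H" "H \<le> 1" unfolding H_def using Y0 Y sn by auto
  have HL: "real L * (h * C\<^sup>2) = H" unfolding h_def H_def Y by simp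
  have nH: "real n * H\<^sup>2 = Y\<^sup>2" unfolding H_def using n by (simp add: power_divide)
  define D where "D = (\<lambda>t y. U t (y t) * V L c t y)"
  have D: "\<bar>D t y\<bar> \<le> H" if "\<And>s. 1 \<le> s \<Longrightarrow> s \<le> t \<Longrightarrow> y s \<le> B" "1 \<le> t" for t y
  proof -
    have "\<bar>D t y\<bar> \<le> C * (real L * (h * C))" unfolding D_def abs_mult using that C_nonneg c
      by (intro mult_mono U_bound V_bound) (auto simp: h_def)
    also have "\<dots> = H" unfolding HL[symmetric] by (simp add: power2_eq_square mult_ac)
    finally show ?thesis .
  qed
  define A where "A = (\<lambda>t y. exp (\<i> * of_real (D t y) + of_real ((D t y)\<^sup>2 / 2)))"
  have Ddep: "D s (y(t := b)) = D s y" if "s < t" for s t y b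
    unfolding D_def using that by (simp add: V_dep)
  have DS: "(\<Sum>t=1..j. (D t y)\<^sup>2) \<le> Y\<^sup>2" if "y \<in> PiE {1..j} (\<lambda>_. {..B})" "j \<le> n" for j y
  proof -
    have "(\<Sum>t=1..j. (D t y)\<^sup>2) \<le> (\<Sum>t=1..j. H\<^sup>2)"
      using that H D[where y=y] by (intro sum_mono) (auto simp: abs_le_square_iff[symmetric] PiE_iff)
    also have "\<dots> \<le> real n * H\<^sup>2" using that by (simp add: mult_right_mono)
    finally show ?thesis unfolding nH .
  qed
  have normA: "cmod (A t y) = exp ((D t y)\<^sup>2 / 2)" for t y unfolding A_def by simp
  have normP: "cmod (\<Prod>t=1..j. A t y) \<le> exp (Y\<^sup>2 / 2)" if "y \<in> PiE {1..j} (\<lambda>_. {..B})" "j \<le> n" for j y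
    unfolding prod_norm[symmetric] normA exp_sum[OF finite_atLeastAtMost, symmetric] sum_divide_distrib[symmetric] using DS[OF that] by simp
  have cond: "cmod ((\<Sum>b\<le>B. p t b *\<^sub>R A t (y(t := b))) - 1) \<le> 4 * H ^ 3"
    if "y \<in> PiE {1..j} (\<lambda>_. {..B})" "t = Suc j" for j t y
  proof -
    have "(\<Sum>b\<le>B. p t b * D t (y(t := b))) = (\<Sum>b\<le>B. p t b * U t b) * V L c t y"
      unfolding D_def sum_distrib_right by (intro sum.cong) (auto simp: V_dep)
    then have D0: "(\<Sum>b\<le>B. p t b *\<^sub>R (\<i> * of_real (D t (y(t := b))))) = 0"
      unfolding U_cent by (simp add: scaleR_conv_of_real mult.left_commute[of _ \<i>] sum_distrib_left[symmetric] of_real_mult[symmetric] of_real_sum[symmetric] del: of_real_mult of_real_sum)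
    have "(\<Sum>b\<le>B. p t b *\<^sub>R A t (y(t := b))) - 1 = (\<Sum>b\<le>B. p t b *\<^sub>R (A t (y(t := b)) - 1 - \<i> * of_real (D t (y(t := b)))))"
      unfolding scaleR_diff_right sum_subtractf D0 scaleR_sum_left[symmetric] p_sum by simp
    also have "cmod \<dots> \<le> (\<Sum>b\<le>B. p t b * (4 * H ^ 3))"
    proof (rule order_trans[OF norm_sum], intro sum_mono)
      fix b assume b: "b \<in> {..B}"
      have "\<bar>D t (y(t := b))\<bar> \<le> H" using that b by (intro D) (auto simp: PiE_iff le_Suc_eq)
      then have "cmod (A t (y(t := b)) - 1 - \<i> * of_real (D t (y(t := b)))) \<le> 4 * \<bar>D t (y(t := b))\<bar> ^ 3" "\<bar>D t (y(t := b))\<bar> ^ 3 \<le> H ^ 3"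
        using exp_quadratic_remainder[of "D t (y(t := b))"] H unfolding A_def by (auto intro: power_mono)
      then show "norm (p t b *\<^sub>R (A t (y(t := b)) - 1 - \<i> * of_real (D t (y(t := b))))) \<le> p t b * (4 * H ^ 3)"
        by (simp add: p_nonneg mult_left_mono)
    qed
    also have "\<dots> = 4 * H ^ 3" unfolding sum_distrib_right[symmetric] p_sum by simp
    finally show ?thesis .
  qed
  have P1: "cmod (EE B p {1..j} (\<lambda>y. \<Prod>t=1..j. A t y) - 1) \<le> real j * (exp (Y\<^sup>2 / 2) * (4 * H ^ 3))" if "j \<le> n" for j
    using that
  proof (induction j)
    case (Suc j)
    let ?P = "\<lambda>y. \<Prod>t=1..j. A t y"
    have dep: "(\<Prod>t=1..Suc j. A t (y(Suc j := b))) = ?P y * A (Suc j) (y(Suc j := b))" for y b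
    proof -
      have "(\<Prod>t=1..j. A t (y(Suc j := b))) = ?P y" by (intro prod.cong refl) (auto simp: A_def Ddep)
      then show ?thesis by simp
    qed
    have "EE B p {1..Suc j} (\<lambda>y. \<Prod>t=1..Suc j. A t y) = EE B p {1..j} (\<lambda>y. ?P y * (\<Sum>b\<le>B. p (Suc j) b *\<^sub>R A (Suc j) (y(Suc j := b))))"
      unfolding EE_Suc' dep by (simp add: sum_distrib_left)
    then have "EE B p {1..Suc j} (\<lambda>y. \<Prod>t=1..Suc j. A t y) - 1 = EE B p {1..j} (\<lambda>y. ?P y * ((\<Sum>b\<le>B. p (Suc j) b *\<^sub>R A (Suc j) (y(Suc j := b))) - 1)) + (EE B p {1..j} ?P - 1)"
      by (simp add: right_diff_distrib EE_diff)
    also have "cmod \<dots> \<le> exp (Y\<^sup>2 / 2) * (4 * H ^ 3) + real j * (exp (Y\<^sup>2 / 2) * (4 * H ^ 3))"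
    proof (intro order_trans[OF norm_triangle_ineq] add_mono Suc.IH)
      have "cmod (EE B p {1..j} (\<lambda>y. ?P y * ((\<Sum>b\<le>B. p (Suc j) b *\<^sub>R A (Suc j) (y(Suc j := b))) - 1))) 
        \<le> EE B p {1..j} (\<lambda>y. exp (Y\<^sup>2 / 2) * (4 * H ^ 3))"
      proof (rule order_trans[OF EE_norm], rule EE_mono)
        fix y assume y: "y \<in> {1..j} \<rightarrow>\<^sub>E {..B}"
        show "norm (?P y * ((\<Sum>b\<le>B. p (Suc j) b *\<^sub>R A (Suc j) (y(Suc j := b))) - 1)) \<le> exp (Y\<^sup>2 / 2) * (4 * H ^ 3)"
          unfolding norm_mult using Suc.prems by (intro mult_mono normP cond[OF y] y) auto
      qed
      also have "\<dots> = exp (Y\<^sup>2 / 2) * (4 * H ^ 3)" by (simp add: EE_const)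
      finally show "cmod (EE B p {1..j} (\<lambda>y. ?P y * ((\<Sum>b\<le>B. p (Suc j) b *\<^sub>R A (Suc j) (y(Suc j := b))) - 1))) \<le> exp (Y\<^sup>2 / 2) * (4 * H ^ 3)" .
    qed (use Suc.prems in auto)
    finally show ?case by (simp add: algebra_simps)
  qed simp
  define Q where "Q = (\<lambda>y. \<Sum>t=1..n. (D t y)\<^sup>2)"
  define lam where "lam = (\<Sum>a=1..L. (c a)\<^sup>2 * Lam n a)"
  have lam: "0 \<le> lam" unfolding lam_def by (intro sum_nonneg mult_nonneg_nonneg Lam_nonneg) auto
  have Q: "0 \<le> Q y" for y unfolding Q_def by (intro sum_nonneg) auto
  have P: "(\<Prod>t=1..n. A t y) = exp (\<i> * of_real (\<Sum>a=1..L. c a * W n a y)) * of_real (exp (Q y / 2))" for y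
  proof -
    have "(\<Sum>a=1..L. c a * W n a y) = (\<Sum>t=1..n. D t y)" unfolding D_def sum_D ..
    then show ?thesis unfolding A_def exp_sum[OF finite_atLeastAtMost, symmetric] Q_def sum.distrib
      by (simp add: exp_add exp_of_real[symmetric] sum_distrib_left sum_divide_distrib)
  qed
  have iexp: "exp (\<i> * of_real (\<Sum>a=1..L. c a * W n a y)) = (\<Prod>t=1..n. A t y) * of_real (exp (- Q y / 2))" for y
    unfolding P by (simp add: exp_minus mult.assoc of_real_mult[symmetric] del: of_real_mult)
  \<comment> \<open>The first term is the error of replacing Q by \<open>lam\<close> in the
    compensator, the second the deviation of the mean of the compensated product from 1.\<close>
  have "EE B p {1..n} (\<lambda>y. exp (\<i> * of_real (\<Sum>a=1..L. c a * W n a y))) - of_real (exp (- lam / 2))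
    = EE B p {1..n} (\<lambda>y. (\<Prod>t=1..n. A t y) * (of_real (exp (- (Q y / 2)) - exp (- (lam / 2))))) + (EE B p {1..n} (\<lambda>y. \<Prod>t=1..n. A t y) - 1) * of_real (exp (- lam / 2))"
    unfolding iexp by (simp add: EE_diff EE_cmult right_diff_distrib left_diff_distrib)
  also have "cmod \<dots> \<le> exp (Y\<^sup>2 / 2) * (H\<^sup>2 * sqrt (real n)) + real n * (exp (Y\<^sup>2 / 2) * (4 * H ^ 3)) * 1"
  proof (intro order_trans[OF norm_triangle_ineq] add_mono)
    have "cmod (EE B p {1..n} (\<lambda>y. (\<Prod>t=1..n. A t y) * (of_real (exp (- (Q y / 2)) - exp (- (lam / 2)))))) \<le> EE B p {1..n} (\<lambda>y. exp (Y\<^sup>2 / 2) * (\<bar>Q y - lam\<bar> * (1 / 2)))"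
    proof (rule order_trans[OF EE_norm], rule EE_mono)
      fix y assume y: "y \<in> {1..n} \<rightarrow>\<^sub>E {..B}"
      have "\<bar>exp (- (Q y / 2)) - exp (- (lam / 2))\<bar> \<le> \<bar>Q y / 2 - lam / 2\<bar>" using Q lam by (intro exp_neg_lipschitz) auto
      also have "\<dots> = \<bar>Q y - lam\<bar> * (1 / 2)" unfolding diff_divide_distrib[symmetric] by simp
      finally show "norm ((\<Prod>t=1..n. A t y) * (of_real (exp (- (Q y / 2)) - exp (- (lam / 2))))) \<le> exp (Y\<^sup>2 / 2) * (\<bar>Q y - lam\<bar> * (1 / 2))"
        unfolding norm_mult norm_of_real by (intro mult_mono normP y) auto
    qed
    also have "\<dots> = exp (Y\<^sup>2 / 2) * (EE B p {1..n} (\<lambda>y. \<bar>Q y - lam\<bar>) * (1 / 2))" by (simp only: EE_cmult)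
    also have "\<dots> \<le> exp (Y\<^sup>2 / 2) * ((2 * H\<^sup>2 * sqrt (real n)) * (1 / 2))"
      using quadratic_variation[of L c h n] c h unfolding HL by (intro mult_left_mono mult_right_mono) (auto simp: Q_def D_def lam_def h_def)
    finally show "cmod (EE B p {1..n} (\<lambda>y. (\<Prod>t=1..n. A t y) * (of_real (exp (- (Q y / 2)) - exp (- (lam / 2)))))) \<le> exp (Y\<^sup>2 / 2) * (H\<^sup>2 * sqrt (real n))" by simp
    show "cmod ((EE B p {1..n} (\<lambda>y. \<Prod>t=1..n. A t y) - 1) * of_real (exp (- lam / 2))) \<le> real n * (exp (Y\<^sup>2 / 2) * (4 * H ^ 3)) * 1"
      unfolding norm_mult using P1[of n] lam H by (intro mult_mono) auto
  qed
  also have "\<dots> = exp (Y\<^sup>2 / 2) * (Y\<^sup>2 + 4 * Y ^ 3) / sqrt (real n)"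
  proof -
    have "H\<^sup>2 * sqrt (real n) = Y\<^sup>2 / sqrt (real n)" unfolding H_def using sn n
      by (simp add: power_divide real_div_sqrt field_simps)
    moreover have "real n * H ^ 3 = Y ^ 3 / sqrt (real n)"
      using nH unfolding power3_eq_cube power2_eq_square H_def by (simp add: mult.assoc[symmetric])
    moreover have "real n * (exp (Y\<^sup>2 / 2) * (4 * H ^ 3)) * 1 = exp (Y\<^sup>2 / 2) * (4 * (real n * H ^ 3))" by simp
    ultimately show ?thesis by (simp only: distrib_left add_divide_distrib times_divide_eq_right)
  qed
  finally show ?thesis unfolding lam_def .
qed

end

section \<open>Gaussian linearisation of the Laplace transform\<close>

abbreviation gauss :: "nat \<Rightarrow> (nat \<Rightarrow> real) measure" where
  "gauss L \<equiv> PiM {1..L} (\<lambda>_. std_normal_distribution)"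

lemma prob_space_gauss: "prob_space (gauss L)"
  using prob_space_normal_density[of 1 0] by (intro prob_space_PiM) simp

lemma char_gauss: "(CLINT x|std_normal_distribution. exp (\<i> * of_real (t * x))) = of_real (exp (- (t\<^sup>2) / 2))"
  using fun_cong[OF char_std_normal_distribution, of t] unfolding char_def by simp

lemma product_sigma_finite_normal: "product_sigma_finite (\<lambda>_::nat. std_normal_distribution)"
  using prob_space_normal_density[of 1 0]
  by (auto simp: product_sigma_finite_def prob_space_imp_sigma_finite)

text \<open>Hubbard--Stratonovich linearisation: it turns the Laplace transform of a quadratic statistic into
  characteristic functions of linear statistics.\<close>
lemma gauss_linearize:
  assumes "0 \<le> k"
  shows "(CLINT x|gauss L. exp (\<i> * of_real (\<Sum>a=1..L. sqrt (2 * k) * x a * z a))) = of_real (exp (- k * (\<Sum>a=1..L. (z a)\<^sup>2)))"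
proof -
  interpret product_sigma_finite "\<lambda>_::nat. std_normal_distribution" by (rule product_sigma_finite_normal)
  have rd: "finite_measure std_normal_distribution" using prob_space_normal_density[of 1 0] by (simp add: prob_space.axioms(1))
  have "(CLINT x|gauss L. exp (\<i> * of_real (\<Sum>a=1..L. sqrt (2 * k) * x a * z a)))
    = (CLINT x|gauss L. (\<Prod>a\<in>{1..L}. exp (\<i> * of_real ((sqrt (2 * k) * z a) * x a))))"
    by (simp add: exp_sum[symmetric] sum_distrib_left mult_ac)
  also have "\<dots> = (\<Prod>a\<in>{1..L}. CLINT x|std_normal_distribution. exp (\<i> * of_real ((sqrt (2 * k) * z a) * x)))"
    by (intro product_integral_prod finite_measure.integrable_const_bound[OF rd, where B=1]) auto
  also have "\<dots> = (\<Prod>a\<in>{1..L}. of_real (exp (- k * (z a)\<^sup>2)))"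
    unfolding char_gauss using assms by (simp add: power_mult_distrib)
  also have "\<dots> = of_real (exp (- k * (\<Sum>a=1..L. (z a)\<^sup>2)))"
    unfolding of_real_prod[symmetric] sum_distrib_left exp_sum[OF finite_atLeastAtMost] ..
  finally show ?thesis .
qed

text \<open>Tilting the standard normal density by exp (- k * x^2) gives a multiple of the density
  with variance 1 / (1 + 2 * k), so each coordinate contributes (1 + 2 * k) powr (-1/2). The product
  is the value found in \<open>chi2_laplace\<close>.\<close>

lemma gauss_laplace:
  assumes k: "0 \<le> k"
  shows "(LINT x|gauss L. exp (- k * (\<Sum>a=1..L. (x a)\<^sup>2))) = (1 + 2 * k) powr (- real L / 2)"
proof -
  interpret product_sigma_finite "\<lambda>_::nat. std_normal_distribution" by (rule product_sigma_finite_normal)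
  have rd: "finite_measure std_normal_distribution" using prob_space_normal_density[of 1 0] by (simp add: prob_space.axioms(1))
  have "(LINT x|gauss L. exp (- k * (\<Sum>a=1..L. (x a)\<^sup>2))) = (LINT x|gauss L. (\<Prod>a\<in>{1..L}. exp (- k * (x a)\<^sup>2)))"
    by (simp add: exp_sum[symmetric] sum_distrib_left sum_negf)
  also have "\<dots> = (\<Prod>a\<in>{1..L}. LINT x|std_normal_distribution. exp (- k * x\<^sup>2))"
    using k by (intro product_integral_prod finite_measure.integrable_const_bound[OF rd, where B=1]) auto
  also have "(LINT x|std_normal_distribution. exp (- k * x\<^sup>2)) = (1 + 2 * k) powr (- 1 / 2)"
  proof -
    have s: "0 < 1 / sqrt (1 + 2 * k)" using k by simp
    have eq: "std_normal_density x * exp (- k * x\<^sup>2) = (1 / sqrt (1 + 2 * k)) * normal_density 0 (1 / sqrt (1 + 2 * k)) x" for x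
    proof -
      define r where "r = 1 + 2 * k"
      have r: "0 < r" unfolding r_def using k by simp
      have s2: "(1 / sqrt r)\<^sup>2 = 1 / r" using r by (simp add: power_divide)
      have e: "exp (- x\<^sup>2 / 2) * exp (- k * x\<^sup>2) = exp (- x\<^sup>2 * r / 2)"
        unfolding exp_add[symmetric] r_def by (simp add: algebra_simps add_divide_distrib)
      have "sqrt (2 * pi * (1 / r)) = sqrt (2 * pi) / sqrt r" by (simp add: real_sqrt_divide)
      then have "(1 / sqrt r) * normal_density 0 (1 / sqrt r) x = 1 / sqrt (2 * pi) * exp (- x\<^sup>2 * r / 2)"
        unfolding normal_density_def s2 using r by simp
      then show ?thesis unfolding r_def[symmetric] e[symmetric] std_normal_density_def by simp
    qed
    have "(LINT x|std_normal_distribution. exp (- k * x\<^sup>2)) = (LINT x|lborel. std_normal_density x * exp (- k * x\<^sup>2))"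
      by (subst integral_density) auto
    also have "\<dots> = (1 / sqrt (1 + 2 * k)) * (LINT x|lborel. normal_density 0 (1 / sqrt (1 + 2 * k)) x)"
      unfolding eq by simp
    also have "\<dots> = (1 + 2 * k) powr (- 1 / 2)"
      using k s by (simp add: powr_minus_divide powr_half_sqrt)
    finally show ?thesis .
  qed
  also have "(\<Prod>a\<in>{1..L}. (1 + 2 * k) powr (- 1 / 2)) = (1 + 2 * k) powr (- real L / 2)"
    using k by (simp add: powr_realpow[symmetric] powr_powr)
  finally show ?thesis .
qed

definition clt_err :: "real \<Rightarrow> nat \<Rightarrow> real \<Rightarrow> real" where
  "clt_err Y n w = (let Z = Y * w in
     if Z \<le> sqrt (real n) then min 2 (exp (Z\<^sup>2 / 2) * (Z\<^sup>2 + 4 * Z ^ 3) / sqrt (real n)) else 2)"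

definition lap_err :: "nat \<Rightarrow> real \<Rightarrow> nat \<Rightarrow> real" where
  "lap_err L Y n = (LINT x|gauss L. clt_err Y n (\<Sum>a=1..L. \<bar>x a\<bar>))"

lemma gauss_component[measurable]: "a \<in> {1..L} \<Longrightarrow> (\<lambda>x. x a) \<in> borel_measurable (gauss L)"
  using measurable_component_singleton[of a "{1..L}" "\<lambda>_. std_normal_distribution"] by simp

lemma gauss_abs_sum[measurable]: "(\<lambda>x. \<Sum>a=1..L. \<bar>x a\<bar>) \<in> borel_measurable (gauss L)"
  by (intro borel_measurable_sum borel_measurable_abs gauss_component)

lemma clt_err_measurable[measurable]: "clt_err Y n \<in> borel_measurable borel"
  unfolding clt_err_def[abs_def] Let_def by measurable

lemma clt_err_bounds: 
  assumes "0 \<le> Y" "0 \<le> w" shows "0 \<le> clt_err Y n w" "clt_err Y n w \<le> 2"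
  using assms unfolding clt_err_def Let_def by auto

text \<open>For a fixed Gaussian vector the error is of order 1 / sqrt n, and the cap 2 permits
  dominated convergence.\<close>

lemma lap_err_tendsto:
  assumes Y: "0 \<le> Y"
  shows "lap_err L Y \<longlonglongrightarrow> 0"
proof -
  interpret prob_space "gauss L" by (rule prob_space_gauss)
  have "(\<lambda>n. LINT x|gauss L. clt_err Y n (\<Sum>a=1..L. \<bar>x a\<bar>)) \<longlonglongrightarrow> (LINT x|gauss L. 0)"
  proof (rule integral_dominated_convergence[where w="\<lambda>_. 2"])
    show "AE x in gauss L. (\<lambda>n. clt_err Y n (\<Sum>a=1..L. \<bar>x a\<bar>)) \<longlonglongrightarrow> 0"
    proof (intro AE_I2)
      fix x :: "nat \<Rightarrow> real"
      define Z where "Z = Y * (\<Sum>a=1..L. \<bar>x a\<bar>)"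
      have Z: "0 \<le> Z" unfolding Z_def using Y by (intro mult_nonneg_nonneg sum_nonneg) auto
      have lim: "filterlim (\<lambda>n. sqrt (real n)) at_top sequentially"
        using filterlim_compose[OF sqrt_at_top filterlim_real_sequentially] by simp
      have "eventually (\<lambda>n. Z \<le> sqrt (real n)) sequentially"
        using lim unfolding filterlim_at_top by auto
      have lim0: "(\<lambda>n. exp (Z\<^sup>2 / 2) * (Z\<^sup>2 + 4 * Z ^ 3) / sqrt (real n)) \<longlonglongrightarrow> 0"
        by (intro tendsto_divide_0[OF tendsto_const] filterlim_at_top_imp_at_infinity lim)
      have nn: "\<forall>\<^sub>F n in sequentially. 0 \<le> clt_err Y n (\<Sum>a=1..L. \<bar>x a\<bar>)"
        by (intro always_eventually allI clt_err_bounds Y sum_nonneg abs_ge_zero)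
      have ub: "\<forall>\<^sub>F n in sequentially. clt_err Y n (\<Sum>a=1..L. \<bar>x a\<bar>) \<le> exp (Z\<^sup>2 / 2) * (Z\<^sup>2 + 4 * Z ^ 3) / sqrt (real n)"
        using \<open>eventually (\<lambda>n. Z \<le> sqrt (real n)) sequentially\<close>
      proof (rule eventually_mono)
        fix n assume "Z \<le> sqrt (real n)"
        then show "clt_err Y n (\<Sum>a=1..L. \<bar>x a\<bar>) \<le> exp (Z\<^sup>2 / 2) * (Z\<^sup>2 + 4 * Z ^ 3) / sqrt (real n)"
          unfolding clt_err_def Let_def Z_def[symmetric] by (simp only: if_True min.cobounded2)
      qed
      show "(\<lambda>n. clt_err Y n (\<Sum>a=1..L. \<bar>x a\<bar>)) \<longlonglongrightarrow> 0"
        by (rule real_tendsto_sandwich[OF nn ub tendsto_const lim0])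
    qed
    show "AE x in gauss L. norm (clt_err Y n (\<Sum>a=1..L. \<bar>x a\<bar>)) \<le> 2" for n
    proof (intro AE_I2)
      fix x :: "nat \<Rightarrow> real"
      have "0 \<le> (\<Sum>a=1..L. \<bar>x a\<bar>)" by (intro sum_nonneg abs_ge_zero)
      from clt_err_bounds[OF Y this, of n] show "norm (clt_err Y n (\<Sum>a=1..L. \<bar>x a\<bar>)) \<le> 2"
        by (simp only: real_norm_def abs_of_nonneg)
    qed
    show "(\<lambda>x. clt_err Y n (\<Sum>a=1..L. \<bar>x a\<bar>)) \<in> borel_measurable (gauss L)" for n
      by (rule measurable_compose[OF gauss_abs_sum clt_err_measurable])
    show "integrable (gauss L) (\<lambda>_. 2 :: real)" by (rule integrable_const)
  qed simp
  then show ?thesis unfolding lap_err_def[abs_def] by simp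
qed

context bounded_scores
begin

text \<open>With coefficients sqrt (2 * k) * x a / sqrt (Lam n a) the variance in the exponent
  becomes 2 * k times the sum of squares of x, free of \<open>p\<close> and \<open>U\<close>, so
  averaging over Gaussian x gives exactly \<open>gauss_laplace\<close>. The error depends only on L,
  k, c, C and n, hence is uniform over the conditional laws.\<close>

lemma laplace_bound:
  assumes k: "0 \<le> k" and c: "0 < c" and n: "1 \<le> n"
    and Lam: "\<And>a. 1 \<le> a \<Longrightarrow> a \<le> L \<Longrightarrow> c * real n \<le> Lam n a"
  shows "\<bar>EE B p {1..n} (\<lambda>y. exp (- k * (\<Sum>a=1..L. (W n a y)\<^sup>2 / Lam n a))) - (1 + 2 * k) powr (- real L / 2)\<bar>
     \<le> lap_err L (real L * (sqrt (2 * k) / sqrt c * C\<^sup>2)) n"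
proof -
  interpret g: prob_space "gauss L" by (rule prob_space_gauss)
  define Y where "Y = real L * (sqrt (2 * k) / sqrt c * C\<^sup>2)"
  have Y: "0 \<le> Y" unfolding Y_def using k c by simp
  define w :: "(nat \<Rightarrow> real) \<Rightarrow> real" where "w x = (\<Sum>a=1..L. \<bar>x a\<bar>)" for x
  have w: "0 \<le> w x" for x unfolding w_def by (intro sum_nonneg) auto
  define co where "co = (\<lambda>x a. sqrt (2 * k) * x a / sqrt (Lam n a))"
  have Lpos: "0 < Lam n a" if "1 \<le> a" "a \<le> L" for a
    using Lam[OF that] c n by (intro less_le_trans[OF _ Lam[OF that]]) simp
  define \<phi> where "\<phi> = (\<lambda>x. EE B p {1..n} (\<lambda>y. exp (\<i> * of_real (\<Sum>a=1..L. co x a * W n a y))))"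
  have m: "(\<lambda>x. exp (\<i> * of_real (\<Sum>a=1..L. co x a * W n a y))) \<in> borel_measurable (gauss L)" for y
  proof -
    have "(\<lambda>x. \<Sum>a=1..L. co x a * W n a y) \<in> borel_measurable (gauss L)"
      unfolding co_def by (intro borel_measurable_sum borel_measurable_times borel_measurable_divide gauss_component) auto
    then show ?thesis by measurable
  qed
  have int: "integrable (gauss L) (\<lambda>x. exp (\<i> * of_real (\<Sum>a=1..L. co x a * W n a y)))" for y
    by (intro g.integrable_const_bound[where B=1] m) auto
  have \<phi>int: "integrable (gauss L) \<phi>" unfolding \<phi>_def EE_def
    by (intro Bochner_Integration.integrable_sum integrable_scaleR_right int)
  have lim_int: "integrable (gauss L) (\<lambda>x. complex_of_real (exp (- k * (\<Sum>a=1..L. (x a)\<^sup>2))))"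
  proof (intro g.integrable_const_bound[where B=1])
    have "(\<lambda>x. \<Sum>a=1..L. (x a)\<^sup>2) \<in> borel_measurable (gauss L)"
      by (intro borel_measurable_sum borel_measurable_power gauss_component)
    then show "(\<lambda>x. complex_of_real (exp (- k * (\<Sum>a=1..L. (x a)\<^sup>2)))) \<in> borel_measurable (gauss L)" by measurable
    show "AE x in gauss L. norm (complex_of_real (exp (- k * (\<Sum>a=1..L. (x a)\<^sup>2)))) \<le> 1"
      unfolding norm_of_real using k by (auto intro!: mult_nonneg_nonneg sum_nonneg)
  qed
  have lin: "(\<Sum>a=1..L. co x a * W n a y) = (\<Sum>a=1..L. sqrt (2 * k) * x a * (W n a y / sqrt (Lam n a)))" for x y
    unfolding co_def by simp
  have sq: "(\<Sum>a=1..L. (W n a y / sqrt (Lam n a))\<^sup>2) = (\<Sum>a=1..L. (W n a y)\<^sup>2 / Lam n a)" for y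
    using Lam_nonneg by (simp add: power_divide)
  have "complex_of_real (EE B p {1..n} (\<lambda>y. exp (- k * (\<Sum>a=1..L. (W n a y)\<^sup>2 / Lam n a))))
    = EE B p {1..n} (\<lambda>y. complex_of_real (exp (- k * (\<Sum>a=1..L. (W n a y)\<^sup>2 / Lam n a))))"
    unfolding EE_def by (simp add: scaleR_conv_of_real)
  also have "\<dots> = EE B p {1..n} (\<lambda>y. CLINT x|gauss L. exp (\<i> * of_real (\<Sum>a=1..L. co x a * W n a y)))"
    unfolding lin gauss_linearize[OF k] sq ..
  also have "\<dots> = (CLINT x|gauss L. \<phi> x)"
    unfolding EE_def \<phi>_def
    by (simp only: Bochner_Integration.integral_sum integrable_scaleR_right int integral_scaleR_right)
  finally have "complex_of_real (EE B p {1..n} (\<lambda>y. exp (- k * (\<Sum>a=1..L. (W n a y)\<^sup>2 / Lam n a))) - (1 + 2 * k) powr (- real L / 2))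
    = (CLINT x|gauss L. \<phi> x - complex_of_real (exp (- k * (\<Sum>a=1..L. (x a)\<^sup>2))))"
    unfolding gauss_laplace[OF k, symmetric] of_real_diff Bochner_Integration.integral_diff[OF \<phi>int lim_int] integral_complex_of_real
    by (rule arg_cong2[where f="(-)", OF _ refl])
  from arg_cong[OF this, of cmod]
  have "\<bar>EE B p {1..n} (\<lambda>y. exp (- k * (\<Sum>a=1..L. (W n a y)\<^sup>2 / Lam n a))) - (1 + 2 * k) powr (- real L / 2)\<bar>
    = cmod (CLINT x|gauss L. \<phi> x - complex_of_real (exp (- k * (\<Sum>a=1..L. (x a)\<^sup>2))))"
    unfolding norm_of_real .
  also have "\<dots> \<le> (LINT x|gauss L. clt_err Y n (w x))"
  proof (rule order_trans[OF integral_norm_bound], rule integral_mono)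
    show "integrable (gauss L) (\<lambda>x. norm (\<phi> x - complex_of_real (exp (- k * (\<Sum>a=1..L. (x a)\<^sup>2)))))"
      by (intro integrable_norm Bochner_Integration.integrable_diff \<phi>int lim_int)
    show "integrable (gauss L) (\<lambda>x. clt_err Y n (w x))"
    proof (intro g.integrable_const_bound[where B=2] AE_I2)
      show "(\<lambda>x. clt_err Y n (w x)) \<in> borel_measurable (gauss L)"
        unfolding w_def by (rule measurable_compose[OF gauss_abs_sum clt_err_measurable])
    qed (use clt_err_bounds[OF Y w] in \<open>simp only: real_norm_def abs_of_nonneg\<close>)
    fix x
    have e: "exp (- (\<Sum>a=1..L. (co x a)\<^sup>2 * Lam n a) / 2) = exp (- k * (\<Sum>a=1..L. (x a)\<^sup>2))"
    proof -
      have "(\<Sum>a=1..L. (co x a)\<^sup>2 * Lam n a) = (\<Sum>a=1..L. 2 * k * (x a)\<^sup>2)"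
        using Lpos k unfolding co_def by (intro sum.cong) (auto simp: power_divide power_mult_distrib less_imp_le less_imp_neq[symmetric])
      then show ?thesis by (simp add: sum_distrib_left[symmetric])
    qed
    define Z where "Z = Y * w x"
    show "cmod (\<phi> x - complex_of_real (exp (- k * (\<Sum>a=1..L. (x a)\<^sup>2)))) \<le> clt_err Y n (w x)"
    proof -
      have "cmod (\<phi> x) \<le> EE B p {1..n} (\<lambda>y. 1)" unfolding \<phi>_def
        by (rule order_trans[OF EE_norm], rule EE_mono) simp
      then have "cmod (\<phi> x) \<le> 1" by (simp add: EE_const)
      moreover have "exp (- k * (\<Sum>a=1..L. (x a)\<^sup>2)) \<le> 1" using k by (auto intro!: mult_nonneg_nonneg sum_nonneg)
      then have "cmod (complex_of_real (exp (- k * (\<Sum>a=1..L. (x a)\<^sup>2)))) \<le> 1" unfolding norm_of_real by simp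
      ultimately have 2: "cmod (\<phi> x - complex_of_real (exp (- k * (\<Sum>a=1..L. (x a)\<^sup>2)))) \<le> 2"
        using norm_triangle_ineq4[of "\<phi> x" "complex_of_real (exp (- k * (\<Sum>a=1..L. (x a)\<^sup>2)))"] by linarith
      have "cmod (\<phi> x - complex_of_real (exp (- k * (\<Sum>a=1..L. (x a)\<^sup>2)))) \<le> exp (Z\<^sup>2 / 2) * (Z\<^sup>2 + 4 * Z ^ 3) / sqrt (real n)"
        if "Z \<le> sqrt (real n)" 
        unfolding \<phi>_def e[symmetric]
      proof (rule char_function_bound[where X="sqrt (2 * k) / sqrt c * w x"])
        fix a assume a: "1 \<le> a" "a \<le> L"
        have "\<bar>co x a\<bar> = sqrt (2 * k) * \<bar>x a\<bar> / sqrt (Lam n a)" unfolding co_def using k Lpos[OF a] by (simp add: abs_mult)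
        also have "\<dots> \<le> sqrt (2 * k) * w x / sqrt (c * real n)"
        proof (intro frac_le mult_left_mono)
          show "\<bar>x a\<bar> \<le> w x" unfolding w_def using a by (intro member_le_sum) auto
        qed (use k c n w Lam[OF a] in auto)
        finally show "\<bar>co x a\<bar> \<le> sqrt (2 * k) / sqrt c * w x / sqrt (real n)" by (simp add: real_sqrt_mult)
      next
        show "Z = real L * (sqrt (2 * k) / sqrt c * w x * C\<^sup>2)" unfolding Z_def Y_def by simp
      qed (use k c w n that in auto)
      then show ?thesis using 2 unfolding clt_err_def Let_def Z_def[symmetric] by simp
    qed
  qed
  finally show ?thesis unfolding lap_err_def Y_def w_def .
qed

end

section \<open>Symmetrisation and contraction\<close>

text \<open>Average over all signs of the maximum over v in F of g v plus the signed sum of the z .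
  v, a Rademacher complexity. Unfolding one sign at a time lets list inductions absorb that sign
  into g.\<close>

fun rad :: "'v::real_inner set \<Rightarrow> 'v list \<Rightarrow> ('v \<Rightarrow> real) \<Rightarrow> real" where
  "rad F [] g = Max (g ` F)"
| "rad F (z # zs) g = (rad F zs (\<lambda>v. g v + z \<bullet> v) + rad F zs (\<lambda>v. g v - z \<bullet> v)) / 2"

context
  fixes F :: "'v::real_inner set"
  assumes F: "finite F" "F \<noteq> {}"
begin

lemma Max_img_le: "(\<And>v. v \<in> F \<Longrightarrow> g v \<le> c) \<Longrightarrow> Max (g ` F) \<le> c" for g :: "'v \<Rightarrow> real"
  using F by simp

lemma le_Max_img: "v \<in> F \<Longrightarrow> g v \<le> Max (g ` F)" for g :: "'v \<Rightarrow> real"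
  using F by simp

lemma Max_img_attained: "\<exists>v\<in>F. Max (g ` F) = g v" for g :: "'v \<Rightarrow> real"
proof -
  have "Max (g ` F) \<in> g ` F" using F by (intro Max_in) auto
  then show ?thesis by auto
qed

text \<open>A maximum is midpoint convex in g, since the maximiser of g competes in both perturbed
  maxima; averaging over signs preserves this.\<close>

lemma rad_convex: "2 * rad F zs g \<le> rad F zs (\<lambda>v. g v + h v) + rad F zs (\<lambda>v. g v - h v)"
proof (induction zs arbitrary: g)
  case Nil
  obtain v where v: "v \<in> F" "Max (g ` F) = g v" using Max_img_attained by blast
  show ?case using le_Max_img[OF v(1), of "\<lambda>v. g v + h v"] le_Max_img[OF v(1), of "\<lambda>v. g v - h v"] v by simp
next
  case (Cons z zs)
  have "2 * rad F zs (\<lambda>v. g v + z \<bullet> v) \<le> rad F zs (\<lambda>v. g v + h v + z \<bullet> v) + rad F zs (\<lambda>v. g v - h v + z \<bullet> v)"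
    using Cons.IH[of "\<lambda>v. g v + z \<bullet> v"] by (simp add: algebra_simps)
  moreover have "2 * rad F zs (\<lambda>v. g v - z \<bullet> v) \<le> rad F zs (\<lambda>v. g v + h v - z \<bullet> v) + rad F zs (\<lambda>v. g v - h v - z \<bullet> v)"
    using Cons.IH[of "\<lambda>v. g v - z \<bullet> v"] by (simp add: algebra_simps)
  ultimately show ?case unfolding rad.simps by argo
qed

lemma rad_Cons_ge: "rad F zs g \<le> rad F (z # zs) g"
  using rad_convex[of zs g "\<lambda>v. z \<bullet> v"] by simp

lemma rad_append_ge: "rad F (xs @ zs) g \<ge> rad F zs g"
proof (induction xs arbitrary: g)
  case (Cons x xs)
  have "rad F (xs @ zs) g \<le> rad F ((x # xs) @ zs) g" using rad_Cons_ge by simp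
  then show ?case using Cons[of g] by linarith
qed simp

text \<open>By convexity, dropping a sign can only lower the average; all signs except that of z are
  dropped.\<close>

lemma rad_singleton_le: "z \<in> set zs \<Longrightarrow> rad F [z] g \<le> rad F zs g"
proof (induction zs arbitrary: g)
  case (Cons x xs)
  show ?case
  proof (cases "z = x")
    case True
    have "Max ((\<lambda>v. g v + x \<bullet> v) ` F) \<le> rad F xs (\<lambda>v. g v + x \<bullet> v)" "Max ((\<lambda>v. g v - x \<bullet> v) ` F) \<le> rad F xs (\<lambda>v. g v - x \<bullet> v)"
      using rad_append_ge[where zs="[]"] by simp_all
    then show ?thesis using True by simp
  next
    case False
    then have "rad F [z] g \<le> rad F xs g" using Cons.prems by (intro Cons.IH) auto
    also have "\<dots> \<le> rad F (x # xs) g" by (rule rad_Cons_ge)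
    finally show ?thesis .
  qed
qed simp

text \<open>The second moment bound for a Rademacher sum of vectors. One sign is averaged by
  concavity of the square root and the parallelogram law, with w collecting the vectors already
  treated.\<close>

lemma rad_linear_bound:
  assumes "\<And>v. v \<in> F \<Longrightarrow> norm v \<le> \<rho>" "0 \<le> \<rho>"
  shows "rad F zs (\<lambda>v. w \<bullet> v) \<le> \<rho> * sqrt ((norm w)\<^sup>2 + (\<Sum>z\<leftarrow>zs. (norm z)\<^sup>2))"
proof (induction zs arbitrary: w)
  case Nil
  have "w \<bullet> v \<le> \<rho> * norm w" if "v \<in> F" for v
    using norm_cauchy_schwarz[of w v] assms(1)[OF that] by (metis mult.commute mult_left_mono norm_ge_zero order_trans)
  then show ?case by (auto intro!: Max_img_le)
next
  case (Cons z zs)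
  let ?S = "\<Sum>z\<leftarrow>zs. (norm z)\<^sup>2"
  have S: "0 \<le> ?S" by (intro sum_list_nonneg) auto
  have avg: "sqrt a + sqrt b \<le> 2 * sqrt ((a + b) / 2)" if "0 \<le> a" "0 \<le> b" for a b :: real
  proof (rule power2_le_imp_le)
    have "2 * (sqrt a * sqrt b) \<le> (sqrt a)\<^sup>2 + (sqrt b)\<^sup>2" using sum_squares_bound[of "sqrt a" "sqrt b"] by simp
    then show "(sqrt a + sqrt b)\<^sup>2 \<le> (2 * sqrt ((a + b) / 2))\<^sup>2" using that
      by (simp add: power2_sum power_mult_distrib)
  qed (use that in simp)
  have 1: "rad F zs (\<lambda>v. w \<bullet> v + z \<bullet> v) \<le> \<rho> * sqrt ((norm (w + z))\<^sup>2 + ?S)"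
    using Cons[of "w + z"] by (simp add: inner_add_left)
  have 2: "rad F zs (\<lambda>v. w \<bullet> v - z \<bullet> v) \<le> \<rho> * sqrt ((norm (w - z))\<^sup>2 + ?S)"
    using Cons[of "w - z"] by (simp add: inner_diff_left)
  have n: "(norm (w + z))\<^sup>2 + (norm (w - z))\<^sup>2 = 2 * ((norm w)\<^sup>2 + (norm z)\<^sup>2)"
    by (simp add: power2_norm_eq_inner inner_add_left inner_add_right inner_diff_left inner_diff_right)
  have "rad F (z # zs) (\<lambda>v. w \<bullet> v) \<le> \<rho> * ((sqrt ((norm (w + z))\<^sup>2 + ?S) + sqrt ((norm (w - z))\<^sup>2 + ?S)) / 2)"
    using 1 2 by (simp add: distrib_left)
  also have "\<dots> \<le> \<rho> * sqrt ((norm w)\<^sup>2 + ((norm z)\<^sup>2 + ?S))"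
  proof (intro mult_left_mono assms(2))
    have eq: "((norm (w + z))\<^sup>2 + ?S + ((norm (w - z))\<^sup>2 + ?S)) / 2 = (norm w)\<^sup>2 + ((norm z)\<^sup>2 + ?S)" using n by simp
    show "(sqrt ((norm (w + z))\<^sup>2 + ?S) + sqrt ((norm (w - z))\<^sup>2 + ?S)) / 2 \<le> sqrt ((norm w)\<^sup>2 + ((norm z)\<^sup>2 + ?S))"
      using avg[of "(norm (w + z))\<^sup>2 + ?S" "(norm (w - z))\<^sup>2 + ?S"] S unfolding eq by simp
  qed
  finally show ?case by simp
qed

text \<open>The symmetrised form of the Ledoux--Talagrand comparison: a coordinate with a large increment
  dominates the sum of the Lipschitz bounds.\<close>
lemma contraction_pair:
  fixes k g :: "'v \<Rightarrow> real"
  assumes lip: "\<And>v v'. v \<in> F \<Longrightarrow> v' \<in> F \<Longrightarrow> \<bar>k v - k v'\<bar> \<le> (\<Sum>z\<leftarrow>zs. \<bar>z \<bullet> v - z \<bullet> v'\<bar>)" and K: "length zs \<le> K"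
  shows "Max ((\<lambda>v. k v + g v) ` F) + Max ((\<lambda>v. - k v + g v) ` F) \<le> 2 * rad F (map (\<lambda>z. real K *\<^sub>R z) zs) g"
proof -
  let ?zs = "map (\<lambda>z. real K *\<^sub>R z) zs"
  obtain v where v: "v \<in> F" "Max ((\<lambda>v. k v + g v) ` F) = k v + g v" using Max_img_attained by blast
  obtain v' where v': "v' \<in> F" "Max ((\<lambda>v. - k v + g v) ` F) = - k v' + g v'" using Max_img_attained by blast
  show ?thesis
  proof (cases "zs = []")
    case True
    then have "k v = k v'" using lip[OF v(1) v'(1)] by simp
    then show ?thesis using v v' le_Max_img[OF v(1), of g] le_Max_img[OF v'(1), of g] True by simp
  next
    case False
    let ?f = "\<lambda>z. \<bar>z \<bullet> v - z \<bullet> v'\<bar>"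
    have "Max (?f ` set zs) \<in> ?f ` set zs" by (rule Max_in) (use False in auto)
    then obtain z where zs: "z \<in> set zs" "Max (?f ` set zs) = ?f z" by blast
    have z: "z \<in> set zs" "?f y \<le> ?f z" if "y \<in> set zs" for y
      using zs(1) Max_ge[of "?f ` set zs" "?f y"] that unfolding zs(2) by auto
    have "k v - k v' \<le> (\<Sum>y\<leftarrow>zs. \<bar>y \<bullet> v - y \<bullet> v'\<bar>)" using lip[OF v(1) v'(1)] by simp
    also have "\<dots> \<le> (\<Sum>y\<leftarrow>zs. \<bar>z \<bullet> v - z \<bullet> v'\<bar>)" using z by (intro sum_list_mono) auto
    also have "\<dots> = real (length zs) * \<bar>z \<bullet> v - z \<bullet> v'\<bar>" by (simp add: sum_list_triv)
    also have "\<dots> \<le> real K * \<bar>z \<bullet> v - z \<bullet> v'\<bar>" using K by (intro mult_right_mono) auto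
    finally have kk: "k v - k v' \<le> \<bar>(real K *\<^sub>R z) \<bullet> v - (real K *\<^sub>R z) \<bullet> v'\<bar>"
      by (simp add: abs_mult flip: right_diff_distrib)
    let ?z = "real K *\<^sub>R z"
    \<comment> \<open>Inserting v and v' into the two maxima in one order or the other realises
      either sign of the increment of \<open>?z\<close>, hence its absolute value.\<close>
    have "k v - k v' + g v + g v' \<le> Max ((\<lambda>v. g v + ?z \<bullet> v) ` F) + Max ((\<lambda>v. g v - ?z \<bullet> v) ` F)"
      using kk le_Max_img[OF v(1), of "\<lambda>v. g v + ?z \<bullet> v"] le_Max_img[OF v'(1), of "\<lambda>v. g v - ?z \<bullet> v"]
        le_Max_img[OF v'(1), of "\<lambda>v. g v + ?z \<bullet> v"] le_Max_img[OF v(1), of "\<lambda>v. g v - ?z \<bullet> v"] by linarith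
    also have "\<dots> = 2 * rad F [?z] g" by simp
    also have "\<dots> \<le> 2 * rad F ?zs g" using zs(1) by (intro mult_left_mono rad_singleton_le) auto
    finally show ?thesis using v v' by simp
  qed
qed

end

section \<open>Contraction for independent blocks of responses\<close>

context indep_pmf
begin

lemma EE_divide: "EE B p A (\<lambda>y. f y / c) = EE B p A f / (c :: real)"
  unfolding EE_def by (simp add: sum_divide_distrib)

text \<open>Symmetrisation with an independent copy y' of the block: Jensen replaces the mean by h v
  y', and exchanging y with y' supplies both signs of the difference, as
  \<open>contraction_pair\<close> requires. The factor 2 in front of K arises because the difference
  has twice the Lipschitz bound.\<close>

lemma contraction_step:
  fixes h :: "'v::real_inner \<Rightarrow> (nat \<Rightarrow> nat) \<Rightarrow> real"
  assumes F: "finite F" "F \<noteq> {}" and J: "finite J"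
    and lip: "\<And>v v' y. v \<in> F \<Longrightarrow> v' \<in> F \<Longrightarrow> y \<in> PiE J (\<lambda>_. {..B}) \<Longrightarrow> \<bar>h v y - h v' y\<bar> \<le> (\<Sum>z\<leftarrow>zs. \<bar>z \<bullet> v - z \<bullet> v'\<bar>)"
    and K: "length zs \<le> K"
  shows "EE B p J (\<lambda>y. Max ((\<lambda>v. h v y - EE B p J (h v) + g v) ` F)) \<le> rad F (map (\<lambda>z. (2 * real K) *\<^sub>R z) zs) g"
proof -
  let ?zs = "map (\<lambda>z. (2 * real K) *\<^sub>R z) zs"
  have jensen: "Max ((\<lambda>v. h v y - EE B p J (h v) + g v) ` F) \<le> EE B p J (\<lambda>y'. Max ((\<lambda>v. h v y - h v y' + g v) ` F))" for y
  proof (rule Max_img_le[OF F])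
    fix v assume v: "v \<in> F"
    have "h v y - EE B p J (h v) + g v = EE B p J (\<lambda>y'. h v y - h v y' + g v)"
      by (simp add: EE_add EE_diff EE_const J)
    also have "\<dots> \<le> EE B p J (\<lambda>y'. Max ((\<lambda>v. h v y - h v y' + g v) ` F))"
      by (rule EE_mono) (rule le_Max_img[OF F v])
    finally show "h v y - EE B p J (h v) + g v \<le> EE B p J (\<lambda>y'. Max ((\<lambda>v. h v y - h v y' + g v) ` F))" .
  qed
  have swap: "EE B p J (\<lambda>y. EE B p J (\<lambda>y'. f y y')) = EE B p J (\<lambda>y. EE B p J (\<lambda>y'. f y' y))" for f :: "_ \<Rightarrow> _ \<Rightarrow> real"
    unfolding EE_def by (simp add: sum_distrib_left) (subst sum.swap, simp add: mult_ac)
  let ?T = "\<lambda>y y'. Max ((\<lambda>v. h v y - h v y' + g v) ` F)"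
  have "2 * EE B p J (\<lambda>y. Max ((\<lambda>v. h v y - EE B p J (h v) + g v) ` F)) \<le> 2 * EE B p J (\<lambda>y. EE B p J (\<lambda>y'. ?T y y'))"
    by (intro mult_left_mono EE_mono jensen) auto
  also have "\<dots> = EE B p J (\<lambda>y. EE B p J (\<lambda>y'. ?T y y')) + EE B p J (\<lambda>y. EE B p J (\<lambda>y'. ?T y' y))"
    using swap[of ?T] by simp
  also have "\<dots> = EE B p J (\<lambda>y. EE B p J (\<lambda>y'. ?T y y' + ?T y' y))" by (simp add: EE_add)
  also have "\<dots> \<le> EE B p J (\<lambda>y. EE B p J (\<lambda>y'. 2 * rad F ?zs g))"
  proof (intro EE_mono)
    fix y y' assume y: "y \<in> PiE J (\<lambda>_. {..B})" "y' \<in> PiE J (\<lambda>_. {..B})"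
    let ?k = "\<lambda>v. h v y - h v y'"
    have "Max ((\<lambda>v. ?k v + g v) ` F) + Max ((\<lambda>v. - ?k v + g v) ` F) \<le> 2 * rad F (map (\<lambda>z. real K *\<^sub>R z) (map (\<lambda>z. 2 *\<^sub>R z) zs)) g"
    proof (rule contraction_pair[OF F])
      fix v v' assume v: "v \<in> F" "v' \<in> F"
      have "\<bar>?k v - ?k v'\<bar> \<le> 2 * (\<Sum>z\<leftarrow>zs. \<bar>z \<bullet> v - z \<bullet> v'\<bar>)"
        using lip[OF v y(1)] lip[OF v y(2)] by linarith
      also have "\<dots> = (\<Sum>z\<leftarrow>map (\<lambda>z. 2 *\<^sub>R z) zs. \<bar>z \<bullet> v - z \<bullet> v'\<bar>)"
        unfolding map_map o_def sum_list_const_mult[symmetric] inner_scaleR_left right_diff_distrib[symmetric] abs_mult by simp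
      finally show "\<bar>?k v - ?k v'\<bar> \<le> (\<Sum>z\<leftarrow>map (\<lambda>z. 2 *\<^sub>R z) zs. \<bar>z \<bullet> v - z \<bullet> v'\<bar>)" .
    qed (use K in simp)
    then show "?T y y' + ?T y' y \<le> 2 * rad F ?zs g" by (simp add: o_def mult.commute)
  qed
  also have "\<dots> = 2 * rad F ?zs g" by (simp add: EE_const J)
  finally show ?thesis by simp
qed

text \<open>Signs introduced by other blocks only add a linear term to g, so they are unfolded one
  by one until \<open>contraction_step\<close> applies.\<close>

lemma contraction_rad_step:
  fixes h :: "'v::real_inner \<Rightarrow> (nat \<Rightarrow> nat) \<Rightarrow> real"
  assumes F: "finite F" "F \<noteq> {}" and J: "finite J"
    and lip: "\<And>v v' y. v \<in> F \<Longrightarrow> v' \<in> F \<Longrightarrow> y \<in> PiE J (\<lambda>_. {..B}) \<Longrightarrow> \<bar>h v y - h v' y\<bar> \<le> (\<Sum>z\<leftarrow>zs. \<bar>z \<bullet> v - z \<bullet> v'\<bar>)"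
    and K: "length zs \<le> K"
  shows "EE B p J (\<lambda>y. rad F xs (\<lambda>v. h v y - EE B p J (h v) + g v)) \<le> rad F (xs @ map (\<lambda>z. (2 * real K) *\<^sub>R z) zs) g"
proof (induction xs arbitrary: g)
  case Nil
  show ?case using contraction_step[OF F J lip K] by simp
next
  case (Cons x xs)
  have "EE B p J (\<lambda>y. rad F (x # xs) (\<lambda>v. h v y - EE B p J (h v) + g v)) =
    (EE B p J (\<lambda>y. rad F xs (\<lambda>v. h v y - EE B p J (h v) + (g v + x \<bullet> v))) + EE B p J (\<lambda>y. rad F xs (\<lambda>v. h v y - EE B p J (h v) + (g v - x \<bullet> v)))) / 2"
    unfolding EE_add[symmetric] EE_divide[symmetric] by (simp add: algebra_simps)
  also have "\<dots> \<le> rad F ((x # xs) @ map (\<lambda>z. (2 * real K) *\<^sub>R z) zs) g"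
    using Cons[of "\<lambda>v. g v + x \<bullet> v"] Cons[of "\<lambda>v. g v - x \<bullet> v"] by simp
  finally show ?case .
qed

text \<open>Blocks are replaced one at a time. Since the \<open>J i\<close> are disjoint, the
  centred summand of block i is constant while the other blocks are integrated, so it can be counted
  as part of g.\<close>

lemma contraction_sum:
  fixes h :: "'i \<Rightarrow> 'v::real_inner \<Rightarrow> (nat \<Rightarrow> nat) \<Rightarrow> real"
  assumes F: "finite F" "F \<noteq> {}" and A: "finite A"
    and J: "\<And>i. i \<in> set is \<Longrightarrow> J i \<subseteq> A" "disjoint_family_on J (set is)" "distinct is"
    and dep: "\<And>i v y y'. i \<in> set is \<Longrightarrow> (\<And>t. t \<in> J i \<Longrightarrow> y t = y' t) \<Longrightarrow> h i v y = h i v y'"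
    and lip: "\<And>i v v' y. i \<in> set is \<Longrightarrow> v \<in> F \<Longrightarrow> v' \<in> F \<Longrightarrow> (\<And>t. t \<in> J i \<Longrightarrow> y t \<le> B) \<Longrightarrow> \<bar>h i v y - h i v' y\<bar> \<le> (\<Sum>z\<leftarrow>zs i. \<bar>z \<bullet> v - z \<bullet> v'\<bar>)"
    and K: "\<And>i. i \<in> set is \<Longrightarrow> length (zs i) \<le> K"
  shows "EE B p A (\<lambda>y. Max ((\<lambda>v. (\<Sum>i\<leftarrow>is. h i v y - EE B p (J i) (h i v)) + g v) ` F))
    \<le> rad F (concat (map (\<lambda>i. map (\<lambda>z. (2 * real K) *\<^sub>R z) (zs i)) is)) g"
  using A J dep lip K
proof (induction "is" arbitrary: A g)
  case Nil
  then show ?case by (simp add: EE_const)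
next
  case (Cons i "is")
  let ?zi = "map (\<lambda>z. (2 * real K) *\<^sub>R z) (zs i)"
  let ?R = "concat (map (\<lambda>i. map (\<lambda>z. (2 * real K) *\<^sub>R z) (zs i)) is)"
  define A' where "A' = A - J i"
  have "J i \<subseteq> A" by (rule Cons.prems(2)) simp
  then have Ji: "finite (J i)" "J i \<subseteq> A" using finite_subset[OF _ Cons.prems(1)] by simp_all
  have A: "A = A' \<union> J i" "finite A'" "A' \<inter> J i = {}" using Ji(2) Cons.prems(1) unfolding A'_def by auto
  have sub: "J j \<subseteq> A'" if "j \<in> set is" for j
  proof -
    have "j \<noteq> i" using that Cons.prems(4) by auto
    then have "J j \<inter> J i = {}" using that disjoint_family_onD[OF Cons.prems(3), of j i] by simp
    moreover have "J j \<subseteq> A" using that by (intro Cons.prems(2)) simp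
    ultimately show ?thesis unfolding A'_def by blast
  qed
  have dis: "disjoint_family_on J (set is)" using disjoint_family_on_mono[OF set_subset_Cons Cons.prems(3)] .
  let ?c = "\<lambda>i v. EE B p (J i) (h i v)"
  have "EE B p A (\<lambda>y. Max ((\<lambda>v. (\<Sum>j\<leftarrow>i # is. h j v y - ?c j v) + g v) ` F))
    = EE B p (J i) (\<lambda>y. EE B p A' (\<lambda>z. Max ((\<lambda>v. (\<Sum>j\<leftarrow>is. h j v z - ?c j v) + (h i v y - ?c i v + g v)) ` F)))"
  proof -
    have "EE B p (A' \<union> J i) (\<lambda>y. Max ((\<lambda>v. (\<Sum>j\<leftarrow>i # is. h j v y - ?c j v) + g v) ` F))
      = EE B p (J i) (\<lambda>y. EE B p A' (\<lambda>z. Max ((\<lambda>v. (\<Sum>j\<leftarrow>i # is. h j v (\<lambda>t. if t \<in> J i then y t else z t) - ?c j v) + g v) ` F)))"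
    proof -
      have "J i \<inter> A' = {}" using A(3) by blast
      from EE_Fubini[OF Ji(1) A(2) this, of "\<lambda>y. Max ((\<lambda>v. (\<Sum>j\<leftarrow>i # is. h j v y - ?c j v) + g v) ` F)"]
      show ?thesis unfolding Un_commute[of A' "J i"] .
    qed
    also have "\<dots> = EE B p (J i) (\<lambda>y. EE B p A' (\<lambda>z. Max ((\<lambda>v. (\<Sum>j\<leftarrow>is. h j v z - ?c j v) + (h i v y - ?c i v + g v)) ` F)))"
    proof -
      have "(\<Sum>j\<leftarrow>i # is. h j v (\<lambda>t. if t \<in> J i then y t else z t) - ?c j v) + g v = (\<Sum>j\<leftarrow>is. h j v z - ?c j v) + (h i v y - ?c i v + g v)" for v y z
      proof -
        have "h i v (\<lambda>t. if t \<in> J i then y t else z t) = h i v y" by (rule Cons.prems(5)) auto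
        moreover have "h j v (\<lambda>t. if t \<in> J i then y t else z t) = h j v z" if "j \<in> set is" for j
          using sub[OF that] A(3) that by (intro Cons.prems(5)) auto
        then have "(\<Sum>j\<leftarrow>is. h j v (\<lambda>t. if t \<in> J i then y t else z t) - ?c j v) = (\<Sum>j\<leftarrow>is. h j v z - ?c j v)"
          by (intro arg_cong[where f=sum_list] map_cong) auto
        ultimately show ?thesis by simp
      qed
      then show ?thesis by (intro arg_cong[where f="EE B p (J i)"] arg_cong[where f="EE B p A'"] ext) (simp only:)
    qed
    finally show ?thesis using A(1) by simp
  qed
  also have "\<dots> \<le> EE B p (J i) (\<lambda>y. rad F ?R (\<lambda>v. h i v y - ?c i v + g v))"
  proof (rule EE_mono)
    fix y
    show "EE B p A' (\<lambda>z. Max ((\<lambda>v. (\<Sum>j\<leftarrow>is. h j v z - ?c j v) + (h i v y - ?c i v + g v)) ` F)) \<le> rad F ?R (\<lambda>v. h i v y - ?c i v + g v)"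
    proof (rule Cons.IH[OF A(2) sub dis])
      show "distinct is" using Cons.prems(4) by simp
      show "h j v y = h j v y'" if "j \<in> set is" "\<And>t. t \<in> J j \<Longrightarrow> y t = y' t" for j v y y'
        using that by (intro Cons.prems(5)) auto
      show "\<bar>h j v y - h j v' y\<bar> \<le> (\<Sum>z\<leftarrow>zs j. \<bar>z \<bullet> v - z \<bullet> v'\<bar>)"
        if "j \<in> set is" "v \<in> F" "v' \<in> F" "\<And>t. t \<in> J j \<Longrightarrow> y t \<le> B" for j v v' y
        using that by (intro Cons.prems(6)) auto
      show "length (zs j) \<le> K" if "j \<in> set is" for j using that by (intro Cons.prems(7)) auto
    qed
  qed
  also have "\<dots> \<le> rad F (?R @ ?zi) g"
  proof (rule contraction_rad_step[OF F Ji(1)])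
    show "\<bar>h i v y - h i v' y\<bar> \<le> (\<Sum>z\<leftarrow>zs i. \<bar>z \<bullet> v - z \<bullet> v'\<bar>)"
      if "v \<in> F" "v' \<in> F" "y \<in> J i \<rightarrow>\<^sub>E {..B}" for v v' y
    proof (rule Cons.prems(6)[OF _ that(1,2)])
      fix t assume "t \<in> J i"
      then show "y t \<le> B" using PiE_mem[OF that(3)] by simp
    qed simp
    show "length (zs i) \<le> K" by (intro Cons.prems(7)) auto
  qed
  also have "\<dots> = rad F (?zi @ ?R) g"
  proof -
    \<comment> \<open>The value of \<open>rad\<close> does not depend on the order of the list; the
      vectors of block i emerge at the rear and are moved to the front.\<close>
    have ins: "rad F (z # us @ ws) g = rad F (us @ z # ws) g" for z us ws and g :: "'v \<Rightarrow> real"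
    proof (induction us arbitrary: g)
      case (Cons u us)
      have "rad F (z # (u # us) @ ws) g = (rad F (z # us @ ws) (\<lambda>v. g v + u \<bullet> v) + rad F (z # us @ ws) (\<lambda>v. g v - u \<bullet> v)) / 2"
        by (simp add: algebra_simps add_divide_distrib)
      then show ?case unfolding Cons.IH by simp
    qed simp
    have "rad F (us @ ws) g = rad F (ws @ us) g" for us ws and g :: "'v \<Rightarrow> real"
    proof (induction us arbitrary: g)
      case (Cons u us)
      have "rad F ((u # us) @ ws) g = rad F (u # ws @ us) g" using Cons by simp
      then show ?case unfolding ins .
    qed simp
    from this[of ?R ?zi g] show ?thesis .
  qed
  finally show ?case by simp
qed

text \<open>The one-sided bound is applied to h and to -h, each costing 2 * K * \<rho> times the
  square root. Since 0 lies in F and h vanishes there, both maxima are nonnegative, and their sum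
  bounds the absolute deviation.\<close>

lemma uniform_deviation:
  fixes h :: "nat \<Rightarrow> 'v::real_inner \<Rightarrow> (nat \<Rightarrow> nat) \<Rightarrow> real"
  assumes F: "finite F" "0 \<in> F" "\<And>v. v \<in> F \<Longrightarrow> norm v \<le> \<rho>" and \<rho>: "0 \<le> \<rho>" and A: "finite A" and I: "finite I"
    and J: "\<And>i. i \<in> I \<Longrightarrow> J i \<subseteq> A" "disjoint_family_on J I"
    and dep: "\<And>i v y y'. i \<in> I \<Longrightarrow> (\<And>t. t \<in> J i \<Longrightarrow> y t = y' t) \<Longrightarrow> h i v y = h i v y'"
    and lip: "\<And>i v v' y. i \<in> I \<Longrightarrow> v \<in> F \<Longrightarrow> v' \<in> F \<Longrightarrow> (\<And>t. t \<in> J i \<Longrightarrow> y t \<le> B) \<Longrightarrow> \<bar>h i v y - h i v' y\<bar> \<le> (\<Sum>z\<leftarrow>zs i. \<bar>z \<bullet> v - z \<bullet> v'\<bar>)"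
    and zero: "\<And>i y. i \<in> I \<Longrightarrow> h i 0 y = 0"
    and K: "\<And>i. i \<in> I \<Longrightarrow> length (zs i) \<le> K"
  shows "EE B p A (\<lambda>y. Max ((\<lambda>v. \<bar>\<Sum>i\<in>I. h i v y - EE B p (J i) (h i v)\<bar>) ` F))
    \<le> 4 * real K * \<rho> * sqrt (\<Sum>i\<in>I. \<Sum>z\<leftarrow>zs i. (norm z)\<^sup>2)"
proof -
  obtain "is" where "is": "set is = I" "distinct is" using finite_distinct_list[OF I] by blast
  have F': "F \<noteq> {}" using F by auto
  let ?zs = "concat (map (\<lambda>i. map (\<lambda>z. (2 * real K) *\<^sub>R z) (zs i)) is)"
  have sum_is: "(\<Sum>i\<leftarrow>is. f i) = (\<Sum>i\<in>I. f i)" for f :: "nat \<Rightarrow> real"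
    using "is" by (simp add: sum_list_distinct_conv_sum_set)
  have bound: "EE B p A (\<lambda>y. Max ((\<lambda>v. \<Sum>i\<in>I. h i v y - EE B p (J i) (h i v)) ` F)) \<le> 2 * real K * \<rho> * sqrt (\<Sum>i\<in>I. \<Sum>z\<leftarrow>zs i. (norm z)\<^sup>2)"
    if lip: "\<And>i v v' y. i \<in> I \<Longrightarrow> v \<in> F \<Longrightarrow> v' \<in> F \<Longrightarrow> (\<And>t. t \<in> J i \<Longrightarrow> y t \<le> B) \<Longrightarrow> \<bar>h i v y - h i v' y\<bar> \<le> (\<Sum>z\<leftarrow>zs i. \<bar>z \<bullet> v - z \<bullet> v'\<bar>)"
    and dep: "\<And>i v y y'. i \<in> I \<Longrightarrow> (\<And>t. t \<in> J i \<Longrightarrow> y t = y' t) \<Longrightarrow> h i v y = h i v y'"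
    for h :: "nat \<Rightarrow> 'v \<Rightarrow> (nat \<Rightarrow> nat) \<Rightarrow> real"
  proof -
    have "EE B p A (\<lambda>y. Max ((\<lambda>v. (\<Sum>i\<leftarrow>is. h i v y - EE B p (J i) (h i v)) + 0 \<bullet> v) ` F)) \<le> rad F ?zs (\<lambda>v. 0 \<bullet> v)"
      using "is" J by (intro contraction_sum[where K=K] F F' A dep lip K) auto
    also have "\<dots> \<le> \<rho> * sqrt ((norm (0::'v))\<^sup>2 + (\<Sum>z\<leftarrow>?zs. (norm z)\<^sup>2))"
      by (intro rad_linear_bound F F' \<rho>)
    also have "(\<Sum>z\<leftarrow>?zs. (norm z)\<^sup>2) = (2 * real K)\<^sup>2 * (\<Sum>i\<in>I. \<Sum>z\<leftarrow>zs i. (norm z)\<^sup>2)"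
      unfolding sum_is[symmetric]
      by (induction "is") (simp_all add: o_def power_mult_distrib sum_list_const_mult distrib_left)
    finally show ?thesis by (simp add: sum_is real_sqrt_mult mult_ac)
  qed
  have "EE B p A (\<lambda>y. Max ((\<lambda>v. \<bar>\<Sum>i\<in>I. h i v y - EE B p (J i) (h i v)\<bar>) ` F))
    \<le> EE B p A (\<lambda>y. Max ((\<lambda>v. \<Sum>i\<in>I. h i v y - EE B p (J i) (h i v)) ` F) + Max ((\<lambda>v. \<Sum>i\<in>I. - h i v y - EE B p (J i) (\<lambda>y. - h i v y)) ` F))"
  proof (intro EE_mono Max_img_le F(1) F')
    fix y v assume v: "v \<in> F"
    let ?S = "\<lambda>v. \<Sum>i\<in>I. h i v y - EE B p (J i) (h i v)" and ?S' = "\<lambda>v. \<Sum>i\<in>I. - h i v y - EE B p (J i) (\<lambda>y. - h i v y)"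
    have neg: "EE B p (J i) (\<lambda>y. - h i v y) = - EE B p (J i) (h i v)" for i v
      unfolding EE_def by (simp add: sum_negf)
    have S': "?S' v = - ?S v" for v unfolding neg by (subst sum_negf[symmetric], rule sum.cong) auto
    have "EE B p (J i) (h i 0) = 0" if "i \<in> I" for i unfolding EE_def using zero[OF that] by simp
    then have "?S 0 = 0" using zero by simp
    then have "0 \<le> Max (?S ` F)" "0 \<le> Max (?S' ` F)"
      using le_Max_img[OF F(1) F' F(2), of ?S] le_Max_img[OF F(1) F' F(2), of ?S'] S'[of 0] by simp_all
    then show "\<bar>?S v\<bar> \<le> Max (?S ` F) + Max (?S' ` F)"
      using le_Max_img[OF F(1) F' v, of ?S] le_Max_img[OF F(1) F' v, of ?S'] S'[of v] by linarith
  qed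
  also have "\<dots> = EE B p A (\<lambda>y. Max ((\<lambda>v. \<Sum>i\<in>I. h i v y - EE B p (J i) (h i v)) ` F)) + EE B p A (\<lambda>y. Max ((\<lambda>v. \<Sum>i\<in>I. - h i v y - EE B p (J i) (\<lambda>y. - h i v y)) ` F))"
    by (rule EE_add)
  also have "\<dots> \<le> 2 * real K * \<rho> * sqrt (\<Sum>i\<in>I. \<Sum>z\<leftarrow>zs i. (norm z)\<^sup>2) + 2 * real K * \<rho> * sqrt (\<Sum>i\<in>I. \<Sum>z\<leftarrow>zs i. (norm z)\<^sup>2)"
  proof (intro add_mono bound lip dep)
    fix i v v' y assume "i \<in> I" "v \<in> F" "v' \<in> F" "\<And>t. t \<in> J i \<Longrightarrow> y t \<le> B"
    from lip[OF this] show "\<bar>- h i v y - - h i v' y\<bar> \<le> (\<Sum>z\<leftarrow>zs i. \<bar>z \<bullet> v - z \<bullet> v'\<bar>)" by (simp add: abs_minus_commute)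
  next
    fix i v and y y' :: "nat \<Rightarrow> nat" assume "i \<in> I" "\<And>t. t \<in> J i \<Longrightarrow> y t = y' t"
    then show "- h i v y = - h i v y'" using dep[of i y y' v] by simp
  qed
  finally show ?thesis by (simp add: mult_ac)
qed

end

section \<open>Conditioning on regressors and trials\<close>

lemma sigma_sets_measurable_event:
  assumes "f \<in> measurable (sigma S E) N" "E \<subseteq> Pow S" "A \<in> sets N"
  shows "f -` A \<inter> S \<in> sigma_sets S E"
  using measurable_sets[OF assms(1,3)] assms(2) by simp

text \<open>The latent vector over T is independent of G, so its joint law with the identity into G
  is a product measure. Fubini then integrates the latent coordinates first, each turning
  \<open>fcond\<close> into the mixture \<open>fs\<close>.\<close>

lemma (in prob_space) latent_integrated:
  fixes alpha :: "nat \<Rightarrow> 'a \<Rightarrow> real" and \<eta> :: "nat \<Rightarrow> 'a \<Rightarrow> real" and m :: "nat \<Rightarrow> 'a \<Rightarrow> nat"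
  assumes indep: "indep_vars (\<lambda>_. borel) alpha I" and normal: "\<And>t. t \<in> I \<Longrightarrow> distributed M lborel (alpha t) std_normal_density"
    and ind: "indep_set (sigma_sets (space M) {alpha t -` A \<inter> space M | t A. t \<in> I \<and> A \<in> sets borel}) (sigma_sets (space M) X)"
    and G: "subalgebra M G" "sets G = sigma_sets (space M) X"
    and T: "finite T" "T \<subseteq> I"
    and \<eta>[measurable]: "\<And>t. t \<in> T \<Longrightarrow> \<eta> t \<in> borel_measurable G" and m[measurable]: "\<And>t. t \<in> T \<Longrightarrow> m t \<in> measurable G (count_space UNIV)"
    and E: "E \<in> sets G"
  shows "(\<integral>\<omega>. indicator E \<omega> * (\<Prod>t\<in>T. fcond (m t \<omega>) (yv t) (\<eta> t \<omega> + s * alpha t \<omega>)) \<partial>M)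
    = (\<integral>\<omega>. indicator E \<omega> * (\<Prod>t\<in>T. fs (m t \<omega>) (\<eta> t \<omega>) s (yv t)) \<partial>M)"
proof (cases "T = {}")
  case False
  have spG: "space G = space M" using G(1) by (simp add: subalgebra_def)
  have al[measurable]: "alpha t \<in> borel_measurable M" if "t \<in> I" for t
    using distributed_measurable[OF normal[OF that]] by simp
  let ?P = "PiM T (\<lambda>_. borel) :: (nat \<Rightarrow> real) measure"
  define a where "a = (\<lambda>\<omega>. \<lambda>t\<in>T. alpha t \<omega>)"
  have a[measurable]: "a \<in> measurable M ?P" unfolding a_def using T by (intro measurable_restrict al) auto
  \<comment> \<open>The identity from M into the coarser space G stands for all regressors and
    trials at once.\<close>
  have idG[measurable]: "(\<lambda>\<omega>. \<omega>) \<in> measurable M G"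
    using G(1) by (intro measurableI) (auto simp: subalgebra_def dest: sets.sets_into_space[of _ G] intro: sets.Int)
  let ?AE = "{alpha t -` A \<inter> space M | t A. t \<in> I \<and> A \<in> sets borel}"
  note ind' = ind[unfolded indep_sets2_eq]
  have aS: "a \<in> measurable (sigma (space M) ?AE) ?P" unfolding a_def
  proof (intro measurable_restrict)
    fix t assume "t \<in> T"
    then have t: "t \<in> I" using T by auto
    show "alpha t \<in> measurable (sigma (space M) ?AE) borel"
    proof (rule measurableI)
      fix A assume "A \<in> sets (borel :: real measure)"
      then have "alpha t -` A \<inter> space M \<in> ?AE" using t by blast
      then show "alpha t -` A \<inter> space (sigma (space M) ?AE) \<in> sets (sigma (space M) ?AE)"
        by (auto simp: space_measure_of_conv sets_measure_of_conv intro: sigma_sets.Basic)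
    qed simp
  qed
  have indep_prod: "prob (a -` A \<inter> space M \<inter> A') = prob (a -` A \<inter> space M) * prob A'" if "A \<in> sets ?P" "A' \<in> sets G" for A A'
  proof -
    have "a -` A \<inter> space M \<in> sigma_sets (space M) ?AE"
      by (rule sigma_sets_measurable_event[OF aS _ that(1)]) auto
    then show ?thesis using ind' that(2) unfolding G(2) by blast
  qed
  have da: "distr M ?P a = PiM T (\<lambda>_. std_normal_distribution)"
  proof -
    have "indep_vars (\<lambda>_. borel) alpha T" using indep T(2) by (rule indep_vars_subset)
    then have "distr M ?P a = PiM T (\<lambda>t. distr M borel (alpha t))"
      unfolding a_def using T False by (subst (asm) indep_vars_iff_distr_eq_PiM'[OF False]) (auto intro!: al)
    also have "\<dots> = PiM T (\<lambda>_. std_normal_distribution)"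
    proof (rule PiM_cong[OF refl])
      fix t assume "t \<in> T"
      then have "distributed M lborel (alpha t) std_normal_density" using normal T by auto
      then show "distr M borel (alpha t) = std_normal_distribution"
        unfolding distributed_def by (metis distr_cong sets_lborel)
    qed
    finally show ?thesis .
  qed
  interpret N: product_sigma_finite "\<lambda>_::nat. std_normal_distribution"
    using prob_space_normal_density[of 1 0] by (auto simp: product_sigma_finite_def prob_space_imp_sigma_finite)
  have fmN: "finite_measure std_normal_distribution" using prob_space_normal_density[of 1 0] by (simp add: prob_space.axioms(1))
  interpret PN: prob_space "PiM T (\<lambda>_. std_normal_distribution)"
    using prob_space_normal_density[of 1 0] by (intro prob_space_PiM) simp
  interpret PG: prob_space "distr M G (\<lambda>\<omega>. \<omega>)" by (rule prob_space_distr) measurable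
  interpret PP: pair_prob_space "PiM T (\<lambda>_. std_normal_distribution)" "distr M G (\<lambda>\<omega>. \<omega>)" ..
  define F where "F = (\<lambda>(z, \<omega>). indicator E \<omega> * (\<Prod>t\<in>T. fcond (m t \<omega>) (yv t) (\<eta> t \<omega> + s * z t)) :: real)"
  have fac: "(\<lambda>p. fcond (m t (snd p)) (yv t) (\<eta> t (snd p) + s * fst p t)) \<in> borel_measurable (?P \<Otimes>\<^sub>M G)" if t: "t \<in> T" for t
  proof (rule measurable_compose_countable[where g="\<lambda>p. m t (snd p)" and f="\<lambda>k p. fcond k (yv t) (\<eta> t (snd p) + s * fst p t)"])
    show "(\<lambda>p. m t (snd p)) \<in> measurable (?P \<Otimes>\<^sub>M G) (count_space UNIV)"
      by (rule measurable_compose[OF measurable_snd m[OF t]])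
    have 1: "(\<lambda>p. fst p t) \<in> borel_measurable (?P \<Otimes>\<^sub>M G)"
      using t by (intro measurable_compose[OF measurable_fst measurable_component_singleton]) auto
    have 2: "(\<lambda>p. \<eta> t (snd p)) \<in> borel_measurable (?P \<Otimes>\<^sub>M G)"
      by (rule measurable_compose[OF measurable_snd \<eta>[OF t]])
    show "(\<lambda>p. fcond k (yv t) (\<eta> t (snd p) + s * fst p t)) \<in> borel_measurable (?P \<Otimes>\<^sub>M G)" for k
      by (intro measurable_compose[OF _ fcond_measurable] borel_measurable_add borel_measurable_times 1 2 borel_measurable_const)
  qed
  have Fm: "F \<in> borel_measurable (?P \<Otimes>\<^sub>M G)"
    unfolding F_def case_prod_unfold
    using E by (intro borel_measurable_times borel_measurable_prod fac measurable_compose[OF measurable_snd borel_measurable_indicator]) auto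
  have fc1: "0 \<le> fcond k y w" "fcond k y w \<le> 1" for k y w
  proof -
    show "0 \<le> fcond k y w" by (rule fcond_bounds)
    show "fcond k y w \<le> 1"
    proof (cases "y \<le> k")
      case True
      have "fcond k y w \<le> (\<Sum>y\<le>k. fcond k y w)" using True by (intro member_le_sum) (auto simp: fcond_bounds)
      then show ?thesis by (simp add: sum_fcond)
    qed (simp add: fcond_pk binomial_eq_0)
  qed
  have Fb: "\<bar>F p\<bar> \<le> 1" for p
    unfolding F_def case_prod_unfold abs_mult using fc1 
    by (intro mult_le_one) (auto simp: indicator_def abs_prod intro!: prod_le_1 prod_nonneg)
  have Fint: "integrable (PiM T (\<lambda>_. std_normal_distribution) \<Otimes>\<^sub>M distr M G (\<lambda>\<omega>. \<omega>)) F"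
  proof (rule PP.P.integrable_const_bound[where B=1])
    have s: "sets (PiM T (\<lambda>_. std_normal_distribution) \<Otimes>\<^sub>M distr M G (\<lambda>\<omega>. \<omega>)) = sets (?P \<Otimes>\<^sub>M G)"
      by (intro sets_pair_measure_cong sets_PiM_cong) auto
    show "F \<in> borel_measurable (PiM T (\<lambda>_. std_normal_distribution) \<Otimes>\<^sub>M distr M G (\<lambda>\<omega>. \<omega>))"
      using Fm unfolding measurable_cong_sets[OF s refl] .
  qed (use Fb in auto)
  have "(\<integral>\<omega>. indicator E \<omega> * (\<Prod>t\<in>T. fcond (m t \<omega>) (yv t) (\<eta> t \<omega> + s * alpha t \<omega>)) \<partial>M) = (\<integral>\<omega>. F (a \<omega>, \<omega>) \<partial>M)"
    unfolding F_def a_def by (intro Bochner_Integration.integral_cong refl) (auto intro!: prod.cong)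
  also have "\<dots> = integral\<^sup>L (distr M (?P \<Otimes>\<^sub>M G) (\<lambda>\<omega>. (a \<omega>, \<omega>))) F"
    by (rule integral_distr[symmetric]) (auto intro: Fm)
  also have "distr M (?P \<Otimes>\<^sub>M G) (\<lambda>\<omega>. (a \<omega>, \<omega>)) = PiM T (\<lambda>_. std_normal_distribution) \<Otimes>\<^sub>M distr M G (\<lambda>\<omega>. \<omega>)"
  proof (rule pair_measure_eqI[symmetric])
    show "sigma_finite_measure (PiM T (\<lambda>_. std_normal_distribution))" ..
    show "sigma_finite_measure (distr M G (\<lambda>\<omega>. \<omega>))" ..
    show "sets (PiM T (\<lambda>_. std_normal_distribution) \<Otimes>\<^sub>M distr M G (\<lambda>\<omega>. \<omega>)) = sets (distr M (?P \<Otimes>\<^sub>M G) (\<lambda>\<omega>. (a \<omega>, \<omega>)))"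
      unfolding sets_distr by (intro sets_pair_measure_cong sets_PiM_cong) auto
    fix A A' assume "A \<in> sets (PiM T (\<lambda>_. std_normal_distribution))" and A': "A' \<in> sets (distr M G (\<lambda>\<omega>. \<omega>))"
    then have A: "A \<in> sets ?P" unfolding da[symmetric] by simp
    have G': "A' \<in> sets G" using A' by simp
    have 1: "emeasure (PiM T (\<lambda>_. std_normal_distribution)) A = prob (a -` A \<inter> space M)"
      unfolding da[symmetric] using A by (simp add: emeasure_distr emeasure_eq_measure)
    have 2: "emeasure (distr M G (\<lambda>\<omega>. \<omega>)) A' = prob A'"
      using G' sets.sets_into_space[OF G'] spG by (simp add: emeasure_distr emeasure_eq_measure Int_absorb2)
    have "(\<lambda>\<omega>. (a \<omega>, \<omega>)) -` (A \<times> A') \<inter> space M = a -` A \<inter> space M \<inter> A'"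
      using sets.sets_into_space[OF G'] spG by auto
    then have 3: "emeasure (distr M (?P \<Otimes>\<^sub>M G) (\<lambda>\<omega>. (a \<omega>, \<omega>))) (A \<times> A') = prob (a -` A \<inter> space M \<inter> A')"
      using A G' by (subst emeasure_distr) (auto simp: emeasure_eq_measure)
    show "emeasure (PiM T (\<lambda>_. std_normal_distribution)) A * emeasure (distr M G (\<lambda>\<omega>. \<omega>)) A' = emeasure (distr M (?P \<Otimes>\<^sub>M G) (\<lambda>\<omega>. (a \<omega>, \<omega>))) (A \<times> A')"
      unfolding 1 2 3 indep_prod[OF A G'] by (simp add: ennreal_mult)
  qed
  also have "integral\<^sup>L (PiM T (\<lambda>_. std_normal_distribution) \<Otimes>\<^sub>M distr M G (\<lambda>\<omega>. \<omega>)) F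
    = (\<integral>\<omega>. (\<integral>z. F (z, \<omega>) \<partial>PiM T (\<lambda>_. std_normal_distribution)) \<partial>distr M G (\<lambda>\<omega>. \<omega>))"
    using PP.integral_snd[of "\<lambda>z \<omega>. F (z, \<omega>)"] Fint by simp
  also have "\<dots> = (\<integral>\<omega>. indicator E \<omega> * (\<Prod>t\<in>T. fs (m t \<omega>) (\<eta> t \<omega>) s (yv t)) \<partial>distr M G (\<lambda>\<omega>. \<omega>))"
  proof (intro Bochner_Integration.integral_cong refl)
    fix \<omega>
    have "(\<integral>z. F (z, \<omega>) \<partial>PiM T (\<lambda>_. std_normal_distribution)) = indicator E \<omega> * (\<integral>z. (\<Prod>t\<in>T. fcond (m t \<omega>) (yv t) (\<eta> t \<omega> + s * z t)) \<partial>PiM T (\<lambda>_. std_normal_distribution))"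
      unfolding F_def by simp
    also have "(\<integral>z. (\<Prod>t\<in>T. fcond (m t \<omega>) (yv t) (\<eta> t \<omega> + s * z t)) \<partial>PiM T (\<lambda>_. std_normal_distribution))
      = (\<Prod>t\<in>T. \<integral>z. fcond (m t \<omega>) (yv t) (\<eta> t \<omega> + s * z) \<partial>std_normal_distribution)"
      using fc1 T by (intro N.product_integral_prod finite_measure.integrable_const_bound[OF fmN, where B=1]) (auto intro!: measurable_compose[OF _ fcond_measurable])
    also have "\<dots> = (\<Prod>t\<in>T. fs (m t \<omega>) (\<eta> t \<omega>) s (yv t))"
      by (intro prod.cong refl) (subst integral_density, auto simp: fs_integral mult.commute intro!: measurable_compose[OF _ fcond_measurable])
    finally show "(\<integral>z. F (z, \<omega>) \<partial>PiM T (\<lambda>_. std_normal_distribution)) = indicator E \<omega> * (\<Prod>t\<in>T. fs (m t \<omega>) (\<eta> t \<omega>) s (yv t))" .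
  qed
  also have "\<dots> = (\<integral>\<omega>. indicator E \<omega> * (\<Prod>t\<in>T. fs (m t \<omega>) (\<eta> t \<omega>) s (yv t)) \<partial>M)"
  proof (rule integral_distr[OF idG])
    have "(\<lambda>\<omega>. fs (m t \<omega>) (\<eta> t \<omega>) s (yv t)) \<in> borel_measurable G" if t: "t \<in> T" for t
    proof (rule measurable_compose_countable[where g="m t" and f="\<lambda>k \<omega>. fs k (\<eta> t \<omega>) s (yv t)"])
      fix k
      have "(\<lambda>w. fs k w s (yv t)) \<in> borel_measurable borel"
        unfolding fs_integral by measurable
      from measurable_compose[OF \<eta>[OF t] this] show "(\<lambda>\<omega>. fs k (\<eta> t \<omega>) s (yv t)) \<in> borel_measurable G" .
    qed (rule m[OF t])
    then show "(\<lambda>\<omega>. indicator E \<omega> * (\<Prod>t\<in>T. fs (m t \<omega>) (\<eta> t \<omega>) s (yv t))) \<in> borel_measurable G"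
      using E by (intro borel_measurable_times borel_measurable_prod borel_measurable_indicator) auto
  qed
  finally show ?thesis .
qed simp

section \<open>Measurability of the model functions\<close>

lemma gmix_measurable:
  assumes [measurable]: "f \<in> borel_measurable N" "g \<in> borel_measurable N"
  shows "(\<lambda>\<omega>. gmix k l (f \<omega>) (g \<omega>)) \<in> borel_measurable N"
  unfolding gmix_def by measurable

text \<open>The integer arguments take countably many values, so it is enough to treat fixed
  integers, where \<open>gmix_measurable\<close> applies.\<close>

lemma fs_measurable:
  assumes k: "k \<in> measurable N (count_space UNIV)" and f: "f \<in> borel_measurable N" "g \<in> borel_measurable N" and y: "y \<in> measurable N (count_space UNIV)"
  shows "(\<lambda>\<omega>. fs (k \<omega>) (f \<omega>) (g \<omega>) (y \<omega>)) \<in> borel_measurable N"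
proof (rule measurable_compose_countable[OF _ k, of "\<lambda>i \<omega>. fs i (f \<omega>) (g \<omega>) (y \<omega>)"], rule measurable_compose_countable[OF _ y, of "\<lambda>j \<omega>. fs i (f \<omega>) (g \<omega>) j" for i])
  show "(\<lambda>\<omega>. fs i (f \<omega>) (g \<omega>) j) \<in> borel_measurable N" for i j
    unfolding fs_def by (intro borel_measurable_times borel_measurable_const gmix_measurable f)
qed

lemma us_measurable:
  assumes k: "k \<in> measurable N (count_space UNIV)" and f: "f \<in> borel_measurable N" "g \<in> borel_measurable N" and y: "y \<in> measurable N (count_space UNIV)"
  shows "(\<lambda>\<omega>. us (k \<omega>) (f \<omega>) (g \<omega>) (y \<omega>)) \<in> borel_measurable N"
proof (rule measurable_compose_countable[OF _ k, of "\<lambda>i \<omega>. us i (f \<omega>) (g \<omega>) (y \<omega>)"], rule measurable_compose_countable[OF _ y, of "\<lambda>j \<omega>. us i (f \<omega>) (g \<omega>) j" for i])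
  show "(\<lambda>\<omega>. us i (f \<omega>) (g \<omega>) j) \<in> borel_measurable N" for i j
    unfolding us_def
    by (cases "j \<le> i") (auto intro!: borel_measurable_diff borel_measurable_times borel_measurable_divide borel_measurable_const gmix_measurable f)
qed

lemma es_measurable:
  assumes k: "k \<in> measurable N (count_space UNIV)" and f: "f \<in> borel_measurable N" "g \<in> borel_measurable N"
  shows "(\<lambda>\<omega>. es (k \<omega>) (f \<omega>) (g \<omega>)) \<in> borel_measurable N"
proof (rule measurable_compose_countable[OF _ k, of "\<lambda>i \<omega>. es i (f \<omega>) (g \<omega>)"])
  show "(\<lambda>\<omega>. es i (f \<omega>) (g \<omega>)) \<in> borel_measurable N" for i
    unfolding es_def
    by (intro borel_measurable_sum borel_measurable_times borel_measurable_power fs_measurable us_measurable f) auto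
qed

text \<open>Condition \<open>cond\<close> says in integrated form that, given G, the responses are
  independent with densities \<open>fs\<close>; it stands in for a regular conditional law. In the
  application G is generated by regressors and trials, and \<open>s\<close> is the true latent
  standard deviation.\<close>

locale binomial_panel = prob_space M for M :: "'a measure" +
  fixes G :: "'a measure" and x :: "nat \<Rightarrow> nat \<Rightarrow> 'a \<Rightarrow> real^'r" and m :: "nat \<Rightarrow> 'a \<Rightarrow> nat"
    and Y :: "nat \<Rightarrow> nat \<Rightarrow> 'a \<Rightarrow> nat" and \<beta>0 :: "real^'r" and s :: real and B :: nat and K2 :: real
  assumes subG: "subalgebra M G"
    and x_G: "\<And>n t. 1 \<le> t \<Longrightarrow> t \<le> n \<Longrightarrow> x n t \<in> borel_measurable G"
    and m_G: "\<And>t. 1 \<le> t \<Longrightarrow> m t \<in> measurable G (count_space UNIV)"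
    and Y_M: "\<And>n t. Y n t \<in> measurable M (count_space UNIV)"
    and m_bd: "\<And>t \<omega>. 1 \<le> t \<Longrightarrow> \<omega> \<in> space M \<Longrightarrow> 1 \<le> m t \<omega> \<and> m t \<omega> \<le> B"
    and s_pos: "0 < s"
    and cond: "\<And>n yv A. A \<in> sets G \<Longrightarrow> measure M (A \<inter> {\<omega> \<in> space M. \<forall>t\<in>{1..n}. Y n t \<omega> = yv t}) =
        (\<integral>\<omega>. indicator A \<omega> * (\<Prod>t\<in>{1..n}. fs (m t \<omega>) (x n t \<omega> \<bullet> \<beta>0) s (yv t)) \<partial>M)"
    and x_int: "\<And>n t. 1 \<le> t \<Longrightarrow> t \<le> n \<Longrightarrow> integrable M (\<lambda>\<omega>. (norm (x n t \<omega>))\<^sup>2)"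
    and x_sq: "\<And>n t. 1 \<le> t \<Longrightarrow> t \<le> n \<Longrightarrow> (\<integral>\<omega>. (norm (x n t \<omega>))\<^sup>2 \<partial>M) \<le> K2"
begin

text \<open>Index 0 never occurs; \<open>max 1\<close> only makes every \<open>pm n \<omega> t\<close> a probability vector on \<open>{..B}\<close>.\<close>
definition pm :: "nat \<Rightarrow> 'a \<Rightarrow> nat \<Rightarrow> nat \<Rightarrow> real" where
  "pm n \<omega> t b = fs (m (max 1 t) \<omega>) (x n t \<omega> \<bullet> \<beta>0) s b"

lemma indep_pmf_pm: "\<omega> \<in> space M \<Longrightarrow> indep_pmf B (pm n \<omega>)"
  unfolding pm_def using m_bd by unfold_locales (auto intro!: fs_nonneg sum_fs')

lemma G_to_M: "f \<in> measurable G N \<Longrightarrow> f \<in> measurable M N"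
  using subG by (rule measurable_from_subalg)

lemma pm_G: "1 \<le> t \<Longrightarrow> t \<le> n \<Longrightarrow> (\<lambda>\<omega>. pm n \<omega> t b) \<in> borel_measurable G"
  unfolding pm_def by (intro fs_measurable borel_measurable_inner x_G m_G) auto

text \<open>Conditional probability, given G, of the response path y.\<close>

definition wt :: "nat \<Rightarrow> (nat \<Rightarrow> nat) \<Rightarrow> 'a \<Rightarrow> real" where
  "wt n y \<omega> = (\<Prod>t\<in>{1..n}. pm n \<omega> t (y t))"

definition ev :: "nat \<Rightarrow> (nat \<Rightarrow> nat) \<Rightarrow> 'a set" where
  "ev n y = {\<omega> \<in> space M. \<forall>t\<in>{1..n}. Y n t \<omega> = y t}"

lemma ev_sets[measurable]: "ev n y \<in> sets M"
proof -
  have [measurable]: "Y n t \<in> measurable M (count_space UNIV)" for t by (rule Y_M)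
  show ?thesis unfolding ev_def by measurable
qed

lemma wt_G: "wt n y \<in> borel_measurable G"
  unfolding wt_def by (intro borel_measurable_prod pm_G) auto

lemma wt_bounds: "0 \<le> wt n y \<omega>" "wt n y \<omega> \<le> 1"
  unfolding wt_def pm_def using fs_nonneg fs_le_1 by (auto intro!: prod_nonneg prod_le_1)

lemma wt_int: "integrable M (wt n y)"
  using wt_bounds by (intro integrable_const_bound[where B=1] G_to_M wt_G) auto

lemma cond_wt: "A \<in> sets G \<Longrightarrow> measure M (A \<inter> ev n y) = (\<integral>\<omega>. indicator A \<omega> * wt n y \<omega> \<partial>M)"
  unfolding ev_def cond wt_def pm_def
  by (intro Bochner_Integration.integral_cong refl arg_cong2[where f="(*)"] prod.cong) (auto simp: max_def le_Suc_eq)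

text \<open>By \<open>cond_wt\<close> the weight \<open>wt n y\<close> is the conditional
  expectation of the indicator of \<open>ev n y\<close> given G, so integrable G-measurable factors
  may be pulled through.\<close>

lemma integral_ev:
  assumes f: "f \<in> borel_measurable G" "integrable M f"
  shows "(\<integral>\<omega>. f \<omega> * indicator (ev n y) \<omega> \<partial>M) = (\<integral>\<omega>. f \<omega> * wt n y \<omega> \<partial>M)"
proof -
  interpret F: finite_measure_subalgebra M G by unfold_locales (rule subG)
  let ?I = "indicator (ev n y) :: 'a \<Rightarrow> real"
  have Iint: "integrable M ?I" by (rule integrable_real_indicator) (simp_all add: emeasure_eq_measure)
  have fint: "integrable M (\<lambda>\<omega>. f \<omega> * ?I \<omega>)" using integrable_mult_indicator[OF ev_sets f(2)] by (simp add: mult.commute)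
  have ae: "AE \<omega> in M. real_cond_exp M G ?I \<omega> = wt n y \<omega>"
  proof (rule F.real_cond_exp_charact[OF _ Iint wt_int wt_G])
    fix A assume A: "A \<in> sets G"
    then have AM: "A \<in> sets M" using subG by (auto simp: subalgebra_def)
    have "(\<integral>\<omega>\<in>A. ?I \<omega> \<partial>M) = measure M (A \<inter> ev n y)"
      unfolding set_lebesgue_integral_def using AM sets.sets_into_space[OF AM]
      by (simp add: indicator_inter_arith[symmetric] Int_absorb2 le_infI1)
    then show "(\<integral>\<omega>\<in>A. ?I \<omega> \<partial>M) = (\<integral>\<omega>\<in>A. wt n y \<omega> \<partial>M)"
      unfolding cond_wt[OF A] set_lebesgue_integral_def by simp
  qed
  have "(\<integral>\<omega>. f \<omega> * ?I \<omega> \<partial>M) = (\<integral>\<omega>. f \<omega> * real_cond_exp M G ?I \<omega> \<partial>M)"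
    by (rule F.real_cond_exp_intg(2)[symmetric]) (use fint f in auto)
  also have "\<dots> = (\<integral>\<omega>. f \<omega> * wt n y \<omega> \<partial>M)"
    by (rule integral_cong_AE)
      (use ae f wt_G G_to_M in \<open>auto intro!: borel_measurable_times borel_measurable_cond_exp[THEN G_to_M] elim!: eventually_mono\<close>)
  finally show ?thesis .
qed

abbreviation supp :: "nat \<Rightarrow> (nat \<Rightarrow> nat) set" where "supp n \<equiv> PiE {1..n} (\<lambda>_. {..B})"

lemma finite_supp: "finite (supp n)" by (intro finite_PiE) auto

text \<open>Elements of \<open>supp n\<close> are extensional, so the only path that can match
  \<omega> is the restriction of the responses to {1..n}; none matches once a response exceeds
  B.\<close>

lemma sum_indicator_ev:
  assumes "\<omega> \<in> space M"
  shows "(\<Sum>y\<in>supp n. f y * indicator (ev n y) \<omega>) = (if \<forall>t\<in>{1..n}. Y n t \<omega> \<le> B then f (restrict (\<lambda>t. Y n t \<omega>) {1..n}) else (0::real))"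
proof (cases "\<forall>t\<in>{1..n}. Y n t \<omega> \<le> B")
  case True
  let ?y = "restrict (\<lambda>t. Y n t \<omega>) {1..n}"
  have ym: "?y \<in> supp n" using True by auto
  have "(\<Sum>y\<in>supp n. f y * indicator (ev n y) \<omega>) = (\<Sum>y\<in>supp n. if y = ?y then f y else 0)"
  proof (intro sum.cong refl)
    fix y assume y: "y \<in> supp n"
    have "\<omega> \<in> ev n y \<longleftrightarrow> y = ?y"
    proof
      assume "\<omega> \<in> ev n y"
      then show "y = ?y" unfolding ev_def by (intro PiE_ext[OF y ym]) auto
    next
      assume "y = ?y"
      then have "y t = Y n t \<omega>" if "t \<in> {1..n}" for t using that by simp
      then show "\<omega> \<in> ev n y" using assms unfolding ev_def by auto
    qed
    then show "f y * indicator (ev n y) \<omega> = (if y = ?y then f y else 0)" by (auto simp: indicator_def)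
  qed
  also have "\<dots> = f ?y" unfolding sum.delta[OF finite_supp] using ym by (simp only: if_True)
  finally show ?thesis using True by simp
next
  case False
  have "indicator (ev n y) \<omega> = (0::real)" if y: "y \<in> supp n" for y
  proof -
    have "\<omega> \<notin> ev n y"
    proof
      assume "\<omega> \<in> ev n y"
      then have "\<forall>t\<in>{1..n}. Y n t \<omega> = y t" unfolding ev_def by auto
      then show False using False PiE_mem[OF y] by auto
    qed
    then show ?thesis by simp
  qed
  then show ?thesis using False by (auto intro!: sum.neutral)
qed

text \<open>The conditional weights of the paths in \<open>supp n\<close> already sum to 1. The
  bound is almost sure only, because the conditional law does not constrain \<open>Y\<close> on null
  sets.\<close>

lemma Y_le_B: "AE \<omega> in M. \<forall>t\<in>{1..n}. Y n t \<omega> \<le> B"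
proof -
  let ?U = "{\<omega> \<in> space M. \<forall>t\<in>{1..n}. Y n t \<omega> \<le> B}"
  have [measurable]: "Y n t \<in> measurable M (count_space UNIV)" for t by (rule Y_M)
  have U[measurable]: "?U \<in> sets M" by measurable
  have "prob ?U = (\<integral>\<omega>. indicator ?U \<omega> \<partial>M)" by simp
  also have "\<dots> = (\<integral>\<omega>. (\<Sum>y\<in>supp n. 1 * indicator (ev n y) \<omega>) \<partial>M)"
    by (intro Bochner_Integration.integral_cong refl, subst sum_indicator_ev) auto
  also have "\<dots> = (\<Sum>y\<in>supp n. (\<integral>\<omega>. 1 * indicator (ev n y) \<omega> \<partial>M))"
    by (rule Bochner_Integration.integral_sum) (simp add: emeasure_eq_measure)
  also have "\<dots> = (\<Sum>y\<in>supp n. (\<integral>\<omega>. wt n y \<omega> \<partial>M))"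
  proof (rule sum.cong[OF refl])
    fix y
    have "integrable M (\<lambda>_. 1 :: real)" by (rule integrable_const)
    from integral_ev[OF borel_measurable_const this, of n y]
    show "(\<integral>\<omega>. 1 * indicator (ev n y) \<omega> \<partial>M) = (\<integral>\<omega>. wt n y \<omega> \<partial>M)" by (simp only: mult_1_left)
  qed
  also have "\<dots> = (\<integral>\<omega>. (\<Sum>y\<in>supp n. wt n y \<omega>) \<partial>M)"
    by (rule Bochner_Integration.integral_sum[symmetric]) (rule wt_int)
  also have "\<dots> = (\<integral>\<omega>. 1 \<partial>M)"
  proof (intro Bochner_Integration.integral_cong refl)
    fix \<omega> assume "\<omega> \<in> space M"
    then interpret indep_pmf B "pm n \<omega>" by (rule indep_pmf_pm)
    show "(\<Sum>y\<in>supp n. wt n y \<omega>) = 1" using EE_const[of "{1..n}" "1::real"] unfolding EE_def wt_def by simp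
  qed
  also have "\<dots> = 1" using prob_space by simp
  finally have "AE \<omega> in M. \<omega> \<in> ?U" using U by (simp add: prob_eq_1)
  then show ?thesis by (rule eventually_mono) simp
qed

text \<open>The path up to n takes countably many values, so measurability of \<phi> is only needed
  for each fixed path.\<close>

lemma measurable_Y_compose:
  fixes \<phi> :: "'a \<Rightarrow> (nat \<Rightarrow> nat) \<Rightarrow> real"
  assumes \<phi>: "\<And>y. (\<lambda>\<omega>. \<phi> \<omega> y) \<in> borel_measurable G"
    and dep: "\<And>\<omega> y y'. \<omega> \<in> space M \<Longrightarrow> (\<And>t. t \<in> {1..n} \<Longrightarrow> y t = y' t) \<Longrightarrow> \<phi> \<omega> y = \<phi> \<omega> y'"
  shows "(\<lambda>\<omega>. \<phi> \<omega> (\<lambda>t. Y n t \<omega>)) \<in> borel_measurable M"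
proof -
  let ?I = "PiE {1..n} (\<lambda>_. UNIV :: nat set)"
  let ?r = "\<lambda>\<omega>. restrict (\<lambda>t. Y n t \<omega>) {1..n}"
  have I: "countable ?I" by (intro countable_PiE) auto
  have "?r \<in> measurable M (count_space ?I)"
  proof (subst measurable_count_space_eq_countable[OF I], intro conjI ballI)
    show "?r \<in> space M \<rightarrow> ?I" by auto
    fix y assume y: "y \<in> ?I"
    have "?r -` {y} \<inter> space M = ev n y"
    proof (intro set_eqI iffI)
      fix \<omega> assume w: "\<omega> \<in> ev n y"
      then have "?r \<omega> = y" unfolding ev_def by (intro PiE_ext[OF _ y]) auto
      then show "\<omega> \<in> ?r -` {y} \<inter> space M" using w unfolding ev_def by simp
    next
      fix \<omega> assume "\<omega> \<in> ?r -` {y} \<inter> space M"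
      then have "\<omega> \<in> space M" "y = ?r \<omega>" by auto
      then show "\<omega> \<in> ev n y" unfolding ev_def by simp
    qed
    then show "?r -` {y} \<inter> space M \<in> events" by simp
  qed
  then have "(\<lambda>\<omega>. \<phi> \<omega> (?r \<omega>)) \<in> borel_measurable M"
    by (rule measurable_compose_countable'[OF G_to_M[OF \<phi>] _ I])
  then show ?thesis
    by (rule measurable_cong[THEN iffD1, rotated]) (auto intro!: dep)
qed

text \<open>The bridge from finite sums to the probability space: split by the response path, apply
  \<open>integral_ev\<close> to each of the finitely many pieces, and reassemble the weighted sum as
  \<open>EE\<close>.\<close>

lemma cond_expectation:
  fixes \<phi> :: "'a \<Rightarrow> (nat \<Rightarrow> nat) \<Rightarrow> real"
  assumes \<phi>: "\<And>y. (\<lambda>\<omega>. \<phi> \<omega> y) \<in> borel_measurable G" "\<And>y. y \<in> supp n \<Longrightarrow> integrable M (\<lambda>\<omega>. \<phi> \<omega> y)"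
    and dep: "\<And>\<omega> y y'. \<omega> \<in> space M \<Longrightarrow> (\<And>t. t \<in> {1..n} \<Longrightarrow> y t = y' t) \<Longrightarrow> \<phi> \<omega> y = \<phi> \<omega> y'"
  shows "integrable M (\<lambda>\<omega>. \<phi> \<omega> (\<lambda>t. Y n t \<omega>))"
    and "(\<integral>\<omega>. \<phi> \<omega> (\<lambda>t. Y n t \<omega>) \<partial>M) = (\<integral>\<omega>. EE B (pm n \<omega>) {1..n} (\<phi> \<omega>) \<partial>M)"
    and "integrable M (\<lambda>\<omega>. EE B (pm n \<omega>) {1..n} (\<phi> \<omega>))"
proof -
  let ?S = "\<lambda>\<omega>. \<Sum>y\<in>supp n. \<phi> \<omega> y * indicator (ev n y) \<omega>"
  note meas = measurable_Y_compose[OF \<phi>(1) dep]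
  have i1: "integrable M (\<lambda>\<omega>. \<phi> \<omega> y * indicator (ev n y) \<omega>)" if "y \<in> supp n" for y
    using integrable_mult_indicator[OF ev_sets \<phi>(2)[OF that]] by (simp add: mult.commute)
  have Sint: "integrable M ?S" by (intro Bochner_Integration.integrable_sum i1)
  have ae: "AE \<omega> in M. \<phi> \<omega> (\<lambda>t. Y n t \<omega>) = ?S \<omega>"
    using Y_le_B[of n] AE_space
  proof eventually_elim
    case (elim \<omega>)
    have "\<phi> \<omega> (\<lambda>t. Y n t \<omega>) = \<phi> \<omega> (restrict (\<lambda>t. Y n t \<omega>) {1..n})" using elim by (intro dep) auto
    then show ?case unfolding sum_indicator_ev[OF elim(2)] if_P[OF elim(1)] .
  qed
  have Sm: "?S \<in> borel_measurable M" using Sint by (rule borel_measurable_integrable)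
  show "integrable M (\<lambda>\<omega>. \<phi> \<omega> (\<lambda>t. Y n t \<omega>))"
    using integrable_cong_AE[OF meas Sm ae] Sint by simp
  have i2: "integrable M (\<lambda>\<omega>. wt n y \<omega> * \<phi> \<omega> y)" if "y \<in> supp n" for y
  proof (rule Bochner_Integration.integrable_bound[OF \<phi>(2)[OF that]])
    show "(\<lambda>\<omega>. wt n y \<omega> * \<phi> \<omega> y) \<in> borel_measurable M" by (intro borel_measurable_times G_to_M wt_G \<phi>(1))
    show "AE \<omega> in M. norm (wt n y \<omega> * \<phi> \<omega> y) \<le> norm (\<phi> \<omega> y)"
      using wt_bounds by (auto simp: abs_mult intro!: mult_left_le_one_le)
  qed
  have EEeq: "EE B (pm n \<omega>) {1..n} (\<phi> \<omega>) = (\<Sum>y\<in>supp n. wt n y \<omega> * \<phi> \<omega> y)" for \<omega>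
    unfolding EE_def wt_def by simp
  show "integrable M (\<lambda>\<omega>. EE B (pm n \<omega>) {1..n} (\<phi> \<omega>))" unfolding EEeq by (intro Bochner_Integration.integrable_sum i2)
  have "(\<integral>\<omega>. \<phi> \<omega> (\<lambda>t. Y n t \<omega>) \<partial>M) = (\<integral>\<omega>. ?S \<omega> \<partial>M)" by (rule integral_cong_AE[OF meas Sm ae])
  also have "\<dots> = (\<Sum>y\<in>supp n. \<integral>\<omega>. \<phi> \<omega> y * indicator (ev n y) \<omega> \<partial>M)" by (rule Bochner_Integration.integral_sum[OF i1])
  also have "\<dots> = (\<Sum>y\<in>supp n. \<integral>\<omega>. wt n y \<omega> * \<phi> \<omega> y \<partial>M)"
    using integral_ev[OF \<phi>] by (intro sum.cong refl) (simp add: mult.commute)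
  also have "\<dots> = (\<integral>\<omega>. (\<Sum>y\<in>supp n. wt n y \<omega> * \<phi> \<omega> y) \<partial>M)" by (rule Bochner_Integration.integral_sum[OF i2, symmetric])
  finally show "(\<integral>\<omega>. \<phi> \<omega> (\<lambda>t. Y n t \<omega>) \<partial>M) = (\<integral>\<omega>. EE B (pm n \<omega>) {1..n} (\<phi> \<omega>) \<partial>M)" unfolding EEeq .
qed

end

section \<open>Stochastic order symbols\<close>

context prob_space
begin

text \<open>Stochastic \<open>o\<close> and \<open>O\<close>, phrased with exceptional events so that no measurability of the sequence is required.\<close>
definition oP :: "(nat \<Rightarrow> 'a \<Rightarrow> real) \<Rightarrow> bool" where
  "oP X \<longleftrightarrow> (\<forall>e>0. \<forall>h>0. \<forall>\<^sub>F n in sequentially. \<exists>A\<in>events. prob A \<le> h \<and> (\<forall>\<omega>\<in>space M - A. \<bar>X n \<omega>\<bar> \<le> e))"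

definition OP :: "(nat \<Rightarrow> 'a \<Rightarrow> real) \<Rightarrow> bool" where
  "OP X \<longleftrightarrow> (\<forall>h>0. \<exists>c. \<forall>\<^sub>F n in sequentially. \<exists>A\<in>events. prob A \<le> h \<and> (\<forall>\<omega>\<in>space M - A. \<bar>X n \<omega>\<bar> \<le> c))"

lemma oPD: "oP X \<Longrightarrow> 0 < e \<Longrightarrow> 0 < h \<Longrightarrow> \<forall>\<^sub>F n in sequentially. \<exists>A\<in>events. prob A \<le> h \<and> (\<forall>\<omega>\<in>space M - A. \<bar>X n \<omega>\<bar> \<le> e)"
  unfolding oP_def by blast

lemma OPD:
  assumes "OP X" "0 < h"
  obtains c where "0 < c" "\<forall>\<^sub>F n in sequentially. \<exists>A\<in>events. prob A \<le> h \<and> (\<forall>\<omega>\<in>space M - A. \<bar>X n \<omega>\<bar> \<le> c)"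
proof -
  obtain c where c: "\<forall>\<^sub>F n in sequentially. \<exists>A\<in>events. prob A \<le> h \<and> (\<forall>\<omega>\<in>space M - A. \<bar>X n \<omega>\<bar> \<le> c)"
    using assms unfolding OP_def by blast
  show thesis
  proof (rule that[of "max c 1"])
    show "\<forall>\<^sub>F n in sequentially. \<exists>A\<in>events. prob A \<le> h \<and> (\<forall>\<omega>\<in>space M - A. \<bar>X n \<omega>\<bar> \<le> max c 1)"
      using c by (rule eventually_mono) force
  qed simp
qed

lemma union_bound2:
  assumes "\<exists>A\<in>events. prob A \<le> a \<and> (\<forall>\<omega>\<in>space M - A. P \<omega>)" "\<exists>A\<in>events. prob A \<le> b \<and> (\<forall>\<omega>\<in>space M - A. R \<omega>)"
  shows "\<exists>A\<in>events. prob A \<le> a + b \<and> (\<forall>\<omega>\<in>space M - A. P \<omega> \<and> R \<omega>)"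
proof -
  obtain A1 where A1: "A1 \<in> events" "prob A1 \<le> a" "\<forall>\<omega>\<in>space M - A1. P \<omega>" using assms(1) by blast
  obtain A2 where A2: "A2 \<in> events" "prob A2 \<le> b" "\<forall>\<omega>\<in>space M - A2. R \<omega>" using assms(2) by blast
  have "prob (A1 \<union> A2) \<le> prob A1 + prob A2" using A1 A2 by (intro measure_Un_le) auto
  then show ?thesis using A1 A2 by (intro bexI[of _ "A1 \<union> A2"]) auto
qed

lemma exceptional_AE:
  assumes "AE \<omega> in M. P \<omega>"
  shows "\<exists>A\<in>events. prob A \<le> 0 \<and> (\<forall>\<omega>\<in>space M - A. P \<omega>)"
proof -
  obtain N where "N \<in> null_sets M" "{\<omega>\<in>space M. \<not> P \<omega>} \<subseteq> N" using assms unfolding eventually_ae_filter by blast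
  then show ?thesis by (intro bexI[of _ N]) (auto simp: null_sets_def measure_def)
qed

lemma exceptional_mono:
  assumes "\<exists>A\<in>events. prob A \<le> a \<and> (\<forall>\<omega>\<in>space M - A. P \<omega>)" "AE \<omega> in M. P \<omega> \<longrightarrow> R \<omega>" "a \<le> b"
  shows "\<exists>A\<in>events. prob A \<le> b \<and> (\<forall>\<omega>\<in>space M - A. R \<omega>)"
proof -
  obtain A where "A \<in> events" "prob A \<le> a + 0" "\<forall>\<omega>\<in>space M - A. P \<omega> \<and> (P \<omega> \<longrightarrow> R \<omega>)"
    using union_bound2[OF assms(1) exceptional_AE[OF assms(2)]] by blast
  then show ?thesis using assms(3) by (intro bexI[of _ A]) auto
qed

lemma oP_mono:
  assumes "oP Z" "\<forall>\<^sub>F n in sequentially. AE \<omega> in M. \<bar>X n \<omega>\<bar> \<le> \<bar>Z n \<omega>\<bar>"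
  shows "oP X"
  unfolding oP_def
proof (intro allI impI)
  fix e h :: real assume "0 < e" "0 < h"
  from oPD[OF assms(1) this] assms(2)
  show "\<forall>\<^sub>F n in sequentially. \<exists>A\<in>events. prob A \<le> h \<and> (\<forall>\<omega>\<in>space M - A. \<bar>X n \<omega>\<bar> \<le> e)"
    by eventually_elim (erule exceptional_mono, auto elim!: eventually_mono)
qed

lemma OP_mono:
  assumes "OP Z" "\<forall>\<^sub>F n in sequentially. AE \<omega> in M. \<bar>X n \<omega>\<bar> \<le> \<bar>Z n \<omega>\<bar>"
  shows "OP X"
  unfolding OP_def
proof (intro allI impI)
  fix h :: real assume "0 < h"
  from OPD[OF assms(1) this] obtain c where "\<forall>\<^sub>F n in sequentially. \<exists>A\<in>events. prob A \<le> h \<and> (\<forall>\<omega>\<in>space M - A. \<bar>Z n \<omega>\<bar> \<le> c)"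
    by blast
  then have "\<forall>\<^sub>F n in sequentially. \<exists>A\<in>events. prob A \<le> h \<and> (\<forall>\<omega>\<in>space M - A. \<bar>X n \<omega>\<bar> \<le> c)"
    using assms(2) by eventually_elim (erule exceptional_mono, auto elim!: eventually_mono)
  then show "\<exists>c. \<forall>\<^sub>F n in sequentially. \<exists>A\<in>events. prob A \<le> h \<and> (\<forall>\<omega>\<in>space M - A. \<bar>X n \<omega>\<bar> \<le> c)" by blast
qed

lemma oP_add:
  assumes "oP X" "oP Z" shows "oP (\<lambda>n \<omega>. X n \<omega> + Z n \<omega>)"
  unfolding oP_def
proof (intro allI impI)
  fix e h :: real assume "0 < e" "0 < h"
  then have "0 < e / 2" "0 < h / 2" by auto
  from oPD[OF assms(1) this] oPD[OF assms(2) this]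
  show "\<forall>\<^sub>F n in sequentially. \<exists>A\<in>events. prob A \<le> h \<and> (\<forall>\<omega>\<in>space M - A. \<bar>X n \<omega> + Z n \<omega>\<bar> \<le> e)"
  proof eventually_elim
    case (elim n)
    show ?case by (rule exceptional_mono[OF union_bound2[OF elim]]) auto
  qed
qed

lemma oP_OP_mult:
  assumes "OP X" "oP Z" shows "oP (\<lambda>n \<omega>. X n \<omega> * Z n \<omega>)"
  unfolding oP_def
proof (intro allI impI)
  fix e h :: real assume e: "0 < e" "0 < h"
  obtain c where c: "0 < c" "\<forall>\<^sub>F n in sequentially. \<exists>A\<in>events. prob A \<le> h / 2 \<and> (\<forall>\<omega>\<in>space M - A. \<bar>X n \<omega>\<bar> \<le> c)"
    using OPD[OF assms(1), of "h / 2"] e by auto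
  have "0 < e / c" "0 < h / 2" using e c by auto
  from c(2) oPD[OF assms(2) this]
  show "\<forall>\<^sub>F n in sequentially. \<exists>A\<in>events. prob A \<le> h \<and> (\<forall>\<omega>\<in>space M - A. \<bar>X n \<omega> * Z n \<omega>\<bar> \<le> e)"
  proof eventually_elim
    case (elim n)
    show ?case
    proof (rule exceptional_mono[OF union_bound2[OF elim]])
      show "AE \<omega> in M. \<bar>X n \<omega>\<bar> \<le> c \<and> \<bar>Z n \<omega>\<bar> \<le> e / c \<longrightarrow> \<bar>X n \<omega> * Z n \<omega>\<bar> \<le> e"
      proof (intro AE_I2 impI)
        fix \<omega> assume "\<bar>X n \<omega>\<bar> \<le> c \<and> \<bar>Z n \<omega>\<bar> \<le> e / c"
        then have "\<bar>X n \<omega>\<bar> * \<bar>Z n \<omega>\<bar> \<le> c * (e / c)" using c by (intro mult_mono) auto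
        then show "\<bar>X n \<omega> * Z n \<omega>\<bar> \<le> e" using c by (simp add: abs_mult)
      qed
    qed simp
  qed
qed

lemma oP_imp_OP: assumes "oP X" shows "OP X"
  unfolding OP_def using oPD[OF assms zero_less_one] by blast

lemma OP_add:
  assumes "OP X" "OP Z" shows "OP (\<lambda>n \<omega>. X n \<omega> + Z n \<omega>)"
  unfolding OP_def
proof (intro allI impI)
  fix h :: real assume h: "0 < h"
  obtain c where c: "\<forall>\<^sub>F n in sequentially. \<exists>A\<in>events. prob A \<le> h / 2 \<and> (\<forall>\<omega>\<in>space M - A. \<bar>X n \<omega>\<bar> \<le> c)"
    using OPD[OF assms(1), of "h / 2"] h by auto
  obtain d where d: "\<forall>\<^sub>F n in sequentially. \<exists>A\<in>events. prob A \<le> h / 2 \<and> (\<forall>\<omega>\<in>space M - A. \<bar>Z n \<omega>\<bar> \<le> d)"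
    using OPD[OF assms(2), of "h / 2"] h by auto
  have "\<forall>\<^sub>F n in sequentially. \<exists>A\<in>events. prob A \<le> h \<and> (\<forall>\<omega>\<in>space M - A. \<bar>X n \<omega> + Z n \<omega>\<bar> \<le> c + d)"
    using c d
  proof eventually_elim
    case (elim n)
    show ?case by (rule exceptional_mono[OF union_bound2[OF elim]]) auto
  qed
  then show "\<exists>c. \<forall>\<^sub>F n in sequentially. \<exists>A\<in>events. prob A \<le> h \<and> (\<forall>\<omega>\<in>space M - A. \<bar>X n \<omega> + Z n \<omega>\<bar> \<le> c)" by blast
qed

lemma OP_const: "OP (\<lambda>n \<omega>. c)"
  unfolding OP_def by (intro allI impI exI[of _ "\<bar>c\<bar>"] always_eventually bexI[of _ "{}"]) auto

lemma oP_zero: "oP (\<lambda>n \<omega>. 0)"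
  unfolding oP_def by (intro allI impI always_eventually bexI[of _ "{}"]) auto

lemma oP_cmult: "oP X \<Longrightarrow> oP (\<lambda>n \<omega>. c * X n \<omega>)"
  by (rule oP_OP_mult[OF OP_const])

lemma oP_sum: "finite I \<Longrightarrow> (\<And>i. i \<in> I \<Longrightarrow> oP (X i)) \<Longrightarrow> oP (\<lambda>n \<omega>. \<Sum>i\<in>I. X i n \<omega>)"
  by (induction I rule: finite_induct) (auto intro!: oP_zero oP_add)

lemma oP_abs: "oP X \<Longrightarrow> oP (\<lambda>n \<omega>. \<bar>X n \<omega>\<bar>)"
  by (erule oP_mono) simp

lemma markov_exceptional:
  assumes "integrable M X" "AE \<omega> in M. 0 \<le> X \<omega>" "0 < c"
  shows "\<exists>A\<in>events. prob A \<le> expectation X / c \<and> (\<forall>\<omega>\<in>space M - A. X \<omega> \<le> c)"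
proof -
  have [measurable]: "X \<in> borel_measurable M" using assms(1) by simp
  have "prob {\<omega> \<in> space M. c \<le> X \<omega>} \<le> expectation X / c"
    by (rule integral_Markov_inequality_measure[OF assms(1), of _ c, where A="{}"]) (use assms in auto)
  then show ?thesis by (intro bexI[of _ "{\<omega> \<in> space M. c \<le> X \<omega>}"]) auto
qed

lemma OP_expectation:
  assumes "\<forall>\<^sub>F n in sequentially. integrable M (X n) \<and> (AE \<omega> in M. 0 \<le> X n \<omega>) \<and> expectation (X n) \<le> c"
  shows "OP X"
  unfolding OP_def
proof (intro allI impI)
  fix h :: real assume h: "0 < h"
  define K where "K = max c 1 / h"
  have K: "0 < K" unfolding K_def using h by simp
  have "\<forall>\<^sub>F n in sequentially. \<exists>A\<in>events. prob A \<le> h \<and> (\<forall>\<omega>\<in>space M - A. \<bar>X n \<omega>\<bar> \<le> K)"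
    using assms
  proof eventually_elim
    case (elim n)
    have "expectation (X n) / K \<le> max c 1 / K" using elim K by (intro divide_right_mono) auto
    also have "\<dots> = h" unfolding K_def using h by simp
    finally have le: "expectation (X n) / K \<le> h" .
    have "AE \<omega> in M. X n \<omega> \<le> K \<longrightarrow> \<bar>X n \<omega>\<bar> \<le> K" using elim by auto
    then show ?case using elim by (intro exceptional_mono[OF markov_exceptional[OF _ _ K] _ le]) auto
  qed
  then show "\<exists>c. \<forall>\<^sub>F n in sequentially. \<exists>A\<in>events. prob A \<le> h \<and> (\<forall>\<omega>\<in>space M - A. \<bar>X n \<omega>\<bar> \<le> c)" by blast
qed

text \<open>Dominated convergence sends the means of min 1 |X| to 0, and the Markov inequality turns
  this into small exceptional events.\<close>

lemma oP_AE_limit: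
  assumes X: "\<And>n. X n \<in> borel_measurable M" and lim: "AE \<omega> in M. (\<lambda>n. X n \<omega>) \<longlonglongrightarrow> 0"
  shows "oP X"
  unfolding oP_def
proof (intro allI impI)
  fix e h :: real assume e: "0 < e" "0 < h"
  define f where "f = (\<lambda>n \<omega>. min 1 \<bar>X n \<omega>\<bar>)"
  have [measurable]: "X n \<in> borel_measurable M" for n by (rule X)
  have f[measurable]: "f n \<in> borel_measurable M" for n unfolding f_def by measurable
  have fi: "integrable M (f n)" for n by (rule integrable_const_bound[where B=1]) (auto simp: f_def)
  have "(\<lambda>n. expectation (f n)) \<longlonglongrightarrow> expectation (\<lambda>_. 0)"
  proof (rule integral_dominated_convergence[where w="\<lambda>_. 1"])
    show "AE \<omega> in M. (\<lambda>n. f n \<omega>) \<longlonglongrightarrow> 0"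
      using lim
    proof eventually_elim
      case (elim \<omega>)
      have "(\<lambda>n. min 1 \<bar>X n \<omega>\<bar>) \<longlonglongrightarrow> min 1 \<bar>0\<bar>" by (intro tendsto_intros elim)
      then show ?case unfolding f_def by simp
    qed
  qed (auto simp: f_def)
  then have l: "(\<lambda>n. expectation (f n)) \<longlonglongrightarrow> 0" by simp
  \<comment> \<open>Staying below the cap 1 matters: min 1 |X| <= c then forces |X| <= c.\<close>
  define c where "c = min e (1 / 2)"
  have c: "0 < c" "c \<le> e" "c < 1" unfolding c_def using e by auto
  have "\<forall>\<^sub>F n in sequentially. expectation (f n) < h * c"
    using order_tendstoD(2)[OF l, of "h * c"] e c by simp
  then show "\<forall>\<^sub>F n in sequentially. \<exists>A\<in>events. prob A \<le> h \<and> (\<forall>\<omega>\<in>space M - A. \<bar>X n \<omega>\<bar> \<le> e)"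
  proof eventually_elim
    case (elim n)
    have le: "expectation (f n) / c \<le> h" using elim c by (simp add: field_simps)
    have "AE \<omega> in M. f n \<omega> \<le> c \<longrightarrow> \<bar>X n \<omega>\<bar> \<le> e" unfolding f_def using c by auto
    then show ?case
      by (intro exceptional_mono[OF markov_exceptional[OF fi _ c(1)] _ le]) (auto simp: f_def)
  qed
qed

end

section \<open>The marginal maximum likelihood estimator\<close>

lemma le_one_plus_square: "a \<le> 1 + a\<^sup>2" for a :: real
proof -
  have "0 \<le> (a - 1 / 2)\<^sup>2" by simp
  then show ?thesis by (simp add: power2_eq_square algebra_simps)
qed

text \<open>Parameters are recentred to v = (\<beta> - \<beta>0, \<sigma> - s). The truth is then 0,
  a shrinking neighbourhood is a ball around 0, and the predictor and \<sigma> are affine in v, as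
  the contraction bounds require. \<open>K\<close> is the recentred parameter set and
  \<open>vh\<close> the recentred estimator.\<close>

locale panel_mle = binomial_panel M G x m Y \<beta>0 s B K2
  for M :: "'a measure" and G and x :: "nat \<Rightarrow> nat \<Rightarrow> 'a \<Rightarrow> real^'r" and m Y \<beta>0 s B K2 +
  fixes K :: "((real^'r) \<times> real) set" and S C :: real and vh :: "nat \<Rightarrow> 'a \<Rightarrow> (real^'r) \<times> real"
    and Q :: "(real^'r) \<times> real \<Rightarrow> real"
  assumes K_compact: "compact K" and K0: "0 \<in> K" and K_S: "\<And>v. v \<in> K \<Longrightarrow> 0 \<le> s + snd v \<and> s + snd v \<le> S"
    and C_pos: "0 < C"
    and ln_lip: "\<And>k y \<eta> \<eta>' \<sigma> \<sigma>'. k \<le> B \<Longrightarrow> y \<le> B \<Longrightarrow> 0 \<le> \<sigma> \<Longrightarrow> \<sigma> \<le> S \<Longrightarrow> 0 \<le> \<sigma>' \<Longrightarrow> \<sigma>' \<le> S \<Longrightarrow>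
      \<bar>ln (fs k \<eta> \<sigma> y) - ln (fs k \<eta>' \<sigma>' y)\<bar> \<le> C * (\<bar>\<eta> - \<eta>'\<bar> + \<bar>\<sigma> - \<sigma>'\<bar>)"
    and us_lip: "\<And>k y \<eta> \<eta>' \<sigma> \<sigma>'. k \<le> B \<Longrightarrow> y \<le> B \<Longrightarrow> 0 \<le> \<sigma> \<Longrightarrow> \<sigma> \<le> S \<Longrightarrow> 0 \<le> \<sigma>' \<Longrightarrow> \<sigma>' \<le> S \<Longrightarrow>
      \<bar>us k \<eta> \<sigma> y - us k \<eta>' \<sigma>' y\<bar> \<le> C * (\<bar>\<eta> - \<eta>'\<bar> + \<bar>\<sigma> - \<sigma>'\<bar>)"
    and es_lip: "\<And>k \<eta> \<eta>' \<sigma> \<sigma>'. k \<le> B \<Longrightarrow> 0 \<le> \<sigma> \<Longrightarrow> \<sigma> \<le> S \<Longrightarrow> 0 \<le> \<sigma>' \<Longrightarrow> \<sigma>' \<le> S \<Longrightarrow>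
      \<bar>es k \<eta> \<sigma> - es k \<eta>' \<sigma>'\<bar> \<le> C * (\<bar>\<eta> - \<eta>'\<bar> + \<bar>\<sigma> - \<sigma>'\<bar>)"
    and vh_meas: "\<And>n. vh n \<in> borel_measurable M"
    and vh_K: "\<And>n \<omega>. \<omega> \<in> space M \<Longrightarrow> vh n \<omega> \<in> K"
begin

definition uu :: "nat \<Rightarrow> 'a \<Rightarrow> (real^'r) \<times> real \<Rightarrow> nat \<Rightarrow> nat \<Rightarrow> real" where
  "uu n \<omega> v t b = us (m (max 1 t) \<omega>) (x n t \<omega> \<bullet> (\<beta>0 + fst v)) (s + snd v) b"

definition ll :: "nat \<Rightarrow> 'a \<Rightarrow> (real^'r) \<times> real \<Rightarrow> nat \<Rightarrow> nat \<Rightarrow> real" where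
  "ll n \<omega> v t b = ln (fs (m (max 1 t) \<omega>) (x n t \<omega> \<bullet> (\<beta>0 + fst v)) (s + snd v) b)"

definition ee :: "nat \<Rightarrow> 'a \<Rightarrow> (real^'r) \<times> real \<Rightarrow> nat \<Rightarrow> real" where
  "ee n \<omega> v t = es (m (max 1 t) \<omega>) (x n t \<omega> \<bullet> (\<beta>0 + fst v)) (s + snd v)"

abbreviation Yv :: "nat \<Rightarrow> 'a \<Rightarrow> nat \<Rightarrow> nat" where "Yv n \<omega> \<equiv> (\<lambda>t. Y n t \<omega>)"

definition X2 :: "nat \<Rightarrow> 'a \<Rightarrow> real" where
  "X2 n \<omega> = (\<Sum>t=1..n. (norm (x n t \<omega>))\<^sup>2) / real n"

lemma m_le: "\<omega> \<in> space M \<Longrightarrow> m (max 1 t) \<omega> \<le> B"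
  using m_bd[of "max 1 t" \<omega>] by simp

lemma bounded_scores_true:
  assumes w: "\<omega> \<in> space M"
  shows "bounded_scores B (pm n \<omega>) (uu n \<omega> 0) (real B)"
proof -
  interpret indep_pmf B "pm n \<omega>" by (rule indep_pmf_pm[OF w])
  show ?thesis
    unfolding uu_def by unfold_locales (auto simp: pm_def m_le[OF w, simplified] intro!: us_bound sum_fs_us')
qed

lemma v_ee: "\<omega> \<in> space M \<Longrightarrow> bounded_scores.v B (pm n \<omega>) (uu n \<omega> 0) t = ee n \<omega> 0 t"
  unfolding bounded_scores.v_def[OF bounded_scores_true] ee_def using es'[OF m_le]
  by (simp add: pm_def uu_def)

text \<open>Brings the Lipschitz modulus into the form of increments of two linear functionals on
  the product space, the shape of the lists \<open>zs\<close> in the contraction bounds.\<close>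

lemma param_lip:
  assumes "v \<in> K" "v' \<in> K"
  shows "C * (\<bar>x n t \<omega> \<bullet> (\<beta>0 + fst v) - x n t \<omega> \<bullet> (\<beta>0 + fst v')\<bar> + \<bar>(s + snd v) - (s + snd v')\<bar>)
    = \<bar>(C *\<^sub>R x n t \<omega>, 0) \<bullet> v - (C *\<^sub>R x n t \<omega>, 0) \<bullet> v'\<bar> + \<bar>(0, C) \<bullet> v - (0, C) \<bullet> v'\<bar>"
  using C_pos by (simp add: inner_prod_def inner_add_right distrib_left abs_mult flip: right_diff_distrib)

lemma uu_lip:
  assumes "\<omega> \<in> space M" "v \<in> K" "v' \<in> K" "b \<le> B"
  shows "\<bar>uu n \<omega> v t b - uu n \<omega> v' t b\<bar> \<le> \<bar>(C *\<^sub>R x n t \<omega>, 0) \<bullet> v - (C *\<^sub>R x n t \<omega>, 0) \<bullet> v'\<bar> + \<bar>(0, C) \<bullet> v - (0, C) \<bullet> v'\<bar>"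
  unfolding uu_def param_lip[OF assms(2,3), symmetric] using assms K_S[of v] K_S[of v'] by (intro us_lip m_le) auto

lemma ll_lip:
  assumes "\<omega> \<in> space M" "v \<in> K" "v' \<in> K" "b \<le> B"
  shows "\<bar>ll n \<omega> v t b - ll n \<omega> v' t b\<bar> \<le> \<bar>(C *\<^sub>R x n t \<omega>, 0) \<bullet> v - (C *\<^sub>R x n t \<omega>, 0) \<bullet> v'\<bar> + \<bar>(0, C) \<bullet> v - (0, C) \<bullet> v'\<bar>"
  unfolding ll_def param_lip[OF assms(2,3), symmetric] using assms K_S[of v] K_S[of v'] by (intro ln_lip m_le) auto

lemma ee_lip:
  assumes "\<omega> \<in> space M" "v \<in> K" "v' \<in> K"
  shows "\<bar>ee n \<omega> v t - ee n \<omega> v' t\<bar> \<le> \<bar>(C *\<^sub>R x n t \<omega>, 0) \<bullet> v - (C *\<^sub>R x n t \<omega>, 0) \<bullet> v'\<bar> + \<bar>(0, C) \<bullet> v - (0, C) \<bullet> v'\<bar>"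
  unfolding ee_def param_lip[OF assms(2,3), symmetric] using assms K_S[of v] K_S[of v'] by (intro es_lip m_le) auto

lemma inner_diff_le: "\<bar>z \<bullet> v - z \<bullet> v'\<bar> \<le> norm z * norm (v - v')" for z :: "(real^'r) \<times> real"
  unfolding inner_diff_right[symmetric] by (rule Cauchy_Schwarz_ineq2)

lemma norm_coef: "norm (C *\<^sub>R x n t \<omega>, 0::real) = C * norm (x n t \<omega>)" "norm (0::real^'r, C) = C"
  using C_pos by (simp_all add: norm_prod_def)

text \<open>The norm of x is estimated by 1 plus its square, so that \<open>X2\<close> alone has to
  be controlled afterwards.\<close>

lemma coef_le: "\<bar>(C *\<^sub>R x n t \<omega>, 0) \<bullet> v - (C *\<^sub>R x n t \<omega>, 0) \<bullet> v'\<bar> + \<bar>(0, C) \<bullet> v - (0, C) \<bullet> v'\<bar>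
    \<le> C * (2 + (norm (x n t \<omega>))\<^sup>2) * norm (v - v')"
proof -
  have "norm (x n t \<omega>) \<le> 1 + (norm (x n t \<omega>))\<^sup>2" by (rule le_one_plus_square)
  then have "C * norm (x n t \<omega>) + C \<le> C * (2 + (norm (x n t \<omega>))\<^sup>2)" using C_pos mult_left_mono[of "norm (x n t \<omega>)" "1 + (norm (x n t \<omega>))\<^sup>2" C] by (simp add: distrib_left)
  then have "(C * norm (x n t \<omega>) + C) * norm (v - v') \<le> C * (2 + (norm (x n t \<omega>))\<^sup>2) * norm (v - v')" by (rule mult_right_mono) simp
  then show ?thesis
    using inner_diff_le[of "(C *\<^sub>R x n t \<omega>, 0)" v v'] inner_diff_le[of "(0, C)" v v'] unfolding norm_coef by (simp add: distrib_right)
qed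

lemma uu_bound: "\<omega> \<in> space M \<Longrightarrow> b \<le> B \<Longrightarrow> \<bar>uu n \<omega> v t b\<bar> \<le> real B"
  unfolding uu_def by (intro us_bound m_le)

lemma ee_nonneg: "\<omega> \<in> space M \<Longrightarrow> 0 \<le> ee n \<omega> v t"
  unfolding ee_def by (intro es_bounds(1)[OF m_le])

lemma ee_le: "\<omega> \<in> space M \<Longrightarrow> ee n \<omega> v t \<le> (real B)\<^sup>2"
  unfolding ee_def by (intro es_bounds(2)[OF m_le])

lemma uu_G: "1 \<le> t \<Longrightarrow> t \<le> n \<Longrightarrow> (\<lambda>\<omega>. uu n \<omega> v t b) \<in> borel_measurable G"
  unfolding uu_def by (intro us_measurable borel_measurable_inner x_G m_G) auto

lemma ll_G: "1 \<le> t \<Longrightarrow> t \<le> n \<Longrightarrow> (\<lambda>\<omega>. ll n \<omega> v t b) \<in> borel_measurable G"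
  unfolding ll_def by (intro borel_measurable_ln fs_measurable borel_measurable_inner x_G m_G) auto

lemma ee_G: "1 \<le> t \<Longrightarrow> t \<le> n \<Longrightarrow> (\<lambda>\<omega>. ee n \<omega> v t) \<in> borel_measurable G"
  unfolding ee_def by (intro es_measurable borel_measurable_inner x_G m_G) auto

lemma EE_G:
  fixes f :: "'a \<Rightarrow> (nat \<Rightarrow> nat) \<Rightarrow> real"
  assumes "A \<subseteq> {1..n}" "\<And>y. (\<lambda>\<omega>. f \<omega> y) \<in> borel_measurable G"
  shows "(\<lambda>\<omega>. EE B (pm n \<omega>) A (f \<omega>)) \<in> borel_measurable G"
proof -
  have "(\<lambda>\<omega>. \<Prod>t\<in>A. pm n \<omega> t (y t)) \<in> borel_measurable G" for y
    using assms(1) by (intro borel_measurable_prod pm_G) auto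
  then show ?thesis unfolding EE_def real_scaleR_def
    by (intro borel_measurable_sum borel_measurable_times assms(2))
qed

lemma X2_nonneg: "0 \<le> X2 n \<omega>"
  unfolding X2_def by (intro divide_nonneg_nonneg sum_nonneg) auto

lemma X2_int: "integrable M (X2 n)"
  unfolding X2_def[abs_def] by (intro integrable_divide Bochner_Integration.integrable_sum x_int) auto

lemma X2_expectation: "1 \<le> n \<Longrightarrow> expectation (X2 n) \<le> K2"
proof -
  assume n: "1 \<le> n"
  have "expectation (X2 n) = (\<Sum>t=1..n. expectation (\<lambda>\<omega>. (norm (x n t \<omega>))\<^sup>2)) / real n"
    unfolding X2_def[abs_def] by (simp add: Bochner_Integration.integral_sum x_int)
  also have "\<dots> \<le> (\<Sum>t=1..n. K2) / real n" by (intro divide_right_mono sum_mono x_sq) auto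
  finally show ?thesis using n by simp
qed

lemma K2_nonneg: "0 \<le> K2"
proof -
  have "0 \<le> expectation (X2 1)" by (intro integral_nonneg_AE AE_I2 X2_nonneg)
  then show ?thesis using X2_expectation[of 1] by simp
qed

lemma X2_OP: "OP X2"
  by (rule OP_expectation[where c=K2], rule eventually_sequentiallyI[of 1])
    (auto intro: X2_int X2_nonneg X2_expectation)

lemma sum_norm_sq: "1 \<le> n \<Longrightarrow> (\<Sum>t=1..n. (norm (x n t \<omega>))\<^sup>2) = real n * X2 n \<omega>"
  unfolding X2_def by simp

lemma sequentially_1: "\<forall>\<^sub>F n::nat in sequentially. 1 \<le> n"
  by (rule eventually_ge_at_top)

lemma compact_net:
  assumes "compact (T :: ((real^'r) \<times> real) set)" "0 \<in> T" "0 < e"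
  obtains F where "finite F" "F \<subseteq> T" "0 \<in> F" "\<And>v. v \<in> T \<Longrightarrow> \<exists>w\<in>F. norm (v - w) \<le> e"
proof -
  obtain k where k: "finite k" "k \<subseteq> T" "T \<subseteq> (\<Union>x\<in>k. ball x e)"
    using seq_compact_imp_totally_bounded[of T] assms compact_imp_seq_compact by metis
  show thesis
  proof (rule that[of "insert 0 k"])
    fix v assume "v \<in> T"
    then obtain w where "w \<in> k" "dist w v < e" using k(3) by auto
    then show "\<exists>w\<in>insert 0 k. norm (v - w) \<le> e" by (intro bexI[of _ w]) (auto simp: dist_norm norm_minus_commute)
  qed (use k assms in auto)
qed

text \<open>While the estimator stays in a ball of radius \<rho>, the centred sum is governed by its
  maximum over a net of that ball, whose mean is of order \<rho> * sqrt n by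
  \<open>uniform_deviation\<close>. Consistency allows every \<rho> > 0, which turns the order sqrt
  n into o(sqrt n).\<close>

lemma uniform_oP:
  fixes h :: "nat \<Rightarrow> 'a \<Rightarrow> (real^'r) \<times> real \<Rightarrow> nat \<Rightarrow> (nat \<Rightarrow> nat) \<Rightarrow> real"
    and zs :: "nat \<Rightarrow> 'a \<Rightarrow> nat \<Rightarrow> ((real^'r) \<times> real) list"
  assumes I: "\<And>n. I n \<subseteq> {1..n}" and J: "\<And>n t. t \<in> I n \<Longrightarrow> J t \<subseteq> {1..n}" "\<And>n. disjoint_family_on J (I n)"
    and dep: "\<And>n \<omega> v t y y'. t \<in> I n \<Longrightarrow> (\<And>r. r \<in> J t \<Longrightarrow> y r = y' r) \<Longrightarrow> h n \<omega> v t y = h n \<omega> v t y'"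
    and lip: "\<And>n \<omega> v v' t y. \<omega> \<in> space M \<Longrightarrow> t \<in> I n \<Longrightarrow> v \<in> K \<Longrightarrow> v' \<in> K \<Longrightarrow> (\<And>r. r \<in> J t \<Longrightarrow> y r \<le> B) \<Longrightarrow>
       \<bar>h n \<omega> v t y - h n \<omega> v' t y\<bar> \<le> (\<Sum>z\<leftarrow>zs n \<omega> t. \<bar>z \<bullet> v - z \<bullet> v'\<bar>)"
    and zero: "\<And>n \<omega> t y. t \<in> I n \<Longrightarrow> h n \<omega> 0 t y = 0"
    and len: "\<And>n \<omega> t. t \<in> I n \<Longrightarrow> length (zs n \<omega> t) \<le> 3"
    and meas: "\<And>n v t y. t \<in> I n \<Longrightarrow> (\<lambda>\<omega>. h n \<omega> v t y) \<in> borel_measurable G"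
    and D: "0 \<le> D" "\<And>n \<omega>. 1 \<le> n \<Longrightarrow> \<omega> \<in> space M \<Longrightarrow> (\<Sum>t\<in>I n. \<Sum>z\<leftarrow>zs n \<omega> t. (norm z)\<^sup>2) \<le> real n * (D * (1 + X2 n \<omega>))"
    and cons: "oP (\<lambda>n \<omega>. norm (vh n \<omega>))"
  shows "oP (\<lambda>n \<omega>. (\<Sum>t\<in>I n. h n \<omega> (vh n \<omega>) t (Yv n \<omega>) - EE B (pm n \<omega>) (J t) (h n \<omega> (vh n \<omega>) t)) / sqrt (real n))"
proof -
  define SS where "SS = (\<lambda>n \<omega> v y. \<Sum>t\<in>I n. h n \<omega> v t y - EE B (pm n \<omega>) (J t) (h n \<omega> v t))"
  define RR where "RR = (\<lambda>n \<omega>. \<Sum>t\<in>I n. \<Sum>z\<leftarrow>zs n \<omega> t. (norm z)\<^sup>2)"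
  have fI: "finite (I n)" for n using I finite_subset by blast
  have fJ: "finite (J t)" if "t \<in> I n" for n t using J(1)[OF that] finite_subset by blast
  have cI: "card (I n) \<le> n" for n using card_mono[OF _ I, of n] by simp
  have RR0: "0 \<le> RR n \<omega>" for n \<omega> unfolding RR_def by (intro sum_nonneg sum_list_nonneg) auto
  have RRD: "RR n \<omega> \<le> real n * (D * (1 + X2 n \<omega>))" if "1 \<le> n" "\<omega> \<in> space M" for n \<omega>
    unfolding RR_def using D(2)[OF that] .
  have Sdiff: "\<bar>SS n \<omega> v y - SS n \<omega> w y\<bar> \<le> 2 * norm (v - w) * (3 * real n + RR n \<omega>)"
    if w: "\<omega> \<in> space M" and vw: "v \<in> K" "w \<in> K" and y: "\<And>t. t \<in> {1..n} \<Longrightarrow> y t \<le> B" for n \<omega> v w y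
  proof -
    interpret indep_pmf B "pm n \<omega>" by (rule indep_pmf_pm[OF w])
    have z: "(\<Sum>z\<leftarrow>zs n \<omega> t. \<bar>z \<bullet> v - z \<bullet> w\<bar>) \<le> norm (v - w) * (3 + (\<Sum>z\<leftarrow>zs n \<omega> t. (norm z)\<^sup>2))" if t: "t \<in> I n" for t
    proof -
      have "(\<Sum>z\<leftarrow>zs n \<omega> t. \<bar>z \<bullet> v - z \<bullet> w\<bar>) \<le> (\<Sum>z\<leftarrow>zs n \<omega> t. norm (v - w) * (1 + (norm z)\<^sup>2))"
      proof (rule sum_list_mono)
        fix z :: "(real^'r) \<times> real"
        have "norm z \<le> 1 + (norm z)\<^sup>2" by (rule le_one_plus_square)
        then have "norm (v - w) * norm z \<le> norm (v - w) * (1 + (norm z)\<^sup>2)" by (rule mult_left_mono) simp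
        then show "\<bar>z \<bullet> v - z \<bullet> w\<bar> \<le> norm (v - w) * (1 + (norm z)\<^sup>2)"
          using inner_diff_le[of z v w] by (simp add: mult.commute)
      qed
      also have "\<dots> = norm (v - w) * (real (length (zs n \<omega> t)) + (\<Sum>z\<leftarrow>zs n \<omega> t. (norm z)\<^sup>2))"
        by (simp add: sum_list_const_mult sum_list_addf sum_list_triv)
      also have "\<dots> \<le> norm (v - w) * (3 + (\<Sum>z\<leftarrow>zs n \<omega> t. (norm z)\<^sup>2))"
        using len[OF t, of \<omega>] by (intro mult_left_mono add_right_mono) auto
      finally show ?thesis .
    qed
    have "\<bar>SS n \<omega> v y - SS n \<omega> w y\<bar> \<le> (\<Sum>t\<in>I n. \<bar>(h n \<omega> v t y - EE B (pm n \<omega>) (J t) (h n \<omega> v t)) - (h n \<omega> w t y - EE B (pm n \<omega>) (J t) (h n \<omega> w t))\<bar>)"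
      unfolding SS_def sum_subtractf[symmetric] by (rule sum_abs)
    also have "\<dots> \<le> (\<Sum>t\<in>I n. 2 * (norm (v - w) * (3 + (\<Sum>z\<leftarrow>zs n \<omega> t. (norm z)\<^sup>2))))"
    proof (rule sum_mono)
      fix t assume t: "t \<in> I n"
      have 1: "\<bar>h n \<omega> v t y - h n \<omega> w t y\<bar> \<le> norm (v - w) * (3 + (\<Sum>z\<leftarrow>zs n \<omega> t. (norm z)\<^sup>2))"
      proof -
        have "y r \<le> B" if "r \<in> J t" for r using y J(1)[OF t] that by blast
        then have "\<bar>h n \<omega> v t y - h n \<omega> w t y\<bar> \<le> (\<Sum>z\<leftarrow>zs n \<omega> t. \<bar>z \<bullet> v - z \<bullet> w\<bar>)" by (rule lip[OF w t vw])
        then show ?thesis using z[OF t] by simp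
      qed
      have "\<bar>EE B (pm n \<omega>) (J t) (\<lambda>y. h n \<omega> v t y - h n \<omega> w t y)\<bar> \<le> EE B (pm n \<omega>) (J t) (\<lambda>y. norm (h n \<omega> v t y - h n \<omega> w t y))"
        using EE_norm[of "J t" "\<lambda>y. h n \<omega> v t y - h n \<omega> w t y"] by simp
      also have "\<dots> \<le> EE B (pm n \<omega>) (J t) (\<lambda>y. norm (v - w) * (3 + (\<Sum>z\<leftarrow>zs n \<omega> t. (norm z)\<^sup>2)))"
      proof (rule EE_mono)
        fix y assume "y \<in> PiE (J t) (\<lambda>_. {..B})"
        then have "y r \<le> B" if "r \<in> J t" for r using that by (auto simp: PiE_iff)
        then have "\<bar>h n \<omega> v t y - h n \<omega> w t y\<bar> \<le> (\<Sum>z\<leftarrow>zs n \<omega> t. \<bar>z \<bullet> v - z \<bullet> w\<bar>)" by (rule lip[OF w t vw])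
        then show "norm (h n \<omega> v t y - h n \<omega> w t y) \<le> norm (v - w) * (3 + (\<Sum>z\<leftarrow>zs n \<omega> t. (norm z)\<^sup>2))"
          using z[OF t] by simp
      qed
      also have "\<dots> = norm (v - w) * (3 + (\<Sum>z\<leftarrow>zs n \<omega> t. (norm z)\<^sup>2))" by (simp only: EE_const fJ[OF t])
      finally show "\<bar>(h n \<omega> v t y - EE B (pm n \<omega>) (J t) (h n \<omega> v t)) - (h n \<omega> w t y - EE B (pm n \<omega>) (J t) (h n \<omega> w t))\<bar> \<le> 2 * (norm (v - w) * (3 + (\<Sum>z\<leftarrow>zs n \<omega> t. (norm z)\<^sup>2)))"
        using 1 unfolding EE_diff by linarith
    qed
    also have "\<dots> = 2 * norm (v - w) * (3 * real (card (I n)) + RR n \<omega>)"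
      unfolding RR_def sum_distrib_left[symmetric] by (simp add: sum.distrib mult_ac)
    also have "\<dots> \<le> 2 * norm (v - w) * (3 * real n + RR n \<omega>)"
      using cI by (intro mult_left_mono add_right_mono) auto
    finally show ?thesis .
  qed
  have SS0: "SS n \<omega> 0 y = 0" for n \<omega> y unfolding SS_def EE_def using zero by (simp add: sum.neutral)
  have SSG: "(\<lambda>\<omega>. SS n \<omega> v y) \<in> borel_measurable G" for n v y
    unfolding SS_def by (intro borel_measurable_sum borel_measurable_diff meas EE_G J)
  have SSdep: "SS n \<omega> v y = SS n \<omega> v y'" if "\<And>t. t \<in> {1..n} \<Longrightarrow> y t = y' t" for n \<omega> v y y'
    unfolding SS_def using that J(1) by (intro sum.cong refl arg_cong2[where f="(-)"] dep) blast+
  show ?thesis unfolding oP_def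
  proof (intro allI impI)
    fix e \<epsilon> :: real assume e: "0 < e" "0 < \<epsilon>"
    define c1 where "c1 = 1 + D * (1 + K2)"
    have c1: "1 \<le> c1" unfolding c1_def using D(1) K2_nonneg by simp
    \<comment> \<open>Here 72 = 12 * 2 * 3: the mean of the maximum is at most 12 * \<rho> * sqrt n
      * c1, the Markov inequality is used at level e / 2 * sqrt n, and the resulting probability
      should be \<epsilon> / 3.\<close>
    define \<rho> where "\<rho> = e * \<epsilon> / (72 * c1)"
    have \<rho>: "0 < \<rho>" unfolding \<rho>_def using e c1 by simp
    obtain cX where cX: "0 < cX" "\<forall>\<^sub>F n in sequentially. \<exists>A\<in>events. prob A \<le> \<epsilon> / 3 \<and> (\<forall>\<omega>\<in>space M - A. \<bar>X2 n \<omega>\<bar> \<le> cX)"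
      using OPD[OF X2_OP, of "\<epsilon> / 3"] e by auto
    have "filterlim (\<lambda>n. sqrt (real n)) at_top sequentially"
      using filterlim_compose[OF sqrt_at_top filterlim_real_sequentially] by simp
    then have big: "\<forall>\<^sub>F n in sequentially. 2 * (3 + D * (1 + cX)) * 2 / e \<le> sqrt (real n)"
      unfolding filterlim_at_top by blast
    have "0 < \<epsilon> / 3" using e by simp
    from cX(2) big oPD[OF cons \<rho> this] sequentially_1
    show "\<forall>\<^sub>F n in sequentially. \<exists>A\<in>events. prob A \<le> \<epsilon> \<and> (\<forall>\<omega>\<in>space M - A.
       \<bar>(\<Sum>t\<in>I n. h n \<omega> (vh n \<omega>) t (Yv n \<omega>) - EE B (pm n \<omega>) (J t) (h n \<omega> (vh n \<omega>) t)) / sqrt (real n)\<bar> \<le> e)"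
    proof eventually_elim
      case (elim n)
      have n: "1 \<le> n" using elim by simp
      have sn: "0 < sqrt (real n)" using n by simp
      \<comment> \<open>A net of mesh 1 / n is fine enough: by \<open>Sdiff\<close> the sum has a
        Lipschitz constant of order n while \<open>X2\<close> is bounded, so passing to a net point
        costs a bounded amount, negligible against sqrt n. Finiteness also makes the maximum
        measurable.\<close>
      have "compact (K \<inter> cball 0 \<rho>)" by (intro compact_Int_closed K_compact closed_cball)
      moreover have "0 \<in> K \<inter> cball 0 \<rho>" using K0 \<rho> by simp
      moreover have "0 < 1 / real n" using n by simp
      ultimately obtain F where F: "finite F" "F \<subseteq> K \<inter> cball 0 \<rho>" "0 \<in> F" "\<And>v. v \<in> K \<inter> cball 0 \<rho> \<Longrightarrow> \<exists>w\<in>F. norm (v - w) \<le> 1 / real n"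
        by (rule compact_net) blast
      have FK: "v \<in> K" "norm v \<le> \<rho>" if "v \<in> F" for v using F(2) that by auto
      have F': "F \<noteq> {}" using F(3) by auto
      define \<phi> where "\<phi> = (\<lambda>\<omega> y. Max ((\<lambda>v. \<bar>SS n \<omega> v y\<bar>) ` F))"
      have \<phi>G: "(\<lambda>\<omega>. \<phi> \<omega> y) \<in> borel_measurable G" for y
        unfolding \<phi>_def by (intro borel_measurable_Max F(1) borel_measurable_abs SSG)
      have \<phi>0: "0 \<le> \<phi> \<omega> y" for \<omega> y
        unfolding \<phi>_def using le_Max_img[OF F(1) F' F(3), of "\<lambda>v. \<bar>SS n \<omega> v y\<bar>"] by (simp add: SS0)
      have \<phi>int: "integrable M (\<lambda>\<omega>. \<phi> \<omega> y)" if y: "y \<in> supp n" for y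
      proof (rule Bochner_Integration.integrable_bound)
        show "integrable M (\<lambda>\<omega>. 2 * \<rho> * (3 * real n + real n * (D * (1 + X2 n \<omega>))))"
          by (intro integrable_mult_right Bochner_Integration.integrable_add integrable_const X2_int)
        show "(\<lambda>\<omega>. \<phi> \<omega> y) \<in> borel_measurable M" by (rule G_to_M[OF \<phi>G])
        show "AE \<omega> in M. norm (\<phi> \<omega> y) \<le> norm (2 * \<rho> * (3 * real n + real n * (D * (1 + X2 n \<omega>))))"
          using AE_space
        proof eventually_elim
          case (elim \<omega>)
          have yB: "y t \<le> B" if "t \<in> {1..n}" for t using y that by (auto simp: PiE_iff)
          have "\<phi> \<omega> y \<le> 2 * \<rho> * (3 * real n + real n * (D * (1 + X2 n \<omega>)))"
            unfolding \<phi>_def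
          proof (rule Max_img_le[OF F(1) F'])
            fix v assume v: "v \<in> F"
            have "\<bar>SS n \<omega> v y\<bar> \<le> 2 * norm v * (3 * real n + RR n \<omega>)"
            proof -
              have "\<bar>SS n \<omega> v y - SS n \<omega> 0 y\<bar> \<le> 2 * norm (v - 0) * (3 * real n + RR n \<omega>)"
                by (rule Sdiff[OF elim FK(1)[OF v] K0]) (rule yB)
              then show ?thesis unfolding SS0 by simp
            qed
            also have "\<dots> \<le> 2 * \<rho> * (3 * real n + real n * (D * (1 + X2 n \<omega>)))"
              using FK(2)[OF v] RR0[of n \<omega>] RRD[OF n elim] \<rho> by (intro mult_mono) auto
            finally show "\<bar>SS n \<omega> v y\<bar> \<le> 2 * \<rho> * (3 * real n + real n * (D * (1 + X2 n \<omega>)))" .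
          qed
          then show ?case using \<phi>0[of \<omega> y] by simp
        qed
      qed
      have \<phi>dep: "\<phi> \<omega> y = \<phi> \<omega> y'" if "\<And>t. t \<in> {1..n} \<Longrightarrow> y t = y' t" for \<omega> y y'
        unfolding \<phi>_def using SSdep[OF that] by simp
      note ce = cond_expectation[of \<phi> n, OF \<phi>G \<phi>int \<phi>dep]
      have "expectation (\<lambda>\<omega>. \<phi> \<omega> (Yv n \<omega>)) = expectation (\<lambda>\<omega>. EE B (pm n \<omega>) {1..n} (\<phi> \<omega>))" by (rule ce(2))
      also have "\<dots> \<le> expectation (\<lambda>\<omega>. 12 * \<rho> * sqrt (real n) * (1 + D * (1 + X2 n \<omega>)))"
      proof (rule integral_mono[OF ce(3)])
        show "integrable M (\<lambda>\<omega>. 12 * \<rho> * sqrt (real n) * (1 + D * (1 + X2 n \<omega>)))"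
          by (intro integrable_mult_right Bochner_Integration.integrable_add integrable_const X2_int)
        fix \<omega> assume w: "\<omega> \<in> space M"
        interpret indep_pmf B "pm n \<omega>" by (rule indep_pmf_pm[OF w])
        have "EE B (pm n \<omega>) {1..n} (\<phi> \<omega>) \<le> 4 * real 3 * \<rho> * sqrt (\<Sum>t\<in>I n. \<Sum>z\<leftarrow>zs n \<omega> t. (norm z)\<^sup>2)"
          unfolding \<phi>_def SS_def
        proof (rule uniform_deviation[where J=J, OF F(1,3) FK(2) _ _ fI J])
          show "h n \<omega> v t y = h n \<omega> v t y'" if "t \<in> I n" "\<And>r. r \<in> J t \<Longrightarrow> y r = y' r" for t v y y'
            using that by (rule dep)
          show "\<bar>h n \<omega> v t y - h n \<omega> v' t y\<bar> \<le> (\<Sum>z\<leftarrow>zs n \<omega> t. \<bar>z \<bullet> v - z \<bullet> v'\<bar>)"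
            if "t \<in> I n" "v \<in> F" "v' \<in> F" "\<And>r. r \<in> J t \<Longrightarrow> y r \<le> B" for t v v' y
            by (rule lip[OF w that(1) FK(1)[OF that(2)] FK(1)[OF that(3)]]) (rule that(4))
          show "h n \<omega> 0 t y = 0" if "t \<in> I n" for t y using that by (rule zero)
          show "length (zs n \<omega> t) \<le> 3" if "t \<in> I n" for t using that by (rule len)
        qed (use \<rho> in auto)
        also have "\<dots> = 12 * \<rho> * sqrt (RR n \<omega>)" unfolding RR_def by simp
        also have "\<dots> \<le> 12 * \<rho> * sqrt (real n * (D * (1 + X2 n \<omega>)))" using RRD[OF n w] \<rho> by simp
        also have "\<dots> = 12 * \<rho> * sqrt (real n) * sqrt (D * (1 + X2 n \<omega>))" by (simp add: real_sqrt_mult)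
        \<comment> \<open>The square root is traded for an expression linear in \<open>X2\<close>,
          whose expectation is bounded directly.\<close>
        also have "\<dots> \<le> 12 * \<rho> * sqrt (real n) * (1 + D * (1 + X2 n \<omega>))"
        proof (rule mult_left_mono)
          have z: "0 \<le> D * (1 + X2 n \<omega>)" using D(1) X2_nonneg[of n \<omega>] by simp
          have "sqrt z \<le> 1 + z" if "0 \<le> z" for z :: real
            using that by (intro real_le_lsqrt) (auto simp: power2_eq_square algebra_simps)
          from this[OF z] show "sqrt (D * (1 + X2 n \<omega>)) \<le> 1 + D * (1 + X2 n \<omega>)" .
        qed (use \<rho> in simp)
        finally show "EE B (pm n \<omega>) {1..n} (\<phi> \<omega>) \<le> 12 * \<rho> * sqrt (real n) * (1 + D * (1 + X2 n \<omega>))" .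
      qed
      also have "\<dots> = 12 * \<rho> * sqrt (real n) * (1 + D * (1 + expectation (X2 n)))"
        using X2_int[of n] prob_space by simp
      also have "\<dots> \<le> 12 * \<rho> * sqrt (real n) * c1"
        unfolding c1_def using X2_expectation[OF n] D(1) \<rho> by (intro mult_left_mono add_left_mono) auto
      finally have "expectation (\<lambda>\<omega>. \<phi> \<omega> (Yv n \<omega>)) / (e / 2 * sqrt (real n)) \<le> 12 * \<rho> * sqrt (real n) * c1 / (e / 2 * sqrt (real n))"
        using e by (intro divide_right_mono) auto
      also have "\<dots> = \<epsilon> / 3" unfolding \<rho>_def using e c1 sn by (simp add: field_simps)
      finally have le: "expectation (\<lambda>\<omega>. \<phi> \<omega> (Yv n \<omega>)) / (e / 2 * sqrt (real n)) \<le> \<epsilon> / 3" .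
      have ev1: "\<exists>A\<in>events. prob A \<le> \<epsilon> / 3 \<and> (\<forall>\<omega>\<in>space M - A. \<phi> \<omega> (Yv n \<omega>) \<le> e / 2 * sqrt (real n))"
        using exceptional_mono[OF markov_exceptional[OF ce(1), of "e / 2 * sqrt (real n)"] _ le] \<phi>0 e sn by auto
      show ?case
      proof (rule exceptional_mono[OF union_bound2[OF ev1 union_bound2[OF elim(1) elim(3)]]])
        show "\<epsilon> / 3 + (\<epsilon> / 3 + \<epsilon> / 3) \<le> \<epsilon>" by simp
        show "AE \<omega> in M. \<phi> \<omega> (Yv n \<omega>) \<le> e / 2 * sqrt (real n) \<and> \<bar>X2 n \<omega>\<bar> \<le> cX \<and> \<bar>norm (vh n \<omega>)\<bar> \<le> \<rho> \<longrightarrow>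
          \<bar>(\<Sum>t\<in>I n. h n \<omega> (vh n \<omega>) t (Yv n \<omega>) - EE B (pm n \<omega>) (J t) (h n \<omega> (vh n \<omega>) t)) / sqrt (real n)\<bar> \<le> e"
          using Y_le_B[of n] AE_space
        proof eventually_elim
          case (elim \<omega>)
          show ?case
          proof
            assume a: "\<phi> \<omega> (Yv n \<omega>) \<le> e / 2 * sqrt (real n) \<and> \<bar>X2 n \<omega>\<bar> \<le> cX \<and> \<bar>norm (vh n \<omega>)\<bar> \<le> \<rho>"
            then have "vh n \<omega> \<in> K \<inter> cball 0 \<rho>" using vh_K[OF elim(2)] by simp
            then obtain w where w: "w \<in> F" "norm (vh n \<omega> - w) \<le> 1 / real n" using F(4) by blast
            have "\<bar>SS n \<omega> (vh n \<omega>) (Yv n \<omega>) - SS n \<omega> w (Yv n \<omega>)\<bar> \<le> 2 * norm (vh n \<omega> - w) * (3 * real n + RR n \<omega>)"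
              using elim by (intro Sdiff vh_K FK w) auto
            also have "\<dots> \<le> 2 * (1 / real n) * (3 * real n + real n * (D * (1 + cX)))"
            proof (intro mult_mono add_left_mono)
              have "RR n \<omega> \<le> real n * (D * (1 + X2 n \<omega>))" by (rule RRD[OF n elim(2)])
              also have "\<dots> \<le> real n * (D * (1 + cX))" using a D(1) by (intro mult_left_mono add_left_mono) auto
              finally show "RR n \<omega> \<le> real n * (D * (1 + cX))" .
            qed (use w RR0[of n \<omega>] in auto)
            also have "\<dots> = 2 * (3 + D * (1 + cX))" using n by (simp add: field_simps)
            also have "\<dots> \<le> e / 2 * sqrt (real n)" using \<open>2 * (3 + D * (1 + cX)) * 2 / e \<le> sqrt (real n)\<close> e by (simp add: field_simps)
            finally have 1: "\<bar>SS n \<omega> (vh n \<omega>) (Yv n \<omega>) - SS n \<omega> w (Yv n \<omega>)\<bar> \<le> e / 2 * sqrt (real n)" .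
            have "\<bar>SS n \<omega> w (Yv n \<omega>)\<bar> \<le> \<phi> \<omega> (Yv n \<omega>)"
              unfolding \<phi>_def by (rule le_Max_img[OF F(1) F' w(1)])
            then have "\<bar>SS n \<omega> (vh n \<omega>) (Yv n \<omega>)\<bar> \<le> e * sqrt (real n)" using a 1 by argo
            then have "\<bar>SS n \<omega> (vh n \<omega>) (Yv n \<omega>) / sqrt (real n)\<bar> \<le> e"
              using sn by (simp add: abs_divide pos_divide_le_eq)
            then show "\<bar>(\<Sum>t\<in>I n. h n \<omega> (vh n \<omega>) t (Yv n \<omega>) - EE B (pm n \<omega>) (J t) (h n \<omega> (vh n \<omega>) t)) / sqrt (real n)\<bar> \<le> e"
              unfolding SS_def .
          qed
        qed
      qed
    qed
  qed
qed

end

lemma sum_shift_le: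
  fixes f :: "nat \<Rightarrow> real"
  assumes "\<And>t. 0 \<le> f t" "1 \<le> a"
  shows "(\<Sum>t=a+1..n. f t) \<le> (\<Sum>t=1..n. f t)" "(\<Sum>t=a+1..n. f (t - a)) \<le> (\<Sum>t=1..n. f t)"
proof -
  show "(\<Sum>t=a+1..n. f t) \<le> (\<Sum>t=1..n. f t)" using assms by (intro sum_mono2) auto
  have "(\<Sum>t=a+1..n. f (t - a)) = (\<Sum>t=1..n-a. f t)"
    by (rule sum.reindex_bij_witness[where i="\<lambda>t. t + a" and j="\<lambda>t. t - a"]) auto
  also have "\<dots> \<le> (\<Sum>t=1..n. f t)" using assms by (intro sum_mono2) auto
  finally show "(\<Sum>t=a+1..n. f (t - a)) \<le> (\<Sum>t=1..n. f t)" .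
qed

section \<open>Consistency and total divergence of the estimator\<close>

context panel_mle
begin

definition lik :: "nat \<Rightarrow> (real^'r) \<times> real \<Rightarrow> 'a \<Rightarrow> real" where
  "lik n v \<omega> = (\<Sum>t=1..n. ll n \<omega> v t (Y n t \<omega>))"

definition mu :: "nat \<Rightarrow> 'a \<Rightarrow> (real^'r) \<times> real \<Rightarrow> nat \<Rightarrow> real" where
  "mu n \<omega> v t = (\<Sum>b\<le>B. pm n \<omega> t b * uu n \<omega> v t b)"

definition KL :: "nat \<Rightarrow> 'a \<Rightarrow> (real^'r) \<times> real \<Rightarrow> real" where
  "KL n \<omega> v = (\<Sum>t=1..n. \<Sum>b\<le>B. pm n \<omega> t b * (ll n \<omega> 0 t b - ll n \<omega> v t b))"

definition WW :: "nat \<Rightarrow> nat \<Rightarrow> (real^'r) \<times> real \<Rightarrow> 'a \<Rightarrow> real" where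
  "WW n a v \<omega> = (\<Sum>t=a+1..n. uu n \<omega> v t (Y n t \<omega>) * uu n \<omega> v (t - a) (Y n (t - a) \<omega>))"

definition LL :: "nat \<Rightarrow> nat \<Rightarrow> (real^'r) \<times> real \<Rightarrow> 'a \<Rightarrow> real" where
  "LL n a v \<omega> = (\<Sum>t=a+1..n. ee n \<omega> v t * ee n \<omega> v (t - a))"

lemma lik_measurable: "lik n v \<in> borel_measurable M"
proof -
  have "(\<lambda>\<omega>. \<Sum>t=1..n. ll n \<omega> v t (Yv n \<omega> t)) \<in> borel_measurable M"
    by (rule measurable_Y_compose[where \<phi>="\<lambda>\<omega> y. \<Sum>t=1..n. ll n \<omega> v t (y t)" and n=n])
      (auto intro!: borel_measurable_sum ll_G sum.cong)
  then show ?thesis unfolding lik_def .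
qed

lemma sum_coef: "1 \<le> n \<Longrightarrow> (\<Sum>t=1..n. C * (2 + (norm (x n t \<omega>))\<^sup>2) * c) = real n * (C * (2 + X2 n \<omega>)) * c"
proof -
  assume "1 \<le> n"
  then have "(\<Sum>t=1..n. C * (2 + (norm (x n t \<omega>))\<^sup>2)) = C * (real n * 2 + real n * X2 n \<omega>)"
    unfolding sum_distrib_left[symmetric] sum.distrib sum_norm_sq[OF \<open>1 \<le> n\<close>] by simp
  also have "\<dots> = real n * (C * (2 + X2 n \<omega>))" by (simp add: algebra_simps)
  finally show ?thesis unfolding sum_distrib_right[symmetric] by simp
qed

lemma lik_lip:
  assumes "1 \<le> n" "\<omega> \<in> space M" "\<forall>t\<in>{1..n}. Y n t \<omega> \<le> B" "v \<in> K" "v' \<in> K"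
  shows "\<bar>lik n v \<omega> - lik n v' \<omega>\<bar> \<le> real n * (C * (2 + X2 n \<omega>)) * norm (v - v')"
proof -
  have "\<bar>lik n v \<omega> - lik n v' \<omega>\<bar> \<le> (\<Sum>t=1..n. \<bar>ll n \<omega> v t (Y n t \<omega>) - ll n \<omega> v' t (Y n t \<omega>)\<bar>)"
    unfolding lik_def sum_subtractf[symmetric] by (rule sum_abs)
  also have "\<dots> \<le> (\<Sum>t=1..n. C * (2 + (norm (x n t \<omega>))\<^sup>2) * norm (v - v'))"
  proof (rule sum_mono)
    fix t assume t: "t \<in> {1..n}"
    then have "Y n t \<omega> \<le> B" using assms(3) by blast
    from order_trans[OF ll_lip[OF assms(2,4,5) this] coef_le]
    show "\<bar>ll n \<omega> v t (Y n t \<omega>) - ll n \<omega> v' t (Y n t \<omega>)\<bar> \<le> C * (2 + (norm (x n t \<omega>))\<^sup>2) * norm (v - v')" .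
  qed
  finally show ?thesis unfolding sum_coef[OF assms(1)] .
qed

text \<open>Wald's argument. Pointwise limits are used at 0 and at finitely many centres only; in
  between the likelihood is controlled by \<open>lik_lip\<close>, whose random constant is bounded
  in probability through \<open>X2\<close>.\<close>

lemma mle_consistent:
  assumes vh_max: "\<And>n \<omega>. \<omega> \<in> space M \<Longrightarrow> lik n 0 \<omega> \<le> lik n (vh n \<omega>) \<omega>"
    and conv: "\<And>v. v \<in> K \<Longrightarrow> AE \<omega> in M. (\<lambda>n. lik n v \<omega> / real n) \<longlonglongrightarrow> Q v"
    and uniq: "\<And>v. v \<in> K \<Longrightarrow> v \<noteq> 0 \<Longrightarrow> Q v < (Q 0 :: real)"
  shows "oP (\<lambda>n \<omega>. norm (vh n \<omega>))"
  unfolding oP_def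
proof (intro allI impI)
  fix e h :: real assume e: "0 < e" "0 < h"
  define N where "N = K \<inter> - ball 0 e"
  have N: "compact N" unfolding N_def using K_compact by (intro compact_Int_closed) auto
  have N0: "v \<noteq> 0" "v \<in> K" if "v \<in> N" for v using that e unfolding N_def by auto
  obtain cX where cX: "0 < cX" "\<forall>\<^sub>F n in sequentially. \<exists>A\<in>events. prob A \<le> h / 2 \<and> (\<forall>\<omega>\<in>space M - A. \<bar>X2 n \<omega>\<bar> \<le> cX)"
    using OPD[OF X2_OP, of "h / 2"] e by auto
  define Lc where "Lc = C * (2 + cX)"
  have Lc: "0 < Lc" unfolding Lc_def using C_pos cX by simp
  define gap where "gap = (\<lambda>v. Q 0 - Q v)"
  have gap: "0 < gap v" if "v \<in> N" for v unfolding gap_def using uniq N0[OF that] by simp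
  \<comment> \<open>Within this radius the normalised likelihood moves by at most a quarter of the
    gap, provided \<open>Lc\<close> bounds its Lipschitz constant.\<close>
  define r where "r = (\<lambda>v. gap v / (4 * Lc))"
  obtain T where T: "T \<subseteq> N" "finite T" "N \<subseteq> (\<Union>v\<in>T. ball v (r v))"
  proof (rule compactE_image[OF N, of N "\<lambda>v. ball v (r v)"])
    show "N \<subseteq> (\<Union>v\<in>N. ball v (r v))" using gap Lc unfolding r_def by force
  qed auto
  define Gm where "Gm = Min (insert 1 (gap ` T))"
  have Gm: "0 < Gm" unfolding Gm_def using T gap by (subst Min_gr_iff) auto
  have Gm_le: "Gm \<le> gap v" if "v \<in> T" for v unfolding Gm_def using T that by (intro Min_le) auto
  have dev: "oP (\<lambda>n \<omega>. \<Sum>v\<in>insert 0 T. \<bar>lik n v \<omega> / real n - Q v\<bar>)"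
  proof (intro oP_sum oP_abs)
    fix v assume "v \<in> insert 0 T"
    then have v: "v \<in> K" using T(1) N0(2) K0 by blast
    show "oP (\<lambda>n \<omega>. lik n v \<omega> / real n - Q v)"
    proof (rule oP_AE_limit)
      show "(\<lambda>\<omega>. lik n v \<omega> / real n - Q v) \<in> borel_measurable M" for n
        by (intro borel_measurable_diff borel_measurable_divide borel_measurable_const lik_measurable)
      show "AE \<omega> in M. (\<lambda>n. lik n v \<omega> / real n - Q v) \<longlonglongrightarrow> 0"
        using conv[OF v]
      proof eventually_elim
        case (elim \<omega>)
        from tendsto_diff[OF this tendsto_const, of "Q v"] show ?case by simp
      qed
    qed
  qed (use T in simp)
  have "0 < Gm / 4" "0 < h / 2" using Gm e by auto
  from cX(2) oPD[OF dev this] sequentially_1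
  show "\<forall>\<^sub>F n in sequentially. \<exists>A\<in>events. prob A \<le> h \<and> (\<forall>\<omega>\<in>space M - A. \<bar>norm (vh n \<omega>)\<bar> \<le> e)"
  proof eventually_elim
    case (elim n)
    note n1 = elim(3)
    show ?case
    proof (rule exceptional_mono[OF union_bound2[OF elim(1,2)]])
      show "h / 2 + h / 2 \<le> h" by simp
      show "AE \<omega> in M. \<bar>X2 n \<omega>\<bar> \<le> cX \<and> \<bar>\<Sum>v\<in>insert 0 T. \<bar>lik n v \<omega> / real n - Q v\<bar>\<bar> \<le> Gm / 4 \<longrightarrow> \<bar>norm (vh n \<omega>)\<bar> \<le> e"
        using Y_le_B[of n] AE_space
      proof eventually_elim
        case (elim \<omega>)
        note Yb = elim(1) and w = elim(2)
        show ?case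
        proof (rule impI, rule ccontr)
        assume a: "\<bar>X2 n \<omega>\<bar> \<le> cX \<and> \<bar>\<Sum>v\<in>insert 0 T. \<bar>lik n v \<omega> / real n - Q v\<bar>\<bar> \<le> Gm / 4" and c: "\<not> \<bar>norm (vh n \<omega>)\<bar> \<le> e"
        have n: "0 < real n" using n1 by simp
        have near: "\<bar>lik n v \<omega> / real n - Q v\<bar> \<le> Gm / 4" if "v \<in> insert 0 T" for v
        proof -
          have "\<bar>lik n v \<omega> / real n - Q v\<bar> \<le> (\<Sum>v\<in>insert 0 T. \<bar>lik n v \<omega> / real n - Q v\<bar>)"
            using T that by (intro member_le_sum) auto
          then show ?thesis using a by linarith
        qed
        have "vh n \<omega> \<in> N" unfolding N_def using vh_K[OF w] c by simp
        then obtain v where v: "v \<in> T" "dist v (vh n \<omega>) < r v" using T(3) by auto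
        have "\<bar>lik n (vh n \<omega>) \<omega> - lik n v \<omega>\<bar> \<le> real n * (C * (2 + X2 n \<omega>)) * norm (vh n \<omega> - v)"
          by (rule lik_lip[OF n1 w Yb vh_K[OF w]]) (use T(1) N0(2) v(1) in blast)
        also have "\<dots> \<le> real n * Lc * r v"
          unfolding Lc_def using v a C_pos X2_nonneg[of n \<omega>] cX by (intro mult_mono mult_nonneg_nonneg) (auto simp: dist_norm norm_minus_commute)
        also have "\<dots> = real n * (gap v / 4)" unfolding r_def using Lc by simp
        finally have "\<bar>lik n (vh n \<omega>) \<omega> / real n - lik n v \<omega> / real n\<bar> \<le> gap v / 4"
          unfolding diff_divide_distrib[symmetric] abs_divide using n by (simp add: field_simps)
        moreover have "lik n 0 \<omega> / real n \<le> lik n (vh n \<omega>) \<omega> / real n"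
          using vh_max[OF w] n by (simp add: divide_right_mono)
        \<comment> \<open>Three errors of at most a quarter gap each cannot bridge the gap between
          \<open>Q 0\<close> and \<open>Q v\<close>.\<close>
        moreover have False if "\<bar>a - b\<bar> \<le> (q0 - q) / 4" "c \<le> a" "\<bar>b - q\<bar> \<le> g / 4" "\<bar>c - q0\<bar> \<le> g / 4" "g \<le> q0 - q" "0 < g"
          for a b c q q0 g :: real using that unfolding abs_le_iff by argo
        ultimately show False
          using near[OF insertI2[OF v(1)]] near[OF insertI1] Gm_le[OF v(1)] Gm unfolding gap_def by blast
        qed
      qed
    qed
  qed
qed

lemma pm_ll: "ll n \<omega> 0 t b = ln (pm n \<omega> t b)"
  unfolding ll_def pm_def by simp

lemma B_pos: "1 \<le> B"
proof -
  obtain \<omega> where "\<omega> \<in> space M" using not_empty by auto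
  from m_bd[OF order_refl this] show ?thesis by simp
qed

lemma mu_sq_le: 
  assumes w: "\<omega> \<in> space M" 
  shows "(mu n \<omega> v t)\<^sup>2 \<le> 4 * (real B)\<^sup>2 * (\<Sum>b\<le>B. pm n \<omega> t b * (ll n \<omega> 0 t b - ll n \<omega> v t b))"
  unfolding mu_def pm_ll unfolding pm_def uu_def ll_def by (rule hellinger_bound[OF m_le[OF w]])

lemma sum_mu_sq_le:
  assumes w: "\<omega> \<in> space M" 
  shows "(\<Sum>t=1..n. (mu n \<omega> v t)\<^sup>2) \<le> 4 * (real B)\<^sup>2 * KL n \<omega> v"
  unfolding KL_def sum_distrib_left using mu_sq_le[OF w] by (intro sum_mono) (simp add: sum_distrib_left mult.assoc)

lemma mu_0: "\<omega> \<in> space M \<Longrightarrow> mu n \<omega> 0 t = 0"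
  unfolding mu_def using bounded_scores.U_cent[OF bounded_scores_true] by simp

text \<open>The likelihood inequality bounds the total divergence of the estimate by the centred log-likelihood
  process. This needs no curvature of the limit criterion, so singular information is allowed.\<close>
lemma KL_oP:
  assumes cons: "oP (\<lambda>n \<omega>. norm (vh n \<omega>))"
    and vh_max: "\<And>n \<omega>. \<omega> \<in> space M \<Longrightarrow> lik n 0 \<omega> \<le> lik n (vh n \<omega>) \<omega>"
  shows "oP (\<lambda>n \<omega>. KL n \<omega> (vh n \<omega>) / sqrt (real n))"
proof -
  let ?h = "\<lambda>n \<omega> v t y. ll n \<omega> v t (y t) - ll n \<omega> 0 t (y t)"
  let ?zs = "\<lambda>n \<omega> t. [(C *\<^sub>R x n t \<omega>, 0), (0, C)]"
  have u: "oP (\<lambda>n \<omega>. (\<Sum>t\<in>{1..n}. ?h n \<omega> (vh n \<omega>) t (Yv n \<omega>) - EE B (pm n \<omega>) {t} (?h n \<omega> (vh n \<omega>) t)) / sqrt (real n))"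
  proof (rule uniform_oP[where J="\<lambda>t. {t}" and zs="?zs" and h="?h" and D="C\<^sup>2", OF _ _ _ _ _ _ _ _ _ _ cons])
    fix n \<omega> v v' t and y :: "nat \<Rightarrow> nat" assume a: "\<omega> \<in> space M" "v \<in> K" "v' \<in> K" "\<And>r. r \<in> {t} \<Longrightarrow> y r \<le> B"
    show "\<bar>?h n \<omega> v t y - ?h n \<omega> v' t y\<bar> \<le> (\<Sum>z\<leftarrow>?zs n \<omega> t. \<bar>z \<bullet> v - z \<bullet> v'\<bar>)"
      using ll_lip[OF a(1-3), of "y t" n t] a(4) by simp
  next
    fix n :: nat and \<omega> assume n: "1 \<le> n"
    have "(\<Sum>t\<in>{1..n}. \<Sum>z\<leftarrow>?zs n \<omega> t. (norm z)\<^sup>2) = C\<^sup>2 * (\<Sum>t=1..n. (norm (x n t \<omega>))\<^sup>2) + real n * C\<^sup>2"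
      by (simp add: norm_coef power_mult_distrib sum.distrib sum_distrib_left)
    also have "\<dots> = real n * (C\<^sup>2 * (1 + X2 n \<omega>))" unfolding sum_norm_sq[OF n] by (simp add: algebra_simps)
    finally show "(\<Sum>t\<in>{1..n}. \<Sum>z\<leftarrow>?zs n \<omega> t. (norm z)\<^sup>2) \<le> real n * (C\<^sup>2 * (1 + X2 n \<omega>))" by simp
  qed (auto simp: disjoint_family_on_def intro!: borel_measurable_diff ll_G)
  show ?thesis
  proof (rule oP_mono[OF u], rule always_eventually, intro allI AE_I2)
    fix n \<omega> assume w: "\<omega> \<in> space M"
    interpret indep_pmf B "pm n \<omega>" by (rule indep_pmf_pm[OF w])
    have E: "EE B (pm n \<omega>) {t} (?h n \<omega> v t) = - (\<Sum>b\<le>B. pm n \<omega> t b * (ll n \<omega> 0 t b - ll n \<omega> v t b))" for v t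
      by (subst EE_insert) (auto simp: sum_negf[symmetric] algebra_simps intro!: sum.cong)
    \<comment> \<open>The centred process at the estimate equals the likelihood gain plus the
      divergence. Both are nonnegative, so the process bounds the divergence alone.\<close>
    have "(\<Sum>t\<in>{1..n}. ?h n \<omega> (vh n \<omega>) t (Yv n \<omega>) - EE B (pm n \<omega>) {t} (?h n \<omega> (vh n \<omega>) t))
      = (lik n (vh n \<omega>) \<omega> - lik n 0 \<omega>) + KL n \<omega> (vh n \<omega>)"
      unfolding E lik_def KL_def sum_subtractf[symmetric] sum.distrib[symmetric] by simp
    moreover have "0 \<le> KL n \<omega> (vh n \<omega>)"
    proof -
      have "0 \<le> 4 * (real B)\<^sup>2 * KL n \<omega> (vh n \<omega>)"
        by (rule order_trans[OF _ sum_mu_sq_le[OF w]]) (intro sum_nonneg, simp)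
      then show ?thesis using B_pos by (simp add: zero_le_mult_iff)
    qed
    ultimately show "\<bar>KL n \<omega> (vh n \<omega>) / sqrt (real n)\<bar> \<le> \<bar>(\<Sum>t\<in>{1..n}. ?h n \<omega> (vh n \<omega>) t (Yv n \<omega>) - EE B (pm n \<omega>) {t} (?h n \<omega> (vh n \<omega>) t)) / sqrt (real n)\<bar>"
      using vh_max[OF w, of n] by (simp add: abs_divide divide_right_mono)
  qed
qed

section \<open>Replacing the estimate by the truth in lag sums and variance sums\<close>

lemma mu_oP:
  assumes "oP (\<lambda>n \<omega>. KL n \<omega> (vh n \<omega>) / sqrt (real n))"
  shows "oP (\<lambda>n \<omega>. (\<Sum>t=1..n. (mu n \<omega> (vh n \<omega>) t)\<^sup>2) / sqrt (real n))"
proof (rule oP_mono[OF oP_cmult[OF assms, of "4 * (real B)\<^sup>2"]], rule always_eventually, intro allI AE_I2)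
  fix n \<omega> assume w: "\<omega> \<in> space M"
  have 0: "0 \<le> (\<Sum>t=1..n. (mu n \<omega> (vh n \<omega>) t)\<^sup>2)" by (intro sum_nonneg) auto
  then have "\<bar>(\<Sum>t=1..n. (mu n \<omega> (vh n \<omega>) t)\<^sup>2) / sqrt (real n)\<bar> = (\<Sum>t=1..n. (mu n \<omega> (vh n \<omega>) t)\<^sup>2) / sqrt (real n)" by simp
  also have "\<dots> \<le> (4 * (real B)\<^sup>2 * KL n \<omega> (vh n \<omega>)) / sqrt (real n)"
    by (intro divide_right_mono sum_mu_sq_le w) simp
  finally show "\<bar>(\<Sum>t=1..n. (mu n \<omega> (vh n \<omega>) t)\<^sup>2) / sqrt (real n)\<bar> \<le> \<bar>4 * (real B)\<^sup>2 * (KL n \<omega> (vh n \<omega>) / sqrt (real n))\<bar>"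
    using abs_ge_self[of "4 * (real B)\<^sup>2 * (KL n \<omega> (vh n \<omega>) / sqrt (real n))"] unfolding times_divide_eq_right by linarith
qed

text \<open>The pairs {t, t - a} overlap for different t, which \<open>uniform_oP\<close> forbids.
  Cutting time into blocks of length a puts t and t - a into adjacent blocks, so the pairs whose t
  lies in blocks of one parity are disjoint.\<close>

lemma lag_parity_oP:
  assumes cons: "oP (\<lambda>n \<omega>. norm (vh n \<omega>))" and a: "1 \<le> a"
  defines "I \<equiv> \<lambda>q n. {t \<in> {a+1..n}. ((t - 1) div a) mod 2 = q}"
  shows "oP (\<lambda>n \<omega>. (\<Sum>t\<in>I q n. (uu n \<omega> (vh n \<omega>) t (Y n t \<omega>) * uu n \<omega> (vh n \<omega>) (t - a) (Y n (t - a) \<omega>)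
      - uu n \<omega> 0 t (Y n t \<omega>) * uu n \<omega> 0 (t - a) (Y n (t - a) \<omega>)) - mu n \<omega> (vh n \<omega>) t * mu n \<omega> (vh n \<omega>) (t - a)) / sqrt (real n))"
proof -
  let ?h = "\<lambda>n \<omega> v t y. uu n \<omega> v t (y t) * uu n \<omega> v (t - a) (y (t - a)) - uu n \<omega> 0 t (y t) * uu n \<omega> 0 (t - a) (y (t - a))"
  \<comment> \<open>Product rule with scores bounded by B: one functional for each of the two
    regressors, and the one for \<sigma> with double weight because it enters both factors.\<close>
  let ?zs = "\<lambda>n \<omega> t. [real B *\<^sub>R (C *\<^sub>R x n t \<omega>, 0), real B *\<^sub>R (C *\<^sub>R x n (t - a) \<omega>, 0), (2 * real B) *\<^sub>R (0, C)]"
  have u: "oP (\<lambda>n \<omega>. (\<Sum>t\<in>I q n. ?h n \<omega> (vh n \<omega>) t (Yv n \<omega>) - EE B (pm n \<omega>) {t, t - a} (?h n \<omega> (vh n \<omega>) t)) / sqrt (real n))"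
  proof (rule uniform_oP[where J="\<lambda>t. {t, t - a}" and zs="?zs" and h="?h" and D="4 * (real B * C)\<^sup>2", OF _ _ _ _ _ _ _ _ _ _ cons])
    show "I q n \<subseteq> {1..n}" for n unfolding I_def by auto
    show "{t, t - a} \<subseteq> {1..n}" if "t \<in> I q n" for n t using that unfolding I_def by auto
    show "disjoint_family_on (\<lambda>t. {t, t - a}) (I q n)" for n
      unfolding disjoint_family_on_def
    proof (intro ballI impI)
      fix t t' assume t: "t \<in> I q n" "t' \<in> I q n" "t \<noteq> t'"
      have neq: "r - a \<noteq> r'" if r: "r \<in> I q n" "r' \<in> I q n" for r r'
      proof
        assume e: "r - a = r'"
        have "r - 1 = (r' - 1) + a" using r e unfolding I_def by auto
        then have step: "(r - 1) div a = Suc ((r' - 1) div a)" using a by simp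
        have "((r - 1) div a) mod 2 = q" "((r' - 1) div a) mod 2 = q" using r unfolding I_def by auto
        then have "Suc ((r' - 1) div a) mod 2 = ((r' - 1) div a) mod 2" using step by simp
        moreover have "Suc k mod 2 \<noteq> k mod 2" for k :: nat by presburger
        ultimately show False by blast
      qed
      have "t - a \<noteq> t' - a" using t unfolding I_def by auto
      then show "{t, t - a} \<inter> {t', t' - a} = {}" using t neq[of t t'] neq[of t' t] by auto
    qed
    show "?h n \<omega> v t y = ?h n \<omega> v t y'" if "\<And>r. r \<in> {t, t - a} \<Longrightarrow> y r = y' r" for n \<omega> v t and y y' :: "nat \<Rightarrow> nat"
      using that by simp
    show "(\<lambda>\<omega>. ?h n \<omega> v t y) \<in> borel_measurable G" if "t \<in> I q n" for n v t y
      using that a unfolding I_def by (intro borel_measurable_diff borel_measurable_times uu_G) auto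
  next
    fix n \<omega> v v' t and y :: "nat \<Rightarrow> nat" assume A: "\<omega> \<in> space M" "v \<in> K" "v' \<in> K" "\<And>r. r \<in> {t, t - a} \<Longrightarrow> y r \<le> B"
    let ?u = "uu n \<omega> v t (y t)" and ?w = "uu n \<omega> v (t - a) (y (t - a))" and ?u' = "uu n \<omega> v' t (y t)" and ?w' = "uu n \<omega> v' (t - a) (y (t - a))"
    have y: "y t \<le> B" "y (t - a) \<le> B" using A(4) by auto
    let ?d1 = "\<bar>(C *\<^sub>R x n t \<omega>, 0) \<bullet> v - (C *\<^sub>R x n t \<omega>, 0) \<bullet> v'\<bar>" and ?d2 = "\<bar>(C *\<^sub>R x n (t - a) \<omega>, 0) \<bullet> v - (C *\<^sub>R x n (t - a) \<omega>, 0) \<bullet> v'\<bar>"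
      and ?d3 = "\<bar>(0::real^'r, C) \<bullet> v - (0, C) \<bullet> v'\<bar>"
    have "\<bar>?u * ?w - ?u' * ?w'\<bar> = \<bar>(?u - ?u') * ?w + ?u' * (?w - ?w')\<bar>" by (simp add: algebra_simps)
    also have "\<dots> \<le> \<bar>?u - ?u'\<bar> * \<bar>?w\<bar> + \<bar>?u'\<bar> * \<bar>?w - ?w'\<bar>" unfolding abs_mult[symmetric] by (rule abs_triangle_ineq)
    also have "\<dots> \<le> (?d1 + ?d3) * real B + real B * (?d2 + ?d3)"
      by (intro add_mono mult_mono uu_lip uu_bound A y) auto
    also have "\<dots> = real B * ?d1 + real B * ?d2 + 2 * real B * ?d3" by (simp add: algebra_simps)
    also have "\<dots> = (\<Sum>z\<leftarrow>?zs n \<omega> t. \<bar>z \<bullet> v - z \<bullet> v'\<bar>)"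
    proof -
      have sc: "\<bar>(c *\<^sub>R z) \<bullet> v - (c *\<^sub>R z) \<bullet> v'\<bar> = c * \<bar>z \<bullet> v - z \<bullet> v'\<bar>" if "0 \<le> c" for c and z :: "(real^'r) \<times> real"
        using that unfolding inner_scaleR_left right_diff_distrib[symmetric] abs_mult by simp
      have "0 \<le> 2 * real B" "0 \<le> real B" by auto
      then show ?thesis by (simp only: list.map sum_list.Cons sum_list.Nil sc add_0_right add.assoc)
    qed
    finally show "\<bar>?h n \<omega> v t y - ?h n \<omega> v' t y\<bar> \<le> (\<Sum>z\<leftarrow>?zs n \<omega> t. \<bar>z \<bullet> v - z \<bullet> v'\<bar>)" by simp
  next
    fix n :: nat and \<omega> assume n: "1 \<le> n"
    have fin: "finite {a+1..n}" by simp
    have "(\<Sum>t\<in>I q n. \<Sum>z\<leftarrow>?zs n \<omega> t. (norm z)\<^sup>2) = (\<Sum>t\<in>I q n. (real B * C)\<^sup>2 * (norm (x n t \<omega>))\<^sup>2 + (real B * C)\<^sup>2 * (norm (x n (t - a) \<omega>))\<^sup>2 + 4 * (real B * C)\<^sup>2)"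
    proof (rule sum.cong[OF refl])
      fix t
      have nz: "(norm (c *\<^sub>R z))\<^sup>2 = c\<^sup>2 * (norm z)\<^sup>2" for c and z :: "(real^'r) \<times> real" by (simp add: power_mult_distrib)
      show "(\<Sum>z\<leftarrow>?zs n \<omega> t. (norm z)\<^sup>2) = (real B * C)\<^sup>2 * (norm (x n t \<omega>))\<^sup>2 + (real B * C)\<^sup>2 * (norm (x n (t - a) \<omega>))\<^sup>2 + 4 * (real B * C)\<^sup>2"
        unfolding list.map sum_list.Cons sum_list.Nil nz norm_coef by (simp add: power_mult_distrib)
    qed
    also have "\<dots> \<le> (\<Sum>t\<in>{a+1..n}. (real B * C)\<^sup>2 * (norm (x n t \<omega>))\<^sup>2 + (real B * C)\<^sup>2 * (norm (x n (t - a) \<omega>))\<^sup>2 + 4 * (real B * C)\<^sup>2)"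
      unfolding I_def by (intro sum_mono2) auto
    also have "\<dots> = (real B * C)\<^sup>2 * ((\<Sum>t=a+1..n. (norm (x n t \<omega>))\<^sup>2) + (\<Sum>t=a+1..n. (norm (x n (t - a) \<omega>))\<^sup>2) + 4 * real (n - a))"
      by (simp add: sum.distrib sum_distrib_left distrib_left)
    also have "\<dots> \<le> (real B * C)\<^sup>2 * (real n * X2 n \<omega> + real n * X2 n \<omega> + 4 * real n)"
      unfolding sum_norm_sq[OF n, symmetric]
      using sum_shift_le[where f="\<lambda>t. (norm (x n t \<omega>))\<^sup>2" and a=a and n=n] a by (intro mult_left_mono add_mono) auto
    also have "\<dots> \<le> real n * (4 * (real B * C)\<^sup>2 * (1 + X2 n \<omega>))"
    proof -
      have "(real B * C)\<^sup>2 * (real n * X2 n \<omega> + real n * X2 n \<omega> + 4 * real n) \<le> (real B * C)\<^sup>2 * (4 * real n * (1 + X2 n \<omega>))"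
        using X2_nonneg[of n \<omega>] by (intro mult_left_mono) (auto simp: algebra_simps)
      also have "\<dots> = real n * (4 * (real B * C)\<^sup>2 * (1 + X2 n \<omega>))" by simp
      finally show ?thesis .
    qed
    finally show "(\<Sum>t\<in>I q n. \<Sum>z\<leftarrow>?zs n \<omega> t. (norm z)\<^sup>2) \<le> real n * (4 * (real B * C)\<^sup>2 * (1 + X2 n \<omega>))" .
  qed auto
  show ?thesis
  proof (rule oP_mono[OF u], rule always_eventually, intro allI AE_I2)
    fix n \<omega> assume w: "\<omega> \<in> space M"
    interpret indep_pmf B "pm n \<omega>" by (rule indep_pmf_pm[OF w])
    \<comment> \<open>The two coordinates are distinct, hence independent, and the subtracted true
      scores have mean 0; what remains is the bias, the product of the fitted conditional
      means.\<close>
    have E: "EE B (pm n \<omega>) {t, t - a} (?h n \<omega> v t) = mu n \<omega> v t * mu n \<omega> v (t - a)" if t: "t \<in> I q n" for v t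
    proof -
      have ta: "t \<noteq> t - a" using t a unfolding I_def by auto
      have P: "EE B (pm n \<omega>) {t, t - a} (\<lambda>y. f (y t) * g (y (t - a))) = (\<Sum>b\<le>B. pm n \<omega> t b * f b) * (\<Sum>b\<le>B. pm n \<omega> (t - a) b * g b)" for f g :: "nat \<Rightarrow> real"
      proof -
        have "EE B (pm n \<omega>) {t, t - a} (\<lambda>y. f (y t) * g (y (t - a))) = (\<Sum>b\<le>B. pm n \<omega> t b *\<^sub>R EE B (pm n \<omega>) {t - a} (\<lambda>y. f b * g (y (t - a))))"
          using ta by (subst EE_insert) auto
        also have "\<dots> = (\<Sum>b\<le>B. pm n \<omega> t b * f b * (\<Sum>b\<le>B. pm n \<omega> (t - a) b * g b))"
          by (intro sum.cong refl) (simp add: EE_cmult, simp add: EE_insert)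
        finally show ?thesis by (simp add: sum_distrib_right)
      qed
      show ?thesis unfolding EE_diff P mu_def[symmetric] mu_0[OF w] by simp
    qed
    have "(\<Sum>t\<in>I q n. ?h n \<omega> (vh n \<omega>) t (Yv n \<omega>) - EE B (pm n \<omega>) {t, t - a} (?h n \<omega> (vh n \<omega>) t)) =
      (\<Sum>t\<in>I q n. ?h n \<omega> (vh n \<omega>) t (Yv n \<omega>) - mu n \<omega> (vh n \<omega>) t * mu n \<omega> (vh n \<omega>) (t - a))"
      by (intro sum.cong refl) (simp only: E)
    then show "\<bar>(\<Sum>t\<in>I q n. ?h n \<omega> (vh n \<omega>) t (Yv n \<omega>) - mu n \<omega> (vh n \<omega>) t * mu n \<omega> (vh n \<omega>) (t - a)) / sqrt (real n)\<bar>
      \<le> \<bar>(\<Sum>t\<in>I q n. ?h n \<omega> (vh n \<omega>) t (Yv n \<omega>) - EE B (pm n \<omega>) {t, t - a} (?h n \<omega> (vh n \<omega>) t)) / sqrt (real n)\<bar>"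
      by simp
  qed
qed

text \<open>The two parity classes cover all t. The bias they leave is a sum of products mu t * mu
  (t - a), which by the arithmetic-geometric mean inequality is at most the sum of all mu^2.\<close>

lemma WW_oP:
  assumes cons: "oP (\<lambda>n \<omega>. norm (vh n \<omega>))" and mu: "oP (\<lambda>n \<omega>. (\<Sum>t=1..n. (mu n \<omega> (vh n \<omega>) t)\<^sup>2) / sqrt (real n))"
    and a: "1 \<le> a"
  shows "oP (\<lambda>n \<omega>. (WW n a (vh n \<omega>) \<omega> - WW n a 0 \<omega>) / sqrt (real n))"
proof -
  let ?I = "\<lambda>q n. {t \<in> {a+1..n}. ((t - 1) div a) mod 2 = q}"
  let ?T = "\<lambda>n \<omega> t. (uu n \<omega> (vh n \<omega>) t (Y n t \<omega>) * uu n \<omega> (vh n \<omega>) (t - a) (Y n (t - a) \<omega>)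
      - uu n \<omega> 0 t (Y n t \<omega>) * uu n \<omega> 0 (t - a) (Y n (t - a) \<omega>)) - mu n \<omega> (vh n \<omega>) t * mu n \<omega> (vh n \<omega>) (t - a)"
  let ?M = "\<lambda>n \<omega>. (\<Sum>t=1..n. (mu n \<omega> (vh n \<omega>) t)\<^sup>2) / sqrt (real n)"
  have "oP (\<lambda>n \<omega>. (\<bar>(\<Sum>t\<in>?I 0 n. ?T n \<omega> t) / sqrt (real n)\<bar> + \<bar>(\<Sum>t\<in>?I 1 n. ?T n \<omega> t) / sqrt (real n)\<bar>) + ?M n \<omega>)"
    by (intro oP_add oP_abs lag_parity_oP[OF cons a] mu)
  then show ?thesis
  proof (rule oP_mono, intro always_eventually allI AE_I2)
    fix n \<omega>
    let ?mm = "\<Sum>t=a+1..n. mu n \<omega> (vh n \<omega>) t * mu n \<omega> (vh n \<omega>) (t - a)"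
    have "(\<Sum>t=a+1..n. ?T n \<omega> t) = (\<Sum>t\<in>?I 0 n \<union> ?I 1 n. ?T n \<omega> t)"
      by (rule sum.cong) auto
    also have "\<dots> = (\<Sum>t\<in>?I 0 n. ?T n \<omega> t) + (\<Sum>t\<in>?I 1 n. ?T n \<omega> t)" by (rule sum.union_disjoint) auto
    also have "(\<Sum>t=a+1..n. ?T n \<omega> t) = (WW n a (vh n \<omega>) \<omega> - WW n a 0 \<omega>) - ?mm"
      unfolding WW_def sum_subtractf ..
    finally have eq: "WW n a (vh n \<omega>) \<omega> - WW n a 0 \<omega> = (\<Sum>t\<in>?I 0 n. ?T n \<omega> t) + (\<Sum>t\<in>?I 1 n. ?T n \<omega> t) + ?mm" by simp
    have "\<bar>?mm\<bar> \<le> (\<Sum>t=a+1..n. \<bar>mu n \<omega> (vh n \<omega>) t * mu n \<omega> (vh n \<omega>) (t - a)\<bar>)" by (rule sum_abs)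
    also have "\<dots> \<le> (\<Sum>t=a+1..n. ((mu n \<omega> (vh n \<omega>) t)\<^sup>2 + (mu n \<omega> (vh n \<omega>) (t - a))\<^sup>2) / 2)"
    proof (rule sum_mono)
      fix t
      show "\<bar>mu n \<omega> (vh n \<omega>) t * mu n \<omega> (vh n \<omega>) (t - a)\<bar> \<le> ((mu n \<omega> (vh n \<omega>) t)\<^sup>2 + (mu n \<omega> (vh n \<omega>) (t - a))\<^sup>2) / 2"
        using sum_squares_bound[of "\<bar>mu n \<omega> (vh n \<omega>) t\<bar>" "\<bar>mu n \<omega> (vh n \<omega>) (t - a)\<bar>"] by (simp add: abs_mult)
    qed
    also have "\<dots> = ((\<Sum>t=a+1..n. (mu n \<omega> (vh n \<omega>) t)\<^sup>2) + (\<Sum>t=a+1..n. (mu n \<omega> (vh n \<omega>) (t - a))\<^sup>2)) / 2"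
      by (simp add: sum_divide_distrib[symmetric] sum.distrib)
    also have "\<dots> \<le> (\<Sum>t=1..n. (mu n \<omega> (vh n \<omega>) t)\<^sup>2)"
      using sum_shift_le[where f="\<lambda>t. (mu n \<omega> (vh n \<omega>) t)\<^sup>2" and a=a and n=n] a by simp
    finally have mm: "\<bar>?mm\<bar> \<le> (\<Sum>t=1..n. (mu n \<omega> (vh n \<omega>) t)\<^sup>2)" .
    have "\<bar>(p + q + r) / s'\<bar> \<le> \<bar>(\<bar>p / s'\<bar> + \<bar>q / s'\<bar>) + R / s'\<bar>" if "\<bar>r\<bar> \<le> R" "0 \<le> s'" for p q r R s' :: real
    proof -
      have "\<bar>(p + q + r) / s'\<bar> \<le> \<bar>p / s'\<bar> + \<bar>q / s'\<bar> + \<bar>r / s'\<bar>" unfolding add_divide_distrib by linarith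
      also have "\<bar>r / s'\<bar> \<le> R / s'" using that by (simp add: abs_divide divide_right_mono)
      finally show ?thesis by linarith
    qed
    from this[OF mm, of "sqrt (real n)"]
    show "\<bar>(WW n a (vh n \<omega>) \<omega> - WW n a 0 \<omega>) / sqrt (real n)\<bar> \<le> \<bar>(\<bar>(\<Sum>t\<in>?I 0 n. ?T n \<omega> t) / sqrt (real n)\<bar> + \<bar>(\<Sum>t\<in>?I 1 n. ?T n \<omega> t) / sqrt (real n)\<bar>) + ?M n \<omega>\<bar>"
      unfolding eq by simp
  qed
qed

text \<open>The score variances are bounded by B^2 and Lipschitz, so the average change of their lag
  products is of order (2 + X2) * norm vh, and \<open>X2\<close> is bounded in probability.\<close>

lemma LL_oP:
  assumes cons: "oP (\<lambda>n \<omega>. norm (vh n \<omega>))" and a: "1 \<le> a"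
  shows "oP (\<lambda>n \<omega>. (LL n a (vh n \<omega>) \<omega> - LL n a 0 \<omega>) / real n)"
proof -
  let ?c = "2 * (real B)\<^sup>2 * C"
  have "oP (\<lambda>n \<omega>. (2 + X2 n \<omega>) * norm (vh n \<omega>))" by (intro oP_OP_mult OP_add OP_const X2_OP cons)
  from oP_cmult[OF this, of ?c] show ?thesis
  proof (rule oP_mono, intro eventually_mono[OF sequentially_1] AE_I2)
    fix n :: nat and \<omega> assume n: "1 \<le> n" and w: "\<omega> \<in> space M"
    let ?f = "ee n \<omega> (vh n \<omega>)" and ?g = "ee n \<omega> 0"
    let ?b = "\<lambda>t. C * (2 + (norm (x n t \<omega>))\<^sup>2) * norm (vh n \<omega>)"
    have d: "\<bar>?f t - ?g t\<bar> \<le> ?b t" for t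
      using order_trans[OF ee_lip[OF w vh_K[OF w] K0] coef_le] by simp
    have "\<bar>LL n a (vh n \<omega>) \<omega> - LL n a 0 \<omega>\<bar> \<le> (\<Sum>t=a+1..n. \<bar>?f t * ?f (t - a) - ?g t * ?g (t - a)\<bar>)"
      unfolding LL_def sum_subtractf[symmetric] by (rule sum_abs)
    also have "\<dots> \<le> (\<Sum>t=a+1..n. (real B)\<^sup>2 * ?b t + (real B)\<^sup>2 * ?b (t - a))"
    proof (rule sum_mono)
      fix t
      have "\<bar>?f t * ?f (t - a) - ?g t * ?g (t - a)\<bar> = \<bar>?f (t - a) * (?f t - ?g t) + ?g t * (?f (t - a) - ?g (t - a))\<bar>"
        by (simp add: algebra_simps)
      also have "\<dots> \<le> \<bar>?f (t - a)\<bar> * \<bar>?f t - ?g t\<bar> + \<bar>?g t\<bar> * \<bar>?f (t - a) - ?g (t - a)\<bar>"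
        unfolding abs_mult[symmetric] by (rule abs_triangle_ineq)
      also have "\<dots> \<le> (real B)\<^sup>2 * ?b t + (real B)\<^sup>2 * ?b (t - a)"
        using ee_nonneg[OF w] ee_le[OF w] by (intro add_mono mult_mono d) auto
      finally show "\<bar>?f t * ?f (t - a) - ?g t * ?g (t - a)\<bar> \<le> (real B)\<^sup>2 * ?b t + (real B)\<^sup>2 * ?b (t - a)" .
    qed
    also have "\<dots> = (real B)\<^sup>2 * ((\<Sum>t=a+1..n. ?b t) + (\<Sum>t=a+1..n. ?b (t - a)))"
      by (simp add: sum.distrib sum_distrib_left distrib_left)
    also have "\<dots> \<le> (real B)\<^sup>2 * ((\<Sum>t=1..n. ?b t) + (\<Sum>t=1..n. ?b t))"
      using C_pos by (intro mult_left_mono add_mono sum_shift_le a) auto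
    also have "\<dots> = real n * (?c * ((2 + X2 n \<omega>) * norm (vh n \<omega>)))" unfolding sum_coef[OF n] by (simp add: algebra_simps)
    finally have "\<bar>LL n a (vh n \<omega>) \<omega> - LL n a 0 \<omega>\<bar> / real n \<le> ?c * ((2 + X2 n \<omega>) * norm (vh n \<omega>))"
      using n by (simp add: field_simps)
    then show "\<bar>(LL n a (vh n \<omega>) \<omega> - LL n a 0 \<omega>) / real n\<bar> \<le> \<bar>?c * ((2 + X2 n \<omega>) * norm (vh n \<omega>))\<bar>"
      by (simp only: abs_divide abs_of_nat)
  qed
qed

end

section \<open>The statistic at the estimate\<close>

lemma lap_err_nonneg: "0 \<le> Y \<Longrightarrow> 0 \<le> lap_err L Y n"
  unfolding lap_err_def by (intro integral_nonneg_AE AE_I2 clt_err_bounds sum_nonneg) auto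

text \<open>On nonnegative arguments z, exp (- k * z) is Lipschitz with constant k and takes values
  in [0, 1], so closeness outside a rare event is enough.\<close>

lemma (in prob_space) laplace_transfer:
  fixes Z Z' :: "nat \<Rightarrow> 'a \<Rightarrow> real"
  assumes meas: "\<And>n. Z n \<in> borel_measurable M" "\<And>n. Z' n \<in> borel_measurable M"
    and nn: "\<And>n \<omega>. \<omega> \<in> space M \<Longrightarrow> 0 \<le> Z n \<omega>" "\<And>n \<omega>. \<omega> \<in> space M \<Longrightarrow> 0 \<le> Z' n \<omega>"
    and d: "oP (\<lambda>n \<omega>. Z n \<omega> - Z' n \<omega>)" and k: "0 \<le> k"
    and lim: "(\<lambda>n. expectation (\<lambda>\<omega>. exp (- k * Z' n \<omega>))) \<longlonglongrightarrow> l"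
  shows "(\<lambda>n. expectation (\<lambda>\<omega>. exp (- k * Z n \<omega>))) \<longlonglongrightarrow> l"
proof -
  have int: "integrable M (\<lambda>\<omega>. exp (- k * X \<omega>))" if "X \<in> borel_measurable M" "\<And>\<omega>. \<omega> \<in> space M \<Longrightarrow> 0 \<le> X \<omega>" for X
    using that k by (intro integrable_const_bound[where B=1]) (auto intro!: AE_I2)
  have iZ: "integrable M (\<lambda>\<omega>. exp (- k * Z n \<omega>))" for n
    by (rule int[OF meas(1)]) (rule nn(1))
  have iZ': "integrable M (\<lambda>\<omega>. exp (- k * Z' n \<omega>))" for n
    by (rule int[OF meas(2)]) (rule nn(2))
  have "(\<lambda>n. expectation (\<lambda>\<omega>. exp (- k * Z n \<omega>)) - expectation (\<lambda>\<omega>. exp (- k * Z' n \<omega>))) \<longlonglongrightarrow> 0"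
  proof (rule tendstoI)
    fix e :: real assume e: "0 < e"
    define e' where "e' = e / (4 * (k + 1))"
    have e': "0 < e'" "k * e' \<le> e / 4" unfolding e'_def using e k by (auto simp: field_simps)
    have "0 < e / 4" using e by simp
    from oPD[OF d e'(1) this]
    show "\<forall>\<^sub>F n in sequentially. dist (expectation (\<lambda>\<omega>. exp (- k * Z n \<omega>)) - expectation (\<lambda>\<omega>. exp (- k * Z' n \<omega>))) 0 < e"
    proof eventually_elim
      case (elim n)
      then obtain A where A: "A \<in> events" "prob A \<le> e / 4" "\<forall>\<omega>\<in>space M - A. \<bar>Z n \<omega> - Z' n \<omega>\<bar> \<le> e'" by blast
      have iA: "integrable M (\<lambda>\<omega>. e / 4 + indicator A \<omega>)" using A(1) by (intro Bochner_Integration.integrable_add) (auto simp: emeasure_eq_measure)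
      have "\<bar>expectation (\<lambda>\<omega>. exp (- k * Z n \<omega>) - exp (- k * Z' n \<omega>))\<bar> \<le> expectation (\<lambda>\<omega>. \<bar>exp (- k * Z n \<omega>) - exp (- k * Z' n \<omega>)\<bar>)"
        by (rule integral_abs_bound)
      also have "\<dots> \<le> expectation (\<lambda>\<omega>. e / 4 + indicator A \<omega>)"
      proof (rule integral_mono[OF _ iA])
        show "integrable M (\<lambda>\<omega>. \<bar>exp (- k * Z n \<omega>) - exp (- k * Z' n \<omega>)\<bar>)" by (intro integrable_abs Bochner_Integration.integrable_diff iZ iZ')
        fix \<omega> assume w: "\<omega> \<in> space M"
        have kz: "0 \<le> k * Z n \<omega>" "0 \<le> k * Z' n \<omega>" using nn[OF w] k by auto
        show "\<bar>exp (- k * Z n \<omega>) - exp (- k * Z' n \<omega>)\<bar> \<le> e / 4 + indicator A \<omega>"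
        proof (cases "\<omega> \<in> A")
          case True
          have "exp (- (k * Z n \<omega>)) \<le> 1" "exp (- (k * Z' n \<omega>)) \<le> 1" using kz by auto
          moreover have "0 < exp (- (k * Z n \<omega>))" "0 < exp (- (k * Z' n \<omega>))" by auto
          ultimately have "\<bar>exp (- (k * Z n \<omega>)) - exp (- (k * Z' n \<omega>))\<bar> \<le> 1" unfolding abs_le_iff by linarith
          then show ?thesis using True e by simp
        next
          case False
          have "\<bar>exp (- (k * Z n \<omega>)) - exp (- (k * Z' n \<omega>))\<bar> \<le> \<bar>k * Z n \<omega> - k * Z' n \<omega>\<bar>" by (rule exp_neg_lipschitz[OF kz])
          also have "\<dots> = k * \<bar>Z n \<omega> - Z' n \<omega>\<bar>" using k by (simp add: abs_mult flip: right_diff_distrib)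
          also have "\<dots> \<le> k * e'" using A(3) w False k by (intro mult_left_mono) auto
          finally show ?thesis using e'(2) False by simp
        qed
      qed
      also have "\<dots> = e / 4 + prob A" using A(1) prob_space by (subst Bochner_Integration.integral_add) (auto simp: emeasure_eq_measure)
      finally have "\<bar>expectation (\<lambda>\<omega>. exp (- k * Z n \<omega>) - exp (- k * Z' n \<omega>))\<bar> < e" using A(2) e by linarith
      then show ?case unfolding dist_real_def diff_0_right Bochner_Integration.integral_diff[OF iZ iZ', symmetric] .
    qed
  qed
  from tendsto_add[OF this lim] show ?thesis by simp
qed

section \<open>Weak limit of the statistic\<close>

context panel_mle
begin

text \<open>\<open>es_lower\<close> asks for a bounded predictor, but regressors may be unbounded. A
  Chebyshev count with \<open>X2\<close> shows that norm x exceeds \<open>Kb\<close> at only a small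
  share of times; each of the remaining pairs contributes at least c0^2.\<close>

lemma LL_lower:
  assumes h: "0 < h"
  obtains c where "0 < c" "\<forall>\<^sub>F n in sequentially. \<exists>A\<in>events. prob A \<le> h \<and> (\<forall>\<omega>\<in>space M - A. \<forall>a\<in>{1..L}. c * real n \<le> LL n a 0 \<omega>)"
proof -
  obtain cX where cX: "0 < cX" "\<forall>\<^sub>F n in sequentially. \<exists>A\<in>events. prob A \<le> h \<and> (\<forall>\<omega>\<in>space M - A. \<bar>X2 n \<omega>\<bar> \<le> cX)"
    using OPD[OF X2_OP h] by auto
  \<comment> \<open>With Kb^2 = 8 * cX, each of the two positions of a pair is bad at most n / 8
    times; together with a <= n / 4 this leaves n / 2 good pairs.\<close>
  define Kb where "Kb = sqrt (8 * cX)"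
  have Kb: "0 < Kb" "Kb\<^sup>2 = 8 * cX" unfolding Kb_def using cX by auto
  have s0: "0 \<le> s" using s_pos by simp
  obtain c0 where c0: "0 < c0" "\<And>k \<eta>. 1 \<le> k \<Longrightarrow> k \<le> B \<Longrightarrow> \<bar>\<eta>\<bar> \<le> Kb * norm \<beta>0 \<Longrightarrow> c0 \<le> es k \<eta> s"
    using es_lower[OF s0, of B "Kb * norm \<beta>0"] by blast
  show thesis
  proof (rule that[of "c0\<^sup>2 / 2"])
    show "0 < c0\<^sup>2 / 2" using c0 by simp
    have "\<forall>\<^sub>F n in sequentially. 4 * L \<le> n" by (rule eventually_ge_at_top)
    with cX(2) sequentially_1
    show "\<forall>\<^sub>F n in sequentially. \<exists>A\<in>events. prob A \<le> h \<and> (\<forall>\<omega>\<in>space M - A. \<forall>a\<in>{1..L}. c0\<^sup>2 / 2 * real n \<le> LL n a 0 \<omega>)"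
    proof eventually_elim
      case (elim n)
      note n = elim(2,3)
      show ?case
      proof (rule exceptional_mono[OF elim(1) _ order_refl], intro AE_I2 impI ballI)
        fix \<omega> a assume w: "\<omega> \<in> space M" and X: "\<bar>X2 n \<omega>\<bar> \<le> cX" and a: "a \<in> {1..L}"
        let ?q = "\<lambda>t. (norm (x n t \<omega>))\<^sup>2 / Kb\<^sup>2"
        have ee_low: "c0 \<le> ee n \<omega> 0 t" if "norm (x n t \<omega>) \<le> Kb" for t
        proof -
          have "\<bar>x n t \<omega> \<bullet> \<beta>0\<bar> \<le> norm (x n t \<omega>) * norm \<beta>0" by (rule Cauchy_Schwarz_ineq2)
          also have "\<dots> \<le> Kb * norm \<beta>0" using that by (intro mult_right_mono) auto
          finally show ?thesis using c0(2)[of "m (max 1 t) \<omega>" "x n t \<omega> \<bullet> \<beta>0"] m_bd[of "max 1 t" \<omega>] w unfolding ee_def by simp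
        qed
        have q1: "1 \<le> ?q t" if "\<not> norm (x n t \<omega>) \<le> Kb" for t
        proof -
          have "Kb\<^sup>2 \<le> (norm (x n t \<omega>))\<^sup>2" using that Kb by (intro power_mono) auto
          then show ?thesis using Kb(1) by simp
        qed
        \<comment> \<open>The factor 1 - ?q t - ?q (t - a) is at most 1, and it is nonpositive as
          soon as one of the two regressors is large, so it minorises the indicator of a good
          pair.\<close>
        have "c0\<^sup>2 * (real (n - a) - 2 * (real n * X2 n \<omega> / Kb\<^sup>2)) \<le> (\<Sum>t=a+1..n. c0\<^sup>2 * (1 - ?q t - ?q (t - a)))"
        proof -
          have "(\<Sum>t=a+1..n. ?q t) \<le> real n * X2 n \<omega> / Kb\<^sup>2" "(\<Sum>t=a+1..n. ?q (t - a)) \<le> real n * X2 n \<omega> / Kb\<^sup>2"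
            using sum_shift_le[where f="\<lambda>t. (norm (x n t \<omega>))\<^sup>2" and a=a and n=n] a unfolding sum_divide_distrib[symmetric] sum_norm_sq[OF n(1), symmetric]
            by (auto intro!: divide_right_mono)
          then have "real (n - a) - 2 * (real n * X2 n \<omega> / Kb\<^sup>2) \<le> (\<Sum>t=a+1..n. 1 - ?q t - ?q (t - a))"
          proof -
            have one: "(\<Sum>t=a+1..n. 1 :: real) = real (n - a)" by simp
            have "r - 2 * X \<le> r - p - q" if "p \<le> X \<and> q \<le> X" for p q r X :: real using that by linarith
            from this[OF conjI, OF \<open>(\<Sum>t=a+1..n. ?q t) \<le> _\<close> \<open>(\<Sum>t=a+1..n. ?q (t - a)) \<le> _\<close>]
            show ?thesis unfolding sum_subtractf one .
          qed
          then show ?thesis unfolding sum_distrib_left[symmetric] by (intro mult_left_mono) auto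
        qed
        also have "\<dots> \<le> LL n a 0 \<omega>" unfolding LL_def
        proof (rule sum_mono)
          fix t
          show "c0\<^sup>2 * (1 - ?q t - ?q (t - a)) \<le> ee n \<omega> 0 t * ee n \<omega> 0 (t - a)"
          proof (cases "norm (x n t \<omega>) \<le> Kb \<and> norm (x n (t - a) \<omega>) \<le> Kb")
            case True
            have "c0\<^sup>2 * (1 - ?q t - ?q (t - a)) \<le> c0 * c0"
            proof -
              have "0 \<le> ?q t" "0 \<le> ?q (t - a)" by auto
              then have "1 - ?q t - ?q (t - a) \<le> 1" by linarith
              then have "c0\<^sup>2 * (1 - ?q t - ?q (t - a)) \<le> c0\<^sup>2 * 1" by (rule mult_left_mono) simp
              then show ?thesis by (simp add: power2_eq_square)
            qed
            also have "\<dots> \<le> ee n \<omega> 0 t * ee n \<omega> 0 (t - a)" using True c0(1) by (intro mult_mono ee_low ee_nonneg w) auto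
            finally show ?thesis .
          next
            case False
            then have "1 \<le> ?q t \<or> 1 \<le> ?q (t - a)" using q1 by blast
            moreover have "0 \<le> ?q t" "0 \<le> ?q (t - a)" by auto
            ultimately have "1 - ?q t - ?q (t - a) \<le> 0" by linarith
            then have "c0\<^sup>2 * (1 - ?q t - ?q (t - a)) \<le> 0" by (simp add: mult_nonneg_nonpos)
            also have "0 \<le> ee n \<omega> 0 t * ee n \<omega> 0 (t - a)" by (intro mult_nonneg_nonneg ee_nonneg w)
            finally show ?thesis .
          qed
        qed
        finally have low: "c0\<^sup>2 * (real (n - a) - 2 * (real n * X2 n \<omega> / Kb\<^sup>2)) \<le> LL n a 0 \<omega>" .
        have "real n * X2 n \<omega> / Kb\<^sup>2 \<le> real n * cX / Kb\<^sup>2" using X by (intro divide_right_mono mult_left_mono) auto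
        also have "\<dots> = real n / 8" unfolding Kb(2) using cX(1) by simp
        finally have "real n * X2 n \<omega> / Kb\<^sup>2 \<le> real n / 8" .
        moreover have "real a \<le> real n / 4" using n(2) a by simp
        moreover have "real (n - a) = real n - real a" using n(2) a by (simp add: of_nat_diff)
        ultimately have "real n / 2 \<le> real (n - a) - 2 * (real n * X2 n \<omega> / Kb\<^sup>2)" by linarith
        then have "c0\<^sup>2 * (real n / 2) \<le> c0\<^sup>2 * (real (n - a) - 2 * (real n * X2 n \<omega> / Kb\<^sup>2))" by (intro mult_left_mono) auto
        moreover have "c0\<^sup>2 / 2 * real n = c0\<^sup>2 * (real n / 2)" by simp
        ultimately show "c0\<^sup>2 / 2 * real n \<le> LL n a 0 \<omega>" using low by linarith
      qed
    qed
  qed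
qed

text \<open>\<open>WW\<close> at the true parameter with a free response path y: the form to which
  \<open>cond_expectation\<close> applies, and which for fixed \<omega> is
  \<open>bounded_scores.W\<close>.\<close>

definition W0 :: "nat \<Rightarrow> nat \<Rightarrow> 'a \<Rightarrow> (nat \<Rightarrow> nat) \<Rightarrow> real" where
  "W0 n a \<omega> y = (\<Sum>t=a+1..n. uu n \<omega> 0 t (y t) * uu n \<omega> 0 (t - a) (y (t - a)))"

lemma WW_W0: "WW n a 0 \<omega> = W0 n a \<omega> (Yv n \<omega>)"
  unfolding WW_def W0_def ..

lemma W0_W: "\<omega> \<in> space M \<Longrightarrow> W0 n a \<omega> = bounded_scores.W (uu n \<omega> 0) n a"
  by (rule ext) (simp add: W0_def bounded_scores.W_def[OF bounded_scores_true])

lemma LL_Lam: "\<omega> \<in> space M \<Longrightarrow> LL n a 0 \<omega> = bounded_scores.Lam B (pm n \<omega>) (uu n \<omega> 0) n a"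
  unfolding LL_def bounded_scores.Lam_def[OF bounded_scores_true] by (simp add: v_ee)

lemma W0_G: "1 \<le> a \<Longrightarrow> (\<lambda>\<omega>. W0 n a \<omega> y) \<in> borel_measurable G"
  unfolding W0_def by (intro borel_measurable_sum borel_measurable_times uu_G) auto

lemma LL_G: "1 \<le> a \<Longrightarrow> (\<lambda>\<omega>. LL n a v \<omega>) \<in> borel_measurable G"
  unfolding LL_def by (intro borel_measurable_sum borel_measurable_times ee_G) auto

lemma W0_dep: "1 \<le> a \<Longrightarrow> (\<And>t. t \<in> {1..n} \<Longrightarrow> y t = y' t) \<Longrightarrow> W0 n a \<omega> y = W0 n a \<omega> y'"
  unfolding W0_def
proof (rule sum.cong[OF refl])
  fix t assume "1 \<le> a" and y: "\<And>t. t \<in> {1..n} \<Longrightarrow> y t = y' t" and t: "t \<in> {a+1..n}"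
  then have "y t = y' t" "y (t - a) = y' (t - a)" by (auto intro!: y)
  then show "uu n \<omega> 0 t (y t) * uu n \<omega> 0 (t - a) (y (t - a)) = uu n \<omega> 0 t (y' t) * uu n \<omega> 0 (t - a) (y' (t - a))" by simp
qed

lemma W0_bound:
  assumes "\<omega> \<in> space M" "y \<in> supp n" "1 \<le> a" shows "\<bar>W0 n a \<omega> y\<bar> \<le> real n * (real B * real B)"
proof -
  have "\<bar>W0 n a \<omega> y\<bar> \<le> (\<Sum>t=a+1..n. real B * real B)" unfolding W0_def
  proof (rule order_trans[OF sum_abs], rule sum_mono)
    fix t assume "t \<in> {a+1..n}"
    then have "t \<in> {1..n}" "t - a \<in> {1..n}" using assms(3) by auto
    then have "y t \<le> B" "y (t - a) \<le> B" using PiE_mem[OF assms(2)] by auto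
    then show "\<bar>uu n \<omega> 0 t (y t) * uu n \<omega> 0 (t - a) (y (t - a))\<bar> \<le> real B * real B"
      unfolding abs_mult by (intro mult_mono uu_bound assms) auto
  qed
  also have "\<dots> \<le> real n * (real B * real B)" by (simp add: mult_right_mono)
  finally show ?thesis .
qed

text \<open>Orthogonality of the lag products bounds the conditional second moment of the lag sum by
  n * B^4, whatever the value conditioned on.\<close>

lemma WW0_OP:
  assumes a: "1 \<le> a"
  shows "OP (\<lambda>n \<omega>. WW n a 0 \<omega> / sqrt (real n))"
proof -
  have "OP (\<lambda>n \<omega>. (WW n a 0 \<omega>)\<^sup>2 / real n)"
  proof (rule OP_expectation[where c="((real B)\<^sup>2)\<^sup>2"], intro eventually_mono[OF sequentially_1] conjI AE_I2)
    fix n :: nat assume n: "1 \<le> n"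
    let ?\<phi> = "\<lambda>\<omega> y. (W0 n a \<omega> y)\<^sup>2 / real n"
    have G: "(\<lambda>\<omega>. ?\<phi> \<omega> y) \<in> borel_measurable G" for y by (intro borel_measurable_divide borel_measurable_power W0_G a borel_measurable_const)
    have I: "integrable M (\<lambda>\<omega>. ?\<phi> \<omega> y)" if y: "y \<in> supp n" for y
    proof (rule integrable_const_bound[where B="(real n * (real B * real B))\<^sup>2 / real n"])
      show "AE \<omega> in M. norm (?\<phi> \<omega> y) \<le> (real n * (real B * real B))\<^sup>2 / real n"
      proof (rule AE_I2)
        fix \<omega> assume "\<omega> \<in> space M"
        from W0_bound[OF this y a] have "(W0 n a \<omega> y)\<^sup>2 \<le> (real n * (real B * real B))\<^sup>2"
          by (metis abs_ge_zero power2_abs power_mono)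
        then show "norm (?\<phi> \<omega> y) \<le> (real n * (real B * real B))\<^sup>2 / real n" by (simp add: divide_right_mono)
      qed
    qed (rule G_to_M[OF G])
    have D: "?\<phi> \<omega> y = ?\<phi> \<omega> y'" if "\<And>t. t \<in> {1..n} \<Longrightarrow> y t = y' t" for \<omega> y y' using W0_dep[OF a that] by simp
    note ce = cond_expectation[of ?\<phi> n, OF G I D]
    show "integrable M (\<lambda>\<omega>. (WW n a 0 \<omega>)\<^sup>2 / real n)" unfolding WW_W0 by (rule ce(1))
    have "expectation (\<lambda>\<omega>. (WW n a 0 \<omega>)\<^sup>2 / real n) = expectation (\<lambda>\<omega>. EE B (pm n \<omega>) {1..n} (?\<phi> \<omega>))"
      unfolding WW_W0 by (rule ce(2))
    also have "\<dots> \<le> expectation (\<lambda>\<omega>. ((real B)\<^sup>2)\<^sup>2)"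
    proof (rule integral_mono[OF ce(3)])
      fix \<omega> assume w: "\<omega> \<in> space M"
      interpret bounded_scores B "pm n \<omega>" "uu n \<omega> 0" "real B" by (rule bounded_scores_true[OF w])
      have "EE B (pm n \<omega>) {1..n} (?\<phi> \<omega>) = EE B (pm n \<omega>) {1..n} (\<lambda>y. (W n a y)\<^sup>2) / real n"
        unfolding W0_W[OF w] by (rule EE_divide)
      also have "\<dots> \<le> (real n * ((real B)\<^sup>2)\<^sup>2) / real n" by (intro divide_right_mono W_second_moment a) simp
      finally show "EE B (pm n \<omega>) {1..n} (?\<phi> \<omega>) \<le> ((real B)\<^sup>2)\<^sup>2" using n by simp
    qed (assumption | rule integrable_const | blast)+
    finally show "expectation (\<lambda>\<omega>. (WW n a 0 \<omega>)\<^sup>2 / real n) \<le> ((real B)\<^sup>2)\<^sup>2" using prob_space by simp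
  qed simp
  then have "OP (\<lambda>n \<omega>. 1 + (WW n a 0 \<omega>)\<^sup>2 / real n)" by (intro OP_add OP_const)
  then show ?thesis
  proof (rule OP_mono, intro always_eventually allI AE_I2)
    fix n \<omega>
    have "\<bar>WW n a 0 \<omega> / sqrt (real n)\<bar> \<le> 1 + \<bar>WW n a 0 \<omega> / sqrt (real n)\<bar>\<^sup>2" by (rule le_one_plus_square)
    then show "\<bar>WW n a 0 \<omega> / sqrt (real n)\<bar> \<le> \<bar>1 + (WW n a 0 \<omega>)\<^sup>2 / real n\<bar>" by (simp add: power_divide)
  qed
qed

text \<open>The statistic after cancelling the factor \<tau>^2 between numerator and denominator. It
  keeps its form when the fitted \<tau> is 0, where each summand of \<open>Qstat\<close> degenerates
  to 0 / 0.\<close>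

definition QQ :: "nat \<Rightarrow> nat \<Rightarrow> (real^'r) \<times> real \<Rightarrow> 'a \<Rightarrow> real" where
  "QQ L n v \<omega> = (\<Sum>a=1..L. (WW n a v \<omega>)\<^sup>2 / LL n a v \<omega>)"

lemma LL_nonneg: "\<omega> \<in> space M \<Longrightarrow> 0 \<le> LL n a v \<omega>"
  unfolding LL_def by (intro sum_nonneg mult_nonneg_nonneg ee_nonneg)

lemma QQ_nonneg: "\<omega> \<in> space M \<Longrightarrow> 0 \<le> QQ L n v \<omega>"
  unfolding QQ_def by (intro sum_nonneg divide_nonneg_nonneg LL_nonneg) auto

lemma QQ0_measurable: "QQ L n 0 \<in> borel_measurable M"
proof -
  let ?\<phi> = "\<lambda>\<omega> y. \<Sum>a=1..L. (W0 n a \<omega> y)\<^sup>2 / LL n a 0 \<omega>"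
  have "(\<lambda>\<omega>. ?\<phi> \<omega> (Yv n \<omega>)) \<in> borel_measurable M"
  proof (rule measurable_Y_compose)
    show "(\<lambda>\<omega>. ?\<phi> \<omega> y) \<in> borel_measurable G" for y
      by (intro borel_measurable_sum borel_measurable_divide borel_measurable_power W0_G LL_G) auto
    show "?\<phi> \<omega> y = ?\<phi> \<omega> y'" if "\<And>t. t \<in> {1..n} \<Longrightarrow> y t = y' t" for \<omega> y y'
    proof (rule sum.cong[OF refl])
      fix a assume "a \<in> {1..L}"
      then have "1 \<le> a" by simp
      from W0_dep[OF this that] show "(W0 n a \<omega> y)\<^sup>2 / LL n a 0 \<omega> = (W0 n a \<omega> y')\<^sup>2 / LL n a 0 \<omega>" by simp
    qed
  qed
  then show ?thesis unfolding QQ_def[abs_def] WW_W0 .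
qed

text \<open>\<open>laplace_bound\<close> applies to each \<omega> at which all
  \<open>LL n a 0 \<omega>\<close> exceed c * n, with an error that is the same for all of them; on
  the remaining rare event both quantities lie in [0, 1]. Integration over \<omega> adds up the two
  contributions.\<close>

lemma laplace_true:
  assumes k: "0 \<le> k"
  shows "(\<lambda>n. expectation (\<lambda>\<omega>. exp (- k * QQ L n 0 \<omega>))) \<longlonglongrightarrow> (1 + 2 * k) powr (- real L / 2)"
proof (rule tendstoI)
  fix e :: real assume e: "0 < e"
  then have "0 < e / 3" by simp
  from LL_lower[OF this, of L] obtain c where c: "0 < c" "\<forall>\<^sub>F n in sequentially. \<exists>A\<in>events. prob A \<le> e / 3 \<and> (\<forall>\<omega>\<in>space M - A. \<forall>a\<in>{1..L}. c * real n \<le> LL n a 0 \<omega>)"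
    by blast
  define l where "l = (1 + 2 * k) powr (- real L / 2)"
  have "1 \<le> (1 + 2 * k) powr (real L / 2)" using k by (intro ge_one_powr_ge_zero) auto
  then have l: "0 \<le> l" "l \<le> 1" unfolding l_def by (auto simp: powr_minus_divide divide_le_eq_1)
  define er where "er = lap_err L (real L * (sqrt (2 * k) / sqrt c * (real B)\<^sup>2))"
  have Y0: "0 \<le> real L * (sqrt (2 * k) / sqrt c * (real B)\<^sup>2)" using k c by simp
  have er0: "0 \<le> er n" for n unfolding er_def by (rule lap_err_nonneg[OF Y0])
  have "er \<longlonglongrightarrow> 0" unfolding er_def by (rule lap_err_tendsto[OF Y0])
  then have "\<forall>\<^sub>F n in sequentially. er n < e / 3" by (rule order_tendstoD(2)) (use e in simp)
  with c(2) sequentially_1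
  show "\<forall>\<^sub>F n in sequentially. dist (expectation (\<lambda>\<omega>. exp (- k * QQ L n 0 \<omega>))) ((1 + 2 * k) powr (- real L / 2)) < e"
  proof eventually_elim
    case (elim n)
    obtain A where A: "A \<in> events" "prob A \<le> e / 3" "\<And>\<omega> a. \<omega> \<in> space M - A \<Longrightarrow> a \<in> {1..L} \<Longrightarrow> c * real n \<le> LL n a 0 \<omega>"
      using elim(1) by blast
    let ?\<phi> = "\<lambda>\<omega> y. exp (- k * (\<Sum>a=1..L. (W0 n a \<omega> y)\<^sup>2 / LL n a 0 \<omega>))"
    have sn: "0 \<le> (\<Sum>a=1..L. (W0 n a \<omega> y)\<^sup>2 / LL n a 0 \<omega>)" if "\<omega> \<in> space M" for \<omega> y
      by (intro sum_nonneg divide_nonneg_nonneg LL_nonneg that) auto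
    have G: "(\<lambda>\<omega>. ?\<phi> \<omega> y) \<in> borel_measurable G" for y
    proof -
      have "(\<lambda>\<omega>. \<Sum>a=1..L. (W0 n a \<omega> y)\<^sup>2 / LL n a 0 \<omega>) \<in> borel_measurable G"
        by (intro borel_measurable_sum borel_measurable_divide borel_measurable_power W0_G LL_G) auto
      then show ?thesis by measurable
    qed
    have I: "integrable M (\<lambda>\<omega>. ?\<phi> \<omega> y)" if y: "y \<in> supp n" for y
      using sn k by (intro integrable_const_bound[where B=1] G_to_M[OF G] AE_I2) simp
    have D: "?\<phi> \<omega> y = ?\<phi> \<omega> y'" if "\<And>t. t \<in> {1..n} \<Longrightarrow> y t = y' t" for \<omega> y y'
    proof -
      have "(\<Sum>a=1..L. (W0 n a \<omega> y)\<^sup>2 / LL n a 0 \<omega>) = (\<Sum>a=1..L. (W0 n a \<omega> y')\<^sup>2 / LL n a 0 \<omega>)"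
      proof (rule sum.cong[OF refl])
        fix a assume "a \<in> {1..L}"
        then have "1 \<le> a" by simp
        from W0_dep[OF this that] show "(W0 n a \<omega> y)\<^sup>2 / LL n a 0 \<omega> = (W0 n a \<omega> y')\<^sup>2 / LL n a 0 \<omega>" by simp
      qed
      then show ?thesis by simp
    qed
    note ce = cond_expectation[of ?\<phi> n, OF G I D]
    have iA: "integrable M (\<lambda>\<omega>. er n + indicator A \<omega>)" using A(1) by (intro Bochner_Integration.integrable_add) (auto simp: emeasure_eq_measure)
    have "expectation (\<lambda>\<omega>. exp (- k * QQ L n 0 \<omega>)) - l = expectation (\<lambda>\<omega>. EE B (pm n \<omega>) {1..n} (?\<phi> \<omega>)) - l"
      using ce(2) unfolding QQ_def WW_W0 by simp
    also have "\<dots> = expectation (\<lambda>\<omega>. EE B (pm n \<omega>) {1..n} (?\<phi> \<omega>) - l)"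
      using ce(3) prob_space by (subst Bochner_Integration.integral_diff) auto
    finally have "\<bar>expectation (\<lambda>\<omega>. exp (- k * QQ L n 0 \<omega>)) - l\<bar> \<le> expectation (\<lambda>\<omega>. \<bar>EE B (pm n \<omega>) {1..n} (?\<phi> \<omega>) - l\<bar>)"
      by (simp only: integral_abs_bound)
    also have "\<dots> \<le> expectation (\<lambda>\<omega>. er n + indicator A \<omega>)"
    proof (rule integral_mono[OF _ iA])
      show "integrable M (\<lambda>\<omega>. \<bar>EE B (pm n \<omega>) {1..n} (?\<phi> \<omega>) - l\<bar>)"
        by (intro integrable_abs Bochner_Integration.integrable_diff ce(3) integrable_const)
      fix \<omega> assume w: "\<omega> \<in> space M"
      interpret bounded_scores B "pm n \<omega>" "uu n \<omega> 0" "real B" by (rule bounded_scores_true[OF w])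
      show "\<bar>EE B (pm n \<omega>) {1..n} (?\<phi> \<omega>) - l\<bar> \<le> er n + indicator A \<omega>"
      proof (cases "\<omega> \<in> A")
        case True
        have "EE B (pm n \<omega>) {1..n} (?\<phi> \<omega>) \<le> EE B (pm n \<omega>) {1..n} (\<lambda>_. 1)"
          using sn[OF w] k by (intro EE_mono) simp
        then have "EE B (pm n \<omega>) {1..n} (?\<phi> \<omega>) \<le> 1" by (simp only: EE_const finite_atLeastAtMost)
        moreover have "0 \<le> EE B (pm n \<omega>) {1..n} (?\<phi> \<omega>)" by (intro EE_nonneg) simp
        ultimately have "\<bar>EE B (pm n \<omega>) {1..n} (?\<phi> \<omega>) - l\<bar> \<le> 1" using l unfolding abs_le_iff by linarith
        then show ?thesis using True er0[of n] by simp
      next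
        case False
        have "c * real n \<le> Lam n a" if "1 \<le> a" "a \<le> L" for a
          using A(3)[of \<omega> a] w False that unfolding LL_Lam[OF w] by simp
        from laplace_bound[OF k c(1) elim(2) this]
        have "\<bar>EE B (pm n \<omega>) {1..n} (?\<phi> \<omega>) - l\<bar> \<le> er n"
          unfolding er_def l_def LL_Lam[OF w] W0_W[OF w] .
        then show ?thesis using False by simp
      qed
    qed
    also have "\<dots> = er n + prob A" using A(1) prob_space by (subst Bochner_Integration.integral_add) (auto simp: emeasure_eq_measure)
    also have "\<dots> < e" using A(2) elim(3) e by linarith
    finally show ?case unfolding l_def dist_real_def .
  qed
qed

lemma QQ_oP:
  assumes WW: "\<And>a. 1 \<le> a \<Longrightarrow> oP (\<lambda>n \<omega>. (WW n a (vh n \<omega>) \<omega> - WW n a 0 \<omega>) / sqrt (real n))"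
    and LL: "\<And>a. 1 \<le> a \<Longrightarrow> oP (\<lambda>n \<omega>. (LL n a (vh n \<omega>) \<omega> - LL n a 0 \<omega>) / real n)"
  shows "oP (\<lambda>n \<omega>. QQ L n (vh n \<omega>) \<omega> - QQ L n 0 \<omega>)"
proof -
  have "oP (\<lambda>n \<omega>. (WW n a (vh n \<omega>) \<omega>)\<^sup>2 / LL n a (vh n \<omega>) \<omega> - (WW n a 0 \<omega>)\<^sup>2 / LL n a 0 \<omega>)" if aL: "a \<in> {1..L}" for a
    unfolding oP_def
  proof (intro allI impI)
    fix e h :: real assume e: "0 < e" "0 < h"
    have a: "1 \<le> a" using aL by simp
    define w where "w = (\<lambda>n \<omega>. WW n a 0 \<omega> / sqrt (real n))"
    define w' where "w' = (\<lambda>n \<omega>. WW n a (vh n \<omega>) \<omega> / sqrt (real n))"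
    define lam0 where "lam0 = (\<lambda>n \<omega>. LL n a 0 \<omega> / real n)"
    define lam1 where "lam1 = (\<lambda>n \<omega>. LL n a (vh n \<omega>) \<omega> / real n)"
    have dw: "oP (\<lambda>n \<omega>. w' n \<omega> - w n \<omega>)" using WW[OF a] unfolding w_def w'_def diff_divide_distrib .
    have dl: "oP (\<lambda>n \<omega>. lam1 n \<omega> - lam0 n \<omega>)" using LL[OF a] unfolding lam0_def lam1_def diff_divide_distrib .
    have wO: "OP w" unfolding w_def by (rule WW0_OP[OF a])
    have "oP (\<lambda>n \<omega>. ((w' n \<omega> - w n \<omega>) + (w n \<omega> + w n \<omega>)) * (w' n \<omega> - w n \<omega>))"
      by (intro oP_OP_mult OP_add oP_imp_OP dw wO)
    then have sq: "oP (\<lambda>n \<omega>. (w' n \<omega>)\<^sup>2 - (w n \<omega>)\<^sup>2)"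
      by (rule oP_mono) (auto simp: power2_eq_square algebra_simps)
    have wl: "oP (\<lambda>n \<omega>. w n \<omega> * (w n \<omega> * (lam1 n \<omega> - lam0 n \<omega>)))" by (intro oP_OP_mult dl wO)
    have h4: "0 < h / 4" using e by simp
    from LL_lower[OF h4, of L] obtain c where c: "0 < c" "\<forall>\<^sub>F n in sequentially. \<exists>A\<in>events. prob A \<le> h / 4 \<and> (\<forall>\<omega>\<in>space M - A. \<forall>a\<in>{1..L}. c * real n \<le> LL n a 0 \<omega>)"
      by blast
    \<comment> \<open>The tolerances match the split of the ratio below: with denominators at least
      c / 2 and c, the terms (e * c / 4) / (c / 2) and (e * c^2 / 4) / (c^2 / 2) are e / 2
      each.\<close>
    have "0 < c / 2" "0 < e * c / 4" "0 < e * c\<^sup>2 / 4" using c e by auto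
    from c(2) oPD[OF dl this(1) h4] oPD[OF sq this(2) h4] oPD[OF wl this(3) h4] sequentially_1
    show "\<forall>\<^sub>F n in sequentially. \<exists>A\<in>events. prob A \<le> h \<and> (\<forall>\<omega>\<in>space M - A.
      \<bar>(WW n a (vh n \<omega>) \<omega>)\<^sup>2 / LL n a (vh n \<omega>) \<omega> - (WW n a 0 \<omega>)\<^sup>2 / LL n a 0 \<omega>\<bar> \<le> e)"
    proof eventually_elim
      case (elim n)
      have n: "0 < real n" using elim(5) by simp
      show ?case
      proof (rule exceptional_mono[OF union_bound2[OF union_bound2[OF elim(1,2)] union_bound2[OF elim(3,4)]]], intro AE_I2 impI)
        fix \<omega> assume H: "((\<forall>a\<in>{1..L}. c * real n \<le> LL n a 0 \<omega>) \<and> \<bar>lam1 n \<omega> - lam0 n \<omega>\<bar> \<le> c / 2) \<and>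
          \<bar>(w' n \<omega>)\<^sup>2 - (w n \<omega>)\<^sup>2\<bar> \<le> e * c / 4 \<and> \<bar>w n \<omega> * (w n \<omega> * (lam1 n \<omega> - lam0 n \<omega>))\<bar> \<le> e * c\<^sup>2 / 4"
        let ?l = "lam0 n \<omega>" and ?k = "lam1 n \<omega>" and ?w = "w n \<omega>" and ?u = "w' n \<omega>"
        have "c * real n \<le> LL n a 0 \<omega>" using H aL by blast
        then have l: "c \<le> ?l" unfolding lam0_def using n by (simp add: field_simps)
        then have k: "c / 2 \<le> ?k" using H by linarith
        have pos: "0 < ?l" "0 < ?k" using l k c by auto
        have eq1: "(WW n a (vh n \<omega>) \<omega>)\<^sup>2 / LL n a (vh n \<omega>) \<omega> = ?u\<^sup>2 / ?k" unfolding w'_def lam1_def using n by (simp add: power_divide)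
        have eq2: "(WW n a 0 \<omega>)\<^sup>2 / LL n a 0 \<omega> = ?w\<^sup>2 / ?l" unfolding w_def lam0_def using n by (simp add: power_divide)
        have "?u\<^sup>2 / ?k - ?w\<^sup>2 / ?l = (?u\<^sup>2 - ?w\<^sup>2) / ?k - ?w * (?w * (?k - ?l)) / (?k * ?l)"
          using pos by (simp add: field_simps power2_eq_square)
        also have "\<bar>\<dots>\<bar> \<le> \<bar>?u\<^sup>2 - ?w\<^sup>2\<bar> / ?k + \<bar>?w * (?w * (?k - ?l))\<bar> / (?k * ?l)"
          using pos by (intro order_trans[OF abs_triangle_ineq4]) (simp add: abs_divide)
        also have "\<dots> \<le> (e * c / 4) / (c / 2) + (e * c\<^sup>2 / 4) / (c / 2 * c)"
          using H pos l k c e by (intro add_mono frac_le mult_mono) auto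
        also have "\<dots> = e" using c by (simp add: power2_eq_square)
        finally show "\<bar>(WW n a (vh n \<omega>) \<omega>)\<^sup>2 / LL n a (vh n \<omega>) \<omega> - (WW n a 0 \<omega>)\<^sup>2 / LL n a 0 \<omega>\<bar> \<le> e" unfolding eq1 eq2 .
      qed simp
    qed
  qed
  then have "oP (\<lambda>n \<omega>. \<Sum>a=1..L. (WW n a (vh n \<omega>) \<omega>)\<^sup>2 / LL n a (vh n \<omega>) \<omega> - (WW n a 0 \<omega>)\<^sup>2 / LL n a 0 \<omega>)"
    by (intro oP_sum) auto
  then show ?thesis unfolding QQ_def sum_subtractf .
qed

theorem statistic_weak_conv:
  fixes Z :: "nat \<Rightarrow> 'a \<Rightarrow> real"
  assumes vh_max: "\<And>n \<omega>. \<omega> \<in> space M \<Longrightarrow> lik n 0 \<omega> \<le> lik n (vh n \<omega>) \<omega>"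
    and conv: "\<And>v. v \<in> K \<Longrightarrow> AE \<omega> in M. (\<lambda>n. lik n v \<omega> / real n) \<longlonglongrightarrow> Q v"
    and uniq: "\<And>v. v \<in> K \<Longrightarrow> v \<noteq> 0 \<Longrightarrow> Q v < (Q 0 :: real)"
    and Z: "\<And>n. Z n \<in> borel_measurable M" "\<And>n \<omega>. \<omega> \<in> space M \<Longrightarrow> 0 \<le> Z n \<omega>"
    and ZQ: "\<And>n \<omega>. 1 \<le> n \<Longrightarrow> \<omega> \<in> space M \<Longrightarrow> 0 < s + snd (vh n \<omega>) \<Longrightarrow> Z n \<omega> = QQ L n (vh n \<omega>) \<omega>"
    and L: "1 \<le> L"
  shows "weak_conv_m (\<lambda>n. distr M borel (Z n)) (chi2 L)"
proof -
  have cons: "oP (\<lambda>n \<omega>. norm (vh n \<omega>))" using vh_max conv uniq by (rule mle_consistent)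
  have "oP (\<lambda>n \<omega>. KL n \<omega> (vh n \<omega>) / sqrt (real n))" using cons vh_max by (rule KL_oP)
  note mu = mu_oP[OF this]
  have Q: "oP (\<lambda>n \<omega>. QQ L n (vh n \<omega>) \<omega> - QQ L n 0 \<omega>)"
    by (intro QQ_oP WW_oP LL_oP cons mu)
  \<comment> \<open>\<open>Z\<close> is tied to \<open>QQ\<close> only where the fitted standard
    deviation is positive; since s > 0, consistency places it there outside small events.\<close>
  have D: "oP (\<lambda>n \<omega>. Z n \<omega> - QQ L n (vh n \<omega>) \<omega>)"
    unfolding oP_def
  proof (intro allI impI)
    fix e h :: real assume e: "0 < e" "0 < h"
    have "0 < s / 2" using s_pos by simp
    from oPD[OF cons this e(2)] sequentially_1
    show "\<forall>\<^sub>F n in sequentially. \<exists>A\<in>events. prob A \<le> h \<and> (\<forall>\<omega>\<in>space M - A. \<bar>Z n \<omega> - QQ L n (vh n \<omega>) \<omega>\<bar> \<le> e)"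
    proof eventually_elim
      case (elim n)
      show ?case
      proof (rule exceptional_mono[OF elim(1) _ order_refl], intro AE_I2 impI)
        fix \<omega> assume w: "\<omega> \<in> space M" and "\<bar>norm (vh n \<omega>)\<bar> \<le> s / 2"
        moreover have "\<bar>snd (vh n \<omega>)\<bar> \<le> norm (vh n \<omega>)" using norm_snd_le[of "snd (vh n \<omega>)" "fst (vh n \<omega>)"] by simp
        ultimately have "0 < s + snd (vh n \<omega>)" using s_pos by linarith
        from ZQ[OF elim(2) w this] show "\<bar>Z n \<omega> - QQ L n (vh n \<omega>) \<omega>\<bar> \<le> e" using e by simp
      qed
    qed
  qed
  have d: "oP (\<lambda>n \<omega>. Z n \<omega> - QQ L n 0 \<omega>)" using oP_add[OF D Q] by simp
  show ?thesis
  proof (rule laplace_imp_weak_conv)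
    show "real_distribution (distr M borel (Z n))" for n
      using prob_space_distr[OF Z(1)] by (simp add: real_distribution_def real_distribution_axioms_def)
    show "AE x in distr M borel (Z n). 0 \<le> x" for n
      using Z by (subst AE_distr_iff) auto
    show "real_distribution (chi2 L)" by (rule real_distribution_chi2[OF L])
    show "AE x in chi2 L. 0 \<le> x" by (rule chi2_nonneg)
    fix k :: nat
    have "(\<lambda>n. expectation (\<lambda>\<omega>. exp (- real k * Z n \<omega>))) \<longlonglongrightarrow> (1 + 2 * real k) powr (- real L / 2)"
      by (rule laplace_transfer[OF Z(1) QQ0_measurable Z(2) QQ_nonneg d _ laplace_true]) auto
    moreover have "(\<integral>x. exp (- real k * x) \<partial>distr M borel (Z n)) = expectation (\<lambda>\<omega>. exp (- real k * Z n \<omega>))" for n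
      using Z(1) by (subst integral_distr) auto
    ultimately show "(\<lambda>n. \<integral>x. exp (- real k * x) \<partial>distr M borel (Z n)) \<longlonglongrightarrow> (\<integral>x. exp (- real k * x) \<partial>chi2 L)"
      using chi2_laplace[OF L, of "real k"] by simp
  qed
qed

end

section \<open>The regressors\<close>

text \<open>Local boundedness and compactness of [0, 1]. At a break point the one-sided limits bound
  h on both sides, while its value there is arbitrary and enters the maximum separately.\<close>

lemma piecewise_cont01_bounded:
  fixes h :: "real \<Rightarrow> real^'r"
  assumes "piecewise_cont01 h"
  obtains c where "\<And>u. u \<in> {0..1} \<Longrightarrow> norm (h u) \<le> c"
proof -
  obtain D where D: "finite D" "continuous_on ({0..1} - D) h"
    "\<And>d. d \<in> D \<Longrightarrow> 0 < d \<Longrightarrow> \<exists>l. (h \<longlongrightarrow> l) (at_left d)" "\<And>d. d \<in> D \<Longrightarrow> d < 1 \<Longrightarrow> \<exists>l. (h \<longlongrightarrow> l) (at_right d)"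
    using assms unfolding piecewise_cont01_def by blast
  have nbhd: "\<exists>U c. open U \<and> p \<in> U \<and> (\<forall>u\<in>U \<inter> {0..1}. norm (h u) \<le> c)" if p: "p \<in> {0..1}" for p
  proof (cases "p \<in> D")
    case False
    then have "\<exists>d>0. \<forall>u\<in>{0..1} - D. dist u p < d \<longrightarrow> dist (h u) (h p) < 1"
      using D(2) p unfolding continuous_on_iff by (metis DiffI zero_less_one)
    then obtain d where d: "0 < d" "\<And>u. u \<in> {0..1} - D \<Longrightarrow> dist u p < d \<Longrightarrow> dist (h u) (h p) < 1" by blast
    show ?thesis
    proof (intro exI[of _ "ball p d - D"] exI[of _ "norm (h p) + 1"] conjI ballI)
      show "open (ball p d - D)" using D(1) by (intro open_Diff finite_imp_closed) auto
      show "p \<in> ball p d - D" using d False by simp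
      fix u assume "u \<in> (ball p d - D) \<inter> {0..1}"
      then have "dist (h u) (h p) < 1" by (intro d) (auto simp: dist_commute)
      then show "norm (h u) \<le> norm (h p) + 1" using norm_triangle_ineq2[of "h u" "h p"] by (simp add: dist_norm)
    qed
  next
    case True
    have bd: "\<forall>\<^sub>F u in F. norm (h u) \<le> norm l + 1" if "(h \<longlongrightarrow> l) F" for l F
    proof -
      have "\<forall>\<^sub>F u in F. dist (h u) l < 1" using that by (rule tendstoD) simp
      then show ?thesis
      proof (rule eventually_mono)
        fix u assume "dist (h u) l < 1"
        then show "norm (h u) \<le> norm l + 1" using norm_triangle_ineq2[of "h u" l] by (simp add: dist_norm)
      qed
    qed
    \<comment> \<open>At p = 0 no point of [0, 1] lies to the left, so any b < 0 serves; the right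
      side at p = 1 is symmetric.\<close>
    have "\<exists>b<p. \<exists>c. \<forall>u. b < u \<longrightarrow> u < p \<longrightarrow> u \<in> {0..1} \<longrightarrow> norm (h u) \<le> c"
    proof (cases "0 < p")
      case True
      then obtain l where "(h \<longlongrightarrow> l) (at_left p)" using D(3) \<open>p \<in> D\<close> by blast
      from bd[OF this] obtain b where "b < p" "\<forall>u>b. u < p \<longrightarrow> norm (h u) \<le> norm l + 1"
        unfolding eventually_at_left_field by blast
      then show ?thesis by blast
    next
      case False
      then show ?thesis using p by (intro exI[of _ "-1"]) auto
    qed
    then obtain b c1 where b: "b < p" "\<And>u. b < u \<Longrightarrow> u < p \<Longrightarrow> u \<in> {0..1} \<Longrightarrow> norm (h u) \<le> c1" by blast
    have "\<exists>b>p. \<exists>c. \<forall>u. p < u \<longrightarrow> u < b \<longrightarrow> u \<in> {0..1} \<longrightarrow> norm (h u) \<le> c"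
    proof (cases "p < 1")
      case True
      then obtain l where "(h \<longlongrightarrow> l) (at_right p)" using D(4) \<open>p \<in> D\<close> by blast
      from bd[OF this] obtain b where "p < b" "\<forall>u>p. u < b \<longrightarrow> norm (h u) \<le> norm l + 1"
        unfolding eventually_at_right_field by blast
      then show ?thesis by blast
    next
      case False
      then show ?thesis using p by (intro exI[of _ "2"]) auto
    qed
    then obtain b' c2 where b': "p < b'" "\<And>u. p < u \<Longrightarrow> u < b' \<Longrightarrow> u \<in> {0..1} \<Longrightarrow> norm (h u) \<le> c2" by blast
    show ?thesis
    proof (intro exI[of _ "{b<..<b'}"] exI[of _ "max (norm (h p)) (max c1 c2)"] conjI ballI)
      fix u assume u: "u \<in> {b<..<b'} \<inter> {0..1}"
      show "norm (h u) \<le> max (norm (h p)) (max c1 c2)"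
        using b(2)[of u] b'(2)[of u] u by (cases u p rule: linorder_cases) (auto simp: le_max_iff_disj)
    qed (use b b' in auto)
  qed
  then obtain U c where U: "\<And>p. p \<in> {0..1} \<Longrightarrow> open (U p) \<and> p \<in> U p \<and> (\<forall>u\<in>U p \<inter> {0..1}. norm (h u) \<le> c p)"
    by metis
  obtain T where T: "T \<subseteq> {0..1}" "finite T" "{0..1} \<subseteq> (\<Union>p\<in>T. U p)"
  proof (rule compactE_image[of "{0..1::real}" "{0..1}" U])
    show "{0..1} \<subseteq> (\<Union>p\<in>{0..1}. U p)" using U by blast
  qed (use U in auto)
  show thesis
  proof (rule that)
    fix u :: real assume u: "u \<in> {0..1}"
    then obtain p where p: "p \<in> T" "u \<in> U p" using T(3) by blast
    then have "norm (h u) \<le> c p" using U[of p] T(1) u by blast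
    also have "c p \<le> Max (c ` T)" using p T(2) by auto
    finally show "norm (h u) \<le> Max (c ` T)" .
  qed
qed

text \<open>Projection of the shifted path law onto coordinate 0. Time starts at 1 in the model,
  hence the \<open>Suc\<close> in the stationary sequence.\<close>

lemma stationary_distr:
  assumes st: "stationary_seq M N (\<lambda>t. X (Suc t))" and X: "\<And>t. X t \<in> measurable M N" and t: "1 \<le> t"
  shows "distr M N (X t) = distr M N (X 1)"
proof -
  define k where "k = t - 1"
  have m: "(\<lambda>\<omega> r. X (Suc (r + h)) \<omega>) \<in> measurable M (PiM UNIV (\<lambda>_. N))" for h :: nat
    using X by (intro measurable_PiM_single') (auto intro: measurable_space[OF X])
  have c: "(\<lambda>z. z (0::nat)) \<in> measurable (PiM UNIV (\<lambda>_. N)) N" by (rule measurable_component_singleton) simp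
  have d: "distr (distr M (PiM UNIV (\<lambda>_. N)) (\<lambda>\<omega> r. X (Suc (r + h)) \<omega>)) N (\<lambda>z. z 0) = distr M N (X (Suc h))" for h
    by (subst distr_distr[OF c m]) (simp add: comp_def)
  have "distr M (PiM UNIV (\<lambda>_. N)) (\<lambda>\<omega> r. X (Suc (r + k)) \<omega>) = distr M (PiM UNIV (\<lambda>_. N)) (\<lambda>\<omega> r. X (Suc (r + 0)) \<omega>)"
    using st unfolding stationary_seq_def by simp
  then have "distr M N (X (Suc k)) = distr M N (X (Suc 0))" unfolding d[symmetric] by simp
  then show ?thesis using t unfolding k_def by simp
qed

lemma square_le_exp: "z\<^sup>2 \<le> 2 * (exp z + exp (- z))" for z :: real
proof -
  have "1 + \<bar>z\<bar> + \<bar>z\<bar>\<^sup>2 / 2 \<le> exp \<bar>z\<bar>" by (rule exp_lower_Taylor_quadratic) simp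
  then have "z\<^sup>2 \<le> 2 * exp \<bar>z\<bar>" by simp
  also have "exp \<bar>z\<bar> \<le> exp z + exp (- z)" by (cases "0 \<le> z") auto
  finally show ?thesis by simp
qed

text \<open>Exponential moments along plus and minus each coordinate axis dominate the squared
  coordinates, by \<open>square_le_exp\<close>.\<close>

lemma integrable_norm_square:
  fixes X :: "'a \<Rightarrow> real^'r"
  assumes X: "X \<in> borel_measurable M" and e: "\<And>s. integrable M (\<lambda>\<omega>. exp (s \<bullet> X \<omega>))"
  shows "integrable M (\<lambda>\<omega>. (norm (X \<omega>))\<^sup>2)"
proof (rule Bochner_Integration.integrable_bound)
  let ?g = "\<lambda>\<omega>. \<Sum>i\<in>UNIV. 2 * (exp (axis i 1 \<bullet> X \<omega>) + exp ((- axis i 1) \<bullet> X \<omega>))"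
  show "integrable M ?g" by (intro Bochner_Integration.integrable_sum integrable_mult_right Bochner_Integration.integrable_add e)
  show "(\<lambda>\<omega>. (norm (X \<omega>))\<^sup>2) \<in> borel_measurable M" using X by simp
  show "AE \<omega> in M. norm ((norm (X \<omega>))\<^sup>2) \<le> norm (?g \<omega>)"
  proof (rule AE_I2)
    fix \<omega>
    have "(norm (X \<omega>))\<^sup>2 = (\<Sum>i\<in>UNIV. (X \<omega> $ i)\<^sup>2)"
      unfolding power2_norm_eq_inner inner_vec_def by (simp add: power2_eq_square)
    also have "\<dots> \<le> ?g \<omega>" using square_le_exp by (intro sum_mono) (simp add: inner_axis')
    finally show "norm ((norm (X \<omega>))\<^sup>2) \<le> norm (?g \<omega>)" by simp
  qed
qed

lemma (in prob_space) regressor_second_moment: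
  fixes x :: "nat \<Rightarrow> nat \<Rightarrow> 'a \<Rightarrow> real^'r"
  assumes "(\<exists>h. piecewise_cont01 h \<and>
              (\<forall>n t. \<forall>\<omega>\<in>space M. 1 \<le> t \<and> t \<le> n \<longrightarrow> x n t \<omega> = h (real t / real n)))
           \<or> (\<exists>X :: nat \<Rightarrow> 'a \<Rightarrow> real^'r.
              (\<forall>t. X t \<in> borel_measurable M) \<and>
              stationary_seq M borel (\<lambda>t. X (Suc t)) \<and>
              (\<forall>t s. integrable M (\<lambda>\<omega>. exp (s \<bullet> X t \<omega>))) \<and>
              (\<forall>n t. \<forall>\<omega>\<in>space M. 1 \<le> t \<and> t \<le> n \<longrightarrow> x n t \<omega> = X t \<omega>))"
  shows "\<exists>K. \<forall>n t. 1 \<le> t \<longrightarrow> t \<le> n \<longrightarrow>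
    integrable M (\<lambda>\<omega>. (norm (x n t \<omega>))\<^sup>2) \<and> expectation (\<lambda>\<omega>. (norm (x n t \<omega>))\<^sup>2) \<le> K"
  using assms
proof (elim disjE exE conjE)
  fix h assume h: "piecewise_cont01 h"
    and xh: "\<forall>n t. \<forall>\<omega>\<in>space M. 1 \<le> t \<and> t \<le> n \<longrightarrow> x n t \<omega> = h (real t / real n)"
  obtain c where c: "\<And>u. u \<in> {0..1} \<Longrightarrow> norm (h u) \<le> c"
    using piecewise_cont01_bounded[OF h] by blast
  show ?thesis
  proof (intro exI[of _ "c\<^sup>2"] allI impI)
    fix n t :: nat assume t: "1 \<le> t" "t \<le> n"
    have eq: "(norm (x n t \<omega>))\<^sup>2 = (norm (h (real t / real n)))\<^sup>2" if "\<omega> \<in> space M" for \<omega>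
      using xh that t by simp
    have cong: "integrable M (\<lambda>\<omega>. (norm (x n t \<omega>))\<^sup>2) \<longleftrightarrow> integrable M (\<lambda>_. (norm (h (real t / real n)))\<^sup>2)"
      "expectation (\<lambda>\<omega>. (norm (x n t \<omega>))\<^sup>2) = expectation (\<lambda>_. (norm (h (real t / real n)))\<^sup>2)"
      using eq by (intro Bochner_Integration.integrable_cong Bochner_Integration.integral_cong refl; simp)+
    have "(norm (h (real t / real n)))\<^sup>2 \<le> c\<^sup>2" using t by (intro power_mono c) auto
    then show "integrable M (\<lambda>\<omega>. (norm (x n t \<omega>))\<^sup>2) \<and> expectation (\<lambda>\<omega>. (norm (x n t \<omega>))\<^sup>2) \<le> c\<^sup>2"
      unfolding cong
      by (simp add: prob_space)
  qed
next
  fix X :: "nat \<Rightarrow> 'a \<Rightarrow> real^'r"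
  assume X: "\<forall>t. X t \<in> borel_measurable M" and st: "stationary_seq M borel (\<lambda>t. X (Suc t))"
    and ex: "\<forall>t s. integrable M (\<lambda>\<omega>. exp (s \<bullet> X t \<omega>))"
    and xX: "\<forall>n t. \<forall>\<omega>\<in>space M. 1 \<le> t \<and> t \<le> n \<longrightarrow> x n t \<omega> = X t \<omega>"
  have [measurable]: "X t \<in> borel_measurable M" for t using X by simp
  have int: "integrable M (\<lambda>\<omega>. (norm (X t \<omega>))\<^sup>2)" for t
    using ex by (intro integrable_norm_square) auto
  have ex_eq: "expectation (\<lambda>\<omega>. (norm (X t \<omega>))\<^sup>2) = (\<integral>z. (norm z)\<^sup>2 \<partial>distr M borel (X t))" for t
    by (subst integral_distr) auto
  show ?thesis
  proof (intro exI[of _ "expectation (\<lambda>\<omega>. (norm (X 1 \<omega>))\<^sup>2)"] allI impI)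
    fix n t :: nat assume t: "1 \<le> t" "t \<le> n"
    have eq: "(norm (x n t \<omega>))\<^sup>2 = (norm (X t \<omega>))\<^sup>2" if "\<omega> \<in> space M" for \<omega>
      using xX that t by simp
    have cong: "integrable M (\<lambda>\<omega>. (norm (x n t \<omega>))\<^sup>2) \<longleftrightarrow> integrable M (\<lambda>\<omega>. (norm (X t \<omega>))\<^sup>2)"
      "expectation (\<lambda>\<omega>. (norm (x n t \<omega>))\<^sup>2) = expectation (\<lambda>\<omega>. (norm (X t \<omega>))\<^sup>2)"
      using eq by (intro Bochner_Integration.integrable_cong Bochner_Integration.integral_cong refl; simp)+
    have "expectation (\<lambda>\<omega>. (norm (X t \<omega>))\<^sup>2) = expectation (\<lambda>\<omega>. (norm (X 1 \<omega>))\<^sup>2)"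
      unfolding ex_eq using stationary_distr[OF st _ t(1)] X by simp
    then show "integrable M (\<lambda>\<omega>. (norm (x n t \<omega>))\<^sup>2) \<and>
        expectation (\<lambda>\<omega>. (norm (x n t \<omega>))\<^sup>2) \<le> expectation (\<lambda>\<omega>. (norm (X 1 \<omega>))\<^sup>2)"
      unfolding cong
      using int by simp
  qed
qed

section \<open>From the model conditions to the recentred panel\<close>

theorem theorem2:
  fixes M :: "'a measure"
    and alpha :: "nat \<Rightarrow> 'a \<Rightarrow> real"
    and x :: "nat \<Rightarrow> nat \<Rightarrow> 'a \<Rightarrow> real^'r"
    and m :: "nat \<Rightarrow> 'a \<Rightarrow> nat"
    and Y :: "nat \<Rightarrow> nat \<Rightarrow> 'a \<Rightarrow> nat"
    and \<beta>0 :: "real^'r" and \<tau>0 d1 d2 :: real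
    and \<beta>hat :: "nat \<Rightarrow> 'a \<Rightarrow> real^'r" and \<tau>hat :: "nat \<Rightarrow> 'a \<Rightarrow> real"
    and L :: nat
  defines "AlphaEv \<equiv> {alpha t -` A \<inter> space M | t A. 1 \<le> t \<and> A \<in> sets borel}"
    and "XEv \<equiv> {x n t -` A \<inter> space M | n t A. 1 \<le> t \<and> t \<le> n \<and> A \<in> sets borel}"
    and "MEv \<equiv> {m t -` A \<inter> space M | t A. 1 \<le> t}"
  assumes P: "prob_space M"
    and tau0_pos: "0 < \<tau>0" and d1: "0 \<le> d1" and d2: "0 \<le> d2"
    and L: "1 \<le> L"
    \<comment> \<open>measurability of the observed quantities\<close>
    and meas_x: "\<And>n t. x n t \<in> borel_measurable M"
    and meas_m: "\<And>t. m t \<in> measurable M (count_space UNIV)"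
    and meas_Y: "\<And>n t. Y n t \<in> measurable M (count_space UNIV)"
    \<comment> \<open>null hypothesis psi = 0: latent process i.i.d. N(0,1)\<close>
    and H0_indep: "prob_space.indep_vars M (\<lambda>_. borel) alpha {1..}"
    and H0_normal: "\<And>t. 1 \<le> t \<Longrightarrow> distributed M lborel (alpha t) std_normal_density"
    \<comment> \<open>latent process independent of regressors and numbers of trials\<close>
    and alpha_indep: "prob_space.indep_set M (sigma_sets (space M) AlphaEv)
                                              (sigma_sets (space M) (XEv \<union> MEv))"
    \<comment> \<open>given the latent process, regressors and trials, Y_nt (t = 1..n) are independent
        binomial(m_t, bdot(W_nt)) with W_nt = x_nt' beta0 + sqrt tau0 alpha_t\<close>
    and Y_cond: "\<And>n T yv E. T \<subseteq> {1..n} \<Longrightarrow>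
        E \<in> sigma_sets (space M) (AlphaEv \<union> XEv \<union> MEv) \<Longrightarrow>
        measure M (E \<inter> {\<omega> \<in> space M. \<forall>t\<in>T. Y n t \<omega> = yv t}) =
        (\<integral>\<omega>. indicator E \<omega> *
            (\<Prod>t\<in>T. fcond (m t \<omega>) (yv t) (x n t \<omega> \<bullet> \<beta>0 + sqrt \<tau>0 * alpha t \<omega>)) \<partial>M)"
    \<comment> \<open>(C1)\<close>
    and C1: "\<exists>Mb::nat. (\<forall>t\<ge>1. \<forall>\<omega>\<in>space M. 1 \<le> m t \<omega> \<and> m t \<omega> \<le> Mb) \<and>
        ((stationary_seq M (count_space UNIV) (\<lambda>t. m (Suc t)) \<and>
          measure M {\<omega> \<in> space M. m 1 \<omega> = Mb} > 0 \<and>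
          summable (mix_coef M (count_space UNIV) (\<lambda>t. m (Suc t))) \<and>
          prob_space.indep_set M (sigma_sets (space M) MEv) (sigma_sets (space M) XEv))
         \<or>
         (\<exists>mm :: nat \<Rightarrow> nat. \<exists>\<kappa> :: nat \<Rightarrow> real.
            (\<forall>t\<ge>1. \<forall>\<omega>\<in>space M. m t \<omega> = mm t) \<and>
            (\<forall>j. (\<lambda>n. real (card {t \<in> {1..n}. mm t = j}) / real n) \<longlonglongrightarrow> \<kappa> j)))"
    \<comment> \<open>(C2)\<close>
    and C2: "(\<exists>h. piecewise_cont01 h \<and>
              (\<forall>n t. \<forall>\<omega>\<in>space M. 1 \<le> t \<and> t \<le> n \<longrightarrow> x n t \<omega> = h (real t / real n)))
           \<or> (\<exists>X :: nat \<Rightarrow> 'a \<Rightarrow> real^'r.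
              (\<forall>t. X t \<in> borel_measurable M) \<and>
              stationary_seq M borel (\<lambda>t. X (Suc t)) \<and>
              (\<forall>t s. integrable M (\<lambda>\<omega>. exp (s \<bullet> X t \<omega>))) \<and>
              (\<forall>n t. \<forall>\<omega>\<in>space M. 1 \<le> t \<and> t \<le> n \<longrightarrow> x n t \<omega> = X t \<omega>))"
    \<comment> \<open>(C3)\<close>
    and C3: "AE \<omega> in M. eventually (\<lambda>n. dim {x n t \<omega> | t. t \<in> {1..n}} = CARD('r)) sequentially"
    \<comment> \<open>(C4)\<close>
    and C4: "\<exists>Q :: (real^'r) \<times> real \<Rightarrow> real.
        (\<forall>\<delta>\<in>Theta \<beta>0 \<tau>0 d1 d2. AE \<omega> in M.
            (\<lambda>n. loglik1 (\<lambda>t. x n t \<omega>) (\<lambda>t. m t \<omega>) (\<lambda>t. Y n t \<omega>) n (fst \<delta>) (snd \<delta>) / real n)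
              \<longlonglongrightarrow> Q \<delta>) \<and>
        (\<forall>\<delta>\<in>Theta \<beta>0 \<tau>0 d1 d2. \<delta> \<noteq> (\<beta>0, \<tau>0) \<longrightarrow> Q \<delta> < Q (\<beta>0, \<tau>0))"
    \<comment> \<open>marginal maximum likelihood estimator over Theta\<close>
    and est_meas: "\<And>n. \<beta>hat n \<in> borel_measurable M" "\<And>n. \<tau>hat n \<in> borel_measurable M"
    and est_max: "\<And>n \<omega>. \<omega> \<in> space M \<Longrightarrow> (\<beta>hat n \<omega>, \<tau>hat n \<omega>) \<in> Theta \<beta>0 \<tau>0 d1 d2 \<and>
        (\<forall>\<delta>\<in>Theta \<beta>0 \<tau>0 d1 d2.
          loglik1 (\<lambda>t. x n t \<omega>) (\<lambda>t. m t \<omega>) (\<lambda>t. Y n t \<omega>) n (fst \<delta>) (snd \<delta>)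
          \<le> loglik1 (\<lambda>t. x n t \<omega>) (\<lambda>t. m t \<omega>) (\<lambda>t. Y n t \<omega>) n (\<beta>hat n \<omega>) (\<tau>hat n \<omega>))"
  shows "weak_conv_m
           (\<lambda>n. distr M borel (\<lambda>\<omega>. Qstat (\<lambda>t. x n t \<omega>) (\<lambda>t. m t \<omega>) (\<lambda>t. Y n t \<omega>) n L
                                         (\<beta>hat n \<omega>) (\<tau>hat n \<omega>)))
           (chi2 L)"
proof -
  interpret prob_space M by (rule P)
  define G where "G = sigma (space M) (XEv \<union> MEv)"
  define s where "s = sqrt \<tau>0"
  define S where "S = sqrt (\<tau>0 + d2)"
  have s_pos: "0 < s" and s2: "s\<^sup>2 = \<tau>0" unfolding s_def using tau0_pos by auto
  obtain B where m_bd: "\<And>t \<omega>. 1 \<le> t \<Longrightarrow> \<omega> \<in> space M \<Longrightarrow> 1 \<le> m t \<omega> \<and> m t \<omega> \<le> B"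
    using C1 by blast
  have XM: "XEv \<union> MEv \<subseteq> Pow (space M)" unfolding XEv_def MEv_def by auto
  have XM_events: "XEv \<union> MEv \<subseteq> events"
    unfolding XEv_def MEv_def using measurable_sets[OF meas_x] measurable_sets[OF meas_m] by auto
  have G: "space G = space M" "sets G = sigma_sets (space M) (XEv \<union> MEv)"
    unfolding G_def using XM by (simp_all add: sets_measure_of)
  have subG: "subalgebra M G"
    unfolding subalgebra_def G using sets.sigma_sets_subset[OF XM_events] by simp
  have x_G: "x n t \<in> borel_measurable G" if "1 \<le> t" "t \<le> n" for n t
  proof (rule measurableI)
    fix A :: "(real^'r) set" assume "A \<in> sets borel"
    then have "x n t -` A \<inter> space M \<in> XEv" unfolding XEv_def using that by blast
    then show "x n t -` A \<inter> space G \<in> sets G" unfolding G by (intro sigma_sets.Basic) simp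
  qed simp
  have m_G: "m t \<in> measurable G (count_space UNIV)" if "1 \<le> t" for t
  proof (rule measurableI)
    fix A :: "nat set"
    have "m t -` A \<inter> space M \<in> MEv" unfolding MEv_def using that by blast
    then show "m t -` A \<inter> space G \<in> sets G" unfolding G by (intro sigma_sets.Basic) simp
  qed simp
  \<comment> \<open>\<open>Y_cond\<close> is used with events of G and the full index set {1..n};
    integrating out the latent process replaces \<open>fcond\<close> by the marginal
    density.\<close>
  have cond: "measure M (A \<inter> {\<omega> \<in> space M. \<forall>t\<in>{1..n}. Y n t \<omega> = yv t}) =
        (\<integral>\<omega>. indicator A \<omega> * (\<Prod>t\<in>{1..n}. fs (m t \<omega>) (x n t \<omega> \<bullet> \<beta>0) s (yv t)) \<partial>M)"
    if A: "A \<in> sets G" for n yv A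
  proof -
    have "sigma_sets (space M) (XEv \<union> MEv) \<subseteq> sigma_sets (space M) (AlphaEv \<union> XEv \<union> MEv)"
      by (rule sigma_sets_mono') auto
    then have "A \<in> sigma_sets (space M) (AlphaEv \<union> XEv \<union> MEv)" using A unfolding G by blast
    note Y_cond[OF subset_refl this, of n yv]
    also have "(\<integral>\<omega>. indicator A \<omega> * (\<Prod>t\<in>{1..n}. fcond (m t \<omega>) (yv t) (x n t \<omega> \<bullet> \<beta>0 + sqrt \<tau>0 * alpha t \<omega>)) \<partial>M)
        = (\<integral>\<omega>. indicator A \<omega> * (\<Prod>t\<in>{1..n}. fs (m t \<omega>) (x n t \<omega> \<bullet> \<beta>0) (sqrt \<tau>0) (yv t)) \<partial>M)"
    proof (rule latent_integrated[OF H0_indep _ _ subG G(2)])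
      show "distributed M lborel (alpha t) std_normal_density" if "t \<in> {1..}" for t
        using that by (intro H0_normal) simp
      show "indep_set (sigma_sets (space M) {alpha t -` A \<inter> space M |t A. t \<in> {1..} \<and> A \<in> sets borel})
          (sigma_sets (space M) (XEv \<union> MEv))"
        using alpha_indep unfolding AlphaEv_def by simp
      show "(\<lambda>\<omega>. x n t \<omega> \<bullet> \<beta>0) \<in> borel_measurable G" "m t \<in> measurable G (count_space UNIV)" if "t \<in> {1..n}" for t
        using that by (auto intro!: borel_measurable_inner x_G m_G)
    qed (use A in auto)
    finally show ?thesis unfolding s_def .
  qed
  obtain K2 where x_int: "\<And>n t. 1 \<le> t \<Longrightarrow> t \<le> n \<Longrightarrow> integrable M (\<lambda>\<omega>. (norm (x n t \<omega>))\<^sup>2)"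
    and x_sq: "\<And>n t. 1 \<le> t \<Longrightarrow> t \<le> n \<Longrightarrow> (\<integral>\<omega>. (norm (x n t \<omega>))\<^sup>2 \<partial>M) \<le> K2"
    using regressor_second_moment[OF C2] by metis
  \<comment> \<open>This map is continuous on the parameter set, so the image \<open>K\<close> is
    compact, and it sends the true parameter to 0.\<close>
  define v where "v = (\<lambda>\<delta> :: (real^'r) \<times> real. (fst \<delta> - \<beta>0, sqrt (snd \<delta>) - s))"
  define K where "K = v ` Theta \<beta>0 \<tau>0 d1 d2"
  define vh where "vh = (\<lambda>n \<omega>. v (\<beta>hat n \<omega>, \<tau>hat n \<omega>))"
  have "Theta \<beta>0 \<tau>0 d1 d2 = cball \<beta>0 d1 \<times> ({0..} \<inter> cball \<tau>0 d2)"
    unfolding Theta_def by (auto simp: dist_norm norm_minus_commute abs_minus_commute)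
  then have "compact (Theta \<beta>0 \<tau>0 d1 d2)"
    by (simp add: compact_Times closed_Int_compact)
  then have K_compact: "compact K"
    unfolding K_def v_def by (intro compact_continuous_image continuous_intros)
  have true_par: "(\<beta>0, \<tau>0) \<in> Theta \<beta>0 \<tau>0 d1 d2" unfolding Theta_def using tau0_pos d1 d2 by simp
  have v_true: "v (\<beta>0, \<tau>0) = 0" unfolding v_def s_def by (simp add: zero_prod_def)
  have K0: "0 \<in> K" using imageI[OF true_par, of v] unfolding v_true K_def .
  have K_S: "0 \<le> s + snd u \<and> s + snd u \<le> S" if "u \<in> K" for u
    using that unfolding K_def v_def S_def Theta_def by auto
  have "0 \<le> S" unfolding S_def using tau0_pos d2 by simp
  then obtain C where C: "0 < C"
    "\<And>m y \<eta> \<eta>' \<sigma> \<sigma>'. m \<le> B \<Longrightarrow> y \<le> B \<Longrightarrow> 0 \<le> \<sigma> \<Longrightarrow> \<sigma> \<le> S \<Longrightarrow> 0 \<le> \<sigma>' \<Longrightarrow> \<sigma>' \<le> S \<Longrightarrow>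
      \<bar>ln (fs m \<eta> \<sigma> y) - ln (fs m \<eta>' \<sigma>' y)\<bar> \<le> C * (\<bar>\<eta> - \<eta>'\<bar> + \<bar>\<sigma> - \<sigma>'\<bar>)"
    "\<And>m y \<eta> \<eta>' \<sigma> \<sigma>'. m \<le> B \<Longrightarrow> y \<le> B \<Longrightarrow> 0 \<le> \<sigma> \<Longrightarrow> \<sigma> \<le> S \<Longrightarrow> 0 \<le> \<sigma>' \<Longrightarrow> \<sigma>' \<le> S \<Longrightarrow>
      \<bar>us m \<eta> \<sigma> y - us m \<eta>' \<sigma>' y\<bar> \<le> C * (\<bar>\<eta> - \<eta>'\<bar> + \<bar>\<sigma> - \<sigma>'\<bar>)"
    "\<And>m \<eta> \<eta>' \<sigma> \<sigma>'. m \<le> B \<Longrightarrow> 0 \<le> \<sigma> \<Longrightarrow> \<sigma> \<le> S \<Longrightarrow> 0 \<le> \<sigma>' \<Longrightarrow> \<sigma>' \<le> S \<Longrightarrow>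
      \<bar>es m \<eta> \<sigma> - es m \<eta>' \<sigma>'\<bar> \<le> C * (\<bar>\<eta> - \<eta>'\<bar> + \<bar>\<sigma> - \<sigma>'\<bar>)"
    by (rule model_lipschitz[where B=B]) (rule that)
  obtain Q :: "(real^'r) \<times> real \<Rightarrow> real" where
    Q_lim: "\<forall>\<delta>\<in>Theta \<beta>0 \<tau>0 d1 d2. AE \<omega> in M.
            (\<lambda>n. loglik1 (\<lambda>t. x n t \<omega>) (\<lambda>t. m t \<omega>) (\<lambda>t. Y n t \<omega>) n (fst \<delta>) (snd \<delta>) / real n) \<longlonglongrightarrow> Q \<delta>"
    and Q_max: "\<forall>\<delta>\<in>Theta \<beta>0 \<tau>0 d1 d2. \<delta> \<noteq> (\<beta>0, \<tau>0) \<longrightarrow> Q \<delta> < Q (\<beta>0, \<tau>0)"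
    using C4 by (elim exE conjE)
  \<comment> \<open>The limit criterion read through the inverse of \<open>v\<close>: s + snd u is
    the square root of \<tau>, so squaring it recovers \<tau>.\<close>
  define Q' where "Q' = (\<lambda>u. Q (\<beta>0 + fst u, (s + snd u)\<^sup>2))"
  have Q'_v: "Q' (v \<delta>) = Q \<delta>" if "\<delta> \<in> Theta \<beta>0 \<tau>0 d1 d2" for \<delta>
    using that unfolding Q'_def v_def Theta_def by auto
  have Q'_0: "Q' 0 = Q (\<beta>0, \<tau>0)" unfolding Q'_def by (simp add: s2)
  have bin: "binomial_panel M G x m Y \<beta>0 s B K2"
    by unfold_locales (fact subG x_G m_G meas_Y m_bd[THEN conjunct1] m_bd s_pos cond x_int x_sq)+
  interpret binomial_panel M G x m Y \<beta>0 s B K2 by (rule bin)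
  interpret panel_mle M G x m Y \<beta>0 s B K2 K S C vh Q'
  proof (unfold_locales, goal_cases)
    case (8 n)
    show ?case unfolding vh_def v_def using est_meas[of n] by simp
  next
    case (9 \<omega> n)
    then show ?case unfolding vh_def K_def using est_max by (intro imageI) blast
  qed (fact K_compact K0 K_S[THEN conjunct1] K_S[THEN conjunct2] C K_S)+
  have lik_eq: "loglik1 (\<lambda>t. x n t \<omega>) (\<lambda>t. m t \<omega>) (\<lambda>t. Y n t \<omega>) n (fst \<delta>) (snd \<delta>) = lik n (v \<delta>) \<omega>" for n \<omega> \<delta>
    unfolding loglik1_def lik_def ll_def v_def fmarg_fs by (intro sum.cong) (auto simp: max_def)
  define Z where "Z = (\<lambda>n \<omega>. Qstat (\<lambda>t. x n t \<omega>) (\<lambda>t. m t \<omega>) (\<lambda>t. Y n t \<omega>) n L (\<beta>hat n \<omega>) (\<tau>hat n \<omega>))"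
  have "weak_conv_m (\<lambda>n. distr M borel (Z n)) (chi2 L)"
  proof (rule statistic_weak_conv)
    show "lik n 0 \<omega> \<le> lik n (vh n \<omega>) \<omega>" if "\<omega> \<in> space M" for n \<omega>
      using est_max[OF that, of n] true_par lik_eq[of n \<omega> "(\<beta>hat n \<omega>, \<tau>hat n \<omega>)"] lik_eq[of n \<omega> "(\<beta>0, \<tau>0)"]
      unfolding vh_def v_true by auto
    show "AE \<omega> in M. (\<lambda>n. lik n u \<omega> / real n) \<longlonglongrightarrow> Q' u" if "u \<in> K" for u
      using that Q_lim unfolding K_def lik_eq by (auto simp: Q'_v)
    show "Q' u < Q' 0" if "u \<in> K" "u \<noteq> 0" for u
      using that Q_max unfolding K_def Q'_0 by (metis Q'_v imageE v_true)
    show "Z n \<in> borel_measurable M" for n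
      unfolding Z_def Qstat_def Spsi_def Omega_def ufun_us EU2_es
      by (intro borel_measurable_sum borel_measurable_divide borel_measurable_power borel_measurable_times
          us_measurable es_measurable borel_measurable_inner borel_measurable_const meas_x meas_m meas_Y est_meas
          measurable_compose[OF est_meas(2) borel_measurable_sqrt])
    show "0 \<le> Z n \<omega>" if w: "\<omega> \<in> space M" for n \<omega>
    proof -
      have nn: "0 \<le> es (m t \<omega>) \<eta> \<sigma>" if "1 \<le> t" for t \<eta> \<sigma>
        using m_bd[OF that w] by (intro es_bounds(1)[of _ B]) simp
      have "0 \<le> Omega (\<lambda>t. x n t \<omega>) (\<lambda>t. m t \<omega>) n a (\<beta>hat n \<omega>) (\<tau>hat n \<omega>)" for a
        unfolding Omega_def EU2_es by (intro mult_nonneg_nonneg sum_nonneg nn) auto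
      then show ?thesis unfolding Z_def Qstat_def by (intro sum_nonneg divide_nonneg_nonneg) simp_all
    qed
    show "Z n \<omega> = QQ L n (vh n \<omega>) \<omega>" if n: "1 \<le> n" and "\<omega> \<in> space M" and "0 < s + snd (vh n \<omega>)" for n \<omega>
    proof -
      have \<tau>: "0 < \<tau>hat n \<omega>" using that(3) unfolding vh_def v_def by simp
      have "Spsi (\<lambda>t. x n t \<omega>) (\<lambda>t. m t \<omega>) (\<lambda>t. Y n t \<omega>) n a (\<beta>hat n \<omega>) (\<tau>hat n \<omega>) = \<tau>hat n \<omega> * WW n a (vh n \<omega>) \<omega>"
        "Omega (\<lambda>t. x n t \<omega>) (\<lambda>t. m t \<omega>) n a (\<beta>hat n \<omega>) (\<tau>hat n \<omega>) = (\<tau>hat n \<omega>)\<^sup>2 * LL n a (vh n \<omega>) \<omega>" for a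
        unfolding Spsi_def Omega_def WW_def LL_def uu_def ee_def ufun_us EU2_es vh_def v_def
        by (auto intro!: sum.cong simp: max_def)
      then show ?thesis unfolding Z_def Qstat_def QQ_def using \<tau> n by (simp add: power_mult_distrib)
    qed
  qed (rule L)
  then show ?thesis unfolding Z_def .
qed

end
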